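(* Let $T$ be a fixed closed Lipschitz subdomain of the unit ball $B_1\subset\mathbb{R}^3$, and for $\varepsilon\in(0,1)$ set $\Omega_\varepsilon:=B_1\setminus\varepsilon T$. For every $p$ with $3/2<p<3$ there is a constant $C=C(p)$, independent of $\varepsilon$, such that for every $\varepsilon\in(0,1)$ and every $f\in L^p(\Omega_\varepsilon;\mathbb{R}^3)$, the unique solution $u\in W^{1,p}_0(\Omega_\varepsilon)$ of $$-\Delta u=\operatorname{div} f\ \text{ in }\Omega_\varepsilon,\qquad u=0\ \text{ on }\partial\Omega_\varepsilon=\partial B_1\cup\varepsilon\,\partial T$$ satisfies $$\|\nabla u\|_{L^p(\Omega_\varepsilon)}\le C\,\|f\|_{L^p(\Omega_\varepsilon)}.$$
   Context: $B_1:=\{x\in\mathbb{R}^3:|x|<1\}$. $T\subset B_1$ is a closed subdomain with Lipschitz boundary, fixed once and for all and independent of $\varepsilon$; constants may depend on $T$. $\varepsilon T:=\{\varepsilon x: x\in T\}$. Solutions are weak solutions: $u\in W^{1,p}_0(\Omega_\varepsilon)$ and $\int_{\Omega_\varepsilon}\nabla u\cdot\nabla\phi\,dx=-\int_{\Omega_\varepsilon}f\cdot\nabla\phi\,dx$ for all $\phi\in C_c^\infty(\Omega_\varepsilon)$. For each fixed $\varepsilon$, existence and uniqueness in $W^{1,p}_0(\Omega_\varepsilon)$ for $3/2<p<3$ is a known result of Jerison and Kenig. *)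

theory Defs
  imports "HOL-Analysis.Analysis"
begin

section \<open>Lipschitz domains\<close>

text \<open>
  Near each boundary point the domain is the strict epigraph of a Lipschitz function over a
  hyperplane. The unit vector \<open>e\<close> plays the role of the last coordinate axis after a rotation,
  and \<open>y - (y \<bullet> e) *\<^sub>R e\<close> is the orthogonal projection of \<open>y\<close> onto the hyperplane.
\<close>

definition lipschitz_boundary :: "'a::euclidean_space set \<Rightarrow> bool" where
  "lipschitz_boundary D \<longleftrightarrow>
     (\<forall>x\<in>frontier D. \<exists>r>0. \<exists>e. \<exists>L. \<exists>\<gamma>::'a \<Rightarrow> real.
        norm e = 1 \<and> L-lipschitz_on {y. y \<bullet> e = 0} \<gamma> \<and>
        D \<inter> ball x r = {y \<in> ball x r. \<gamma> (y - (y \<bullet> e) *\<^sub>R e) < y \<bullet> e})"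

definition lipschitz_domain :: "'a::euclidean_space set \<Rightarrow> bool" where
  "lipschitz_domain D \<longleftrightarrow>
     open D \<and> connected D \<and> D \<noteq> {} \<and> bounded D \<and> lipschitz_boundary D"

definition closed_lipschitz_domain :: "'a::euclidean_space set \<Rightarrow> bool" where
  "closed_lipschitz_domain T \<longleftrightarrow> (\<exists>D. lipschitz_domain D \<and> T = closure D)"

definition perforated_ball :: "'a::euclidean_space set \<Rightarrow> real \<Rightarrow> 'a set" where
  "perforated_ball T \<epsilon> = ball 0 1 - (\<lambda>x. \<epsilon> *\<^sub>R x) ` T"


section \<open>Test functions\<close>

fun C_k :: "nat \<Rightarrow> ('a::euclidean_space \<Rightarrow> real) \<Rightarrow> bool" where
  "C_k 0 \<phi> \<longleftrightarrow> continuous_on UNIV \<phi>"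
| "C_k (Suc k) \<phi> \<longleftrightarrow>
     (\<forall>x. \<phi> differentiable (at x)) \<and> (\<forall>v. C_k k (\<lambda>x. frechet_derivative \<phi> (at x) v))"

text \<open>
  Elements of \<open>C\<^sub>c\<^sup>\<infinity>(\<Omega>)\<close> are represented by their extensions by zero to the whole space.
\<close>

definition test_function :: "'a::euclidean_space set \<Rightarrow> ('a \<Rightarrow> real) \<Rightarrow> bool" where
  "test_function \<Omega> \<phi> \<longleftrightarrow>
     (\<forall>k. C_k k \<phi>) \<and> compact (closure {x. \<phi> x \<noteq> 0}) \<and> closure {x. \<phi> x \<noteq> 0} \<subseteq> \<Omega>"

definition gradient :: "('a::euclidean_space \<Rightarrow> real) \<Rightarrow> 'a \<Rightarrow> 'a" where
  "gradient \<phi> x = (\<Sum>b\<in>Basis. frechet_derivative \<phi> (at x) b *\<^sub>R b)"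


section \<open>Lebesgue and Sobolev spaces\<close>

text \<open>
  Elements of \<open>L\<^sup>p\<close> and \<open>W\<^sup>1\<^sup>,\<^sup>p\<close> are represented by functions whose values outside \<open>\<Omega>\<close> are
  irrelevant; two of them are the same element if they agree almost everywhere on \<open>\<Omega>\<close>.
\<close>

definition Lp_space :: "'a::euclidean_space set \<Rightarrow> real \<Rightarrow> ('a \<Rightarrow> 'b::euclidean_space) set" where
  "Lp_space \<Omega> p = {f. f \<in> borel_measurable (lebesgue_on \<Omega>) \<and>
                      integrable (lebesgue_on \<Omega>) (\<lambda>x. norm (f x) powr p)}"

text \<open>The norm is meaningful on \<open>Lp_space \<Omega> p\<close> only: non-integrable functions get value 0.\<close>

definition Lp_norm :: "'a::euclidean_space set \<Rightarrow> real \<Rightarrow> ('a \<Rightarrow> 'b::euclidean_space) \<Rightarrow> real" where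
  "Lp_norm \<Omega> p f = (LINT x|lebesgue_on \<Omega>. norm (f x) powr p) powr (1 / p)"

definition L1_loc :: "'a::euclidean_space set \<Rightarrow> ('a \<Rightarrow> 'b::euclidean_space) set" where
  "L1_loc \<Omega> = {f. \<forall>K. compact K \<and> K \<subseteq> \<Omega> \<longrightarrow> f absolutely_integrable_on K}"

definition is_weak_gradient ::
    "'a::euclidean_space set \<Rightarrow> ('a \<Rightarrow> real) \<Rightarrow> ('a \<Rightarrow> 'a) \<Rightarrow> bool" where
  "is_weak_gradient \<Omega> u g \<longleftrightarrow>
     u \<in> L1_loc \<Omega> \<and> g \<in> L1_loc \<Omega> \<and>
     (\<forall>\<phi>. test_function \<Omega> \<phi> \<longrightarrow>
        (LINT x|lebesgue_on \<Omega>. u x *\<^sub>R gradient \<phi> x) = - (LINT x|lebesgue_on \<Omega>. \<phi> x *\<^sub>R g x))"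

text \<open>
  On an open set, weak gradients are unique up to null sets, so every use of the chosen
  representative below (norms, integrals, membership in \<open>Lp_space\<close>) is independent of the choice.
\<close>

definition weak_gradient :: "'a::euclidean_space set \<Rightarrow> ('a \<Rightarrow> real) \<Rightarrow> 'a \<Rightarrow> 'a" where
  "weak_gradient \<Omega> u = (SOME g. is_weak_gradient \<Omega> u g)"

definition W1p :: "'a::euclidean_space set \<Rightarrow> real \<Rightarrow> ('a \<Rightarrow> real) set" where
  "W1p \<Omega> p = {u \<in> Lp_space \<Omega> p. \<exists>g \<in> Lp_space \<Omega> p. is_weak_gradient \<Omega> u g}"

definition W1p_norm :: "'a::euclidean_space set \<Rightarrow> real \<Rightarrow> ('a \<Rightarrow> real) \<Rightarrow> real" where
  "W1p_norm \<Omega> p u =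
     (Lp_norm \<Omega> p u powr p + Lp_norm \<Omega> p (weak_gradient \<Omega> u) powr p) powr (1 / p)"

text \<open>The closure of the test functions in \<open>W\<^sup>1\<^sup>,\<^sup>p\<close>.\<close>

definition W1p_0 :: "'a::euclidean_space set \<Rightarrow> real \<Rightarrow> ('a \<Rightarrow> real) set" where
  "W1p_0 \<Omega> p = {u \<in> W1p \<Omega> p.
     \<forall>\<delta>>0. \<exists>\<phi>. test_function \<Omega> \<phi> \<and> W1p_norm \<Omega> p (\<lambda>x. u x - \<phi> x) < \<delta>}"


section \<open>The Dirichlet problem\<close>

text \<open>
  Weak solutions of \<open>- \<Delta> u = div f\<close> in \<open>\<Omega>\<close>; the condition \<open>u = 0\<close> on \<open>\<partial>\<Omega>\<close> is membership in
  \<open>W1p_0 \<Omega> p\<close>.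
\<close>

definition weak_solution ::
    "'a::euclidean_space set \<Rightarrow> real \<Rightarrow> ('a \<Rightarrow> 'a) \<Rightarrow> ('a \<Rightarrow> real) \<Rightarrow> bool" where
  "weak_solution \<Omega> p f u \<longleftrightarrow>
     u \<in> W1p_0 \<Omega> p \<and>
     (\<forall>\<phi>. test_function \<Omega> \<phi> \<longrightarrow>
        (LINT x|lebesgue_on \<Omega>. weak_gradient \<Omega> u x \<bullet> gradient \<phi> x) =
        - (LINT x|lebesgue_on \<Omega>. f x \<bullet> gradient \<phi> x))"

end

theory Submission
  imports Defs
begin

text \<open>
  In the cone condition only the scale of the domain \<open>\<Omega>\<^sub>\<epsilon>\<close> degenerates, like \<open>\<epsilon>\<close>. For a
  solution \<open>u\<close> that is harmonic in a ball relative to \<open>\<Omega>\<^sub>\<epsilon>\<close>, testing with \<open>\<eta> (u(\<cdot> - h) - u)\<close> for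
  translations \<open>h\<close> in the cone (Savare) bounds the translation differences of \<open>\<nabla>u\<close> in \<open>L\<^sup>2\<close> by \<open>|h|\<^sup>1\<^sup>/\<^sup>2\<close>,
  which gives almost weak \<open>L\<^sup>3\<close> decay of the superlevel sets. A good-lambda argument turns this into \<open>L\<^sup>q\<close>
  bounds for \<open>2 < q < 3\<close> that are scale invariant for data supported at the scale of the cones. For
  uniformity in \<open>\<epsilon>\<close>, first solve in the whole ball and cut off near the hole: by Hardy's inequality
  (\<open>q < 3\<close>) the correction solves a problem with controlled data supported in a ball of radius \<open>2 \<epsilon>\<close>.
  Duality gives \<open>3/2 < p < 2\<close>; existence follows by truncating \<open>f\<close>, and uniqueness by testing with the
  solution for the data \<open>\<nabla>u / (1 + |\<nabla>u|)\<close>.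
\<close>

section \<open>Functions with integrable powers\<close>

text \<open>Two independent mechanisms stop at the same exponent. A half derivative in L^2
  corresponds in dimension 3 to the exponent 2 * 3 / (3 - 1) = 3, and Hardy's inequality for
  gradients needs q < 3; the conjugate exponent 3/2 closes the range from below. The local estimate
  at scale r carries the term (|f|_2^2 / r^3)^((q - 2) / 2) |f|_2^2. It is controlled by |f|_q^q if
  f lives at scale r, but costs a negative power of \<epsilon> if r is of order \<epsilon> and f
  lives at scale 1; this forces the splitting. The function that is cut off near the hole is a test
  function approximating the solution in the ball. It is chosen after \<epsilon>, so its
  approximation error may carry a constant depending on \<epsilon>. A gradient in L^q does not yet
  place a function in the closure of the test functions for exponent q; that is a separate step,
  where the cones serve to push supports into the domain. The estimates concern Borel gradients on
  the whole space that vanish off the domain: Poincare's inequality recovers the functions, and only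
  the end of the proof translates to Lebesgue measurable functions on the perforated ball.\<close>

definition Lp :: "real \<Rightarrow> ('a::euclidean_space \<Rightarrow> 'b::euclidean_space) \<Rightarrow> bool" where
  "Lp p f \<longleftrightarrow> f \<in> borel_measurable borel \<and> integrable lborel (\<lambda>x. norm (f x) powr p)"

text \<open>The root is omitted: energy identities, Young's inequality and Fatou's lemma all act on
  p-th powers. Minkowski's inequality is replaced by a triangle inequality with the factor
  \<open>2 powr p\<close>, which only affects constants.\<close>

definition pint :: "real \<Rightarrow> ('a::euclidean_space \<Rightarrow> 'b::euclidean_space) \<Rightarrow> real" where
  "pint p f = (LBINT x. norm (f x) powr p)"

abbreviation restr :: "'a set \<Rightarrow> ('a \<Rightarrow> 'b::real_normed_vector) \<Rightarrow> 'a \<Rightarrow> 'b" where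
  "restr S f \<equiv> \<lambda>x. indicator S x *\<^sub>R f x"

abbreviation pdist :: "real \<Rightarrow> ('a::euclidean_space \<Rightarrow> 'b::euclidean_space) \<Rightarrow> ('a \<Rightarrow> 'b) \<Rightarrow> real" where
  "pdist p f g \<equiv> pint p (\<lambda>x. f x - g x)"

abbreviation nnint :: "('a::euclidean_space \<Rightarrow> ennreal) \<Rightarrow> ennreal" (binder "NN " 10) where
  "nnint f \<equiv> nn_integral lborel f"

lemma Lp_borel [measurable_dest]: "Lp p f \<Longrightarrow> f \<in> borel_measurable borel"
  by (simp add: Lp_def)

lemma Lp_integrable: "Lp p f \<Longrightarrow> integrable lborel (\<lambda>x. norm (f x) powr p)"
  by (simp add: Lp_def)

lemma pint_nonneg [simp]: "0 \<le> pint p f"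
  by (simp add: pint_def)

lemma Lp_zero [simp]: "Lp p (\<lambda>x. 0)" and pint_zero [simp]: "pint p (\<lambda>x. 0) = 0"
  by (simp_all add: Lp_def pint_def)

lemma ennreal_pint: "Lp p f \<Longrightarrow> (NN x. ennreal (norm (f x) powr p)) = ennreal (pint p f)"
  by (simp add: Lp_def pint_def nn_integral_eq_integral)

lemma Lp_nn_bound:
  assumes "f \<in> borel_measurable borel" "(NN x. ennreal (norm (f x) powr p)) \<le> ennreal c" "0 \<le> c"
  shows "Lp p f" "pint p f \<le> c"
proof -
  have "(NN x. ennreal (norm (f x) powr p)) < \<infinity>"
    using assms(2) by (metis ennreal_less_top infinity_ennreal_def le_less_trans)
  then show *: "Lp p f" using assms(1) by (auto simp: Lp_def intro!: integrableI_nonneg)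
  show "pint p f \<le> c" using assms(2,3) ennreal_pint[OF *] by simp
qed

lemma Lp_bound:
  assumes "Lp p g" "f \<in> borel_measurable borel" "\<And>x. norm (f x) \<le> C * norm (g x)" "0 \<le> C" "0 < p"
  shows "Lp p f" "pint p f \<le> C powr p * pint p g"
proof -
  have le: "norm (f x) powr p \<le> C powr p * norm (g x) powr p" for x
    using powr_mono2[OF less_imp_le[OF assms(5)] norm_ge_zero assms(3)[of x]] assms(4) by (simp add: powr_mult)
  have i: "integrable lborel (\<lambda>x. C powr p * norm (g x) powr p)" using Lp_integrable[OF assms(1)] by simp
  have i2: "integrable lborel (\<lambda>x. norm (f x) powr p)"
    by (rule Bochner_Integration.integrable_bound[OF i]) (use assms(2) le in auto)
  then show "Lp p f" using assms(2) by (simp add: Lp_def)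
  show "pint p f \<le> C powr p * pint p g" unfolding pint_def using integral_mono[OF i2 i le] by simp
qed

lemma powr_add_le: "(a + b) powr p \<le> 2 powr p * (a powr p + b powr p)"
  if "0 \<le> a" "0 \<le> b" "0 < p" for a b p :: real
proof -
  have "(a + b) powr p \<le> (2 * max a b) powr p" using that by (intro powr_mono2) auto
  also have "\<dots> = 2 powr p * (max a b) powr p" using that by (simp add: powr_mult)
  also have "\<dots> \<le> 2 powr p * (a powr p + b powr p)" by (intro mult_left_mono) (auto simp: max_def)
  finally show ?thesis .
qed

lemma Lp_add:
  assumes "Lp p f" "Lp p g" "0 < p"
  shows "Lp p (\<lambda>x. f x + g x)" "pint p (\<lambda>x. f x + g x) \<le> 2 powr p * (pint p f + pint p g)"
proof -
  have [measurable]: "f \<in> borel_measurable borel" "g \<in> borel_measurable borel" using assms by (auto simp: Lp_def)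
  have le: "norm (f x + g x) powr p \<le> 2 powr p * (norm (f x) powr p + norm (g x) powr p)" for x
    using powr_mono2[OF less_imp_le[OF assms(3)] norm_ge_zero norm_triangle_ineq[of "f x" "g x"]]
      powr_add_le[of "norm (f x)" "norm (g x)" p] assms(3) by simp
  have i: "integrable lborel (\<lambda>x. 2 powr p * (norm (f x) powr p + norm (g x) powr p))"
    using Lp_integrable[OF assms(1)] Lp_integrable[OF assms(2)] by simp
  have i2: "integrable lborel (\<lambda>x. norm (f x + g x) powr p)"
    by (rule Bochner_Integration.integrable_bound[OF i]) (use le in auto)
  then show "Lp p (\<lambda>x. f x + g x)" by (simp add: Lp_def)
  show "pint p (\<lambda>x. f x + g x) \<le> 2 powr p * (pint p f + pint p g)" unfolding pint_def using integral_mono[OF i2 i le]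
    Lp_integrable[OF assms(1)] Lp_integrable[OF assms(2)] by simp
qed

lemma Lp_uminus [simp]: "Lp p (\<lambda>x. - f x) \<longleftrightarrow> Lp p f" and pint_uminus [simp]: "pint p (\<lambda>x. - f x) = pint p f"
proof -
  have "(\<lambda>x. - f x) \<in> borel_measurable borel \<longleftrightarrow> f \<in> borel_measurable borel"
    using borel_measurable_uminus[of f borel] borel_measurable_uminus[of "\<lambda>x. - f x" borel] by auto
  then show "Lp p (\<lambda>x. - f x) \<longleftrightarrow> Lp p f" by (simp add: Lp_def)
qed (simp add: pint_def)

lemma Lp_diff:
  assumes "Lp p f" "Lp p g" "0 < p"
  shows "Lp p (\<lambda>x. f x - g x)" "pdist p f g \<le> 2 powr p * (pint p f + pint p g)"
  using Lp_add[of p f "\<lambda>x. - g x"] assms by auto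

lemma Lp_scaleR: "Lp p f \<Longrightarrow> 0 < p \<Longrightarrow> Lp p (\<lambda>x. c *\<^sub>R f x)"
  by (rule Lp_bound(1)[of p f _ "\<bar>c\<bar>"]) (auto dest: Lp_borel)

lemma pint_scaleR: "pint p (\<lambda>x. c *\<^sub>R f x) = \<bar>c\<bar> powr p * pint p f"
  by (simp add: pint_def powr_mult)

lemma pint_minus_commute: "pdist p f g = pdist p g f"
  by (simp add: pint_def norm_minus_commute)

lemma Lp_restrict:
  assumes "Lp p f" "S \<in> sets borel" "0 < p"
  shows "Lp p (restr S f)" "pint p (restr S f) \<le> pint p f"
proof -
  have *: "(restr S f) \<in> borel_measurable borel" using assms by (auto dest: Lp_borel)
  have le: "norm (indicator S x *\<^sub>R f x) \<le> 1 * norm (f x)" for x by (simp add: indicator_def)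
  show "Lp p (restr S f)" by (rule Lp_bound(1)[OF assms(1) * le _ assms(3)]) simp
  show "pint p (restr S f) \<le> pint p f" using Lp_bound(2)[OF assms(1) * le _ assms(3)] by simp
qed

lemma Lp_bounded_support:
  fixes f :: "'a::euclidean_space \<Rightarrow> 'b::euclidean_space"
  assumes "f \<in> borel_measurable borel" "\<And>x. norm (f x) \<le> M" "\<And>x. x \<notin> S \<Longrightarrow> f x = 0" "bounded S" "0 < p"
  shows "Lp p f"
proof -
  obtain R where "\<forall>x\<in>S. norm x \<le> R" using assms(4) unfolding bounded_iff by blast
  then have R: "S \<subseteq> cball 0 R" by auto
  have i: "integrable lborel (restr (cball (0::'a) R) (\<lambda>x. M powr p))"
    using emeasure_lborel_cball_finite[of "0::'a" R] by (intro integrable_scaleR_left integrable_real_indicator) auto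
  have "integrable lborel (\<lambda>x. norm (f x) powr p)"
  proof (rule Bochner_Integration.integrable_bound[OF i])
    show "(\<lambda>x. norm (f x) powr p) \<in> borel_measurable lborel" using assms(1) by simp
    show "AE x in lborel. norm (norm (f x) powr p) \<le> norm (indicator (cball 0 R) x *\<^sub>R (M powr p))"
    proof (rule AE_I2)
      fix x show "norm (norm (f x) powr p) \<le> norm (indicator (cball 0 R) x *\<^sub>R (M powr p))"
      proof (cases "x \<in> cball 0 R")
        case True
        have "norm (f x) powr p \<le> M powr p" using assms(2)[of x] assms(5) by (intro powr_mono2) auto
        then show ?thesis using True by simp
      next
        case False
        then have "f x = 0" using R assms(3)[of x] by (meson subsetD)
        then show ?thesis by simp
      qed
    qed
  qed
  then show ?thesis using assms(1) by (simp add: Lp_def)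
qed

lemma emeasure_bounded_finite_borel:
  assumes "bounded S" shows "emeasure lborel S < \<infinity>"
  using emeasure_bounded_finite[OF assms] by simp

text \<open>Cutting at the height \<open>\<tau>\<close> gives the embedding of L^q into L^r on sets
  of finite measure without Hoelder's inequality: below \<open>\<tau>\<close> only the measure of
  the set counts, above it \<open>x powr (r - q)\<close> is at most
  \<open>\<tau> powr (r - q)\<close>.\<close>

lemma powr_le_split:
  fixes x \<tau> r q :: real
  assumes "0 \<le> x" "0 < \<tau>" "0 < r" "r \<le> q"
  shows "x powr r \<le> \<tau> powr r + \<tau> powr (r - q) * x powr q"
proof (cases "x \<le> \<tau>")
  case True
  then have "x powr r \<le> \<tau> powr r" using assms by (intro powr_mono2) auto
  then show ?thesis by (simp add: add_increasing2)
next
  case False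
  then have "x powr (r - q) \<le> \<tau> powr (r - q)" using assms by (intro powr_mono2') auto
  then have "x powr (r - q) * x powr q \<le> \<tau> powr (r - q) * x powr q" by (intro mult_right_mono) auto
  then show ?thesis using False assms by (simp flip: powr_add add: add_increasing)
qed

lemma Lp_nest:
  assumes f: "Lp q f" and r: "0 < r" "r \<le> q" and S: "\<And>x. x \<notin> S \<Longrightarrow> f x = 0" "bounded S" "S \<in> sets borel"
  shows "Lp r f" "\<And>\<tau>. 0 < \<tau> \<Longrightarrow> pint r f \<le> \<tau> powr r * measure lborel S + \<tau> powr (r - q) * pint q f"
proof -
  have fin: "emeasure lborel S < \<infinity>" using emeasure_bounded_finite_borel[OF S(2)] .
  have iS: "integrable lborel (\<lambda>x. indicator S x * c)" for c :: real
    using S(3) fin by (intro integrable_mult_left integrable_real_indicator) auto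
  have le: "norm (f x) powr r \<le> indicator S x * \<tau> powr r + \<tau> powr (r - q) * norm (f x) powr q" if "0 < \<tau>" for x \<tau>
    using powr_le_split[of "norm (f x)" \<tau> r q] that r S(1)[of x] by (cases "x \<in> S") auto
  have i: "integrable lborel (\<lambda>x. indicator S x * \<tau> powr r + \<tau> powr (r - q) * norm (f x) powr q)" for \<tau>
    using iS Lp_integrable[OF f] by simp
  have i2: "integrable lborel (\<lambda>x. norm (f x) powr r)"
    by (rule Bochner_Integration.integrable_bound[OF i[of 1]]) (use f le[of 1] in \<open>auto dest: Lp_borel\<close>)
  then show "Lp r f" using f by (simp add: Lp_def)
  show "pint r f \<le> \<tau> powr r * measure lborel S + \<tau> powr (r - q) * pint q f" if "0 < \<tau>" for \<tau>
  proof -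
    have "pint r f \<le> (LBINT x. indicator S x * \<tau> powr r + \<tau> powr (r - q) * norm (f x) powr q)"
      unfolding pint_def using le[OF that] by (intro integral_mono i2 i) auto
    also have "\<dots> = \<tau> powr r * measure lborel S + \<tau> powr (r - q) * pint q f"
      unfolding pint_def using iS Lp_integrable[OF f] S(3) fin by (simp add: mult.commute)
    finally show ?thesis .
  qed
qed

text \<open>Optimizes the height in \<open>Lp_nest\<close>: the chosen \<open>\<tau>\<close> makes
  both terms equal, hence the factor 2 where Hoelder's inequality has 1. If
  \<open>pint q f = 0\<close>, this \<open>\<tau>\<close> would not be positive, so that case is
  separate.\<close>

lemma pint_nest:
  assumes f: "Lp q f" and r: "0 < r" "r \<le> q" and S: "\<And>x. x \<notin> S \<Longrightarrow> f x = 0" "bounded S" "S \<in> sets borel"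
    and m: "0 < m" "measure lborel S \<le> m"
  shows "pint r f \<le> 2 * m powr (1 - r / q) * pint q f powr (r / q)"
proof (cases "pint q f = 0")
  case True
  have "AE x in lborel. norm (f x) powr q = 0" using True Lp_integrable[OF f] unfolding pint_def
    by (subst (asm) integral_nonneg_eq_0_iff_AE) auto
  then have "AE x in lborel. norm (f x) powr r = 0" using r by (auto elim!: eventually_mono)
  then have "pint r f = 0" unfolding pint_def by (intro integral_eq_zero_AE)
  then show ?thesis using m by simp
next
  case False
  define P where "P = pint q f"
  have P: "P > 0" using False pint_nonneg[of q f] by (simp add: P_def less_eq_real_def)
  define \<tau> where "\<tau> = (P / m) powr (1 / q)"
  have t: "\<tau> > 0" using P m by (simp add: \<tau>_def)
  have q: "q > 0" using r by simp
  have "pint r f \<le> \<tau> powr r * measure lborel S + \<tau> powr (r - q) * P" using Lp_nest(2)[OF f r S t] by (simp add: P_def)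
  also have "\<dots> \<le> \<tau> powr r * m + \<tau> powr (r - q) * P" using m by (simp add: mult_left_mono)
  also have "\<tau> powr r * m = m powr (1 - r / q) * P powr (r / q)"
    using P m q by (simp add: \<tau>_def powr_powr powr_divide powr_diff)
  also have "\<tau> powr (r - q) = \<tau> powr r / (P / m)" using P m q by (simp add: \<tau>_def powr_powr powr_diff)
  also have "\<tau> powr r / (P / m) * P = \<tau> powr r * m" using P m by simp
  also have "\<tau> powr r * m = m powr (1 - r / q) * P powr (r / q)"
    using P m q by (simp add: \<tau>_def powr_powr powr_divide powr_diff)
  finally show ?thesis by (simp add: P_def)
qed

section \<open>Pairings of conjugate exponents\<close>

lemma conjugate_gt_1:
  fixes p q :: real
  assumes "1 < p" "1 / p + 1 / q = 1" shows "1 < q"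
proof -
  have "1 / q = 1 - 1 / p" "1 - 1/p < 1" "1 - 1/p > 0" using assms by (auto simp: field_simps)
  then have "0 < 1 / q" "1 / q < 1" by auto
  then show ?thesis by (auto simp: divide_less_eq zero_less_divide_iff split: if_splits)
qed

text \<open>Young's inequality replaces Hoelder's inequality throughout.\<close>

lemma Young_small:
  fixes p q \<delta> :: real
  assumes "1 < p" "1 / p + 1 / q = 1" "0 < \<delta>"
  shows "\<exists>C>0. \<forall>a\<ge>0. \<forall>b\<ge>0. a * b \<le> \<delta> * a powr q + C * b powr p"
proof -
  have q: "1 < q" by (rule conjugate_gt_1[OF assms(1,2)])
  \<comment> \<open>Young's inequality is applied to \<open>s * a\<close> and \<open>b / s\<close>;
    the weight \<open>s\<close> turns the first term into \<open>\<delta> * a powr q\<close>, and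
    the factors \<open>1 / q\<close> and \<open>1 / p\<close> are dropped.\<close>
  define s where "s = \<delta> powr (1 / q)"
  have s: "s > 0" using assms by (simp add: s_def)
  have *: "a * b \<le> \<delta> * a powr q + (1 / s) powr p * b powr p" if "0 \<le> a" "0 \<le> b" for a b
  proof -
    have "(s * a) * (b / s) \<le> (s * a) powr q / q + (b / s) powr p / p"
      using that s q assms by (intro Youngs_inequality) auto
    also have "\<dots> \<le> (s * a) powr q + (b / s) powr p"
      using frac_le[of "(s * a) powr q" "(s * a) powr q" 1 q] frac_le[of "(b / s) powr p" "(b / s) powr p" 1 p] q assms(1)
      by (intro add_mono) auto
    also have "(s * a) powr q = \<delta> * a powr q" using that s q assms by (simp add: powr_mult s_def powr_powr)
    also have "(b / s) powr p = (1 / s) powr p * b powr p" using that s by (simp add: powr_divide)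
    finally show ?thesis using s by simp
  qed
  show ?thesis by (rule exI[of _ "(1 / s) powr p"]) (use s * in auto)
qed

text \<open>The Young pair \<open>\<delta>\<close>, \<open>C\<close> is a parameter so that a caller
  can take \<open>\<delta>\<close> small enough to absorb the first term.\<close>

lemma pairing_bound:
  assumes f: "Lp q f" and g: "Lp p g"
    and ab: "\<And>a b. 0 \<le> a \<Longrightarrow> 0 \<le> b \<Longrightarrow> a * b \<le> \<delta> * a powr q + C * b powr p"
  shows "integrable lborel (\<lambda>x. f x \<bullet> g x)" "\<bar>LBINT x. f x \<bullet> g x\<bar> \<le> \<delta> * pint q f + C * pint p g"
proof -
  have i: "integrable lborel (\<lambda>x. \<delta> * norm (f x) powr q + C * norm (g x) powr p)"
    using Lp_integrable[OF f] Lp_integrable[OF g] by simp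
  have le: "\<bar>f x \<bullet> g x\<bar> \<le> \<delta> * norm (f x) powr q + C * norm (g x) powr p" for x
    using ab[of "norm (f x)" "norm (g x)"] Cauchy_Schwarz_ineq2[of "f x" "g x"] by simp
  show i2: "integrable lborel (\<lambda>x. f x \<bullet> g x)"
  proof (rule Bochner_Integration.integrable_bound[OF i])
    show "(\<lambda>x. f x \<bullet> g x) \<in> borel_measurable lborel" using f g by (auto dest!: Lp_borel)
    show "AE x in lborel. norm (f x \<bullet> g x) \<le> norm (\<delta> * norm (f x) powr q + C * norm (g x) powr p)"
      using le by (intro AE_I2) (simp, meson abs_ge_self order_trans)
  qed
  have "\<bar>LBINT x. f x \<bullet> g x\<bar> \<le> (LBINT x. \<bar>f x \<bullet> g x\<bar>)" using integral_norm_bound[of lborel "\<lambda>x. f x \<bullet> g x"] by simp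
  also have "\<dots> \<le> (LBINT x. \<delta> * norm (f x) powr q + C * norm (g x) powr p)" using i2 i le by (intro integral_mono) auto
  also have "\<dots> = \<delta> * pint q f + C * pint p g" unfolding pint_def using Lp_integrable[OF f] Lp_integrable[OF g] by simp
  finally show "\<bar>LBINT x. f x \<bullet> g x\<bar> \<le> \<delta> * pint q f + C * pint p g" .
qed

lemma pairing_integrable:
  assumes f: "Lp q f" and g: "Lp p g" and pq: "1 < p" "1 / p + 1 / q = 1"
  shows "integrable lborel (\<lambda>x. f x \<bullet> g x)"
proof -
  obtain C where "0 < C" and ab: "\<And>a b. 0 \<le> a \<Longrightarrow> 0 \<le> b \<Longrightarrow> a * b \<le> 1 * a powr q + C * b powr p"
    using Young_small[OF pq zero_less_one] by blast
  show ?thesis by (rule pairing_bound(1)[OF f g ab])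
qed

lemma pairing_limit:
  assumes f: "Lp q f" and g: "Lp p g" and pq: "1 < p" "1 / p + 1 / q = 1"
    and gn: "\<And>n. Lp p (G n)" "(\<lambda>n. pdist p (G n) g) \<longlonglongrightarrow> 0"
  shows "(\<lambda>n. LBINT x. f x \<bullet> G n x) \<longlonglongrightarrow> (LBINT x. f x \<bullet> g x)"
proof (rule LIMSEQ_I)
  fix e :: real assume e: "0 < e"
  \<comment> \<open>Small against the fixed function \<open>f\<close>. The constant \<open>C\<close>
    of Young's inequality is known only afterwards and is beaten by the convergence of
    \<open>G n\<close>; the \<open>+ 1\<close> covers \<open>pint q f = 0\<close>.\<close>
  define \<delta> where "\<delta> = e / (2 * (pint q f + 1))"
  have d: "\<delta> > 0" using e by (simp add: \<delta>_def add_nonneg_pos)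
  have p: "0 < p" using pq by simp
  obtain C where C: "C > 0" and ab: "\<And>a b. 0 \<le> a \<Longrightarrow> 0 \<le> b \<Longrightarrow> a * b \<le> \<delta> * a powr q + C * b powr p"
    using Young_small[OF pq d] by blast
  have "\<forall>\<^sub>F n in sequentially. pdist p (G n) g < e / (2 * C)"
    using order_tendstoD(2)[OF gn(2), of "e / (2 * C)"] e C by simp
  then obtain N where N: "\<And>n. n \<ge> N \<Longrightarrow> pdist p (G n) g < e / (2 * C)" by (auto simp: eventually_sequentially)
  have "\<bar>(LBINT x. f x \<bullet> G n x) - (LBINT x. f x \<bullet> g x)\<bar> < e" if "n \<ge> N" for n
  proof -
    have "(LBINT x. f x \<bullet> G n x) - (LBINT x. f x \<bullet> g x) = (LBINT x. f x \<bullet> (G n x - g x))"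
      using pairing_integrable[OF f g pq] pairing_integrable[OF f gn(1) pq]
      by (subst Bochner_Integration.integral_diff[symmetric]) (auto simp: inner_diff_right)
    also have "\<bar>\<dots>\<bar> \<le> \<delta> * pint q f + C * pdist p (G n) g" by (rule pairing_bound(2)[OF f Lp_diff(1)[OF gn(1) g p] ab])
    also have "C * pdist p (G n) g < e / 2" using N[OF that] C by (simp add: field_simps)
    also have "\<delta> * pint q f \<le> e / 2" using e pint_nonneg[of q f] by (simp add: \<delta>_def pos_divide_le_eq add_nonneg_pos)
    finally show ?thesis by simp
  qed
  then show "\<exists>no. \<forall>n\<ge>no. norm ((LBINT x. f x \<bullet> G n x) - (LBINT x. f x \<bullet> g x)) < e" by auto
qed

text \<open>Supporting line of \<open>t powr p\<close> at \<open>m\<close>; this is Young's inequality for \<open>a * m powr (p - 1)\<close>.\<close>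

lemma powr_supporting_line:
  fixes a m p :: real
  assumes "0 \<le> a" "0 \<le> m" "1 < p"
  shows "m powr p + p * m powr (p - 1) * (a - m) \<le> a powr p"
proof -
  define q where "q = p / (p - 1)"
  have q: "1 < q" "1 / p + 1 / q = 1" using assms by (auto simp: q_def field_simps)
  have "a * m powr (p - 1) \<le> a powr p / p + (m powr (p - 1)) powr q / q"
    using assms q by (intro Youngs_inequality) auto
  also have "(m powr (p - 1)) powr q = m powr p" using assms by (simp add: powr_powr q_def)
  finally have "p * (a * m powr (p - 1)) \<le> a powr p + (p - 1) * m powr p"
    using assms q by (simp add: q_def field_simps)
  moreover have "m powr (p - 1) * m = m powr p" using assms by (cases "m = 0") (auto simp: powr_diff)
  then have "p * m powr (p - 1) * (a - m) = p * (a * m powr (p-1)) - p * m powr p" by (simp add: algebra_simps)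
  ultimately show ?thesis using assms by (simp add: algebra_simps)
qed

text \<open>Integrates the supporting line at the mean, whose linear term has integral 0. The
  conclusion is in \<open>ennreal\<close>, so an infinite right side is a trivial case instead of an
  integrability obligation for callers.\<close>

lemma Jensen_powr:
  assumes M: "emeasure M (space M) = 1" and a: "integrable M a" "\<And>x. 0 \<le> a x" and p: "1 \<le> p"
  shows "ennreal ((LINT x|M. a x) powr p) \<le> (\<integral>\<^sup>+x. ennreal (a x powr p) \<partial>M)"
proof (cases "(\<integral>\<^sup>+x. ennreal (a x powr p) \<partial>M) < \<infinity> \<and> p > 1")
  case True
  have [measurable]: "a \<in> borel_measurable M" using a by auto
  interpret finite_measure M by standard (use M in auto)
  have ms: "measure M (space M) = 1" using M by (simp add: measure_def)
  have i: "integrable M (\<lambda>x. a x powr p)" using True by (intro integrableI_nonneg) auto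
  let ?m = "LINT x|M. a x"
  have m: "0 \<le> ?m" using a by simp
  have "?m powr p = (LINT x|M. ?m powr p + p * ?m powr (p - 1) * (a x - ?m))" using a by (simp add: ms)
  also have "\<dots> \<le> (LINT x|M. a x powr p)" using a i m True powr_supporting_line by (intro integral_mono) auto
  finally show ?thesis using i by (simp add: nn_integral_eq_integral)
next
  case False
  then consider "p = 1" | "(\<integral>\<^sup>+x. ennreal (a x powr p) \<partial>M) = \<infinity>" using p by (force simp: top.not_eq_extremum)
  then show ?thesis by cases (use a in \<open>auto simp: nn_integral_eq_integral\<close>)
qed

text \<open>Riesz--Fischer; since all supports lie in one bounded set, convergence in \<open>L\<^sup>p\<close> implies
  convergence in \<open>L\<^sup>1\<close>, and the limit is found there.\<close>

lemma Lp_complete: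
  assumes F: "\<And>n. Lp p (F n)" and S: "\<And>n x. x \<notin> S \<Longrightarrow> F n x = 0" "bounded S" "S \<in> sets borel"
    and p: "1 \<le> p"
    and C: "\<And>e. 0 < e \<Longrightarrow> \<exists>N. \<forall>m\<ge>N. \<forall>n\<ge>N. pdist p (F m) (F n) < e"
  obtains f where "Lp p f" "\<And>x. x \<notin> S \<Longrightarrow> f x = 0" "(\<lambda>n. pdist p (F n) f) \<longlonglongrightarrow> 0"
proof -
  have p0: "0 < p" using p by simp
  have [measurable]: "F n \<in> borel_measurable borel" for n using F by (auto dest: Lp_borel)
  have L1: "Lp 1 (F n)" for n by (rule Lp_nest(1)[OF F _ p S(1) S(2,3)]) auto
  have C1: "\<exists>N. \<forall>m\<ge>N. \<forall>n\<ge>N. (LBINT x. norm (F m x - F n x)) < e" if e: "0 < e" for e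
  proof -
    define \<tau> where "\<tau> = e / (2 * (measure lborel S + 1))"
    have t: "\<tau> > 0" using e by (simp add: \<tau>_def add_nonneg_pos)
    have t2: "\<tau> * measure lborel S \<le> e / 2"
      using e measure_nonneg[of lborel S] by (simp add: \<tau>_def pos_divide_le_eq add_nonneg_pos)
    obtain N where N: "\<And>m n. m \<ge> N \<Longrightarrow> n \<ge> N \<Longrightarrow> pdist p (F m) (F n) < e / 2 / \<tau> powr (1 - p)"
      using C[of "e / 2 / \<tau> powr (1 - p)"] e t by auto
    have "(LBINT x. norm (F m x - F n x)) < e" if "m \<ge> N" "n \<ge> N" for m n
    proof -
      have "pdist 1 (F m) (F n) \<le> \<tau> powr 1 * measure lborel S + \<tau> powr (1 - p) * pdist p (F m) (F n)"
        by (rule Lp_nest(2)[OF Lp_diff(1)[OF F F p0] _ p _ S(2,3) t]) (auto simp: S(1))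
      moreover have "\<tau> powr (1 - p) * pdist p (F m) (F n) < e / 2"
        using N[OF that] t by (simp add: pos_less_divide_eq mult.commute)
      ultimately show ?thesis using t2 t by (simp add: pint_def)
    qed
    then show ?thesis by blast
  qed
  have "\<exists>r. strict_mono r \<and> (AE x in lborel. Cauchy (\<lambda>i. F (r i) x))"
  proof -
    have "integrable lborel (F n)" for n using L1[of n] by (simp add: Lp_def integrable_norm_iff)
    then obtain r where "strict_mono r" "AE x in lborel. Cauchy (\<lambda>i. F (r i) x)"
      using cauchy_L1_AE_cauchy_subseq[of lborel F] C1 by metis
    then show ?thesis by blast
  qed
  then obtain r where r: "strict_mono r" "AE x in lborel. Cauchy (\<lambda>i. F (r i) x)" by blast
  define f where "f x = lim (\<lambda>i. F (r i) x)" for x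
  have fm [measurable]: "f \<in> borel_measurable borel" unfolding f_def by (rule borel_measurable_lim_metric) auto
  have conv: "AE x in lborel. (\<lambda>i. F (r i) x) \<longlonglongrightarrow> f x"
    using r(2) by eventually_elim (simp add: f_def Cauchy_convergent_iff convergent_LIMSEQ_iff)
  \<comment> \<open>Fatou's lemma along the almost everywhere convergent subsequence turns closeness
    among the \<open>F m\<close> into closeness to \<open>f\<close>.\<close>
  have bd: "Lp p (\<lambda>x. F n x - f x) \<and> pdist p (F n) f \<le> e"
    if "\<And>m. m \<ge> N \<Longrightarrow> pdist p (F n) (F m) < e" for n N e
  proof -
    have e: "0 \<le> e" using that[of N] pint_nonneg[of p "\<lambda>x. F n x - F N x"] by linarith
    have "(NN x. ennreal (norm (F n x - f x) powr p))
        \<le> (NN x. liminf (\<lambda>i. ennreal (norm (F n x - F (r i) x) powr p)))"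
    proof (rule nn_integral_mono_AE)
      show "AE x in lborel. ennreal (norm (F n x - f x) powr p) \<le> liminf (\<lambda>i. ennreal (norm (F n x - F (r i) x) powr p))"
        using conv
      proof eventually_elim
        fix x assume "(\<lambda>i. F (r i) x) \<longlonglongrightarrow> f x"
        then have "(\<lambda>i. ennreal (norm (F n x - F (r i) x) powr p)) \<longlonglongrightarrow> ennreal (norm (F n x - f x) powr p)"
          using p0 by (intro tendsto_ennrealI tendsto_powr') (auto intro!: tendsto_intros)
        then show "ennreal (norm (F n x - f x) powr p) \<le> liminf (\<lambda>i. ennreal (norm (F n x - F (r i) x) powr p))"
          using lim_imp_Liminf[of sequentially] by force
      qed
    qed
    also have "\<dots> \<le> liminf (\<lambda>i. NN x. ennreal (norm (F n x - F (r i) x) powr p))" by (rule nn_integral_liminf) simp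
    also have "\<dots> \<le> liminf (\<lambda>i. ennreal e)"
    proof (rule Liminf_mono, rule eventually_sequentiallyI[of N])
      fix i assume "i \<ge> N"
      then have "r i \<ge> N" using seq_suble[OF r(1), of i] by linarith
      then show "(NN x. ennreal (norm (F n x - F (r i) x) powr p)) \<le> ennreal e"
        using that[of "r i"] Lp_diff(1)[OF F F p0, of n "r i"] by (subst ennreal_pint) (auto intro!: ennreal_leI)
    qed
    also have "\<dots> = ennreal e" by (simp add: Liminf_const)
    finally show ?thesis using Lp_nn_bound[of "\<lambda>x. F n x - f x" p e] e by simp
  qed
  have ex: "\<exists>N. \<forall>n\<ge>N. Lp p (\<lambda>x. F n x - f x) \<and> pdist p (F n) f \<le> e" if "0 < e" for e using C[OF that] bd by metis
  obtain N where N: "Lp p (\<lambda>x. F N x - f x)" using ex[of 1] by auto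
  have "Lp p (\<lambda>x. F N x - (F N x - f x))" by (rule Lp_diff(1)[OF F N p0])
  then have fL: "Lp p f" by simp
  have "f x = 0" if "x \<notin> S" for x by (simp add: f_def S(1)[OF that])
  moreover have "(\<lambda>n. pdist p (F n) f) \<longlonglongrightarrow> 0"
  proof (rule LIMSEQ_I)
    fix e :: real assume "0 < e"
    then obtain N where "\<forall>n\<ge>N. pdist p (F n) f \<le> e / 2" using ex[of "e/2"] by auto
    then show "\<exists>no. \<forall>n\<ge>no. norm (pdist p (F n) f - 0) < e"
      using \<open>0 < e\<close> by (intro exI[of _ N]) (auto intro: le_less_trans)
  qed
  ultimately show thesis using that fL by blast
qed

section \<open>Smooth functions and cutoffs\<close>

lemma C_k_SucI:
  assumes "\<And>x. (\<phi> has_derivative \<phi>' x) (at x)" "\<And>v. C_k k (\<lambda>x. \<phi>' x v)"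
  shows "C_k (Suc k) \<phi>"
proof -
  have "frechet_derivative \<phi> (at x) = \<phi>' x" for x using frechet_derivative_at[OF assms(1)[of x]] by simp
  then show ?thesis using assms by (auto simp: differentiable_def)
qed

lemma C_k_has_derivative:
  "C_k (Suc k) \<phi> \<Longrightarrow> (\<phi> has_derivative frechet_derivative \<phi> (at x)) (at x)" by (simp add: frechet_derivative_works)

lemma C_k_mono: "C_k (Suc k) \<phi> \<Longrightarrow> C_k k \<phi>"
proof (induction k arbitrary: \<phi>)
  case 0
  then show ?case by (auto intro!: continuous_at_imp_continuous_on differentiable_imp_continuous_within)
next
  case (Suc k)
  then show ?case by (meson C_k.simps(2))
qed

lemma C_k_const: "C_k k (\<lambda>x::'a::euclidean_space. c)"
proof (induction k arbitrary: c)
  case (Suc k)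
  show ?case by (rule C_k_SucI[where \<phi>'="\<lambda>x v. 0"]) (use Suc in auto)
qed auto

lemma C_k_add: "C_k k \<phi> \<Longrightarrow> C_k k \<psi> \<Longrightarrow> C_k k (\<lambda>x. \<phi> x + \<psi> x)"
proof (induction k arbitrary: \<phi> \<psi>)
  case (Suc k)
  show ?case by (rule C_k_SucI[where \<phi>'="\<lambda>x v. frechet_derivative \<phi> (at x) v + frechet_derivative \<psi> (at x) v"])
      (use Suc in \<open>auto intro!: has_derivative_add C_k_has_derivative\<close>)
qed (auto intro: continuous_intros)

lemma C_k_mult: "C_k k \<phi> \<Longrightarrow> C_k k \<psi> \<Longrightarrow> C_k k (\<lambda>x. \<phi> x * \<psi> x)"
proof (induction k arbitrary: \<phi> \<psi>)
  case (Suc k)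
  show ?case
  proof (rule C_k_SucI)
    show "((\<lambda>x. \<phi> x * \<psi> x) has_derivative
      (\<lambda>v. \<phi> x * frechet_derivative \<psi> (at x) v + frechet_derivative \<phi> (at x) v * \<psi> x)) (at x)" for x
      using has_derivative_mult[OF C_k_has_derivative[OF Suc.prems(1), of x] C_k_has_derivative[OF Suc.prems(2), of x]] .
    show "C_k k (\<lambda>x. \<phi> x * frechet_derivative \<psi> (at x) v + frechet_derivative \<phi> (at x) v * \<psi> x)" for v
      using Suc.prems C_k_mono[OF Suc.prems(1)] C_k_mono[OF Suc.prems(2)] by (intro C_k_add Suc.IH) auto
  qed
qed (auto intro: continuous_intros)

lemma C_k_affine: "C_k k \<phi> \<Longrightarrow> C_k k (\<lambda>x. \<phi> (c *\<^sub>R x + t))"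
proof (induction k arbitrary: \<phi>)
  case 0
  then show ?case by (auto intro!: continuous_intros intro: continuous_on_compose2[of UNIV \<phi>])
next
  case (Suc k)
  show ?case
  proof (rule C_k_SucI)
    show "((\<lambda>x. \<phi> (c *\<^sub>R x + t)) has_derivative (\<lambda>v. frechet_derivative \<phi> (at (c *\<^sub>R x + t)) (c *\<^sub>R v))) (at x)" for x
    proof -
      have "((\<lambda>x. c *\<^sub>R x + t) has_derivative (\<lambda>v. c *\<^sub>R v)) (at x)" by (auto intro!: derivative_eq_intros)
      from has_derivative_compose[OF this C_k_has_derivative[OF Suc.prems]] show ?thesis .
    qed
    show "C_k k (\<lambda>x. frechet_derivative \<phi> (at (c *\<^sub>R x + t)) (c *\<^sub>R v))" for v
      using Suc.IH[of "\<lambda>x. frechet_derivative \<phi> (at x) (c *\<^sub>R v)"] Suc.prems by simp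
  qed
qed

lemma C_k_inner: "C_k k (\<lambda>x::'a::euclidean_space. x \<bullet> v)"
proof (cases k)
  case (Suc n)
  have "((\<lambda>x::'a. x \<bullet> v) has_derivative (\<lambda>h. h \<bullet> v)) (at x)" for x by (auto intro!: derivative_eq_intros)
  then show ?thesis unfolding Suc by (rule C_k_SucI) (rule C_k_const)
qed (auto intro: continuous_intros)

lemma C_k_sum: "finite I \<Longrightarrow> (\<And>i. i \<in> I \<Longrightarrow> C_k k (\<phi> i)) \<Longrightarrow> C_k k (\<lambda>x. \<Sum>i\<in>I. \<phi> i x)"
  by (induction I rule: finite_induct) (auto intro: C_k_const C_k_add)

lemma C_k_inner_self: "C_k k (\<lambda>x::'a::euclidean_space. x \<bullet> x)"
proof -
  have "C_k k (\<lambda>x::'a. \<Sum>b\<in>Basis. (x \<bullet> b) * (x \<bullet> b))" by (intro C_k_sum C_k_mult C_k_inner) auto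
  then show ?thesis by (simp flip: euclidean_inner)
qed

text \<open>\<open>S\<close> is a family of scalar functions closed under differentiation on
  \<open>U\<close>. The induction has to range over the whole family, since the chain rule replaces
  \<open>F\<close> by \<open>F'\<close>. It is applied to multiples of powers of
  \<open>inverse\<close>, and to polynomials in \<open>inverse t\<close> times
  \<open>exp (- inverse t)\<close>.\<close>

lemma C_k_compose:
  assumes S: "\<And>F. F \<in> S \<Longrightarrow> \<exists>F'\<in>S. \<forall>t\<in>U. (F has_real_derivative F' t) (at t)"
    and "F \<in> S" "C_k k \<phi>" and U: "\<And>x. \<phi> x \<in> U"
  shows "C_k k (\<lambda>x. F (\<phi> x))"
  using assms(2,3) U
proof (induction k arbitrary: F)
  case 0
  obtain F' where F': "\<forall>t\<in>U. (F has_real_derivative F' t) (at t)" using S[OF 0(1)] by (rule bexE)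
  have cF: "continuous_on U F"
  proof (rule continuous_at_imp_continuous_on, rule ballI)
    fix t assume "t \<in> U"
    then show "isCont F t" using F' DERIV_isCont[of F "F' t" t] by simp
  qed
  have "continuous_on UNIV (\<lambda>x. F (\<phi> x))" by (rule continuous_on_compose2[OF cF]) (use 0 in auto)
  then show ?case by simp
next
  case (Suc k)
  obtain F' where F': "F' \<in> S" "\<forall>t\<in>U. (F has_real_derivative F' t) (at t)" using S[OF Suc.prems(1)] by (rule bexE)
  show ?case
  proof (rule C_k_SucI)
    show "((\<lambda>x. F (\<phi> x)) has_derivative (\<lambda>v. F' (\<phi> x) * frechet_derivative \<phi> (at x) v)) (at x)" for x
    proof -
      have "(F has_derivative (\<lambda>t. F' (\<phi> x) * t)) (at (\<phi> x))"
        using F'(2) Suc.prems(3)[of x] by (simp add: has_field_derivative_def)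
      from has_derivative_compose[OF C_k_has_derivative[OF Suc.prems(2)] this] show ?thesis .
    qed
    show "C_k k (\<lambda>x. F' (\<phi> x) * frechet_derivative \<phi> (at x) v)" for v
    proof (rule C_k_mult)
      show "C_k k (\<lambda>x. F' (\<phi> x))" by (rule Suc.IH[OF F'(1) C_k_mono[OF Suc.prems(2)] Suc.prems(3)])
      show "C_k k (\<lambda>x. frechet_derivative \<phi> (at x) v)" using Suc.prems(2) by simp
    qed
  qed
qed

lemma C_k_inverse:
  assumes "C_k k \<phi>" "\<And>x. \<phi> x > 0"
  shows "C_k k (\<lambda>x. inverse (\<phi> x))"
proof -
  define S where "S = {F. \<exists>c::real. \<exists>n. F = (\<lambda>t::real. c * inverse t ^ n)}"
  have S: "\<exists>F'\<in>S. \<forall>t\<in>{0<..}. (F has_real_derivative F' t) (at t)" if FS: "F \<in> S" for F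
  proof -
    obtain c n where F: "F = (\<lambda>t. c * inverse t ^ n)" using FS by (auto simp: S_def)
    have "(F has_real_derivative - (c * real n) * inverse t ^ Suc n) (at t)" if "t > 0" for t
    proof -
      have "((\<lambda>t. c * inverse t ^ n) has_real_derivative c * (real n * (- (inverse t * 1 * inverse t) * inverse t ^ (n - 1)))) (at t)"
        using that by (auto intro!: derivative_eq_intros)
      then show ?thesis unfolding F by (cases n) (auto simp: mult_ac)
    qed
    moreover have "(\<lambda>t. - (c * real n) * inverse t ^ Suc n) \<in> S" unfolding S_def by (rule CollectI, (rule exI)+, rule refl)
    ultimately show ?thesis by (intro bexI[of _ "\<lambda>t. - (c * real n) * inverse t ^ Suc n"]) auto
  qed
  have 1: "(\<lambda>t. 1 * inverse t ^ 1) \<in> S" unfolding S_def by (rule CollectI, (rule exI)+, rule refl)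
  have "C_k k (\<lambda>x. 1 * inverse (\<phi> x) ^ 1)" by (rule C_k_compose[OF S 1 assms(1)]) (use assms(2) in auto)
  then show ?thesis by simp
qed

section \<open>Smooth step functions and radial cutoffs\<close>

definition flat_exp :: "real \<Rightarrow> real" where
  "flat_exp t = (if 0 < t then exp (- inverse t) else 0)"

text \<open>All derivatives of \<open>flat_exp\<close> have the form \<open>P(1/t) exp(-1/t)\<close> for \<open>t > 0\<close>, with a polynomial \<open>P\<close>.\<close>

lemma flat_exp_family:
  fixes P :: "real poly"
  defines "F \<equiv> \<lambda>(P::real poly) t. if 0 < t then poly P (inverse t) * exp (- inverse t) else (0::real)"
  shows "(F P has_real_derivative F ([:0,0,1:] * (P - pderiv P)) t) (at t)"
proof -
  consider "t > 0" | "t < 0" | "t = 0" by linarith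
  then show ?thesis
  proof cases
    case 1
    have i: "(inverse has_real_derivative - (inverse t * inverse t)) (at t)"
      using DERIV_inverse[of t UNIV] 1 by (simp add: power2_eq_square)
    have p: "((\<lambda>t. poly P (inverse t)) has_real_derivative poly (pderiv P) (inverse t) * - (inverse t * inverse t)) (at t)"
      by (rule DERIV_chain2[OF poly_DERIV i])
    have e: "((\<lambda>t. exp (- inverse t)) has_real_derivative exp (- inverse t) * - (- (inverse t * inverse t))) (at t)"
      by (rule DERIV_chain2[OF DERIV_exp DERIV_minus[OF i]])
    have "((\<lambda>t. poly P (inverse t) * exp (- inverse t)) has_real_derivative
        F ([:0,0,1:] * (P - pderiv P)) t) (at t)"
      by (rule DERIV_cong[OF DERIV_mult[OF p e]]) (use 1 in \<open>simp add: F_def algebra_simps\<close>)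
    then show ?thesis
      by (rule has_field_derivative_transform_within_open[where S="{0<..}"]) (use 1 in \<open>auto simp: F_def\<close>)
  next
    case 2
    have "((\<lambda>t. 0) has_real_derivative 0) (at t)" by simp
    then have "(F P has_real_derivative 0) (at t)"
      by (rule has_field_derivative_transform_within_open[where S="{..<0}"]) (use 2 in \<open>auto simp: F_def\<close>)
    then show ?thesis using 2 by (simp add: F_def)
  next
    case 3
    \<comment> \<open>At the origin the right difference quotient is Q(1/h) exp(-1/h) with Q(s) = s
      P(s), so it suffices that polynomials lose against the exponential at infinity; on the left
      everything vanishes.\<close>
    have lim: "((\<lambda>s. poly Q s * exp (- s)) \<longlongrightarrow> (0::real)) at_top" for Q :: "real poly"
    proof (induction Q)
      case (pCons a Q)
      have "((\<lambda>s. s * poly Q s * exp (- s)) \<longlongrightarrow> (0::real)) at_top"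
      proof -
        have *: "((\<lambda>s. s ^ n / exp s) \<longlongrightarrow> (0::real)) at_top" for n by (rule tendsto_power_div_exp_0)
        have "((\<lambda>s. \<Sum>i\<le>degree Q. coeff Q i * (s ^ Suc i / exp s)) \<longlongrightarrow> (\<Sum>i\<le>degree Q. coeff Q i * 0)) at_top"
          by (intro tendsto_sum tendsto_mult tendsto_const *)
        moreover have "(\<Sum>i\<le>degree Q. coeff Q i * (s ^ Suc i / exp s)) = s * poly Q s * exp (- s)" for s
          by (simp add: poly_altdef sum_distrib_left sum_distrib_right exp_minus field_simps)
        ultimately show ?thesis by simp
      qed
      moreover have "((\<lambda>s. a * exp (- s)) \<longlongrightarrow> a * 0) at_top"
        by (intro tendsto_mult tendsto_const) (auto intro: exp_at_bot[THEN filterlim_compose] filterlim_uminus_at_bot_at_top)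
      ultimately have "((\<lambda>s. a * exp (- s) + s * poly Q s * exp (- s)) \<longlongrightarrow> a * 0 + 0) at_top" by (intro tendsto_add)
      then show ?case by (simp add: algebra_simps)
    qed auto
    have "((\<lambda>h. F P h / h) \<longlongrightarrow> 0) (at_right 0)"
    proof -
      have "((\<lambda>h. poly ([:0,1:] * P) (inverse h) * exp (- inverse h)) \<longlongrightarrow> (0::real)) (at_right 0)"
        by (rule filterlim_compose[OF lim filterlim_inverse_at_top_right])
      then show ?thesis by (rule tendsto_cong[THEN iffD1, rotated])
          (auto simp: F_def eventually_at_filter field_simps intro!: always_eventually)
    qed
    moreover have "((\<lambda>h. F P h / h) \<longlongrightarrow> 0) (at_left 0)"
      by (rule tendsto_eventually) (auto simp: F_def eventually_at_filter)
    ultimately have "((\<lambda>h. F P h / h) \<longlongrightarrow> 0) (at 0)" by (rule filterlim_split_at_real[rotated])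
    then show ?thesis unfolding 3 DERIV_def by (simp add: F_def)
  qed
qed

lemma C_k_flat_exp: "C_k k \<phi> \<Longrightarrow> C_k k (\<lambda>x. flat_exp (\<phi> x))"
proof -
  assume phi: "C_k k \<phi>"
  define F where "F = (\<lambda>(P::real poly) t. if 0 < t then poly P (inverse t) * exp (- inverse t) else (0::real))"
  have 1: "flat_exp = F 1" by (auto simp: F_def flat_exp_def)
  have "\<exists>F'\<in>range F. \<forall>t\<in>UNIV. (G has_real_derivative F' t) (at t)" if GF: "G \<in> range F" for G
  proof -
    from GF obtain P where "G = F P" by (rule rangeE)
    moreover have "\<forall>t. (F P has_real_derivative F ([:0,0,1:] * (P - pderiv P)) t) (at t)"
      unfolding F_def using flat_exp_family[of P] by blast
    ultimately show ?thesis by (intro bexI[of _ "F ([:0,0,1:] * (P - pderiv P))"]) auto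
  qed
  then have "C_k k (\<lambda>x. F 1 (\<phi> x))" by (rule C_k_compose[OF _ rangeI phi UNIV_I])
  then show ?thesis by (simp add: 1)
qed

definition smooth_step :: "real \<Rightarrow> real" where
  "smooth_step t = flat_exp t * inverse (flat_exp t + flat_exp (1 - t))"

lemma flat_exp_nonneg: "0 \<le> flat_exp t" and flat_exp_pos: "0 < t \<Longrightarrow> 0 < flat_exp t"
  by (auto simp: flat_exp_def)

lemma flat_exp_sum_pos: "0 < flat_exp t + flat_exp (1 - t)"
  using flat_exp_nonneg[of t] flat_exp_nonneg[of "1 - t"] flat_exp_pos[of t] flat_exp_pos[of "1 - t"]
  by (cases "t > 0") (auto intro: add_pos_nonneg add_nonneg_pos)

lemma smooth_step_bounds: "0 \<le> smooth_step t" "smooth_step t \<le> 1"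
  using flat_exp_nonneg[of t] flat_exp_nonneg[of "1 - t"] flat_exp_sum_pos[of t]
  by (auto simp: smooth_step_def field_simps)

lemma smooth_step_0: "t \<le> 0 \<Longrightarrow> smooth_step t = 0"
  by (simp add: smooth_step_def flat_exp_def)

lemma smooth_step_1: "1 \<le> t \<Longrightarrow> smooth_step t = 1"
  using flat_exp_pos[of t] by (simp add: smooth_step_def) (simp add: flat_exp_def)

lemma C_k_smooth_step: "C_k k \<phi> \<Longrightarrow> C_k k (\<lambda>x. smooth_step (\<phi> x))"
proof -
  assume phi: "C_k k \<phi>"
  have "C_k k (\<lambda>x. 1 + (-1) * \<phi> x)" by (intro C_k_add C_k_mult C_k_const phi)
  then have "C_k k (\<lambda>x. 1 - \<phi> x)" by simp
  then show ?thesis unfolding smooth_step_def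
    by (intro C_k_mult C_k_inverse C_k_add C_k_flat_exp phi flat_exp_sum_pos)
qed

text \<open>The squared distance makes the argument of \<open>smooth_step\<close> a polynomial in
  \<open>y\<close>, which keeps the function smooth at the centre \<open>x\<close>.\<close>

definition cutoff :: "'a::euclidean_space \<Rightarrow> real \<Rightarrow> real \<Rightarrow> 'a \<Rightarrow> real" where
  "cutoff x a b y = smooth_step ((b\<^sup>2 - (norm (y - x))\<^sup>2) / (b\<^sup>2 - a\<^sup>2))"

lemma C_k_cutoff: "C_k k (cutoff x a b)"
proof -
  have "C_k k (\<lambda>y. (1 *\<^sub>R y + - x) \<bullet> (1 *\<^sub>R y + - x))" by (rule C_k_affine[OF C_k_inner_self])
  then have "C_k k (\<lambda>y. b\<^sup>2 * inverse (b\<^sup>2 - a\<^sup>2) + (- inverse (b\<^sup>2 - a\<^sup>2)) * ((1 *\<^sub>R y + - x) \<bullet> (1 *\<^sub>R y + - x)))"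
    by (intro C_k_add C_k_mult C_k_const)
  then have "C_k k (\<lambda>y. smooth_step (b\<^sup>2 * inverse (b\<^sup>2 - a\<^sup>2) + (- inverse (b\<^sup>2 - a\<^sup>2)) * ((1 *\<^sub>R y + - x) \<bullet> (1 *\<^sub>R y + - x))))"
    by (rule C_k_smooth_step)
  then show ?thesis
    by (rule back_subst[where P="C_k k"]) (auto simp: cutoff_def fun_eq_iff power2_norm_eq_inner divide_inverse algebra_simps)
qed

lemma cutoff_bounds: "0 \<le> cutoff x a b y" "cutoff x a b y \<le> 1"
  by (auto simp: cutoff_def smooth_step_bounds)

lemma cutoff_1: "0 \<le> a \<Longrightarrow> a < b \<Longrightarrow> dist x y \<le> a \<Longrightarrow> cutoff x a b y = 1"
proof -
  assume a: "0 \<le> a" "a < b" "dist x y \<le> a"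
  then have "(norm (y - x))\<^sup>2 \<le> a\<^sup>2" "a\<^sup>2 < b\<^sup>2"
    by (auto simp: dist_norm norm_minus_commute intro!: power_mono power_strict_mono)
  then show ?thesis by (simp add: cutoff_def smooth_step_1 le_divide_eq)
qed

lemma cutoff_0: "0 \<le> a \<Longrightarrow> a < b \<Longrightarrow> b \<le> dist x y \<Longrightarrow> cutoff x a b y = 0"
proof -
  assume a: "0 \<le> a" "a < b" "b \<le> dist x y"
  then have "b\<^sup>2 \<le> (norm (y - x))\<^sup>2" "a\<^sup>2 < b\<^sup>2"
    by (auto simp: dist_norm norm_minus_commute intro!: power_mono power_strict_mono)
  then show ?thesis by (simp add: cutoff_def smooth_step_0 divide_le_0_iff)
qed

text \<open>Reduces gradient bounds at every centre and radius to the single cutoff with radii 1 and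
  2.\<close>

lemma cutoff_scale:
  assumes "0 < r"
  shows "cutoff x (r * a) (r * b) y = cutoff 0 a b ((y - x) /\<^sub>R r)"
proof -
  have "(norm ((y - x) /\<^sub>R r))\<^sup>2 = (norm (y - x))\<^sup>2 / r\<^sup>2"
    using assms by (simp add: power_mult_distrib power_inverse divide_inverse mult.commute)
  moreover have "((r * b)\<^sup>2 - N) / ((r * b)\<^sup>2 - (r * a)\<^sup>2) = (b\<^sup>2 - N / r\<^sup>2) / (b\<^sup>2 - a\<^sup>2)" for N
  proof -
    have "(r * b)\<^sup>2 - N = r\<^sup>2 * (b\<^sup>2 - N / r\<^sup>2)" "(r * b)\<^sup>2 - (r * a)\<^sup>2 = r\<^sup>2 * (b\<^sup>2 - a\<^sup>2)"
      using assms by (auto simp: field_simps power_mult_distrib)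
    then show ?thesis using assms by simp
  qed
  ultimately show ?thesis by (simp add: cutoff_def)
qed

section \<open>Gradients and test functions\<close>

definition smooth :: "('a::euclidean_space \<Rightarrow> real) \<Rightarrow> bool" where
  "smooth \<phi> \<longleftrightarrow> (\<forall>k. C_k k \<phi>)"

lemma smoothI: "(\<And>k. C_k k \<phi>) \<Longrightarrow> smooth \<phi>" and smooth_C_k: "smooth \<phi> \<Longrightarrow> C_k k \<phi>"
  by (auto simp: smooth_def)

lemma smooth_gradient_derivative:
  assumes "smooth \<phi>" shows "(\<phi> has_derivative (\<lambda>v. gradient \<phi> x \<bullet> v)) (at x)"
proof -
  have d: "(\<phi> has_derivative frechet_derivative \<phi> (at x)) (at x)"
    using C_k_has_derivative[OF smooth_C_k[OF assms, of "Suc 0"]] .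
  then interpret bounded_linear "frechet_derivative \<phi> (at x)" by (rule has_derivative_bounded_linear)
  have "frechet_derivative \<phi> (at x) v = gradient \<phi> x \<bullet> v" for v
  proof -
    have "frechet_derivative \<phi> (at x) v = frechet_derivative \<phi> (at x) (\<Sum>b\<in>Basis. (v \<bullet> b) *\<^sub>R b)"
      by (simp add: euclidean_representation)
    also have "\<dots> = gradient \<phi> x \<bullet> v"
      by (simp add: sum scaleR gradient_def inner_sum_left mult.commute inner_commute[of v])
    finally show ?thesis .
  qed
  then have "frechet_derivative \<phi> (at x) = (\<lambda>v. gradient \<phi> x \<bullet> v)" by auto
  with d show ?thesis by simp
qed

lemma gradient_eqI:
  assumes "(\<phi> has_derivative (\<lambda>v. g \<bullet> v)) (at x)" shows "gradient \<phi> x = g"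
proof -
  have "frechet_derivative \<phi> (at x) = (\<lambda>v. g \<bullet> v)" using frechet_derivative_at[OF assms] by simp
  then show ?thesis by (simp add: gradient_def euclidean_representation)
qed

lemma smooth_continuous: "smooth \<phi> \<Longrightarrow> continuous_on S \<phi>"
  using smooth_C_k[of \<phi> 0] by (auto intro: continuous_on_subset)

lemma smooth_gradient_continuous:
  assumes "smooth \<phi>" shows "continuous_on S (gradient \<phi>)"
proof -
  have "C_k (Suc 0) \<phi>" using assms by (rule smooth_C_k)
  then have "continuous_on S (\<lambda>x. frechet_derivative \<phi> (at x) b)" for b by (auto intro: continuous_on_subset)
  then show ?thesis unfolding gradient_def by (intro continuous_intros)
qed

lemma smooth_const: "smooth (\<lambda>x. c)" and smooth_add: "smooth \<phi> \<Longrightarrow> smooth \<psi> \<Longrightarrow> smooth (\<lambda>x. \<phi> x + \<psi> x)"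
  and smooth_mult: "smooth \<phi> \<Longrightarrow> smooth \<psi> \<Longrightarrow> smooth (\<lambda>x. \<phi> x * \<psi> x)"
  and smooth_cutoff: "smooth (cutoff z a b)"
  and smooth_sum: "finite I \<Longrightarrow> (\<And>i. i \<in> I \<Longrightarrow> smooth (\<Phi> i)) \<Longrightarrow> smooth (\<lambda>x. \<Sum>i\<in>I. \<Phi> i x)"
  by (auto simp: smooth_def C_k_const C_k_add C_k_mult C_k_cutoff C_k_sum)

lemma smooth_cmult: "smooth \<phi> \<Longrightarrow> smooth (\<lambda>x. c * \<phi> x)"
  by (intro smooth_mult smooth_const)

lemma smooth_diff: "smooth \<phi> \<Longrightarrow> smooth \<psi> \<Longrightarrow> smooth (\<lambda>x. \<phi> x - \<psi> x)"
  using smooth_add[of \<phi> "\<lambda>x. -1 * \<psi> x"] smooth_cmult[of \<psi> "-1"] by simp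

lemma smooth_prod: "finite I \<Longrightarrow> (\<And>i. i \<in> I \<Longrightarrow> smooth (\<Phi> i)) \<Longrightarrow> smooth (\<lambda>x. \<Prod>i\<in>I. \<Phi> i x)"
  by (induction I rule: finite_induct) (auto intro: smooth_const smooth_mult)

lemma smooth_shift: "smooth \<phi> \<Longrightarrow> smooth (\<lambda>x. \<phi> (x - h))"
  using C_k_affine[of _ \<phi> 1 "- h"] by (simp add: smooth_def)

lemma gradient_add: "smooth \<phi> \<Longrightarrow> smooth \<psi> \<Longrightarrow> gradient (\<lambda>x. \<phi> x + \<psi> x) x = gradient \<phi> x + gradient \<psi> x"
  by (intro gradient_eqI) (auto intro!: derivative_eq_intros smooth_gradient_derivative simp: inner_add_left)

lemma gradient_mult:
  "smooth \<phi> \<Longrightarrow> smooth \<psi> \<Longrightarrow> gradient (\<lambda>x. \<phi> x * \<psi> x) x = \<phi> x *\<^sub>R gradient \<psi> x + \<psi> x *\<^sub>R gradient \<phi> x"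
  by (intro gradient_eqI)
    (auto intro!: derivative_eq_intros smooth_gradient_derivative simp: inner_add_left algebra_simps)

lemma gradient_const: "gradient (\<lambda>x. c) x = 0"
  by (intro gradient_eqI) auto

lemma gradient_cmult: "smooth \<phi> \<Longrightarrow> gradient (\<lambda>x. c * \<phi> x) x = c *\<^sub>R gradient \<phi> x"
  by (simp add: gradient_mult smooth_const gradient_const)

lemma gradient_diff: "smooth \<phi> \<Longrightarrow> smooth \<psi> \<Longrightarrow> gradient (\<lambda>x. \<phi> x - \<psi> x) x = gradient \<phi> x - gradient \<psi> x"
  by (intro gradient_eqI) (auto intro!: derivative_eq_intros smooth_gradient_derivative simp: inner_diff_left)

lemma gradient_sum:
  "finite I \<Longrightarrow> (\<And>i. i \<in> I \<Longrightarrow> smooth (\<Phi> i)) \<Longrightarrow> gradient (\<lambda>x. \<Sum>i\<in>I. \<Phi> i x) x = (\<Sum>i\<in>I. gradient (\<Phi> i) x)"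
  by (induction I rule: finite_induct) (auto simp: gradient_const gradient_add smooth_sum)

lemma gradient_shift: "smooth \<phi> \<Longrightarrow> gradient (\<lambda>x. \<phi> (x - h)) x = gradient \<phi> (x - h)"
proof (intro gradient_eqI)
  assume "smooth \<phi>"
  have "((\<lambda>x. x - h) has_derivative (\<lambda>v. v)) (at x)" by (auto intro!: derivative_eq_intros)
  from has_derivative_compose[OF this smooth_gradient_derivative[OF \<open>smooth \<phi>\<close>]]
  show "((\<lambda>x. \<phi> (x - h)) has_derivative (\<lambda>v. gradient \<phi> (x - h) \<bullet> v)) (at x)" .
qed

lemma gradient_0_outside:
  assumes "x \<notin> closure {x. \<phi> x \<noteq> 0}" shows "gradient \<phi> x = 0"
proof (rule gradient_eqI)
  have "((\<lambda>x. 0) has_derivative (\<lambda>v. 0 \<bullet> v)) (at x)" by simp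
  then show "(\<phi> has_derivative (\<lambda>v. 0 \<bullet> v)) (at x)"
  proof (rule has_derivative_transform_within_open)
    show "open (- closure {x. \<phi> x \<noteq> 0})" by auto
    show "0 = \<phi> y" if "y \<in> - closure {x. \<phi> x \<noteq> 0}" for y using that closure_subset[of "{x. \<phi> x \<noteq> 0}"] by auto
  qed (use assms in auto)
qed

lemma test_functionI:
  assumes "smooth \<phi>" "compact K" "K \<subseteq> \<Omega>" "\<And>x. x \<notin> K \<Longrightarrow> \<phi> x = 0"
  shows "test_function \<Omega> \<phi>"
proof -
  have "closure {x. \<phi> x \<noteq> 0} \<subseteq> K" using assms by (intro closure_minimal) (auto simp: compact_imp_closed)
  moreover from this have "compact (closure {x. \<phi> x \<noteq> 0})"
    using assms(2) compact_closure closed_closure compact_Int_closed[of K "closure {x. \<phi> x \<noteq> 0}"]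
    by (simp add: Int_absorb1)
  ultimately show ?thesis using assms by (auto simp: test_function_def smooth_def)
qed

lemma test_functionE:
  assumes "test_function \<Omega> \<phi>"
  shows "smooth \<phi>" "\<exists>K. compact K \<and> K \<subseteq> \<Omega> \<and> (\<forall>x. x \<notin> K \<longrightarrow> \<phi> x = 0 \<and> gradient \<phi> x = 0)"
proof -
  show "smooth \<phi>" using assms unfolding test_function_def smooth_def by blast
  have "\<phi> x = 0 \<and> gradient \<phi> x = 0" if "x \<notin> closure {x. \<phi> x \<noteq> 0}" for x
    using gradient_0_outside[OF that] that closure_subset[of "{x. \<phi> x \<noteq> 0}"] by blast
  then show "\<exists>K. compact K \<and> K \<subseteq> \<Omega> \<and> (\<forall>x. x \<notin> K \<longrightarrow> \<phi> x = 0 \<and> gradient \<phi> x = 0)"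
    using assms unfolding test_function_def by blast
qed

lemma test_function_smooth: "test_function \<Omega> \<phi> \<Longrightarrow> smooth \<phi>"
  by (auto simp: test_function_def smooth_def)

lemma test_function_mono: "test_function \<Omega> \<phi> \<Longrightarrow> \<Omega> \<subseteq> \<Omega>' \<Longrightarrow> test_function \<Omega>' \<phi>"
  by (auto simp: test_function_def)

lemma test_function_0: "test_function \<Omega> (\<lambda>x. 0)"
  by (rule test_functionI[of _ "{}"]) (auto intro: smooth_const)

lemma test_function_add:
  assumes "test_function \<Omega> \<phi>" "test_function \<Omega> \<psi>" shows "test_function \<Omega> (\<lambda>x. \<phi> x + \<psi> x)"
proof -
  obtain K where K: "smooth \<phi>" "compact K" "K \<subseteq> \<Omega>" "\<And>x. x \<notin> K \<Longrightarrow> \<phi> x = 0" using test_functionE[OF assms(1)] by blast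
  obtain L where L: "smooth \<psi>" "compact L" "L \<subseteq> \<Omega>" "\<And>x. x \<notin> L \<Longrightarrow> \<psi> x = 0" using test_functionE[OF assms(2)] by blast
  show ?thesis by (rule test_functionI[of _ "K \<union> L"]) (use K L in \<open>auto intro: smooth_add\<close>)
qed

lemma test_function_mult:
  assumes "smooth \<phi>" "test_function \<Omega> \<psi>" shows "test_function \<Omega> (\<lambda>x. \<phi> x * \<psi> x)"
proof -
  obtain L where L: "smooth \<psi>" "compact L" "L \<subseteq> \<Omega>" "\<And>x. x \<notin> L \<Longrightarrow> \<psi> x = 0" using test_functionE[OF assms(2)] by blast
  show ?thesis by (rule test_functionI[of _ L]) (use assms L in \<open>auto intro: smooth_mult\<close>)
qed

lemma test_function_cmult: "test_function \<Omega> \<psi> \<Longrightarrow> test_function \<Omega> (\<lambda>x. c * \<psi> x)"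
  by (rule test_function_mult[OF smooth_const])

lemma test_function_diff:
  assumes "test_function \<Omega> \<phi>" "test_function \<Omega> \<psi>" shows "test_function \<Omega> (\<lambda>x. \<phi> x - \<psi> x)"
  using test_function_add[OF assms(1) test_function_cmult[OF assms(2), of "-1"]] by simp

lemma bounded_on_compact_support:
  assumes "continuous_on UNIV f" "compact K" "\<And>x. x \<notin> K \<Longrightarrow> f x = 0"
  shows "\<exists>M>0. \<forall>x. norm (f x) \<le> M"
proof -
  have "compact (f ` K)" using assms by (intro compact_continuous_image) (auto intro: continuous_on_subset)
  then obtain M where M: "\<forall>y\<in>f ` K. norm y \<le> M" using compact_imp_bounded bounded_iff by blast
  have "norm (f x) \<le> max 1 M" for x using M assms(3)[of x] by (cases "x \<in> K") auto
  then show ?thesis by (intro exI[of _ "max 1 M"]) auto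
qed

lemma test_function_bounded:
  assumes "test_function \<Omega> \<phi>"
  shows "\<exists>M>0. \<forall>x. \<bar>\<phi> x\<bar> \<le> M \<and> norm (gradient \<phi> x) \<le> M"
proof -
  obtain K where K: "smooth \<phi>" "compact K" "\<And>x. x \<notin> K \<Longrightarrow> \<phi> x = 0" "\<And>x. x \<notin> K \<Longrightarrow> gradient \<phi> x = 0"
    using test_functionE[OF assms] by blast
  obtain M where M: "0 < M" "\<And>x. norm (\<phi> x) \<le> M"
    using bounded_on_compact_support[OF smooth_continuous[OF K(1)] K(2,3)] by blast
  obtain N where N: "0 < N" "\<And>x. norm (gradient \<phi> x) \<le> N"
    using bounded_on_compact_support[OF smooth_gradient_continuous[OF K(1)] K(2,4)] by blast
  show ?thesis by (intro exI[of _ "max M N"]) (use M N in \<open>auto simp: le_max_iff_disj\<close>)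
qed

lemma borel_smooth: "smooth \<phi> \<Longrightarrow> \<phi> \<in> borel_measurable borel"
  and borel_gradient: "smooth \<phi> \<Longrightarrow> gradient \<phi> \<in> borel_measurable borel"
  by (auto intro!: borel_measurable_continuous_onI smooth_continuous smooth_gradient_continuous)

lemma test_function_Lp:
  assumes "test_function \<Omega> \<phi>" "0 < p" shows "Lp p \<phi>" "Lp p (gradient \<phi>)"
proof -
  obtain K where K: "smooth \<phi>" "compact K" "\<And>x. x \<notin> K \<Longrightarrow> \<phi> x = 0" "\<And>x. x \<notin> K \<Longrightarrow> gradient \<phi> x = 0"
    using test_functionE[OF assms(1)] by blast
  obtain M where M: "0 < M" "\<And>x. \<bar>\<phi> x\<bar> \<le> M" "\<And>x. norm (gradient \<phi> x) \<le> M"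
    using test_function_bounded[OF assms(1)] by blast
  show "Lp p \<phi>"
    by (rule Lp_bounded_support[of _ M K]) (use K M assms in \<open>auto simp: borel_smooth compact_imp_bounded\<close>)
  show "Lp p (gradient \<phi>)"
    by (rule Lp_bounded_support[of _ M K]) (use K M assms in \<open>auto simp: borel_gradient compact_imp_bounded\<close>)
qed

lemma smooth_lipschitz:
  assumes "smooth \<phi>" "\<And>x. norm (gradient \<phi> x) \<le> M"
  shows "\<bar>\<phi> x - \<phi> y\<bar> \<le> M * norm (x - y)"
proof -
  have "onorm (\<lambda>v. gradient \<phi> z \<bullet> v) \<le> M" for z
    using assms(2)[of z] by (intro onorm_le) (metis Cauchy_Schwarz_ineq2 mult_right_mono norm_ge_zero order_trans real_norm_def)
  then have "norm (\<phi> x - \<phi> y) \<le> M * norm (x - y)"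
    using assms(1) smooth_gradient_derivative by (intro differentiable_bound[of UNIV]) auto
  then show ?thesis by simp
qed

text \<open>One bound per space for the gradient of the unit cutoff. Giving it a name makes it
  visible in later estimates that their constants do not depend on the centre, the radius or the
  domain.\<close>

definition cutoff_const :: "'a::euclidean_space itself \<Rightarrow> real" where
  "cutoff_const _ = (SOME C. 0 < C \<and> (\<forall>y::'a. norm (gradient (cutoff 0 1 2) y) \<le> C))"

lemma cutoff_const:
  fixes y :: "'a::euclidean_space"
  shows "0 < cutoff_const TYPE('a)"
    and "norm (gradient (cutoff 0 1 2) y) \<le> cutoff_const TYPE('a)"
proof -
  have "test_function UNIV (cutoff (0::'a) 1 2)"
    by (rule test_functionI[of _ "cball 0 2"]) (auto intro: smooth_cutoff intro!: cutoff_0)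
  then have "\<exists>C. 0 < C \<and> (\<forall>y::'a. norm (gradient (cutoff 0 1 2) y) \<le> C)" by (meson test_function_bounded)
  from someI_ex[OF this] show "0 < cutoff_const TYPE('a)" "norm (gradient (cutoff 0 1 2) y) \<le> cutoff_const TYPE('a)"
    unfolding cutoff_const_def by auto
qed

lemma gradient_cutoff_le:
  fixes x :: "'a::euclidean_space"
  assumes "0 < r" shows "norm (gradient (cutoff x r (2 * r)) y) \<le> cutoff_const TYPE('a) / r"
proof -
  have eq: "cutoff x r (2 * r) = (\<lambda>y. cutoff 0 1 2 ((y - x) /\<^sub>R r))"
    using cutoff_scale[OF assms, of x 1 2] by (auto simp: mult.commute)
  have "((\<lambda>y. (y - x) /\<^sub>R r) has_derivative (\<lambda>v. v /\<^sub>R r)) (at y)" by (auto intro!: derivative_eq_intros)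
  from has_derivative_compose[OF this smooth_gradient_derivative[OF smooth_cutoff, of 0 1 2]]
  have "gradient (cutoff x r (2 * r)) y = gradient (cutoff 0 1 2) ((y - x) /\<^sub>R r) /\<^sub>R r"
    by (intro gradient_eqI) (simp add: eq)
  then show ?thesis using cutoff_const(2)[of "(y - x) /\<^sub>R r"] assms
    by (simp add: divide_right_mono divide_inverse mult.commute mult_left_mono)
qed

lemma gradient_cutoff_0:
  assumes "0 \<le> a" "a < b" "b < dist x y" shows "gradient (cutoff x a b) y = 0"
proof (rule gradient_0_outside)
  have "closure {y. cutoff x a b y \<noteq> 0} \<subseteq> cball x b"
    using cutoff_0[OF assms(1,2), of x] by (intro closure_minimal) (force simp: not_le)+
  then show "y \<notin> closure {y. cutoff x a b y \<noteq> 0}" using assms by auto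
qed

section \<open>Translations, and the inequalities of Poincare and Hardy\<close>

lemma lborel_nn_shift:
  assumes [measurable]: "f \<in> borel_measurable borel"
  shows "(NN x. f (x + c)) = (NN x. f x)"
proof -
  have "(NN x. f x) = (\<integral>\<^sup>+x. f x \<partial>distr lborel borel ((+) c))" by (simp add: lborel_distr_plus)
  also have "\<dots> = (NN x. f (c + x))" by (rule nn_integral_distr) auto
  finally show ?thesis by (simp add: add.commute)
qed

lemma lborel_nn_shift_minus:
  assumes "f \<in> borel_measurable borel"
  shows "(NN x. f (x - c)) = (NN x. f x)"
  using lborel_nn_shift[OF assms, of "- c"] by simp

lemma lborel_nn_scale:
  fixes f :: "'a::euclidean_space \<Rightarrow> ennreal"
  assumes [measurable]: "f \<in> borel_measurable borel" and c: "0 < c"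
  shows "(NN x. f x) = ennreal (c ^ DIM('a)) * (NN x. f (c *\<^sub>R x))"
proof -
  have "(NN x. f x) = (\<integral>\<^sup>+x. f x \<partial>density (distr lborel borel (\<lambda>x. 0 + c *\<^sub>R x)) (\<lambda>_. \<bar>c\<bar>^DIM('a)))"
    using lborel_affine[of c "0::'a"] c by simp
  also have "\<dots> = (NN x. ennreal (c ^ DIM('a)) * f (c *\<^sub>R x))"
    using c by (subst nn_integral_density) (auto simp: nn_integral_distr)
  also have "\<dots> = ennreal (c ^ DIM('a)) * (NN x. f (c *\<^sub>R x))" by (rule nn_integral_cmult) auto
  finally show ?thesis .
qed

lemma lborel_nn_reflect:
  fixes f :: "'a::euclidean_space \<Rightarrow> ennreal"
  assumes [measurable]: "f \<in> borel_measurable borel"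
  shows "(NN x. f (c - x)) = (NN x. f x)"
proof -
  have "lborel = density (distr lborel borel (\<lambda>x. c + (-1) *\<^sub>R x)) (\<lambda>_. ennreal (\<bar>-1\<bar> ^ DIM('a)))"
    by (rule lborel_affine) simp
  then have "lborel = distr lborel borel (\<lambda>x. c - x)" by (simp add: density_1)
  then have "(NN x. f x) = (\<integral>\<^sup>+x. f x \<partial>distr lborel borel (\<lambda>x. c - x))" by simp
  also have "\<dots> = (NN x. f (c - x))" by (rule nn_integral_distr) auto
  finally show ?thesis by simp
qed

lemma Lp_shift:
  assumes "Lp p f" shows "Lp p (\<lambda>x. f (x - h))" "pint p (\<lambda>x. f (x - h)) = pint p f"
proof -
  have [measurable]: "f \<in> borel_measurable borel" using assms by (rule Lp_borel)
  have eq: "(NN x. ennreal (norm (f (x - h)) powr p)) = ennreal (pint p f)"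
    by (subst lborel_nn_shift_minus[of "\<lambda>x. ennreal (norm (f x) powr p)"]) (auto simp: ennreal_pint[OF assms])
  show L: "Lp p (\<lambda>x. f (x - h))" by (rule Lp_nn_bound(1)[of _ _ "pint p f"]) (auto simp: eq)
  show "pint p (\<lambda>x. f (x - h)) = pint p f" using ennreal_pint[OF L] eq by simp
qed

lemma lborel_integral_shift:
  fixes f :: "'a::euclidean_space \<Rightarrow> 'b::euclidean_space"
  assumes [measurable]: "f \<in> borel_measurable borel"
  shows "(LBINT x. f (x - c)) = (LBINT x. f x)"
proof -
  have "(LBINT x. f x) = (LINT x|distr lborel borel ((+) (-c)). f x)" by (simp add: lborel_distr_plus)
  also have "\<dots> = (LBINT x. f (- c + x))" by (rule integral_distr) auto
  finally show ?thesis by simp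
qed

lemma lborel_integrable_shift:
  fixes f :: "'a::euclidean_space \<Rightarrow> 'b::euclidean_space"
  assumes "integrable lborel f"
  shows "integrable lborel (\<lambda>x. f (x - c))"
proof -
  have [measurable]: "f \<in> borel_measurable borel" using assms by simp
  have "integrable (distr lborel borel ((+) (-c))) f" using assms by (simp add: lborel_distr_plus)
  then have "integrable lborel (\<lambda>x. f (- c + x))" by (subst (asm) integrable_distr_eq) auto
  then show ?thesis by simp
qed

lemma smooth_line_derivative:
  assumes "smooth \<phi>"
  shows "((\<lambda>s. \<phi> (p + s *\<^sub>R v)) has_real_derivative (gradient \<phi> (p + s *\<^sub>R v) \<bullet> v)) (at s)"
proof -
  have "((\<lambda>s. p + s *\<^sub>R v) has_derivative (\<lambda>t. t *\<^sub>R v)) (at s)" by (auto intro!: derivative_eq_intros)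
  from has_derivative_compose[OF this smooth_gradient_derivative[OF assms]]
  show ?thesis by (simp add: has_field_derivative_def mult_commute_abs)
qed

lemma smooth_line_continuous:
  assumes "smooth \<phi>" shows "continuous_on S (\<lambda>s. gradient \<phi> (p + s *\<^sub>R v))"
  by (rule continuous_on_compose2[OF smooth_gradient_continuous[OF assms, of UNIV]]) (auto intro!: continuous_intros)

lemma smooth_line_bound:
  assumes \<phi>: "smooth \<phi>" and ab: "a \<le> (b::real)"
  shows "\<bar>\<phi> (p + b *\<^sub>R v) - \<phi> (p + a *\<^sub>R v)\<bar>
      \<le> (LBINT s. indicator {a..b} s * (norm (gradient \<phi> (p + s *\<^sub>R v)) * norm v))"
proof -
  let ?g = "\<lambda>s. gradient \<phi> (p + s *\<^sub>R v) \<bullet> v"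
  have cg: "continuous_on {a..b} ?g" by (intro continuous_intros smooth_line_continuous \<phi>)
  have cn: "continuous_on {a..b} (\<lambda>s. norm (gradient \<phi> (p + s *\<^sub>R v)) * norm v)"
    by (intro continuous_intros smooth_line_continuous \<phi>)
  have ig: "integrable lborel (restr {a..b} ?g)" by (rule borel_integrable_compact[OF _ cg]) auto
  have in': "integrable lborel (restr {a..b} (\<lambda>s. norm (gradient \<phi> (p + s *\<^sub>R v)) * norm v))"
    by (rule borel_integrable_compact[OF _ cn]) auto
  have "(LBINT s. indicator {a..b} s *\<^sub>R ?g s) = \<phi> (p + b *\<^sub>R v) - \<phi> (p + a *\<^sub>R v)"
    using smooth_line_derivative[OF \<phi>, of p v] by (intro integral_FTC_Icc[OF ab _ cg])
       (auto simp flip: has_real_derivative_iff_has_vector_derivative intro: DERIV_subset)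
  then have "\<bar>\<phi> (p + b *\<^sub>R v) - \<phi> (p + a *\<^sub>R v)\<bar> \<le> (LBINT s. norm (indicator {a..b} s *\<^sub>R ?g s))"
    using integral_norm_bound[of lborel "\<lambda>s. indicator {a..b} s *\<^sub>R ?g s"] by simp
  also have "\<dots> \<le> (LBINT s. indicator {a..b} s *\<^sub>R (norm (gradient \<phi> (p + s *\<^sub>R v)) * norm v))"
    using ig in' by (intro integral_mono) (auto simp: indicator_def Cauchy_Schwarz_ineq2)
  finally show ?thesis by simp
qed

text \<open>The difference is the integral of the directional derivative over the segment from
  \<open>y\<close> to \<open>y - h\<close>. Jensen's inequality for the uniform density on
  \<open>{0..1}\<close>, Fubini and translation invariance then give the bound. \<open>S'\<close>
  has to contain these segments for points of \<open>S\<close>, which keeps the estimate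
  local.\<close>

lemma translation_estimate:
  assumes \<phi>: "smooth \<phi>" and p: "1 \<le> p"
    and S: "S \<in> sets borel" "S' \<in> sets borel" "\<And>y s. y \<in> S \<Longrightarrow> 0 \<le> s \<Longrightarrow> s \<le> 1 \<Longrightarrow> y - s *\<^sub>R h \<in> S'"
  shows "(NN y. indicator S y * ennreal (\<bar>\<phi> (y - h) - \<phi> y\<bar> powr p))
      \<le> ennreal (norm h powr p) * (NN y. indicator S' y * ennreal (norm (gradient \<phi> y) powr p))"
proof -
  let ?I = "NN y. indicator S' y * ennreal (norm (gradient \<phi> y) powr p)"
  let ?U = "density lborel (\<lambda>s::real. ennreal (indicator {0..1} s))"
  let ?G = "\<lambda>y s. norm (gradient \<phi> (y - s *\<^sub>R h))"
  let ?F = "\<lambda>y s. indicator {0..1} s * ennreal ((?G y s * norm h) powr p)"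
  have [measurable]: "gradient \<phi> \<in> borel_measurable borel" "S \<in> sets borel" "S' \<in> sets borel"
    using S \<phi> by (auto intro: borel_gradient)
  have U1: "emeasure ?U (space ?U) = 1" by (simp add: emeasure_density ennreal_indicator)
  have ptw: "ennreal (\<bar>\<phi> (y - h) - \<phi> y\<bar> powr p)
      \<le> (NN s. ?F y s)" for y
  proof -
    have c: "continuous_on {0..1} (\<lambda>s. ?G y s * norm h)"
      using smooth_line_continuous[OF \<phi>, of _ y "- h"] by (intro continuous_intros) auto
    have i: "integrable lborel (restr {0..1} (\<lambda>s. ?G y s * norm h))" by (rule borel_integrable_compact[OF _ c]) auto
    then have iU: "integrable ?U (\<lambda>s. ?G y s * norm h)" by (subst integrable_density) auto
    have "\<bar>\<phi> (y - h) - \<phi> y\<bar> \<le> (LBINT s. indicator {0..1} s * (?G y s * norm h))"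
      using smooth_line_bound[OF \<phi>, of 0 1 y "- h"] by simp
    also have "\<dots> = (LINT s|?U. ?G y s * norm h)" by (subst integral_density) auto
    finally have "ennreal (\<bar>\<phi> (y - h) - \<phi> y\<bar> powr p) \<le> ennreal ((LINT s|?U. ?G y s * norm h) powr p)"
      using p by (intro ennreal_leI powr_mono2) auto
    also have "\<dots> \<le> (\<integral>\<^sup>+s. ennreal ((?G y s * norm h) powr p) \<partial>?U)" by (rule Jensen_powr[OF U1 iU _ p]) auto
    also have "\<dots> = (NN s. ennreal (indicator {0..1} s) * ennreal ((?G y s * norm h) powr p))"
      by (rule nn_integral_density) auto
    also have "\<dots> = (NN s. ?F y s)" by (simp add: ennreal_indicator)
    finally show ?thesis .
  qed
  have "(NN y. indicator S y * ennreal (\<bar>\<phi> (y - h) - \<phi> y\<bar> powr p))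
      \<le> (NN y. indicator S y * (NN s. ?F y s))" by (intro nn_integral_mono mult_left_mono ptw) auto
  also have "\<dots> = (NN y. (NN s. indicator S y * (?F y s)))"
    by (intro nn_integral_cong nn_integral_cmult[symmetric]) auto
  also have "\<dots> = (NN s. (NN y. indicator S y * (?F y s)))" by (rule lborel_pair.Fubini') simp
  also have "\<dots> \<le> (\<integral>\<^sup>+(s::real). indicator {0..1} s * (ennreal (norm h powr p) * ?I) \<partial>lborel)"
  proof (intro nn_integral_mono)
    fix s :: real
    show "(NN y. indicator S y * (?F y s))
      \<le> indicator {0..1} s * (ennreal (norm h powr p) * ?I)"
    proof (cases "s \<in> {0..1}")
      case True
      have "(NN y. indicator S y * (?F y s))
        \<le> (NN y. ennreal (norm h powr p) * (indicator S' (y - s *\<^sub>R h) * ennreal (?G y s powr p)))"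
        using S(3) True by (intro nn_integral_mono) (auto simp: indicator_def powr_mult mult.commute ennreal_mult)
      also have "\<dots> = ennreal (norm h powr p) * (NN y. indicator S' (y - s *\<^sub>R h) * ennreal (?G y s powr p))"
        by (rule nn_integral_cmult) auto
      also have "(NN y. indicator S' (y - s *\<^sub>R h) * ennreal (?G y s powr p))
        = ?I" by (rule lborel_nn_shift_minus[of "\<lambda>y. indicator S' y * ennreal (norm (gradient \<phi> y) powr p)"]) auto
      finally show ?thesis using True by simp
    qed auto
  qed
  also have "\<dots> = ennreal (norm h powr p) * ?I" by (subst nn_integral_multc) auto
  finally show ?thesis .
qed

text \<open>A translation by \<open>3 * R\<close> moves every point of the ball of radius
  \<open>R\<close> out of it, so on this ball \<open>\<phi>\<close> is, up to sign, its own
  translation difference.\<close>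

lemma Poincare_test:
  fixes \<phi> :: "'a::euclidean_space \<Rightarrow> real"
  assumes \<phi>: "test_function \<Omega> \<phi>" and \<Omega>: "\<Omega> \<subseteq> cball 0 R" and R: "0 < R" and p: "1 \<le> p"
  shows "pint p \<phi> \<le> (3 * R) powr p * pint p (gradient \<phi>)"
proof -
  have sm: "smooth \<phi>" using \<phi> by (rule test_function_smooth)
  obtain b :: 'a where b: "b \<in> Basis" using nonempty_Basis by blast
  define h where "h = (3 * R) *\<^sub>R b"
  have h: "norm h = 3 * R" using b R by (simp add: h_def)
  have z: "\<phi> y = 0" if "y \<notin> cball 0 R" for y using test_functionE(2)[OF \<phi>] \<Omega> that by blast
  have L: "Lp p \<phi>" "Lp p (gradient \<phi>)" using test_function_Lp[OF \<phi>] p by auto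
  have "ennreal (pint p \<phi>) = (NN y. ennreal (norm (\<phi> y) powr p))" by (rule ennreal_pint[OF L(1), symmetric])
  also have "\<dots> \<le> (NN y. indicator (cball 0 R) y * ennreal (\<bar>\<phi> (y - h) - \<phi> y\<bar> powr p))"
  proof (intro nn_integral_mono)
    fix y
    show "ennreal (norm (\<phi> y) powr p) \<le> indicator (cball 0 R) y * ennreal (\<bar>\<phi> (y - h) - \<phi> y\<bar> powr p)"
    proof (cases "y \<in> cball 0 R")
      case True
      have "norm h \<le> norm (y - h) + norm y" using norm_triangle_ineq4[of y "y - h"] by simp
      then have "y - h \<notin> cball 0 R" using True h R by auto
      then show ?thesis using True z[of "y - h"] by simp
    qed (simp add: z)
  qed
  also have "\<dots> \<le> ennreal (norm h powr p) * (NN y. indicator UNIV y * ennreal (norm (gradient \<phi> y) powr p))"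
    by (rule translation_estimate[OF sm p]) auto
  also have "\<dots> = ennreal ((3 * R) powr p * pint p (gradient \<phi>))"
    using h by (simp add: ennreal_pint[OF L(2)] ennreal_mult)
  finally show ?thesis by simp
qed

text \<open>Difference quotients of a compactly supported function have integral 0 by translation
  invariance. For steps of length at most 1 the Lipschitz bound on a slightly larger ball dominates
  them.\<close>

lemma integral_gradient_test:
  assumes \<phi>: "test_function \<Omega> \<phi>"
  shows "(LBINT x. gradient \<phi> x) = 0" "integrable lborel (gradient \<phi>)"
proof -
  have sm: "smooth \<phi>" using \<phi> by (rule test_function_smooth)
  have [measurable]: "\<phi> \<in> borel_measurable borel" "gradient \<phi> \<in> borel_measurable borel"
    using sm by (auto intro: borel_smooth borel_gradient)
  have i: "integrable lborel \<phi>" "integrable lborel (gradient \<phi>)"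
    using test_function_Lp[OF \<phi>, of 1] by (auto simp: Lp_def integrable_norm_iff simp del: real_norm_def)
  then show "integrable lborel (gradient \<phi>)" by simp
  obtain K where K: "compact K" "\<And>x. x \<notin> K \<Longrightarrow> \<phi> x = 0" using test_functionE(2)[OF \<phi>] by blast
  obtain M where M: "\<And>x. norm (gradient \<phi> x) \<le> M" using test_function_bounded[OF \<phi>] by blast
  obtain R where R: "\<And>x. x \<in> K \<Longrightarrow> norm x \<le> R" using compact_imp_bounded[OF K(1)] unfolding bounded_iff by blast
  have "(LBINT x. gradient \<phi> x \<bullet> b) = 0" if b: "b \<in> Basis" for b
  proof -
    define t :: "nat \<Rightarrow> real" where "t n = inverse (real (Suc n))" for n
    have t: "0 < t n" "t n \<le> 1" "t n \<noteq> 0" for n by (auto simp: t_def field_simps)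
    have nb: "norm b = 1" using b by simp
    define D where "D n x = (\<phi> (x + t n *\<^sub>R b) - \<phi> x) / t n" for n x
    have D0: "(LBINT x. D n x) = 0" for n
      using lborel_integral_shift[of \<phi> "- (t n *\<^sub>R b)"] lborel_integrable_shift[OF i(1), of "- (t n *\<^sub>R b)"] i(1)
      by (simp add: D_def)
    have lim: "(\<lambda>n. D n x) \<longlonglongrightarrow> gradient \<phi> x \<bullet> b" for x
    proof -
      have "((\<lambda>s. (\<phi> (x + s *\<^sub>R b) - \<phi> x) / s) \<longlongrightarrow> gradient \<phi> x \<bullet> b) (at 0)"
        using smooth_line_derivative[OF sm, of x b 0] by (simp add: DERIV_def)
      moreover have "filterlim t (at 0) sequentially"
        unfolding filterlim_at t_def using LIMSEQ_inverse_real_of_nat by auto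
      ultimately show ?thesis unfolding D_def by (rule filterlim_compose)
    qed
    have bd: "norm (D n x) \<le> indicator (cball 0 (R + 1)) x * M" for n x
    proof (cases "x \<in> cball 0 (R + 1)")
      case True
      have "\<bar>\<phi> (x + t n *\<^sub>R b) - \<phi> x\<bar> \<le> M * norm (x + t n *\<^sub>R b - x)" by (rule smooth_lipschitz[OF sm M])
      then show ?thesis using True t[of n] nb by (simp add: D_def divide_le_eq)
    next
      case False
      have "norm x \<le> norm (x + t n *\<^sub>R b) + norm (t n *\<^sub>R b)"
        using norm_triangle_ineq4[of "x + t n *\<^sub>R b" "t n *\<^sub>R b"] by simp
      moreover have "norm (t n *\<^sub>R b) \<le> 1" using t[of n] nb by simp
      ultimately have "x \<notin> K" "x + t n *\<^sub>R b \<notin> K" using False R[of x] R[of "x + t n *\<^sub>R b"] by auto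
      then show ?thesis using False K(2) by (simp add: D_def)
    qed
    have iM: "integrable lborel (\<lambda>x. indicator (cball 0 (R + 1)) x * M)"
      using emeasure_lborel_cball_finite[of 0 "R + 1"] by (intro integrable_mult_left integrable_real_indicator) auto
    have "(\<lambda>n. LBINT x. D n x) \<longlonglongrightarrow> (LBINT x. gradient \<phi> x \<bullet> b)"
      by (rule integral_dominated_convergence[OF _ _ iM]) (use lim bd in \<open>auto simp: D_def\<close>)
    then show ?thesis using D0 by (simp add: LIMSEQ_const_iff)
  qed
  then have *: "(LBINT x. gradient \<phi> x) \<bullet> b = 0" if "b \<in> Basis" for b
    using that i(2) by (simp add: integral_inner_left)
  show "(LBINT x. gradient \<phi> x) = 0" by (rule euclidean_eqI) (simp add: *)
qed

lemma integration_by_parts_test: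
  assumes \<phi>: "smooth \<phi>" and \<psi>: "test_function \<Omega> \<psi>"
  shows "(LBINT x. \<phi> x *\<^sub>R gradient \<psi> x) = - (LBINT x. \<psi> x *\<^sub>R gradient \<phi> x)"
    "integrable lborel (\<lambda>x. \<phi> x *\<^sub>R gradient \<psi> x)" "integrable lborel (\<lambda>x. \<psi> x *\<^sub>R gradient \<phi> x)"
proof -
  let ?a = "\<lambda>x. \<phi> x *\<^sub>R gradient \<psi> x"
  let ?b = "\<lambda>x. \<psi> x *\<^sub>R gradient \<phi> x"
  have s: "smooth \<psi>" using \<psi> by (rule test_function_smooth)
  obtain K where K: "compact K" "\<And>x. x \<notin> K \<Longrightarrow> \<psi> x = 0" "\<And>x. x \<notin> K \<Longrightarrow> gradient \<psi> x = 0"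
    using test_functionE(2)[OF \<psi>] by blast
  show 1: "integrable lborel (\<lambda>x. ?a x)"
  proof -
    have c: "continuous_on UNIV (\<lambda>x. ?a x)"
      by (intro continuous_intros smooth_continuous[OF \<phi>] smooth_gradient_continuous[OF s])
    have "integrable lborel (restr K (\<lambda>x. ?a x))"
      by (rule borel_integrable_compact[OF K(1)]) (rule continuous_on_subset[OF c], simp)
    moreover have "(restr K (\<lambda>x. ?a x)) = (\<lambda>x. ?a x)" using K(3) by (auto simp: indicator_def fun_eq_iff)
    ultimately show ?thesis by (simp only:)
  qed
  show 2: "integrable lborel (\<lambda>x. ?b x)"
  proof -
    have c: "continuous_on UNIV (\<lambda>x. ?b x)"
      by (intro continuous_intros smooth_continuous[OF s] smooth_gradient_continuous[OF \<phi>])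
    have "integrable lborel (restr K (\<lambda>x. ?b x))"
      by (rule borel_integrable_compact[OF K(1)]) (rule continuous_on_subset[OF c], simp)
    moreover have "(restr K (\<lambda>x. ?b x)) = (\<lambda>x. ?b x)" using K(2) by (auto simp: indicator_def fun_eq_iff)
    ultimately show ?thesis by (simp only:)
  qed
  have "(LBINT x. ?a x + ?b x) = 0"
    using integral_gradient_test(1)[OF test_function_mult[OF \<phi> \<psi>]] by (simp add: gradient_mult[OF \<phi> s])
  then show "(LBINT x. ?a x) = - (LBINT x. ?b x)" using 1 2 by (simp add: eq_neg_iff_add_eq_0)
qed

lemma nn_integral_powr_tail:
  assumes "a > (1::real)"
  shows "(NN s. indicator {1..} s * ennreal (s powr (- a))) = ennreal (1 / (a - 1))"
proof -
  have "(NN s. ennreal (s powr (- a)) * indicator {1..} s)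
      = ennreal (0 - (- 1 / (a - 1)) * 1 powr (1 - a))"
  proof (rule nn_integral_FTC_atLeast[where F="\<lambda>s. (- 1 / (a - 1)) * s powr (1 - a)" and T=0 and a=1])
    show "DERIV (\<lambda>s. (- 1 / (a - 1)) * s powr (1 - a)) s :> s powr (- a)" if "1 \<le> s" for s
    proof (rule DERIV_cong[OF DERIV_cmult[OF has_real_derivative_powr]])
      have "- 1 / (a - 1) * (1 - a) = 1" using assms by (simp add: field_simps)
      then show "- 1 / (a - 1) * ((1 - a) * s powr (1 - a - 1)) = s powr - a"
        by (simp only: mult.assoc[symmetric]) simp
    qed (use that in auto)
    show "((\<lambda>s. (- 1 / (a - 1)) * s powr (1 - a)) \<longlongrightarrow> 0) at_top"
      using assms by (intro tendsto_mult_right_zero tendsto_neg_powr filterlim_ident) auto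
  qed auto
  then show ?thesis by (simp add: mult.commute)
qed

text \<open>Integrate \<open>\<nabla>\<phi>\<close> along rays to infinity and apply Jensen's inequality to
  the probability density \<open>(\<beta> - 1) s powr (- \<beta>)\<close> on \<open>{1..}\<close>; the dilation by \<open>s\<close> contributes
  \<open>s powr (- n)\<close>, and \<open>\<beta>\<close> is chosen such that the remaining power of \<open>s\<close> is integrable, which needs \<open>q < n\<close>.\<close>

lemma Hardy_test:
  fixes q :: real
  assumes q: "1 < q" "q < DIM('a::euclidean_space)"
  shows "\<exists>C>0. \<forall>\<Omega>. \<forall>\<phi>::'a \<Rightarrow> real. \<forall>\<rho>>0. test_function \<Omega> \<phi> \<longrightarrow>
     (NN x. indicator (cball 0 \<rho>) x * ennreal (\<bar>\<phi> x\<bar> powr q)) \<le> ennreal (C * \<rho> powr q * pint q (gradient \<phi>))"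
proof -
  define n where "n = real DIM('a)"
  \<comment> \<open>\<open>\<beta>\<close> is the midpoint between 1 and \<open>k\<close>:
    \<open>\<beta> > 1\<close> makes the density on \<open>{1..}\<close> normalizable, and
    \<open>\<beta> < k\<close> makes \<open>a > 1\<close>, so that the final integral over the
    dilations converges. The interval is nonempty because \<open>q < n\<close>.\<close>
  define k where "k = (n - 1) / (q - 1)"
  define \<beta> where "\<beta> = (1 + k) / 2"
  have "k > 1" using q by (simp add: n_def k_def field_simps)
  then have b: "\<beta> > 1" "\<beta> < (n - 1) / (q - 1)" by (auto simp: \<beta>_def simp flip: k_def)
  define c where "c = \<beta> - 1"
  let ?k = "\<lambda>s. indicator {1..} s * (c * s powr (- \<beta>))"
  have c: "c > 0" using b by (simp add: c_def)
  define a where "a = n - \<beta> * (q - 1)"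
  have a: "a > 1" using b(2) q by (simp add: a_def field_simps)
  define M where "M = density lborel (\<lambda>s. ennreal (?k s))"
  have M1: "emeasure M (space M) = 1"
  proof -
    have "emeasure M (space M) = (NN s. ennreal (?k s))" unfolding M_def by (subst emeasure_density) auto
    also have "\<dots> = (NN s. ennreal c * (indicator {1..} s * ennreal (s powr (- \<beta>))))"
      using c by (intro nn_integral_cong) (auto simp: indicator_def ennreal_mult)
    also have "\<dots> = ennreal c * ennreal (1 / (\<beta> - 1))"
      by (subst nn_integral_cmult) (auto simp: nn_integral_powr_tail[OF b(1)])
    also have "\<dots> = 1" using c by (simp add: c_def flip: ennreal_mult)
    finally show ?thesis .
  qed
  define C where "C = c powr (1 - q) * (1 / (a - 1))"
  have C: "C > 0" using c a by (simp add: C_def)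
  have main: "(NN x. indicator (cball 0 \<rho>) x * ennreal (\<bar>\<phi> x\<bar> powr q)) \<le> ennreal (C * \<rho> powr q * pint q (gradient \<phi>))"
    if \<rho>: "\<rho> > 0" and \<phi>: "test_function \<Omega> \<phi>" for \<Omega> and \<phi> :: "'a \<Rightarrow> real" and \<rho>
  proof -
    have sm: "smooth \<phi>" using \<phi> by (rule test_function_smooth)
    have [measurable]: "gradient \<phi> \<in> borel_measurable borel" using sm by (rule borel_gradient)
    obtain K where K: "compact K" "\<And>x. x \<notin> K \<Longrightarrow> \<phi> x = 0" "\<And>x. x \<notin> K \<Longrightarrow> gradient \<phi> x = 0"
      using test_functionE(2)[OF \<phi>] by blast
    obtain R where "\<And>x. x \<in> K \<Longrightarrow> norm x \<le> R" using compact_imp_bounded[OF K(1)] unfolding bounded_iff by blast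
    then have z: "\<phi> x = 0" "gradient \<phi> x = 0" if "norm x > R" for x using K(2,3)[of x] that by force+
    let ?G = "\<lambda>s x. norm (gradient \<phi> (s *\<^sub>R x))"
    let ?H = "\<lambda>s x. ?G s x * norm x * (s powr \<beta> / c)"
    let ?J = "\<lambda>s x. indicator {1..} s * ennreal (c powr (1 - q) * \<rho> powr q * (s powr (\<beta> * (q - 1)) * ?G s x powr q))"
    have ptw: "indicator (cball 0 \<rho>) x * ennreal (\<bar>\<phi> x\<bar> powr q)
        \<le> (NN s. ?J s x)"
      if x0: "x \<noteq> 0" for x
    proof (cases "x \<in> cball 0 \<rho>")
      case True
      \<comment> \<open>From \<open>T\<close> on the ray has left the support, so the integral over
        \<open>{1..}\<close> is one over a compact interval.\<close>
      define T where "T = max 1 ((R + 1) / norm x)"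
      have T: "T \<ge> 1" by (simp add: T_def)
      have zT: "norm (s *\<^sub>R x) > R" if "s \<ge> T" for s
      proof -
        have "s \<ge> (R + 1) / norm x" "s \<ge> 1" using that by (auto simp: T_def)
        then have "s * norm x \<ge> R + 1" using x0 by (simp add: divide_le_eq)
        then show ?thesis using \<open>s \<ge> 1\<close> by simp
      qed
      have c1: "continuous_on {1..T} (\<lambda>s. ?G s x * norm x)"
        using smooth_line_continuous[OF sm, of _ 0 x] by (intro continuous_intros) auto
      have i1: "integrable lborel (restr {1..T} (\<lambda>s. ?G s x * norm x))"
        by (rule borel_integrable_compact[OF _ c1]) auto
      \<comment> \<open>Writes the integrand along the ray as the probability density times
        \<open>?H\<close>, the function to which Jensen's inequality is applied.\<close>
      have e1: "indicator {1..T} s * (?G s x * norm x) = ?k s * (?H s x)" for s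
        using zT[of s] z(2)[of "s *\<^sub>R x"] c by (auto simp: indicator_def powr_minus field_simps)
      have iM: "integrable M (\<lambda>s. ?H s x)" unfolding M_def
      proof (subst integrable_density)
        show "integrable lborel (\<lambda>s. (indicator {1..} s * (c * s powr - \<beta>)) *\<^sub>R (?H s x))"
          using i1 by (simp only: e1[symmetric] real_scaleR_def)
      qed (use c in auto)
      have "\<bar>\<phi> x\<bar> = \<bar>\<phi> (0 + T *\<^sub>R x) - \<phi> (0 + 1 *\<^sub>R x)\<bar>" using z(1)[OF zT[of T]] by simp
      also have "\<dots> \<le> (LBINT s. indicator {1..T} s * (?G s x * norm x))"
        using smooth_line_bound[OF sm T, of 0 x] by simp
      also have "\<dots> = (LBINT s. ?k s * (?H s x))" by (simp only: e1)
      also have "\<dots> = (LINT s|M. ?H s x)"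
        unfolding M_def using c by (subst integral_density) (auto simp: indicator_def)
      finally have "ennreal (\<bar>\<phi> x\<bar> powr q) \<le> ennreal ((LINT s|M. ?H s x) powr q)"
        using q by (intro ennreal_leI powr_mono2) auto
      also have "\<dots> \<le> (\<integral>\<^sup>+s. ennreal ((?H s x) powr q) \<partial>M)" using c q by (intro Jensen_powr[OF M1 iM]) auto
      also have "\<dots> = (NN s. ennreal (?k s) * ennreal ((?H s x) powr q))"
        unfolding M_def by (rule nn_integral_density) auto
      also have "\<dots> \<le> (NN s. ?J s x)"
      proof (intro nn_integral_mono)
        fix s :: real
        show "ennreal (?k s) * ennreal ((?H s x) powr q)
          \<le> ?J s x"
        proof (cases "s \<ge> 1")
          case s: True
          have "(c * s powr (- \<beta>)) * (?H s x) powr q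
            = c powr (1 - q) * (norm x) powr q * (s powr (\<beta> * (q - 1)) * ?G s x powr q)"
          proof -
            have "(?H s x) powr q = ?G s x powr q * norm x powr q * (s powr (\<beta> * q) / c powr q)"
              using s c by (simp add: powr_mult powr_divide powr_powr)
            moreover have "c * s powr (- \<beta>) * (s powr (\<beta> * q) / c powr q) = c powr (1 - q) * s powr (\<beta> * (q - 1))"
            proof -
              have 1: "c powr (1 - q) = c / c powr q" using c by (simp add: powr_diff)
              have 2: "s powr (\<beta> * (q - 1)) = s powr (- \<beta>) * s powr (\<beta> * q)"
                by (simp flip: powr_add) (simp add: algebra_simps)
              show ?thesis unfolding 1 2 by simp
            qed
            moreover have "C * (G * N * X) = (C * X) * (N * G)" for C G N X :: real by (simp add: mult_ac)
            moreover have "A * B * (N * G) = A * N * (B * G)" for A B G N :: real by (simp add: mult_ac)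
            ultimately show ?thesis by presburger
          qed
          also have "\<dots> \<le> c powr (1 - q) * \<rho> powr q * (s powr (\<beta> * (q - 1)) * ?G s x powr q)"
            using True q by (intro mult_right_mono mult_left_mono powr_mono2) auto
          finally show ?thesis using s c by (simp flip: ennreal_mult add: ennreal_leI)
        qed auto
      qed
      finally show ?thesis using True by simp
    qed auto
    have ae: "AE x in lborel. x \<noteq> (0::'a)" using AE_lborel_singleton[of "0::'a"] by auto
    have "(NN x. indicator (cball 0 \<rho>) x * ennreal (\<bar>\<phi> x\<bar> powr q))
      \<le> (NN x. (NN s. ?J s x))" by (rule nn_integral_mono_AE) (use ae in eventually_elim, rule ptw)
    also have "\<dots> = (NN s. (NN x. ?J s x))" by (rule lborel_pair.Fubini') simp
    also have "\<dots> = (NN s. ennreal (c powr (1 - q) * \<rho> powr q * pint q (gradient \<phi>)) * (indicator {1..} s * ennreal (s powr (- a))))"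
    proof (intro nn_integral_cong)
      fix s :: real
      show "(NN x. ?J s x)
        = ennreal (c powr (1 - q) * \<rho> powr q * pint q (gradient \<phi>)) * (indicator {1..} s * ennreal (s powr (- a)))"
      proof (cases "s \<ge> 1")
        case True
        have L: "Lp q (gradient \<phi>)" using test_function_Lp[OF \<phi>] q by auto
        have sc: "ennreal (pint q (gradient \<phi>)) = ennreal (s powr n) * (NN x. ennreal (?G s x powr q))"
          using lborel_nn_scale[of "\<lambda>x. ennreal (norm (gradient \<phi> x) powr q)" s] True
          by (simp add: ennreal_pint[OF L] n_def powr_realpow)
        have sc': "(NN x. ennreal (?G s x powr q)) = ennreal (s powr (- n)) * ennreal (pint q (gradient \<phi>))"
          unfolding sc using True by (simp add: mult.assoc[symmetric] powr_minus flip: ennreal_mult)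
        have "(NN x. ?J s x)
          = (NN x. ennreal (c powr (1 - q) * \<rho> powr q * s powr (\<beta> * (q - 1))) * ennreal (?G s x powr q))"
          using True by (intro nn_integral_cong) (simp add: mult.assoc flip: ennreal_mult)
        also have "\<dots> = ennreal (c powr (1 - q) * \<rho> powr q * s powr (\<beta> * (q - 1))) * (ennreal (s powr (- n)) * ennreal (pint q (gradient \<phi>)))"
          by (subst nn_integral_cmult) (auto simp: sc')
        also have "\<dots> = ennreal (c powr (1 - q) * \<rho> powr q * pint q (gradient \<phi>)) * (indicator {1..} s * ennreal (s powr (- a)))"
        proof -
          have "s powr (\<beta> * (q - 1)) * s powr (- n) = s powr (- a)" by (simp add: a_def flip: powr_add)
          then have "c powr (1 - q) * \<rho> powr q * s powr (\<beta> * (q - 1)) * (s powr (- n) * P) = c powr (1 - q) * \<rho> powr q * P * s powr (- a)" for P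
            by (metis mult.assoc mult.commute)
          then show ?thesis using True by (simp flip: ennreal_mult)
        qed
        finally show ?thesis .
      qed auto
    qed
    also have "\<dots> = ennreal (c powr (1 - q) * \<rho> powr q * pint q (gradient \<phi>)) * ennreal (1 / (a - 1))"
      by (subst nn_integral_cmult) (auto simp: nn_integral_powr_tail[OF a])
    also have "\<dots> = ennreal (C * \<rho> powr q * pint q (gradient \<phi>))"
      using a by (simp add: C_def mult_ac flip: ennreal_mult)
    finally show ?thesis .
  qed
  show ?thesis using C main by blast
qed

section \<open>Solutions of finite energy\<close>

text \<open>\<open>grad_closure p \<Omega>\<close> is the closure of the gradients of test functions in \<open>L\<^sup>p\<close>, i.e.\ the space of
  gradients of functions in \<open>W\<^sub>0\<^sup>1\<^sup>,\<^sup>p(\<Omega>)\<close>, extended by zero.\<close>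

definition grad_closure :: "real \<Rightarrow> 'a::euclidean_space set \<Rightarrow> ('a \<Rightarrow> 'a) \<Rightarrow> bool" where
  "grad_closure p \<Omega> g \<longleftrightarrow> Lp p g \<and> (\<forall>x. x \<notin> \<Omega> \<longrightarrow> g x = 0) \<and>
     (\<exists>\<phi>. (\<forall>n::nat. test_function \<Omega> (\<phi> n)) \<and> (\<lambda>n. pdist p (gradient (\<phi> n)) g) \<longlonglongrightarrow> 0)"

lemma grad_closure_Lp: "grad_closure p \<Omega> g \<Longrightarrow> Lp p g"
  and grad_closure_0: "grad_closure p \<Omega> g \<Longrightarrow> x \<notin> \<Omega> \<Longrightarrow> g x = 0" by (simp_all add: grad_closure_def)

lemma grad_closure_approx:
  "grad_closure p \<Omega> g \<Longrightarrow> \<exists>\<phi>. (\<forall>n::nat. test_function \<Omega> (\<phi> n)) \<and> (\<lambda>n. pdist p (gradient (\<phi> n)) g) \<longlonglongrightarrow> 0"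
  by (simp add: grad_closure_def)

lemma gradient_test_0: "test_function \<Omega> \<phi> \<Longrightarrow> x \<notin> \<Omega> \<Longrightarrow> gradient \<phi> x = 0"
  using test_functionE(2) by blast

lemma grad_closure_test: "test_function \<Omega> \<phi> \<Longrightarrow> 0 < p \<Longrightarrow> grad_closure p \<Omega> (gradient \<phi>)"
  unfolding grad_closure_def by (intro conjI exI[of _ "\<lambda>n. \<phi>"]) (auto intro: test_function_Lp gradient_test_0)

lemma grad_closureI:
  assumes p: "0 < p" and g: "Lp p g" "\<And>x. x \<notin> \<Omega> \<Longrightarrow> g x = 0"
    and ex: "\<And>e. 0 < e \<Longrightarrow> \<exists>\<phi>. test_function \<Omega> \<phi> \<and> pdist p (gradient \<phi>) g < e"
  shows "grad_closure p \<Omega> g"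
proof -
  have "\<exists>\<phi>. test_function \<Omega> \<phi> \<and> pdist p (gradient \<phi>) g < inverse (real (Suc n))" for n by (rule ex) simp
  then obtain \<phi> where \<phi>: "\<And>n. test_function \<Omega> (\<phi> n)" "\<And>n. pdist p (gradient (\<phi> n)) g < inverse (real (Suc n))"
    by metis
  have "(\<lambda>n. pdist p (gradient (\<phi> n)) g) \<longlonglongrightarrow> 0"
    by (rule tendsto_sandwich[OF _ _ tendsto_const LIMSEQ_inverse_real_of_nat])
      (use \<phi>(2) in \<open>auto intro!: always_eventually less_imp_le simp del: of_nat_Suc\<close>)
  then show ?thesis unfolding grad_closure_def using g \<phi> by blast
qed

lemma grad_closure_ex:
  assumes "grad_closure p \<Omega> g" "0 < e"
  shows "\<exists>\<phi>. test_function \<Omega> \<phi> \<and> pdist p (gradient \<phi>) g < e"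
proof -
  obtain \<phi> where \<phi>: "\<forall>n. test_function \<Omega> (\<phi> n)" "(\<lambda>n. pdist p (gradient (\<phi> n)) g) \<longlonglongrightarrow> 0"
    using grad_closure_approx[OF assms(1)] by blast
  from order_tendstoD(2)[OF \<phi>(2) assms(2)] \<phi>(1) show ?thesis by (auto simp: eventually_sequentially)
qed

lemma grad_closure_limit:
  assumes p: "0 < p" and g: "Lp p g" "\<And>x. x \<notin> \<Omega> \<Longrightarrow> g x = 0"
    and ex: "\<And>e. 0 < e \<Longrightarrow> \<exists>G. grad_closure p \<Omega> G \<and> pdist p G g < e"
  shows "grad_closure p \<Omega> g"
proof (rule grad_closureI[OF p g])
  fix e :: real assume e: "0 < e"
  define d where "d = e / (2 * 2 powr p)"
  have d: "d > 0" using e by (simp add: d_def)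
  obtain G where G: "grad_closure p \<Omega> G" "pdist p G g < d" using ex[OF d] by blast
  obtain \<phi> where \<phi>: "test_function \<Omega> \<phi>" "pdist p (gradient \<phi>) G < d" using grad_closure_ex[OF G(1) d] by blast
  have L: "Lp p (gradient \<phi>)" "Lp p G" using test_function_Lp[OF \<phi>(1) p] grad_closure_Lp[OF G(1)] by auto
  have "pint p (\<lambda>x. (gradient \<phi> x - G x) + (G x - g x)) \<le> 2 powr p * (pdist p (gradient \<phi>) G + pdist p G g)"
    by (intro Lp_add Lp_diff L g p)
  also have "\<dots> < 2 powr p * (d + d)" using \<phi>(2) G(2) by simp
  finally have "pdist p (gradient \<phi>) g < e" by (simp add: d_def)
  then show "\<exists>\<phi>. test_function \<Omega> \<phi> \<and> pdist p (gradient \<phi>) g < e" using \<phi>(1) by blast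
qed auto

lemma grad_closure_add:
  assumes "grad_closure p \<Omega> g" "grad_closure p \<Omega> h" "0 < p"
  shows "grad_closure p \<Omega> (\<lambda>x. g x + h x)"
proof (rule grad_closureI[OF assms(3)])
  show "Lp p (\<lambda>x. g x + h x)" by (intro Lp_add grad_closure_Lp[OF assms(1)] grad_closure_Lp[OF assms(2)] assms)
  show "g x + h x = 0" if "x \<notin> \<Omega>" for x
    using grad_closure_0[OF assms(1) that] grad_closure_0[OF assms(2) that] by simp
  fix e :: real assume e: "0 < e"
  define d where "d = e / (2 * 2 powr p)"
  have d: "d > 0" using e by (simp add: d_def)
  obtain \<phi> where \<phi>: "test_function \<Omega> \<phi>" "pdist p (gradient \<phi>) g < d" using grad_closure_ex[OF assms(1) d] by blast
  obtain \<psi> where \<psi>: "test_function \<Omega> \<psi>" "pdist p (gradient \<psi>) h < d" using grad_closure_ex[OF assms(2) d] by blast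
  have "pint p (\<lambda>x. (gradient \<phi> x - g x) + (gradient \<psi> x - h x)) \<le> 2 powr p * (pdist p (gradient \<phi>) g + pdist p (gradient \<psi>) h)"
    using test_function_Lp[OF \<phi>(1) assms(3)] test_function_Lp[OF \<psi>(1) assms(3)]
    by (intro Lp_add Lp_diff grad_closure_Lp[OF assms(1)] grad_closure_Lp[OF assms(2)] assms)
  also have "\<dots> < 2 powr p * (d + d)" using \<phi>(2) \<psi>(2) by simp
  also have "\<dots> = e" by (simp add: d_def)
  also have "(\<lambda>x. (gradient \<phi> x - g x) + (gradient \<psi> x - h x)) = (\<lambda>x. gradient (\<lambda>x. \<phi> x + \<psi> x) x - (g x + h x))"
    using \<phi>(1) \<psi>(1) by (auto simp: gradient_add test_function_smooth)
  finally show "\<exists>\<phi>. test_function \<Omega> \<phi> \<and> pint p (\<lambda>x. gradient \<phi> x - (g x + h x)) < e"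
    using test_function_add[OF \<phi>(1) \<psi>(1)] by blast
qed

lemma grad_closure_uminus:
  assumes "grad_closure p \<Omega> g" "0 < p"
  shows "grad_closure p \<Omega> (\<lambda>x. - g x)"
proof (rule grad_closureI[OF assms(2)])
  show "Lp p (\<lambda>x. - g x)" using grad_closure_Lp[OF assms(1)] by simp
  show "- g x = 0" if "x \<notin> \<Omega>" for x using grad_closure_0[OF assms(1) that] by simp
  fix e :: real assume e: "0 < e"
  obtain \<phi> where \<phi>: "test_function \<Omega> \<phi>" "pdist p (gradient \<phi>) g < e" using grad_closure_ex[OF assms(1) e] by blast
  have "(\<lambda>x. gradient (\<lambda>x. -1 * \<phi> x) x - - g x) = (\<lambda>x. - (gradient \<phi> x - g x))"
    using \<phi>(1) by (subst gradient_cmult) (auto simp: test_function_smooth)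
  then have "pint p (\<lambda>x. gradient (\<lambda>x. -1 * \<phi> x) x - - g x) < e" using \<phi>(2) by (simp only: pint_uminus)
  then show "\<exists>\<phi>. test_function \<Omega> \<phi> \<and> pint p (\<lambda>x. gradient \<phi> x - - g x) < e"
    using test_function_cmult[OF \<phi>(1), of "-1"] by blast
qed

lemma grad_closure_diff:
  assumes "grad_closure p \<Omega> g" "grad_closure p \<Omega> h" "0 < p"
  shows "grad_closure p \<Omega> (\<lambda>x. g x - h x)"
  using grad_closure_add[OF assms(1) grad_closure_uminus[OF assms(2,3)] assms(3)] by simp

lemma grad_closure_nest:
  assumes g: "grad_closure q \<Omega> g" and r: "0 < r" "r \<le> q" and \<Omega>: "bounded \<Omega>" "\<Omega> \<in> sets borel"
  shows "grad_closure r \<Omega> g"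
proof (rule grad_closureI[OF r(1)])
  note g0 = grad_closure_0[OF g]
  show "Lp r g" by (rule Lp_nest(1)[OF grad_closure_Lp[OF g] r g0 \<Omega>])
  fix e :: real assume e: "0 < e"
  define m where "m = measure lborel \<Omega> + 1"
  have m: "m > 0" "measure lborel \<Omega> \<le> m" by (auto simp: m_def add_nonneg_pos)
  \<comment> \<open>Chosen so that the bound from \<open>pint_nest\<close> becomes
    \<open>e / 2\<close>.\<close>
  define d where "d = (e / (2 * (2 * m powr (1 - r / q)))) powr (q / r)"
  have d: "d > 0" using e m by (simp add: d_def)
  obtain \<phi> where \<phi>: "test_function \<Omega> \<phi>" "pdist q (gradient \<phi>) g < d" using grad_closure_ex[OF g d] by blast
  have q: "0 < q" using r by simp
  have "pdist r (gradient \<phi>) g \<le> 2 * m powr (1 - r / q) * pdist q (gradient \<phi>) g powr (r / q)"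
    by (rule pint_nest[OF Lp_diff(1)[OF test_function_Lp(2)[OF \<phi>(1) q] grad_closure_Lp[OF g] q] r _ \<Omega> m])
      (simp add: gradient_test_0[OF \<phi>(1)] g0)
  also have "\<dots> \<le> 2 * m powr (1 - r / q) * d powr (r / q)" using \<phi>(2) r m by (intro mult_left_mono powr_mono2) auto
  also have "d powr (r / q) = e / (2 * (2 * m powr (1 - r / q)))" using e m r by (simp add: d_def powr_powr)
  also have "2 * m powr (1 - r / q) * \<dots> < e" using e m by simp
  finally show "\<exists>\<phi>. test_function \<Omega> \<phi> \<and> pdist r (gradient \<phi>) g < e" using \<phi>(1) by blast
qed (rule grad_closure_0[OF g])

lemma grad_closure_orthogonal:
  assumes F: "Lp q F" and g: "grad_closure p \<Omega> g" and pq: "1 < p" "1 / p + 1 / q = 1"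
    and orth: "\<And>\<psi>. test_function \<Omega> \<psi> \<Longrightarrow> (LBINT x. F x \<bullet> gradient \<psi> x) = 0"
  shows "(LBINT x. F x \<bullet> g x) = 0"
proof -
  obtain \<phi> where \<phi>: "\<And>n. test_function \<Omega> (\<phi> n)" "(\<lambda>n. pdist p (gradient (\<phi> n)) g) \<longlonglongrightarrow> 0"
    using grad_closure_approx[OF g] by blast
  have "(\<lambda>n. LBINT x. F x \<bullet> gradient (\<phi> n) x) \<longlonglongrightarrow> (LBINT x. F x \<bullet> g x)"
    by (rule pairing_limit[OF F grad_closure_Lp[OF g] pq test_function_Lp(2)[OF \<phi>(1)] \<phi>(2)]) (use pq in auto)
  then show ?thesis by (simp add: orth[OF \<phi>(1)] LIMSEQ_const_iff)
qed

section \<open>The variational problem in L^2\<close>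

lemma norm_powr_2: "norm v powr 2 = v \<bullet> v" for v :: "'a::real_inner"
  by (simp add: power2_norm_eq_inner)

lemma pint_2: "pint 2 f = (LBINT x. f x \<bullet> f x)"
  by (simp add: pint_def norm_powr_2 del: powr_numeral)

lemma L2_integrable_inner:
  assumes "Lp 2 f" "Lp 2 g" shows "integrable lborel (\<lambda>x. f x \<bullet> g x)"
  by (rule pairing_integrable[OF assms]) auto

lemma pint_2_add:
  assumes "Lp 2 f" "Lp 2 g"
  shows "pint 2 (\<lambda>x. f x + t *\<^sub>R g x) = pint 2 f + 2 * t * (LBINT x. f x \<bullet> g x) + t\<^sup>2 * pint 2 g"
proof -
  have "pint 2 (\<lambda>x. f x + t *\<^sub>R g x) = (LBINT x. f x \<bullet> f x + 2 * t * (f x \<bullet> g x) + t\<^sup>2 * (g x \<bullet> g x))"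
    unfolding pint_2 by (intro Bochner_Integration.integral_cong) (auto simp: algebra_simps inner_commute power2_eq_square)
  also have "\<dots> = pint 2 f + 2 * t * (LBINT x. f x \<bullet> g x) + t\<^sup>2 * pint 2 g"
    unfolding pint_2 using L2_integrable_inner[OF assms(1,1)] L2_integrable_inner[OF assms] L2_integrable_inner[OF assms(2,2)]
    by simp
  finally show ?thesis .
qed

lemma parallelogram_2:
  assumes "Lp 2 f" "Lp 2 g"
  shows "pdist 2 f g = 2 * pint 2 f + 2 * pint 2 g - 4 * pint 2 (\<lambda>x. (1 / 2) *\<^sub>R (f x + g x))"
proof -
  have "pint 2 (\<lambda>x. f x + (-1) *\<^sub>R g x) = pint 2 f + 2 * (-1) * (LBINT x. f x \<bullet> g x) + (-1)\<^sup>2 * pint 2 g"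
    by (rule pint_2_add[OF assms])
  moreover have "pint 2 (\<lambda>x. f x + 1 *\<^sub>R g x) = pint 2 f + 2 * 1 * (LBINT x. f x \<bullet> g x) + 1\<^sup>2 * pint 2 g"
    by (rule pint_2_add[OF assms])
  moreover have "pint 2 (\<lambda>x. (1 / 2) *\<^sub>R (f x + g x)) = (1 / 4) * pint 2 (\<lambda>x. f x + g x)"
    by (subst pint_scaleR) (simp add: power2_eq_square)
  ultimately show ?thesis by simp
qed

text \<open>\<open>g\<close> plays the role of the gradient of the solution. The equation says that
  \<open>g\<close> is minus the orthogonal projection of \<open>f\<close> onto the closed space of
  gradients, so the solution itself need not be mentioned.\<close>

definition L2_solution :: "'a::euclidean_space set \<Rightarrow> ('a \<Rightarrow> 'a) \<Rightarrow> ('a \<Rightarrow> 'a) \<Rightarrow> bool" where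
  "L2_solution \<Omega> f g \<longleftrightarrow> grad_closure 2 \<Omega> g \<and>
     (\<forall>\<psi>. test_function \<Omega> \<psi> \<longrightarrow> (LBINT x. (g x + f x) \<bullet> gradient \<psi> x) = 0)"

text \<open>Direct method: \<open>J\<close> is the squared distance between a test gradient and
  \<open>- f\<close>. By the parallelogram law a minimizing sequence has Cauchy gradients, and the
  equation is the first variation at the limit.\<close>

lemma L2_solution_exists:
  fixes f :: "'a::euclidean_space \<Rightarrow> 'a"
  assumes f: "Lp 2 f" and \<Omega>: "bounded \<Omega>" "\<Omega> \<in> sets borel"
  shows "\<exists>g. L2_solution \<Omega> f g"
proof -
  define J where "J \<phi> = pint 2 (\<lambda>x. gradient \<phi> x + f x)" for \<phi> :: "'a \<Rightarrow> real"
  define m where "m = Inf (J ` {\<phi>. test_function \<Omega> \<phi>})"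
  have ne: "{\<phi>. test_function \<Omega> \<phi>} \<noteq> {}" using test_function_0 by blast
  have bb: "bdd_below (J ` {\<phi>. test_function \<Omega> \<phi>})" by (rule bdd_belowI[of _ 0]) (auto simp: J_def)
  have mle: "m \<le> J \<phi>" if "test_function \<Omega> \<phi>" for \<phi> unfolding m_def by (rule cInf_lower[OF _ bb]) (use that in auto)
  have "\<exists>\<phi>. test_function \<Omega> \<phi> \<and> J \<phi> < m + inverse (real (Suc n))" for n
  proof -
    have "Inf (J ` {\<phi>. test_function \<Omega> \<phi>}) < m + inverse (real (Suc n))" by (simp add: m_def)
    from cInf_lessD[OF _ this] ne show ?thesis by blast
  qed
  then obtain \<phi> where \<phi>: "\<And>n. test_function \<Omega> (\<phi> n)" "\<And>n. J (\<phi> n) < m + inverse (real (Suc n))" by metis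
  have L: "Lp 2 (gradient (\<phi> n))" for n using test_function_Lp[OF \<phi>(1)] by simp
  have LJ: "Lp 2 (\<lambda>x. gradient (\<phi> n) x + f x)" for n by (intro Lp_add L f) simp
  have diff: "pdist 2 (gradient (\<phi> n)) (gradient (\<phi> k)) \<le> 2 * inverse (real (Suc n)) + 2 * inverse (real (Suc k))" for n k
  proof -
    let ?\<psi> = "\<lambda>x. (1/2) * (\<phi> n x + \<phi> k x)"
    have t: "test_function \<Omega> ?\<psi>" by (intro test_function_cmult test_function_add \<phi>)
    have "m \<le> J ?\<psi>" by (rule mle[OF t])
    also have "J ?\<psi> = pint 2 (\<lambda>x. (1 / 2) *\<^sub>R ((gradient (\<phi> n) x + f x) + (gradient (\<phi> k) x + f x)))"
    proof -
      have sm: "smooth (\<phi> n)" "smooth (\<phi> k)" using \<phi>(1) by (auto intro: test_function_smooth)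
      have "gradient ?\<psi> x + f x = (1 / 2) *\<^sub>R ((gradient (\<phi> n) x + f x) + (gradient (\<phi> k) x + f x))" for x
      proof -
        have "gradient ?\<psi> x = (1/2) *\<^sub>R (gradient (\<phi> n) x + gradient (\<phi> k) x)"
          by (simp only: gradient_cmult[OF smooth_add[OF sm]] gradient_add[OF sm])
        moreover have "f x = (1/2) *\<^sub>R f x + (1/2) *\<^sub>R f x" by (simp flip: scaleR_add_left)
        ultimately show ?thesis by (simp add: scaleR_add_right)
      qed
      then show ?thesis unfolding J_def by simp
    qed
    finally have "m \<le> pint 2 (\<lambda>x. (1 / 2) *\<^sub>R ((gradient (\<phi> n) x + f x) + (gradient (\<phi> k) x + f x)))" .
    moreover have "pdist 2 (gradient (\<phi> n)) (gradient (\<phi> k)) = 2 * J (\<phi> n) + 2 * J (\<phi> k)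
        - 4 * pint 2 (\<lambda>x. (1 / 2) *\<^sub>R ((gradient (\<phi> n) x + f x) + (gradient (\<phi> k) x + f x)))"
      unfolding J_def using parallelogram_2[OF LJ[of n] LJ[of k]] by simp
    ultimately show ?thesis using \<phi>(2)[of n] \<phi>(2)[of k] by linarith
  qed
  have Cauchy: "\<exists>N. \<forall>n\<ge>N. \<forall>k\<ge>N. pdist 2 (gradient (\<phi> n)) (gradient (\<phi> k)) < e" if e: "0 < e" for e
  proof -
    obtain N where N: "inverse (real (Suc N)) < e / 4" using reals_Archimedean[of "e/4"] e by auto
    have "pdist 2 (gradient (\<phi> n)) (gradient (\<phi> k)) < e" if "n \<ge> N" "k \<ge> N" for n k
    proof -
      have "inverse (real (Suc n)) \<le> inverse (real (Suc N))" "inverse (real (Suc k)) \<le> inverse (real (Suc N))"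
        using that by (auto intro!: le_imp_inverse_le)
      then show ?thesis using diff[of n k] N by linarith
    qed
    then show ?thesis by blast
  qed
  have g0: "gradient (\<phi> n) x = 0" if "x \<notin> \<Omega>" for n x by (rule gradient_test_0[OF \<phi>(1) that])
  obtain g where g: "Lp 2 g" "\<And>x. x \<notin> \<Omega> \<Longrightarrow> g x = 0" "(\<lambda>n. pdist 2 (gradient (\<phi> n)) g) \<longlonglongrightarrow> 0"
    by (rule Lp_complete[of 2 "\<lambda>n. gradient (\<phi> n)" \<Omega>]) (use L g0 \<Omega> Cauchy in auto)
  have gc: "grad_closure 2 \<Omega> g" unfolding grad_closure_def using g \<phi>(1) by blast
  have "(LBINT x. (g x + f x) \<bullet> gradient \<psi> x) = 0" if \<psi>: "test_function \<Omega> \<psi>" for \<psi>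
  proof -
    have L\<psi>: "Lp 2 (gradient \<psi>)" using test_function_Lp[OF \<psi>] by simp
    let ?I = "LBINT x. (g x + f x) \<bullet> gradient \<psi> x"
    have Ilim: "(\<lambda>n. LBINT x. (gradient (\<phi> n) x + f x) \<bullet> gradient \<psi> x) \<longlonglongrightarrow> ?I"
    proof -
      have "(\<lambda>n. LBINT x. gradient \<psi> x \<bullet> (gradient (\<phi> n) x + f x)) \<longlonglongrightarrow> (LBINT x. gradient \<psi> x \<bullet> (g x + f x))"
        by (rule pairing_limit[OF L\<psi> Lp_add(1)[OF g(1) f] _ _ LJ]) (use g(3) in auto)
      then show ?thesis by (simp add: inner_commute)
    qed
    have "0 \<le> 2 * t * ?I + t\<^sup>2 * pint 2 (gradient \<psi>)" for t
    proof -
      have ge: "0 \<le> inverse (real (Suc n)) + 2 * t * (LBINT x. (gradient (\<phi> n) x + f x) \<bullet> gradient \<psi> x) + t\<^sup>2 * pint 2 (gradient \<psi>)" for n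
      proof -
        have "m \<le> J (\<lambda>x. \<phi> n x + t * \<psi> x)" by (intro mle test_function_add test_function_cmult \<phi> \<psi>)
        also have "J (\<lambda>x. \<phi> n x + t * \<psi> x) = pint 2 (\<lambda>x. (gradient (\<phi> n) x + f x) + t *\<^sub>R gradient \<psi> x)"
        proof -
          have sm: "smooth (\<phi> n)" "smooth \<psi>" by (rule test_function_smooth[OF \<phi>(1)], rule test_function_smooth[OF \<psi>])
          have "gradient (\<lambda>x. \<phi> n x + t * \<psi> x) x + f x = (gradient (\<phi> n) x + f x) + t *\<^sub>R gradient \<psi> x" for x
            by (simp add: gradient_add[OF sm(1) smooth_cmult[OF sm(2)]] gradient_cmult[OF sm(2)])
          then show ?thesis unfolding J_def by (simp only:)
        qed
        also have "\<dots> = J (\<phi> n) + 2 * t * (LBINT x. (gradient (\<phi> n) x + f x) \<bullet> gradient \<psi> x) + t\<^sup>2 * pint 2 (gradient \<psi>)"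
          unfolding J_def by (rule pint_2_add[OF LJ L\<psi>])
        finally show ?thesis using \<phi>(2)[of n] by linarith
      qed
      have "(\<lambda>n. inverse (real (Suc n)) + 2 * t * (LBINT x. (gradient (\<phi> n) x + f x) \<bullet> gradient \<psi> x) + t\<^sup>2 * pint 2 (gradient \<psi>))
         \<longlonglongrightarrow> 0 + 2 * t * ?I + t\<^sup>2 * pint 2 (gradient \<psi>)" by (intro tendsto_intros Ilim LIMSEQ_inverse_real_of_nat)
      from LIMSEQ_le_const[OF this] ge show ?thesis by auto
    qed
    note ge0 = this
    \<comment> \<open>\<open>t = - ?I / P\<close> minimizes the quadratic with \<open>P\<close> in
      place of \<open>pint 2 (gradient \<psi>)\<close>; the \<open>+ 1\<close> avoids division by 0
      and only weakens the inequality.\<close>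
    define P where "P = pint 2 (gradient \<psi>) + 1"
    have P: "P > 0" using pint_nonneg[of 2 "gradient \<psi>"] unfolding P_def by linarith
    have "0 \<le> 2 * (- ?I / P) * ?I + (- ?I / P)\<^sup>2 * P"
    proof -
      have "(- ?I / P)\<^sup>2 * pint 2 (gradient \<psi>) \<le> (- ?I / P)\<^sup>2 * P" by (intro mult_left_mono) (auto simp: P_def)
      then show ?thesis using ge0[of "- ?I / P"] by linarith
    qed
    also have "2 * (- ?I / P) * ?I + (- ?I / P)\<^sup>2 * P = - (?I\<^sup>2 / P)"
      using P by (simp add: power2_eq_square field_simps)
    finally have "?I\<^sup>2 / P \<le> 0" by simp
    then show ?thesis using P by (simp add: divide_le_0_iff)
  qed
  then show ?thesis using gc unfolding L2_solution_def by blast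
qed

lemma L2_solution_orthogonal:
  assumes "L2_solution \<Omega> f g" "Lp 2 f" "grad_closure 2 \<Omega> h"
  shows "(LBINT x. (g x + f x) \<bullet> h x) = 0"
proof -
  have g: "Lp 2 g" using assms(1) grad_closure_Lp unfolding L2_solution_def by blast
  show ?thesis by (rule grad_closure_orthogonal[OF Lp_add(1)[OF g assms(2)] assms(3)])
      (use assms(1) in \<open>auto simp: L2_solution_def\<close>)
qed

text \<open>Testing with \<open>g\<close> itself shows that the integral of
  \<open>f \<bullet> g\<close> is \<open>- pint 2 g\<close>. Expanding the nonnegative energy of
  \<open>f + g\<close> then leaves \<open>pint 2 f - pint 2 g\<close>, so the constant is 1.\<close>

lemma L2_solution_bound:
  assumes "L2_solution \<Omega> f g" "Lp 2 f"
  shows "pint 2 g \<le> pint 2 f"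
proof -
  have gc: "grad_closure 2 \<Omega> g" using assms(1) by (simp add: L2_solution_def)
  have g: "Lp 2 g" using gc by (rule grad_closure_Lp)
  have o: "(LBINT x. (g x + f x) \<bullet> g x) = 0" by (rule L2_solution_orthogonal[OF assms gc])
  have i: "integrable lborel (\<lambda>x. g x \<bullet> g x)" "integrable lborel (\<lambda>x. f x \<bullet> g x)"
    by (auto intro: L2_integrable_inner g assms)
  have "pint 2 g + (LBINT x. f x \<bullet> g x) = 0" using o i by (simp add: inner_add_left pint_2)
  moreover have "0 \<le> pint 2 f + 2 * 1 * (LBINT x. f x \<bullet> g x) + 1\<^sup>2 * pint 2 g"
    using pint_2_add[OF assms(2) g, of 1] pint_nonneg[of 2 "\<lambda>x. f x + 1 *\<^sub>R g x"] by simp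
  ultimately show ?thesis by simp
qed

lemma L2_solution_diff:
  assumes "L2_solution \<Omega> f g" "L2_solution \<Omega> f' g'" "Lp 2 f" "Lp 2 f'"
  shows "L2_solution \<Omega> (\<lambda>x. f x - f' x) (\<lambda>x. g x - g' x)"
  unfolding L2_solution_def
proof (intro conjI allI impI)
  have gc: "grad_closure 2 \<Omega> g" "grad_closure 2 \<Omega> g'" using assms by (auto simp: L2_solution_def)
  then show "grad_closure 2 \<Omega> (\<lambda>x. g x - g' x)" by (intro grad_closure_diff) auto
  fix \<psi> assume \<psi>: "test_function \<Omega> \<psi>"
  have L: "Lp 2 (\<lambda>x. g x + f x)" "Lp 2 (\<lambda>x. g' x + f' x)" "Lp 2 (gradient \<psi>)"
    using grad_closure_Lp[OF gc(1)] grad_closure_Lp[OF gc(2)] assms(3,4) test_function_Lp[OF \<psi>] by (auto intro!: Lp_add)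
  have "(LBINT x. (g x - g' x + (f x - f' x)) \<bullet> gradient \<psi> x)
      = (LBINT x. (g x + f x) \<bullet> gradient \<psi> x - (g' x + f' x) \<bullet> gradient \<psi> x)"
    by (intro Bochner_Integration.integral_cong) (auto simp: algebra_simps)
  also have "\<dots> = 0" using assms(1,2) \<psi> L2_integrable_inner[OF L(1,3)] L2_integrable_inner[OF L(2,3)]
    by (subst Bochner_Integration.integral_diff) (auto simp: L2_solution_def)
  finally show "(LBINT x. (g x - g' x + (f x - f' x)) \<bullet> gradient \<psi> x) = 0" .
qed

section \<open>Decay of gradients under a uniform cone condition\<close>

text \<open>The balls around \<open>t *\<^sub>R e\<close> of radius \<open>\<kappa> * t\<close>
  sweep out a truncated cone, with one direction \<open>e\<close> for all points of the domain near
  \<open>x\<close>. The cones point into the domain, so if a function is supported in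
  \<open>\<Omega>\<close> near \<open>x\<close>, its translate \<open>u(\<cdot> - h)\<close> is
  again supported in \<open>\<Omega>\<close>.\<close>

definition uniform_cone :: "'a::euclidean_space set \<Rightarrow> real \<Rightarrow> real \<Rightarrow> bool" where
  "uniform_cone \<Omega> r0 \<kappa> \<longleftrightarrow> 0 < r0 \<and> 0 < \<kappa> \<and> \<kappa> < 1 \<and>
     (\<forall>x. \<exists>e. norm e = 1 \<and>
        (\<forall>y\<in>\<Omega> \<inter> ball x r0. \<forall>t. 0 < t \<and> t < r0 \<longrightarrow> (\<forall>h\<in>ball (t *\<^sub>R e) (\<kappa> * t). y + h \<in> \<Omega>)))"

lemma L2_pint_tendsto:
  assumes "Lp 2 a" "\<And>n. Lp 2 (A n)" "(\<lambda>n. pdist 2 (A n) a) \<longlonglongrightarrow> 0"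
  shows "(\<lambda>n. pint 2 (A n)) \<longlonglongrightarrow> pint 2 a"
proof -
  have L: "Lp 2 (\<lambda>x. A n x - a x)" for n by (intro Lp_diff assms) auto
  have eq: "pint 2 (A n) = pint 2 a + 2 * (LBINT x. a x \<bullet> (A n x - a x)) + pdist 2 (A n) a" for n
    using pint_2_add[OF assms(1) L, of 1 n] by simp
  have "(\<lambda>n. LBINT x. a x \<bullet> (A n x - a x)) \<longlonglongrightarrow> (LBINT x. a x \<bullet> 0)"
    by (rule pairing_limit[OF assms(1) Lp_zero _ _ L]) (use assms(3) in auto)
  then have "(\<lambda>n. pint 2 a + 2 * (LBINT x. a x \<bullet> (A n x - a x)) + pdist 2 (A n) a) \<longlonglongrightarrow> pint 2 a + 2 * 0 + 0"
    by (intro tendsto_intros assms(3)) simp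
  then show ?thesis unfolding eq by simp
qed

text \<open>Savare's argument: for an admissible translation \<open>h\<close>, the function \<open>\<eta> (u(\<cdot> - h) - u)\<close> is a
  test function for the equation, and \<open>a \<bullet> (b - a) = (|b|\<^sup>2 - |a|\<^sup>2 - |b - a|\<^sup>2) / 2\<close> turns the
  equation into a bound of order \<open>|h|\<close> for the squared translation difference of the gradient.\<close>

lemma translation_difference_bound:
  fixes g :: "'a::euclidean_space \<Rightarrow> 'a"
  assumes gc: "grad_closure 2 \<Omega> g" and r: "0 < r" and h: "norm h \<le> r"
    and harm: "\<And>\<psi>. test_function (\<Omega> \<inter> ball x (4 * r)) \<psi> \<Longrightarrow> (LBINT y. g y \<bullet> gradient \<psi> y) = 0"
    and cone: "\<And>y. y \<in> \<Omega> \<inter> ball x (4 * r) \<Longrightarrow> y + h \<in> \<Omega>"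
  shows "pint 2 (restr (cball x r) (\<lambda>y. g (y - h) - g y))
      \<le> 3 * cutoff_const TYPE('a) * (norm h / r) * pint 2 (restr (cball x (3 * r)) g)"
proof (cases "h = 0")
  case h0: False
  define c where "c = cutoff_const TYPE('a) / r"
  have c: "0 < c" using cutoff_const(1)[where 'a='a] r by (simp add: c_def)
  define \<eta> where "\<eta> = cutoff x r (2 * r)"
  have sm\<eta>: "smooth \<eta>" unfolding \<eta>_def by (rule smooth_cutoff)
  have \<eta>01: "0 \<le> \<eta> y" "\<eta> y \<le> 1" for y by (auto simp: \<eta>_def cutoff_bounds)
  have \<eta>1: "\<eta> y = 1" if "y \<in> cball x r" for y using that r by (simp add: \<eta>_def cutoff_1)
  have \<eta>0: "\<eta> y = 0" if "y \<notin> cball x (2 * r)" for y using that r by (simp add: \<eta>_def cutoff_0)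
  have \<eta>g: "norm (gradient \<eta> y) \<le> c" for y unfolding \<eta>_def c_def by (rule gradient_cutoff_le[OF r])
  have \<eta>g0: "gradient \<eta> y = 0" if "y \<notin> cball x (2 * r)" for y
    unfolding \<eta>_def by (rule gradient_cutoff_0) (use that r in auto)
  have L: "Lp 2 g" using gc by (rule grad_closure_Lp)
  have [measurable]: "g \<in> borel_measurable borel" "\<eta> \<in> borel_measurable borel" "gradient \<eta> \<in> borel_measurable borel"
    using Lp_borel[OF L] borel_smooth[OF sm\<eta>] borel_gradient[OF sm\<eta>] by auto
  let ?S = "cball x (3 * r)"
  define A where "A = pint 2 (restr ?S g)"
  obtain \<phi> where \<phi>: "\<And>n. test_function \<Omega> (\<phi> n)" "(\<lambda>n. pdist 2 (gradient (\<phi> n)) g) \<longlonglongrightarrow> 0"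
    using grad_closure_approx[OF gc] by blast
  have sm: "smooth (\<phi> n)" for n by (rule test_function_smooth[OF \<phi>(1)])
  have L\<phi>: "Lp 2 (gradient (\<phi> n))" "Lp 2 (\<phi> n)" for n using test_function_Lp[OF \<phi>(1)] by auto
  define d where "d n y = \<phi> n (y - h) - \<phi> n y" for n y
  define \<psi> where "\<psi> n y = \<eta> y * d n y" for n y
  have smd: "smooth (d n)" for n unfolding d_def by (intro smooth_diff smooth_shift sm)
  have gd: "gradient (d n) y = gradient (\<phi> n) (y - h) - gradient (\<phi> n) y" for n y
    unfolding d_def by (simp add: gradient_diff smooth_shift sm gradient_shift)
  \<comment> \<open>The support lies in the ball of radius \<open>2 * r\<close>. Undoing a
    translation with \<open>norm h \<le> r\<close> stays inside the radius \<open>4 * r\<close>,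
    where the cone condition brings the translated point back into \<open>\<Omega>\<close>.\<close>
  have test: "test_function (\<Omega> \<inter> ball x (4 * r)) (\<psi> n)" for n
  proof -
    obtain K where K: "compact K" "K \<subseteq> \<Omega>" "\<And>y. y \<notin> K \<Longrightarrow> \<phi> n y = 0" using test_functionE(2)[OF \<phi>(1)[of n]] by blast
    show ?thesis
    proof (rule test_functionI)
      show "smooth (\<psi> n)" unfolding \<psi>_def by (intro smooth_mult sm\<eta> smd)
      show "compact (cball x (2 * r) \<inter> (K \<union> (+) h ` K))"
        using K(1) by (intro compact_Int compact_Un compact_translation compact_cball) auto
      show "cball x (2 * r) \<inter> (K \<union> (+) h ` K) \<subseteq> \<Omega> \<inter> ball x (4 * r)"
      proof safe
        fix y assume "y \<in> cball x (2 * r)" then show "y \<in> ball x (4 * r)" using r by simp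
        show "y \<in> \<Omega>" if "y \<in> K" using that K(2) by blast
      next
        fix z assume z: "z \<in> K" "h + z \<in> cball x (2 * r)"
        show "h + z \<in> ball x (4 * r)" using z r by simp
        have "dist x z \<le> dist x (h + z) + norm h" using dist_triangle[of x z "h + z"] by (simp add: dist_norm)
        then have "z \<in> \<Omega> \<inter> ball x (4 * r)" using z K(2) h r by auto
        from cone[OF this] show "h + z \<in> \<Omega>" by (simp add: add.commute)
      qed
      show "\<psi> n y = 0" if "y \<notin> cball x (2 * r) \<inter> (K \<union> (+) h ` K)" for y
      proof (cases "y \<in> cball x (2 * r)")
        case True
        then have "y \<notin> K" "y - h \<notin> K" using that by (auto simp: image_iff)
        then show ?thesis using K(3) by (simp add: \<psi>_def d_def)
      qed (simp add: \<psi>_def \<eta>0)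
    qed
  qed
  have g\<psi>: "gradient (\<psi> n) y = \<eta> y *\<^sub>R gradient (d n) y + d n y *\<^sub>R gradient \<eta> y" for n y
    unfolding \<psi>_def by (rule gradient_mult[OF sm\<eta> smd])
  define F where "F y = \<eta> y *\<^sub>R g y" for y
  have LF: "Lp 2 F" unfolding F_def by (rule Lp_bound(1)[OF L, of _ 1]) (use \<eta>01 in \<open>auto intro: mult_left_le_one_le\<close>)
  have Lsh: "Lp 2 (\<lambda>y. g (y - h))" by (rule Lp_shift(1)[OF L])
  have LD: "Lp 2 (\<lambda>y. g (y - h) - g y)" by (intro Lp_diff Lsh L) auto
  have Lgd: "Lp 2 (gradient (d n))" for n unfolding gd[abs_def] by (intro Lp_diff Lp_shift L\<phi>) auto
  have Ld: "Lp 2 (d n)" for n unfolding d_def by (intro Lp_diff Lp_shift L\<phi>) auto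
  have lim1: "(\<lambda>n. LBINT y. F y \<bullet> gradient (d n) y) \<longlonglongrightarrow> (LBINT y. F y \<bullet> (g (y - h) - g y))"
  proof (rule pairing_limit[OF LF LD _ _ Lgd])
    have Le: "Lp 2 (\<lambda>y. gradient (\<phi> n) y - g y)" for n by (intro Lp_diff L\<phi> L) auto
    have le: "pint 2 (\<lambda>y. gradient (d n) y - (g (y - h) - g y)) \<le> 8 * pdist 2 (gradient (\<phi> n)) g" for n
    proof -
      have "pint 2 (\<lambda>y. (gradient (\<phi> n) (y - h) - g (y - h)) - (gradient (\<phi> n) y - g y))
          \<le> 2 powr 2 * (pint 2 (\<lambda>y. gradient (\<phi> n) (y - h) - g (y - h)) + pdist 2 (gradient (\<phi> n)) g)"
        by (rule Lp_diff(2)[OF Lp_shift(1)[OF Le] Le]) auto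
      moreover have "pint 2 (\<lambda>y. gradient (\<phi> n) (y - h) - g (y - h)) = pdist 2 (gradient (\<phi> n)) g"
        by (rule Lp_shift(2)[OF Le])
      moreover have "(\<lambda>y. (gradient (\<phi> n) (y - h) - g (y - h)) - (gradient (\<phi> n) y - g y)) = (\<lambda>y. gradient (d n) y - (g (y - h) - g y))"
        by (auto simp: gd)
      ultimately show ?thesis by simp
    qed
    show "(\<lambda>n. pint 2 (\<lambda>y. gradient (d n) y - (g (y - h) - g y))) \<longlonglongrightarrow> 0"
      by (rule tendsto_sandwich[OF _ _ tendsto_const tendsto_mult_right_zero[OF \<phi>(2), of 8]])
        (use le in \<open>auto intro!: always_eventually\<close>)
  qed auto
  \<comment> \<open>The equation trades \<open>F \<bullet> gradient (d n)\<close> for a term with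
    \<open>gradient \<eta>\<close>. As \<open>d n\<close> is of order \<open>norm h\<close>, Young's
    inequality is weighted by \<open>1 / norm h\<close> and \<open>norm h\<close>, and both
    resulting terms are of order \<open>norm h\<close>.\<close>
  have bd2: "\<bar>LBINT y. F y \<bullet> gradient (d n) y\<bar>
      \<le> c * norm h / 2 * (pint 2 (restr ?S (gradient (\<phi> n))) + A)" for n
  proof -
    let ?P = "\<lambda>y. g y \<bullet> (d n y *\<^sub>R gradient \<eta> y)"
    let ?B = "cball x (2 * r)"
    let ?W = "\<lambda>y. c / (2 * norm h) * norm (indicator ?B y *\<^sub>R d n y) powr 2 + c * norm h / 2 * norm (indicator ?B y *\<^sub>R g y) powr 2"
    have i1: "integrable lborel (\<lambda>y. F y \<bullet> gradient (d n) y)" by (rule L2_integrable_inner[OF LF Lgd])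
    have Ldg: "Lp 2 (\<lambda>y. d n y *\<^sub>R gradient \<eta> y)"
    proof (rule Lp_bound(1)[OF Ld])
      show "norm (d n y *\<^sub>R gradient \<eta> y) \<le> c * norm (d n y)" for y
        using mult_right_mono[OF \<eta>g[of y], of "\<bar>d n y\<bar>"] by (simp add: mult.commute)
    qed (use c Lp_borel[OF Ld] in auto)
    have i2: "integrable lborel (\<lambda>y. ?P y)" by (rule L2_integrable_inner[OF L Ldg])
    have "0 = (LBINT y. g y \<bullet> gradient (\<psi> n) y)" by (rule harm[OF test, symmetric])
    also have "\<dots> = (LBINT y. F y \<bullet> gradient (d n) y + ?P y)"
      by (intro Bochner_Integration.integral_cong) (auto simp: g\<psi> F_def inner_add_right)
    also have "\<dots> = (LBINT y. F y \<bullet> gradient (d n) y) + (LBINT y. ?P y)"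
      by (rule Bochner_Integration.integral_add[OF i1 i2])
    finally have "\<bar>LBINT y. F y \<bullet> gradient (d n) y\<bar> = \<bar>LBINT y. ?P y\<bar>" by linarith
    also have "\<dots> \<le> (LBINT y. norm (?P y))" using integral_norm_bound[of lborel "\<lambda>y. ?P y"] by simp
    also have "\<dots> \<le> (LBINT y. ?W y)"
    proof (rule integral_mono)
      show "integrable lborel (\<lambda>y. norm (?P y))" using i2 by simp
      show "integrable lborel (\<lambda>y. ?W y)"
        using Lp_integrable[OF Lp_restrict(1)[OF Ld, of ?B n]] Lp_integrable[OF Lp_restrict(1)[OF L, of ?B]]
        by (intro Bochner_Integration.integrable_add Bochner_Integration.integrable_mult_right) auto
      fix y
      show "norm (?P y) \<le> ?W y"
      proof (cases "y \<in> ?B")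
        case True
        let ?D = "\<bar>d n y\<bar>" and ?G = "norm (g y)" and ?H = "norm h"
        have H: "?H > 0" using h0 by simp
        have "norm (?P y) \<le> ?G * norm (d n y *\<^sub>R gradient \<eta> y)" by (simp only: real_norm_def Cauchy_Schwarz_ineq2)
        also have "\<dots> \<le> ?G * (?D * c)" using \<eta>g[of y] by (intro mult_left_mono) (auto intro: mult_left_mono)
        also have "\<dots> \<le> c / (2 * ?H) * ?D\<^sup>2 + c * ?H / 2 * ?G\<^sup>2"
        proof -
          have "0 \<le> c / (2 * ?H) * (?D - ?H * ?G)\<^sup>2" using c H by simp
          also have "\<dots> = c / (2 * ?H) * ?D\<^sup>2 + c * ?H / 2 * ?G\<^sup>2 - ?G * (?D * c)"
            using H by (simp add: power2_diff power_mult_distrib field_simps power2_eq_square)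
          finally show ?thesis by linarith
        qed
        finally show ?thesis using True by simp
      qed (simp add: \<eta>g0)
    qed
    also have "\<dots> = c / (2 * norm h) * pint 2 (restr ?B (d n)) + c * norm h / 2 * pint 2 (restr ?B g)"
      unfolding pint_def
      using Lp_integrable[OF Lp_restrict(1)[OF Ld, of ?B n]] Lp_integrable[OF Lp_restrict(1)[OF L, of ?B]]
      by (subst Bochner_Integration.integral_add) auto
    also have "\<dots> \<le> c / (2 * norm h) * ((norm h)\<^sup>2 * pint 2 (restr ?S (gradient (\<phi> n)))) + c * norm h / 2 * A"
    proof (intro add_mono mult_left_mono)
      have LS: "Lp 2 (restr ?S (gradient (\<phi> n)))" by (rule Lp_restrict(1)[OF L\<phi>(1)]) auto
      have LB: "Lp 2 (restr ?B (d n))" by (rule Lp_restrict(1)[OF Ld]) auto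
      have "ennreal (pint 2 (restr ?B (d n))) = (NN y. indicator ?B y * ennreal (\<bar>\<phi> n (y - h) - \<phi> n y\<bar> powr 2))"
        unfolding ennreal_pint[OF LB, symmetric] by (intro nn_integral_cong) (auto simp: indicator_def d_def)
      also have "\<dots> \<le> ennreal (norm h powr 2) * (NN y. indicator ?S y * ennreal (norm (gradient (\<phi> n) y) powr 2))"
      proof (rule translation_estimate[OF sm])
        fix y s assume y: "y \<in> ?B" and s: "0 \<le> s" "s \<le> (1::real)"
        have "dist x (y - s *\<^sub>R h) \<le> dist x y + norm (s *\<^sub>R h)"
          using dist_triangle[of x "y - s *\<^sub>R h" y] by (simp add: dist_norm)
        also have "norm (s *\<^sub>R h) \<le> 1 * r" using s h r mult_mono[of s 1 "norm h" r] by simp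
        finally show "y - s *\<^sub>R h \<in> ?S" using y by simp
      qed auto
      also have "(NN y. indicator ?S y * ennreal (norm (gradient (\<phi> n) y) powr 2)) = ennreal (pint 2 (restr ?S (gradient (\<phi> n))))"
        unfolding ennreal_pint[OF LS, symmetric] by (intro nn_integral_cong) (auto simp: indicator_def)
      also have "ennreal (norm h powr 2) * \<dots> = ennreal ((norm h)\<^sup>2 * pint 2 (restr ?S (gradient (\<phi> n))))"
        by (simp add: ennreal_mult)
      finally show "pint 2 (restr ?B (d n)) \<le> (norm h)\<^sup>2 * pint 2 (restr ?S (gradient (\<phi> n)))" by simp
      have "pint 2 (restr ?B g) \<le> 1 powr 2 * pint 2 (restr ?S g)"
        by (rule Lp_bound(2)[OF Lp_restrict(1)[OF L]]) (use r in \<open>auto simp: indicator_def\<close>)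
      then show "pint 2 (restr ?B g) \<le> A" by (simp add: A_def)
    qed (use c in auto)
    also have "\<dots> = c * norm h / 2 * (pint 2 (restr ?S (gradient (\<phi> n))) + A)"
      using h0 by (simp add: field_simps power2_eq_square)
    finally show ?thesis .
  qed
  have limS: "(\<lambda>n. pint 2 (restr ?S (gradient (\<phi> n)))) \<longlonglongrightarrow> A" unfolding A_def
  proof (rule L2_pint_tendsto)
    have Le: "Lp 2 (\<lambda>y. gradient (\<phi> n) y - g y)" for n by (intro Lp_diff L\<phi> L) auto
    have eq: "(\<lambda>y. indicator ?S y *\<^sub>R gradient (\<phi> n) y - indicator ?S y *\<^sub>R g y) = (restr ?S (\<lambda>y. gradient (\<phi> n) y - g y))" for n
      by (auto simp: scaleR_diff_right)
    show "(\<lambda>n. pint 2 (\<lambda>y. indicator ?S y *\<^sub>R gradient (\<phi> n) y - indicator ?S y *\<^sub>R g y)) \<longlonglongrightarrow> 0"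
      unfolding eq by (rule tendsto_sandwich[OF _ _ tendsto_const \<phi>(2)])
        (auto intro!: always_eventually Lp_restrict(2)[OF Le])
  qed (auto intro!: Lp_restrict L L\<phi>)
  have I1: "\<bar>LBINT y. F y \<bullet> (g (y - h) - g y)\<bar> \<le> c * norm h * A"
  proof -
    have "\<bar>LBINT y. F y \<bullet> (g (y - h) - g y)\<bar> \<le> c * norm h / 2 * (A + A)"
      by (rule LIMSEQ_le[OF tendsto_rabs[OF lim1] tendsto_mult[OF tendsto_const tendsto_add[OF limS tendsto_const]]])
        (use bd2 in blast)
    then show ?thesis by simp
  qed
  \<comment> \<open>Measures \<open>|g(\<cdot> - h)|\<^sup>2 - |g|\<^sup>2\<close> against
    \<open>\<eta>\<close>, with the translation moved onto the cutoff, which is Lipschitz with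
    constant \<open>c\<close>.\<close>
  define I2 where "I2 = (LBINT y. (\<eta> (y + h) - \<eta> y) * (g y \<bullet> g y))"
  have igg: "integrable lborel (\<lambda>y. g y \<bullet> g y)" by (rule L2_integrable_inner[OF L L])
  have bint: "integrable lborel (\<lambda>y. \<zeta> y * (g y \<bullet> g y))"
    if [measurable]: "\<zeta> \<in> borel_measurable borel" and "\<And>y. \<bar>\<zeta> y\<bar> \<le> 1" for \<zeta> :: "'a \<Rightarrow> real"
    by (rule Bochner_Integration.integrable_bound[OF igg]) (use that(2) in \<open>auto simp: abs_mult intro!: mult_left_le_one_le\<close>)
  have b\<eta>: "integrable lborel (\<lambda>y. \<eta> y * (g y \<bullet> g y))" "integrable lborel (\<lambda>y. \<eta> (y + h) * (g y \<bullet> g y))"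
    using \<eta>01 by (auto intro!: bint)
  have I2: "I2 \<le> c * norm h * A"
  proof -
    have "I2 \<le> (LBINT y. c * norm h * norm (indicator ?S y *\<^sub>R g y) powr 2)" unfolding I2_def
    proof (rule integral_mono)
      show "integrable lborel (\<lambda>y. (\<eta> (y + h) - \<eta> y) * (g y \<bullet> g y))" using b\<eta> by (simp add: left_diff_distrib)
      show "integrable lborel (\<lambda>y. c * norm h * norm (indicator ?S y *\<^sub>R g y) powr 2)"
        using Lp_integrable[OF Lp_restrict(1)[OF L, of ?S]] by (intro Bochner_Integration.integrable_mult_right) auto
      fix y
      show "(\<eta> (y + h) - \<eta> y) * (g y \<bullet> g y) \<le> c * norm h * norm (indicator ?S y *\<^sub>R g y) powr 2"
      proof (cases "y \<in> ?S")
        case True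
        have "\<eta> (y + h) - \<eta> y \<le> c * norm h" using smooth_lipschitz[OF sm\<eta> \<eta>g, of "y + h" y] by (simp add: abs_le_iff)
        then show ?thesis using True by (simp add: power2_norm_eq_inner mult_right_mono)
      next
        case False
        have "dist x y \<le> dist x (y + h) + norm h" using dist_triangle[of x y "y + h"] by (simp add: dist_norm)
        then have "y + h \<notin> cball x (2 * r)" "y \<notin> cball x (2 * r)" using False h r by auto
        then show ?thesis using False \<eta>0 by simp
      qed
    qed
    also have "\<dots> = c * norm h * A" by (simp add: A_def pint_def)
    finally show ?thesis .
  qed
  define W where "W = (LBINT y. \<eta> y * ((g (y - h) - g y) \<bullet> (g (y - h) - g y)))"
  have iD: "integrable lborel (\<lambda>y. (g (y - h) - g y) \<bullet> (g (y - h) - g y))" by (rule L2_integrable_inner[OF LD LD])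
  have iW: "integrable lborel (\<lambda>y. \<eta> y * ((g (y - h) - g y) \<bullet> (g (y - h) - g y)))"
    by (rule Bochner_Integration.integrable_bound[OF iD]) (use \<eta>01 in \<open>auto simp: abs_mult intro!: mult_left_le_one_le\<close>)
  have ish: "integrable lborel (\<lambda>y. \<eta> y * (g (y - h) \<bullet> g (y - h)))"
    using lborel_integrable_shift[OF b\<eta>(2), of h] by simp
  have eqsh: "(LBINT y. \<eta> y * (g (y - h) \<bullet> g (y - h))) = (LBINT y. \<eta> (y + h) * (g y \<bullet> g y))"
    using lborel_integral_shift[of "\<lambda>y. \<eta> (y + h) * (g y \<bullet> g y)" h] by simp
  have iF: "integrable lborel (\<lambda>y. F y \<bullet> (g (y - h) - g y))" by (rule L2_integrable_inner[OF LF LD])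
  have "W = (LBINT y. \<eta> y * (g (y - h) \<bullet> g (y - h)) - \<eta> y * (g y \<bullet> g y) - 2 * (F y \<bullet> (g (y - h) - g y)))"
    unfolding W_def by (intro Bochner_Integration.integral_cong) (auto simp: F_def algebra_simps inner_commute)
  also have "\<dots> = I2 - 2 * (LBINT y. F y \<bullet> (g (y - h) - g y))"
    using ish b\<eta> iF eqsh by (simp add: I2_def left_diff_distrib)
  \<comment> \<open>The 3 counts \<open>I2\<close> once and the mixed integral twice.\<close>
  also have "\<dots> \<le> 3 * (c * norm h * A)" using I1 I2 by linarith
  finally have W: "W \<le> 3 * (c * norm h * A)" .
  have LR: "Lp 2 (restr (cball x r) (\<lambda>y. g (y - h) - g y))" by (rule Lp_restrict(1)[OF LD]) auto
  have "pint 2 (restr (cball x r) (\<lambda>y. g (y - h) - g y)) \<le> W" unfolding pint_def W_def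
  proof (rule integral_mono[OF Lp_integrable[OF LR] iW])
    fix y show "norm (indicator (cball x r) y *\<^sub>R (g (y - h) - g y)) powr 2 \<le> \<eta> y * ((g (y - h) - g y) \<bullet> (g (y - h) - g y))"
      using \<eta>1[of y] \<eta>01(1)[of y] by (cases "y \<in> cball x r") (auto simp: power2_norm_eq_inner)
  qed
  also note W
  finally show ?thesis by (simp add: A_def c_def mult_ac)
qed (simp add: zero_le_mult_iff cutoff_const less_imp_le r)

text \<open>An energy above a level, not the measure of a superlevel set: the measure follows by
  Chebyshev's inequality, while energies can be added up over a covering and over levels.\<close>

definition excess :: "('a::euclidean_space \<Rightarrow> 'a) \<Rightarrow> 'a \<Rightarrow> real \<Rightarrow> real \<Rightarrow> real" where
  "excess g x r L = pint 2 (\<lambda>y. indicator {y \<in> cball x r. L < norm (g y)} y *\<^sub>R g y)"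

lemma excess_sets:
  assumes [measurable]: "g \<in> borel_measurable borel"
  shows "{y \<in> cball x r. L < norm (g y)} \<in> sets borel"
  by measurable

lemma excess_nonneg: "0 \<le> excess g x r L"
  by (simp add: excess_def)

lemma excess_measure:
  assumes L: "Lp 2 g" and l: "0 < L"
  shows "emeasure lborel {y \<in> cball x r. L < norm (g y)} \<le> ennreal (excess g x r L / L\<^sup>2)"
proof -
  have [measurable]: "g \<in> borel_measurable borel" using L by (rule Lp_borel)
  let ?E = "{y \<in> cball x r. L < norm (g y)}"
  have E: "?E \<in> sets borel" by measurable
  note [measurable] = E
  have Ln: "Lp 2 (restr ?E g)" by (rule Lp_restrict(1)[OF L E]) auto
  have "emeasure lborel ?E = (NN y. indicator ?E y)" using E by simp
  also have "\<dots> \<le> (NN y. ennreal (1 / L\<^sup>2) * ennreal (norm (indicator ?E y *\<^sub>R g y) powr 2))"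
  proof (intro nn_integral_mono)
    fix y
    show "indicator ?E y \<le> ennreal (1 / L\<^sup>2) * ennreal (norm (indicator ?E y *\<^sub>R g y) powr 2)"
    proof (cases "y \<in> ?E")
      case True
      then have "L\<^sup>2 \<le> (norm (g y))\<^sup>2" using l by (intro power_mono) auto
      then have "1 \<le> 1 / L\<^sup>2 * (norm (g y))\<^sup>2" using l by (simp add: field_simps)
      then show ?thesis using True by (simp flip: ennreal_mult add: ennreal_1[symmetric] del: ennreal_1)
    qed simp
  qed
  also have "\<dots> = ennreal (1 / L\<^sup>2) * ennreal (excess g x r L)"
    unfolding excess_def ennreal_pint[OF Ln, symmetric] by (rule nn_integral_cmult) measurable
  also have "\<dots> = ennreal (excess g x r L / L\<^sup>2)" by (simp flip: ennreal_mult add: excess_nonneg)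
  finally show ?thesis .
qed

text \<open>If the superlevel set \<open>{|g| > L/2}\<close> is smaller than half of the set \<open>K\<close> of admissible
  translations, then for each \<open>y\<close> with \<open>|g y| > L\<close> at least half of the translations \<open>h \<in> K\<close> satisfy
  \<open>|g (y - h)| \<le> |g y| / 2\<close>, so \<open>|g y|\<^sup>2\<close> is controlled by the translation differences.\<close>

lemma excess_le_translation_difference:
  assumes L: "Lp 2 g" and l: "0 < L" and B: "0 \<le> B"
    and K: "K \<in> sets borel" "emeasure lborel K = ennreal \<mu>" "0 < \<mu>" "\<And>h. h \<in> K \<Longrightarrow> norm h \<le> r"
    and diff: "\<And>h. h \<in> K \<Longrightarrow> pint 2 (restr (cball x r) (\<lambda>y. g (y - h) - g y)) \<le> B"
    and small: "2 * (excess g x (2 * r) (L / 2) / (L / 2)\<^sup>2) \<le> \<mu>"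
  shows "excess g x r L \<le> 8 * B"
proof -
  have [measurable]: "g \<in> borel_measurable borel" using L by (rule Lp_borel)
  note [measurable] = K(1)
  let ?E = "{y \<in> cball x r. L < norm (g y)}"
  let ?N = "{y \<in> cball x (2 * r). L / 2 < norm (g y)}"
  have E: "?E \<in> sets borel" and N: "?N \<in> sets borel" by measurable
  note [measurable] = E N
  let ?f = "\<lambda>y. ennreal (norm (g y) powr 2)"
  let ?w = "\<lambda>y h. indicator K h * indicator {y. norm (g y) \<le> L / 2} (y - h) :: ennreal"
  let ?v = "\<lambda>y h. (indicator ?E y * ?f y) * ?w y h"
  \<comment> \<open>By reflection invariance the translations \<open>h\<close> with
    \<open>y - h\<close> in the superlevel set at \<open>L / 2\<close> form a set of the same
    measure, at most \<open>\<mu> / 2\<close>. At least half of \<open>K\<close> is left.\<close>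
  have pw: "ennreal (\<mu> / 2) \<le> (NN h. ?w y h)"
    if y: "y \<in> ?E" for y
  proof -
    have "ennreal \<mu> = (NN h. indicator K h)" using K by simp
    also have "\<dots> \<le> (NN h. ?w y h + indicator ?N (y - h))"
    proof (intro nn_integral_mono)
      fix h
      show "indicator K h \<le> ?w y h + (indicator ?N (y - h) :: ennreal)"
      proof (cases "h \<in> K")
        case True
        have "dist x (y - h) \<le> dist x y + norm h" using dist_triangle[of x "y - h" y] by (simp add: dist_norm)
        then have "y - h \<in> cball x (2 * r)" using y K(4)[OF True] by auto
        then show ?thesis using True by (auto simp: indicator_def)
      qed simp
    qed
    also have "\<dots> = (NN h. ?w y h) + (NN h. indicator ?N (y - h))" by (rule nn_integral_add) auto
    finally have *: "ennreal \<mu> \<le> (NN h. ?w y h) + (NN h. indicator ?N (y - h))" .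
    have "(NN h. indicator ?N (y - h)) = (NN h. indicator ?N h)" using N by (intro lborel_nn_reflect) auto
    also have "\<dots> = emeasure lborel ?N" using N by simp
    also have "\<dots> \<le> ennreal (excess g x (2 * r) (L / 2) / (L / 2)\<^sup>2)" by (rule excess_measure[OF L]) (use l in simp)
    also have "\<dots> \<le> ennreal (\<mu> / 2)" by (rule ennreal_leI) (use small in linarith)
    finally have "(NN h. indicator ?N (y - h)) \<le> ennreal (\<mu> / 2)" .
    then have *: "ennreal \<mu> \<le> (NN h. ?w y h) + ennreal (\<mu> / 2)" by (intro order_trans[OF *] add_left_mono)
    have "ennreal (\<mu> / 2 + \<mu> / 2) = ennreal (\<mu> / 2) + ennreal (\<mu> / 2)" by (rule ennreal_plus) (use K(3) in auto)
    with * have "ennreal (\<mu> / 2) + ennreal (\<mu> / 2) \<le> ennreal (\<mu> / 2) + (NN h. ?w y h)"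
      by (simp only: field_sum_of_halves add.commute)
    then show ?thesis by (simp only: ennreal_add_left_cancel_le) simp
  qed
  have Ln: "Lp 2 (restr ?E g)" by (rule Lp_restrict(1)[OF L E]) auto
  have "ennreal (\<mu> / 2) * ennreal (excess g x r L) = (NN y. ennreal (\<mu> / 2) * ennreal (norm (indicator ?E y *\<^sub>R g y) powr 2))"
    unfolding excess_def ennreal_pint[OF Ln, symmetric] by (rule nn_integral_cmult[symmetric]) measurable
  also have "\<dots> \<le> (NN y. (NN h. ?v y h))"
  proof (intro nn_integral_mono)
    fix y
    have "ennreal (\<mu> / 2) * ennreal (norm (indicator ?E y *\<^sub>R g y) powr 2) = (indicator ?E y * ?f y) * (if y \<in> ?E then ennreal (\<mu> / 2) else 0)"
      by (auto simp: indicator_def mult.commute)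
    also have "\<dots> \<le> (indicator ?E y * ?f y) * (NN h. ?w y h)" using pw[of y] by (intro mult_left_mono) auto
    also have "\<dots> = (NN h. ?v y h)" by (rule nn_integral_cmult[symmetric]) measurable
    finally show "ennreal (\<mu> / 2) * ennreal (norm (indicator ?E y *\<^sub>R g y) powr 2)
      \<le> (NN h. ?v y h)" .
  qed
  also have "\<dots> = (NN h. (NN y. ?v y h))" by (rule lborel_pair.Fubini') measurable
  also have "\<dots> \<le> (NN h. ennreal (4 * B) * indicator K h)"
  proof (intro nn_integral_mono)
    fix h
    show "(NN y. ?v y h) \<le> ennreal (4 * B) * indicator K h"
    proof (cases "h \<in> K")
      case True
      let ?D = "\<lambda>y. indicator (cball x r) y *\<^sub>R (g (y - h) - g y)"
      have LD: "Lp 2 ?D" by (intro Lp_restrict Lp_diff Lp_shift L) auto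
      have "(NN y. ?v y h)
        \<le> (NN y. ennreal (4 * norm (?D y) powr 2))"
      proof (intro nn_integral_mono)
        fix y
        show "?v y h \<le> ennreal (4 * norm (?D y) powr 2)"
        proof (cases "y \<in> ?E \<and> norm (g (y - h)) \<le> L / 2")
          case c: True
          \<comment> \<open>Since \<open>norm (g (y - h)) \<le> L / 2 < norm (g y) / 2\<close>, the
            difference is at least half of \<open>norm (g y)\<close>. Squaring gives the factor 4,
            and dividing by \<open>\<mu> / 2\<close> in the end makes it 8.\<close>
          have "norm (g y) \<le> norm (g (y - h) - g y) + norm (g (y - h))"
            using norm_triangle_ineq4[of "g (y - h)" "g (y - h) - g y"] by simp
          then have "norm (g y) \<le> 2 * norm (g (y - h) - g y)" using c by auto
          then have "(norm (g y))\<^sup>2 \<le> (2 * norm (g (y - h) - g y))\<^sup>2" by (intro power_mono) auto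
          then show ?thesis using c True by (simp add: power_mult_distrib ennreal_leI)
        qed (auto simp: indicator_def)
      qed
      also have "\<dots> = ennreal (4 * pint 2 ?D)" unfolding pint_def using Lp_integrable[OF LD]
        by (subst nn_integral_eq_integral) (auto simp del: powr_numeral)
      also have "\<dots> \<le> ennreal (4 * B)" using diff[OF True] by (intro ennreal_leI) simp
      finally show ?thesis using True by simp
    qed simp
  qed
  also have "\<dots> = ennreal (4 * B) * ennreal \<mu>" using K by (subst nn_integral_cmult) auto
  finally have "ennreal (\<mu> / 2 * excess g x r L) \<le> ennreal (4 * B * \<mu>)"
    using K(3) B excess_nonneg[of g x r L] by (simp flip: ennreal_mult)
  then have "\<mu> / 2 * excess g x r L \<le> 4 * B * \<mu>" using B K(3) by (subst (asm) ennreal_le_iff) auto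
  then have "\<mu> * excess g x r L \<le> \<mu> * (8 * B)" by (simp add: mult_ac)
  then show ?thesis using K(3) by simp
qed

lemma excess_le:
  assumes L: "Lp 2 g" and "r \<le> R"
  shows "excess g x r L \<le> pint 2 (restr (cball x R) g)"
proof -
  have E: "{y \<in> cball x r. L < norm (g y)} \<in> sets borel" by (rule excess_sets[OF Lp_borel[OF L]])
  have "pint 2 (\<lambda>y. indicator {y \<in> cball x r. L < norm (g y)} y *\<^sub>R g y) \<le> 1 powr 2 * pint 2 (restr (cball x R) g)"
  proof (rule Lp_bound(2)[OF Lp_restrict(1)[OF L]])
    show "(\<lambda>y. indicator {y \<in> cball x r. L < norm (g y)} y *\<^sub>R g y) \<in> borel_measurable borel"
      using Lp_borel[OF Lp_restrict(1)[OF L E]] by auto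
  qed (use assms in \<open>auto simp: indicator_def\<close>)
  then show ?thesis by (simp add: excess_def)
qed

text \<open>The exponent iteration \<open>\<sigma> \<mapsto> (2 + \<sigma>) / 3\<close> starts at 0 and tends to 1; in the limit this is the
  weak \<open>L\<^sup>3\<close> bound for \<open>g\<close> that matches the half derivative in \<open>L\<^sup>2\<close> from the translation estimate.\<close>

lemma excess_decay:
  assumes \<kappa>: "0 < \<kappa>" "\<kappa> < 1" and dim: "DIM('a::euclidean_space) = 3"
  shows "\<exists>C>0. \<forall>\<Omega> r0 (g :: 'a \<Rightarrow> 'a) x r a L. uniform_cone \<Omega> r0 \<kappa> \<longrightarrow> grad_closure 2 \<Omega> g \<longrightarrow>
     (\<forall>\<psi>. test_function (\<Omega> \<inter> ball x (4 * 2 ^ k * r)) \<psi> \<longrightarrow> (LBINT y. g y \<bullet> gradient \<psi> y) = 0) \<longrightarrow>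
     0 < r \<longrightarrow> 4 * 2 ^ k * r \<le> r0 \<longrightarrow> 0 < a \<longrightarrow> 0 < L \<longrightarrow>
     pint 2 (restr (cball x (4 * 2 ^ k * r)) g) \<le> a\<^sup>2 * r ^ 3 \<longrightarrow>
     excess g x r L \<le> C * a\<^sup>2 * r ^ 3 * (a / L) powr (1 - (1 / 3) ^ k)"
proof (induction k)
  case 0
  show ?case
  proof (rule exI[of _ 1], intro conjI allI impI)
    fix \<Omega> r0 and g :: "'a \<Rightarrow> 'a" and x r and a L :: real
    assume *: "grad_closure 2 \<Omega> g" "0 < r" "0 < a" "0 < L" "pint 2 (restr (cball x (4 * 2 ^ 0 * r)) g) \<le> a\<^sup>2 * r ^ 3"
    have "excess g x r L \<le> pint 2 (restr (cball x (4 * 2 ^ 0 * r)) g)"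
      by (rule excess_le[OF grad_closure_Lp[OF *(1)]]) (use * in simp)
    then show "excess g x r L \<le> 1 * a\<^sup>2 * r ^ 3 * (a / L) powr (1 - (1 / 3) ^ 0)" using * by simp
  qed simp
next
  case (Suc k)
  define \<sigma> where "\<sigma> = 1 - (1 / 3 :: real) ^ k"
  have \<sigma>: "0 \<le> \<sigma>" "\<sigma> \<le> 1" by (auto simp: \<sigma>_def power_le_one)
  have \<sigma>S: "1 - (1 / 3 :: real) ^ Suc k = (2 + \<sigma>) / 3" by (simp add: \<sigma>_def)
  obtain C where C: "C > 0" and IH: "\<And>\<Omega> r0 (g :: 'a \<Rightarrow> 'a) x r a L. uniform_cone \<Omega> r0 \<kappa> \<Longrightarrow> grad_closure 2 \<Omega> g \<Longrightarrow>
     (\<forall>\<psi>. test_function (\<Omega> \<inter> ball x (4 * 2 ^ k * r)) \<psi> \<longrightarrow> (LBINT y. g y \<bullet> gradient \<psi> y) = 0) \<Longrightarrow>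
     0 < r \<Longrightarrow> 4 * 2 ^ k * r \<le> r0 \<Longrightarrow> 0 < a \<Longrightarrow> 0 < L \<Longrightarrow>
     pint 2 (restr (cball x (4 * 2 ^ k * r)) g) \<le> a\<^sup>2 * r ^ 3 \<Longrightarrow>
     excess g x r L \<le> C * a\<^sup>2 * r ^ 3 * (a / L) powr \<sigma>" using Suc unfolding \<sigma>_def by blast
  \<comment> \<open>\<open>v * t ^ 3\<close> is the volume of the ball of translations around
    \<open>t *\<^sub>R e\<close>.\<close>
  define v where "v = unit_ball_vol (real DIM('a)) * \<kappa> ^ 3"
  have v: "v > 0" using \<kappa> by (simp add: v_def)
  define C0 where "C0 = 6 * cutoff_const TYPE('a)"
  have C0: "C0 > 0" using cutoff_const(1)[where 'a='a] by (simp add: C0_def)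
  \<comment> \<open>Makes \<open>v * t ^ 3\<close> equal to twice the Chebyshev bound for the
    superlevel set at \<open>L / 2\<close>. In 128 = 2 * 8 * 2 * 4 the factors are this 2, the cube
    of the doubled radius, the halved level under the exponent \<open>\<sigma>\<close> and its
    square in the denominator.\<close>
  define b where "b = (128 * C / v) powr (1 / 3)"
  have b: "b > 0" using C v by (simp add: b_def)
  define C' where "C' = 8 * C0 * b + 2 * b"
  have C': "C' > 0" using C0 b by (simp add: C'_def add_pos_pos)
  have main: "excess g x r L \<le> C' * a\<^sup>2 * r ^ 3 * (a / L) powr ((2 + \<sigma>) / 3)"
    if uc: "uniform_cone \<Omega> r0 \<kappa>" and gc: "grad_closure 2 \<Omega> g"
      and harm: "\<forall>\<psi>. test_function (\<Omega> \<inter> ball x (4 * 2 ^ Suc k * r)) \<psi> \<longrightarrow> (LBINT y. g y \<bullet> gradient \<psi> y) = 0"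
      and r: "0 < r" "4 * 2 ^ Suc k * r \<le> r0" and a: "0 < a" and l: "0 < L"
      and bd: "pint 2 (restr (cball x (4 * 2 ^ Suc k * r)) g) \<le> a\<^sup>2 * r ^ 3"
    for \<Omega> r0 and g :: "'a \<Rightarrow> 'a" and x r and a L :: real
  proof -
    have L: "Lp 2 g" by (rule grad_closure_Lp[OF gc])
    have p2: "(1::real) \<le> 2 ^ Suc k" using one_le_power[of "2::real" "Suc k"] by simp
    have "4 * 1 * r \<le> 4 * 2 ^ Suc k * r" using p2 r by (intro mult_right_mono mult_left_mono) auto
    then have r4: "4 * r \<le> 4 * 2 ^ Suc k * r" by simp
    \<comment> \<open>Forced by comparing volumes: \<open>t ^ 3\<close> has to match
      \<open>(a / L)\<^sup>2 * (a / L) powr \<sigma>\<close>.\<close>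
    define s where "s = (2 + \<sigma>) / 3"
    define t where "t = r * b * (a / L) powr s"
    have t: "t > 0" using r b a l by (simp add: t_def)
    have ind_le: "pint 2 (restr (cball x R) g) \<le> a\<^sup>2 * r ^ 3" if "R \<le> 4 * 2 ^ Suc k * r" for R
    proof -
      have "pint 2 (restr (cball x R) g) \<le> 1 powr 2 * pint 2 (restr (cball x (4 * 2 ^ Suc k * r)) g)"
        by (rule Lp_bound(2)[OF Lp_restrict(1)[OF L]]) (use that Lp_borel[OF L] in \<open>auto simp: indicator_def\<close>)
      then show ?thesis using bd by simp
    qed
    show ?thesis
    proof (cases "2 * t \<le> r")
      case True
      \<comment> \<open>The previous exponent is used on the doubled ball at half the level; this is
        the origin of the factor \<open>2 ^ k\<close> in the outer radius.\<close>
      have e1: "excess g x (2 * r) (L / 2) \<le> C * a\<^sup>2 * (2 * r) ^ 3 * (a / (L / 2)) powr \<sigma>"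
      proof (rule IH[OF uc gc])
        show "\<forall>\<psi>. test_function (\<Omega> \<inter> ball x (4 * 2 ^ k * (2 * r))) \<psi> \<longrightarrow> (LBINT y. g y \<bullet> gradient \<psi> y) = 0"
          using harm by (simp add: mult_ac)
        have "pint 2 (restr (cball x (4 * 2 ^ k * (2 * r))) g) \<le> a\<^sup>2 * r ^ 3" by (rule ind_le) (simp add: mult_ac)
        also have "\<dots> \<le> a\<^sup>2 * (2 * r) ^ 3" using r by (intro mult_left_mono power_mono) auto
        finally show "pint 2 (restr (cball x (4 * 2 ^ k * (2 * r))) g) \<le> a\<^sup>2 * (2 * r) ^ 3" .
      qed (use r a l in \<open>auto simp: mult_ac\<close>)
      have two: "(a / (L / 2)) powr \<sigma> \<le> 2 * (a / L) powr \<sigma>"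
      proof -
        have "a / (L / 2) = 2 * (a / L)" using l by simp
        then have "(a / (L / 2)) powr \<sigma> = 2 powr \<sigma> * (a / L) powr \<sigma>" using a l by (simp only: powr_mult)
        moreover have "2 powr \<sigma> \<le> 2 powr 1" using \<sigma> by (intro powr_mono) auto
        ultimately show ?thesis by (simp add: mult_right_mono)
      qed
      have t3: "v * t ^ 3 = 128 * C * r ^ 3 * ((a / L)\<^sup>2 * (a / L) powr \<sigma>)"
      proof -
        have al: "0 < a / L" using a l by simp
        have "b ^ 3 = b powr 3" using b by simp
        also have "\<dots> = 128 * C / v" unfolding b_def using C v by (simp add: powr_powr)
        finally have b3: "b ^ 3 = 128 * C / v" .
        have "((a / L) powr s) ^ 3 = ((a / L) powr s) powr 3" using al by simp
        also have "\<dots> = (a / L) powr (2 + \<sigma>)" unfolding powr_powr by (rule arg_cong[where f="\<lambda>e. _ powr e"]) (simp add: s_def)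
        also have "\<dots> = (a / L)\<^sup>2 * (a / L) powr \<sigma>" using al by (simp add: powr_add)
        finally have s3: "((a / L) powr s) ^ 3 = (a / L)\<^sup>2 * (a / L) powr \<sigma>" .
        show ?thesis unfolding t_def power_mult_distrib b3 s3 using v by simp
      qed
      obtain e where e: "norm e = 1" and cone: "\<And>y t h. y \<in> \<Omega> \<inter> ball x r0 \<Longrightarrow> 0 < t \<Longrightarrow> t < r0 \<Longrightarrow> h \<in> ball (t *\<^sub>R e) (\<kappa> * t) \<Longrightarrow> y + h \<in> \<Omega>"
        using uc unfolding uniform_cone_def by meson
      let ?K = "ball (t *\<^sub>R e) (\<kappa> * t)"
      have Kn: "norm h \<le> 2 * t" if "h \<in> ?K" for h
      proof -
        have "norm h \<le> norm (t *\<^sub>R e) + norm (h - t *\<^sub>R e)" using norm_triangle_ineq[of "t *\<^sub>R e" "h - t *\<^sub>R e"] by simp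
        also have "norm (h - t *\<^sub>R e) \<le> \<kappa> * t" using that by (simp add: dist_norm norm_minus_commute less_imp_le)
        also have "\<kappa> * t \<le> 1 * t" using \<kappa> t by (intro mult_right_mono) auto
        finally show ?thesis using e t by simp
      qed
      have eK: "emeasure lborel ?K = ennreal (v * t ^ 3)"
        using \<kappa> t dim by (simp add: emeasure_ball v_def power_mult_distrib mult_ac)
      have "excess g x r L \<le> 8 * (C0 * (t / r) * (a\<^sup>2 * r ^ 3))"
      proof (rule excess_le_translation_difference[OF L l _ _ eK])
        show "pint 2 (restr (cball x r) (\<lambda>y. g (y - h) - g y)) \<le> C0 * (t / r) * (a\<^sup>2 * r ^ 3)" if h: "h \<in> ?K" for h
        proof -
          have "pint 2 (restr (cball x r) (\<lambda>y. g (y - h) - g y))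
              \<le> 3 * cutoff_const TYPE('a) * (norm h / r) * pint 2 (restr (cball x (3 * r)) g)"
          proof (rule translation_difference_bound[OF gc r(1)])
            show "norm h \<le> r" using Kn[OF h] True by simp
            show "(LBINT y. g y \<bullet> gradient \<psi> y) = 0" if "test_function (\<Omega> \<inter> ball x (4 * r)) \<psi>" for \<psi>
            proof -
              have "\<Omega> \<inter> ball x (4 * r) \<subseteq> \<Omega> \<inter> ball x (4 * 2 ^ Suc k * r)" using subset_ball[OF r4, of x] by blast
              from test_function_mono[OF that this] show ?thesis using harm by blast
            qed
            show "y + h \<in> \<Omega>" if "y \<in> \<Omega> \<inter> ball x (4 * r)" for y
            proof (rule cone[OF _ t _ h])
              have "4 * r \<le> r0" using r4 r(2) by linarith
              then show "y \<in> \<Omega> \<inter> ball x r0" "t < r0" using that True t r(1) by auto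
            qed
          qed
          also have "\<dots> \<le> C0 * (t / r) * (a\<^sup>2 * r ^ 3)"
          proof (rule mult_mono)
            have "3 * cutoff_const TYPE('a) * (norm h / r) \<le> 3 * cutoff_const TYPE('a) * (2 * t / r)"
              using Kn[OF h] r cutoff_const(1)[where 'a='a] by (intro mult_left_mono divide_right_mono) auto
            then show "3 * cutoff_const TYPE('a) * (norm h / r) \<le> C0 * (t / r)" by (simp add: C0_def)
            show "pint 2 (restr (cball x (3 * r)) g) \<le> a\<^sup>2 * r ^ 3" by (rule ind_le) (use r4 r in linarith)
          qed (use C0 t r in auto)
          finally show ?thesis .
        qed
        have "2 * (excess g x (2 * r) (L / 2) / (L / 2)\<^sup>2) \<le> 2 * ((C * a\<^sup>2 * (2 * r) ^ 3 * (2 * (a / L) powr \<sigma>)) / (L / 2)\<^sup>2)"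
        proof (intro mult_left_mono divide_right_mono)
          have "C * a\<^sup>2 * (2 * r) ^ 3 * (a / (L / 2)) powr \<sigma> \<le> C * a\<^sup>2 * (2 * r) ^ 3 * (2 * (a / L) powr \<sigma>)"
            using C r by (intro mult_left_mono two) auto
          with e1 show "excess g x (2 * r) (L / 2) \<le> C * a\<^sup>2 * (2 * r) ^ 3 * (2 * (a / L) powr \<sigma>)" by linarith
        qed auto
        also have "\<dots> = v * t ^ 3" unfolding t3 using l by (simp add: power_mult_distrib power_divide power2_eq_square field_simps power3_eq_cube)
        finally show "2 * (excess g x (2 * r) (L / 2) / (L / 2)\<^sup>2) \<le> v * t ^ 3" .
        show "norm h \<le> r" if "h \<in> ?K" for h using Kn[OF that] True by simp
      qed (use C0 t r v in auto)
      also have "\<dots> = 8 * C0 * b * a\<^sup>2 * r ^ 3 * (a / L) powr s" using r by (simp add: t_def)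
      also have "\<dots> \<le> C' * a\<^sup>2 * r ^ 3 * (a / L) powr s" using b r by (intro mult_right_mono) (auto simp: C'_def)
      finally show ?thesis by (simp add: s_def)
    next
      \<comment> \<open>The required translations would be too long for the ball. Then
        \<open>a / L\<close> is bounded below, and the trivial bound by the whole energy already has
        the claimed form.\<close>
      case False
      then have "1 \<le> 2 * b * (a / L) powr s" using r by (simp add: t_def)
      then have "a\<^sup>2 * r ^ 3 * 1 \<le> a\<^sup>2 * r ^ 3 * (2 * b * (a / L) powr s)" using r by (intro mult_left_mono) auto
      moreover have "excess g x r L \<le> a\<^sup>2 * r ^ 3"
        by (rule order_trans[OF excess_le[OF L, of r "4 * r"] ind_le[OF r4]]) (use r in simp)
      ultimately have "excess g x r L \<le> 2 * b * a\<^sup>2 * r ^ 3 * (a / L) powr s" by (simp add: mult_ac)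
      also have "\<dots> \<le> C' * a\<^sup>2 * r ^ 3 * (a / L) powr s" using b C0 r by (intro mult_right_mono) (auto simp: C'_def)
      finally show ?thesis by (simp add: s_def)
    qed
  qed
  show ?case unfolding \<sigma>S by (rule exI[of _ C']) (use C' main in blast)
qed

section \<open>Higher integrability\<close>

text \<open>A substitute for the Lebesgue differentiation theorem. The set \<open>S\<close> need not be measurable.\<close>

lemma density_bound_negligible:
  assumes f: "integrable lborel f" "\<And>x. 0 \<le> f x" and L: "0 \<le> L"
    and small: "\<And>x d. x \<in> S \<Longrightarrow> 0 < d \<Longrightarrow>
      \<exists>r. 0 < r \<and> r < d \<and> (NN y. indicator (ball x r) y * ennreal (f y)) \<le> ennreal L * emeasure lborel (ball x r)"
  shows "negligible {x \<in> S. L < f x}"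
proof -
  have [measurable]: "f \<in> borel_measurable borel" using f(1) by simp
  have "negligible {x \<in> S. L + \<delta> \<le> f x}" if \<delta>: "0 < \<delta>" for \<delta> unfolding negligible_outer_le
  proof (intro allI impI)
    fix e :: real assume e: "0 < e"
    \<comment> \<open>Slack for an open set around \<open>F\<close>, sized so that the final bound
      \<open>\<eta> * (1 + L / \<delta>)\<close> equals \<open>e\<close>.\<close>
    define \<eta> where "\<eta> = e / (1 + L / \<delta>)"
    have pos: "0 < 1 + L / \<delta>" using L \<delta> by (simp add: add_pos_nonneg)
    have \<eta>: "0 < \<eta>" using e pos by (simp add: \<eta>_def)
    define F where "F = {x. L + \<delta> \<le> f x}"
    have F[measurable]: "F \<in> sets borel" unfolding F_def by measurable
    have Ffin: "emeasure lborel F < \<infinity>"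
    proof -
      have "emeasure lborel F = (NN x. indicator F x)" by simp
      also have "\<dots> \<le> (NN x. ennreal (f x / (L + \<delta>)))"
      proof (rule nn_integral_mono)
        fix x show "indicator F x \<le> ennreal (f x / (L + \<delta>))"
          using L \<delta> f(2)[of x] by (cases "x \<in> F") (auto simp: F_def le_divide_eq)
      qed
      also have "\<dots> < \<infinity>" using f L \<delta> by (subst nn_integral_eq_integral) auto
      finally show ?thesis .
    qed
    \<comment> \<open>The covering balls are kept inside \<open>U\<close>, so that their union
      \<open>V\<close> exceeds \<open>F\<close> by measure at most \<open>\<eta>\<close>.\<close>
    obtain U where U: "open U" "F \<subseteq> U" "U - F \<in> lmeasurable" "emeasure lebesgue (U - F) < ennreal \<eta>"
    proof -
      have "F \<in> sets lebesgue" using F by simp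
      from sets_lebesgue_outer_open[OF this \<eta>] show ?thesis using that by blast
    qed
    have UF: "emeasure lborel (U - F) \<le> ennreal \<eta>" using U(1,4) F by (simp add: less_imp_le)
    let ?E = "{x \<in> S. L + \<delta> \<le> f x}"
    define K where "K = {(x, r). 0 < r \<and> ball x r \<subseteq> U \<and> (NN y. indicator (ball x r) y * ennreal (f y)) \<le> ennreal L * emeasure lborel (ball x r)}"
    have cover: "\<exists>i. i \<in> K \<and> x \<in> ball (fst i) (snd i) \<and> snd i < d" if x: "x \<in> ?E" and d: "0 < d" for x d
    proof -
      have "x \<in> U" using x U(2) by (auto simp: F_def)
      then obtain d' where d': "0 < d'" "ball x d' \<subseteq> U" using U(1) open_contains_ball by blast
      have xS: "x \<in> S" and m: "0 < min d d'" using x d d' by auto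
      obtain r where r: "0 < r" "r < min d d'" "(NN y. indicator (ball x r) y * ennreal (f y)) \<le> ennreal L * emeasure lborel (ball x r)"
        using small[OF xS m] by blast
      have "ball x r \<subseteq> ball x d'" using r by (intro subset_ball) auto
      then have "(x, r) \<in> K" using r d' by (auto simp: K_def)
      then show ?thesis using r by (intro exI[of _ "(x, r)"]) auto
    qed
    obtain C where C: "countable C" "C \<subseteq> K"
      "pairwise (\<lambda>i j. disjnt (ball (fst i) (snd i)) (ball (fst j) (snd j))) C"
      "negligible (?E - (\<Union>i\<in>C. ball (fst i) (snd i)))"
      using Vitali_covering_theorem_balls[of ?E K fst snd] cover by blast
    define V where "V = (\<Union>i\<in>C. ball (fst i) (snd i))"
    have KU: "ball (fst i) (snd i) \<subseteq> U" if "i \<in> K" for i using that unfolding K_def by (cases i) simp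
    have V: "open V" "V \<subseteq> U" unfolding V_def using C(2) KU by blast+
    have [measurable]: "V \<in> sets borel" "U \<in> sets borel" using V(1) U(1) by auto
    have disj: "disjoint_family_on (\<lambda>i. ball (fst i) (snd i)) C"
      using C(3) by (auto simp: disjoint_family_on_def pairwise_def disjnt_def)
    define M where "M = density lborel (\<lambda>x. ennreal (f x))"
    have MV: "emeasure M X = (NN y. indicator X y * ennreal (f y))" if [measurable]: "X \<in> sets borel" for X
      unfolding M_def by (subst emeasure_density) (auto simp: mult.commute)
    have "emeasure M V = (\<integral>\<^sup>+i. emeasure M (ball (fst i) (snd i)) \<partial>count_space C)"
      unfolding V_def by (rule emeasure_UN_countable[OF _ C(1) disj]) (auto simp: M_def)
    also have "\<dots> \<le> (\<integral>\<^sup>+i. ennreal L * emeasure lborel (ball (fst i) (snd i)) \<partial>count_space C)"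
    proof (rule nn_integral_mono)
      fix i assume "i \<in> space (count_space C)"
      then have "i \<in> K" using C(2) by auto
      then show "emeasure M (ball (fst i) (snd i)) \<le> ennreal L * emeasure lborel (ball (fst i) (snd i))"
        by (subst MV) (auto simp: K_def)
    qed
    also have "\<dots> = ennreal L * (\<integral>\<^sup>+i. emeasure lborel (ball (fst i) (snd i)) \<partial>count_space C)"
      by (rule nn_integral_cmult) auto
    also have "(\<integral>\<^sup>+i. emeasure lborel (ball (fst i) (snd i)) \<partial>count_space C) = emeasure lborel V"
      unfolding V_def by (rule emeasure_UN_countable[OF _ C(1) disj, symmetric]) auto
    finally have up: "emeasure M V \<le> ennreal L * emeasure lborel V" .
    have VFfin: "emeasure lborel (V \<inter> F) < \<infinity>"
      using Ffin emeasure_mono[of "V \<inter> F" F lborel] by (auto intro: le_less_trans)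
    define y where "y = measure lborel (V \<inter> F)"
    have y: "emeasure lborel (V \<inter> F) = ennreal y" "0 \<le> y"
      using VFfin unfolding y_def by (auto intro: emeasure_eq_ennreal_measure)
    have Vle: "emeasure lborel V \<le> ennreal (y + \<eta>)"
    proof -
      have "emeasure lborel V \<le> emeasure lborel ((V \<inter> F) \<union> (U - F))" using V(2) by (intro emeasure_mono) auto
      also have "\<dots> \<le> emeasure lborel (V \<inter> F) + emeasure lborel (U - F)" by (rule emeasure_subadditive) auto
      also have "\<dots> \<le> ennreal y + ennreal \<eta>" unfolding y(1) using UF by (intro add_left_mono)
      finally show ?thesis using y \<eta> by simp
    qed
    \<comment> \<open>On \<open>V \<inter> F\<close> the function is at least
      \<open>L + \<delta>\<close>, while its integral over \<open>V\<close> is at most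
      \<open>L\<close> times the measure of \<open>V\<close>. Hence \<open>V \<inter> F\<close>, and
      with it \<open>V\<close>, is small.\<close>
    have "ennreal ((L + \<delta>) * y) = (NN z. ennreal (L + \<delta>) * indicator (V \<inter> F) z)"
      using y L \<delta> by (subst nn_integral_cmult) (auto simp: ennreal_mult)
    also have "\<dots> \<le> (NN z. indicator V z * ennreal (f z))"
      by (rule nn_integral_mono) (auto simp: indicator_def F_def intro: ennreal_leI)
    also have "\<dots> = emeasure M V" by (rule MV[symmetric]) auto
    also have "\<dots> \<le> ennreal L * emeasure lborel V" by (rule up)
    also have "\<dots> \<le> ennreal L * ennreal (y + \<eta>)" by (rule mult_left_mono[OF Vle]) simp
    also have "\<dots> = ennreal (L * (y + \<eta>))" using L y \<eta> by (simp add: ennreal_mult)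
    finally have "(L + \<delta>) * y \<le> L * (y + \<eta>)" using L y \<eta> by (subst (asm) ennreal_le_iff) auto
    then have "y \<le> L / \<delta> * \<eta>" using \<delta> by (simp add: field_simps)
    then have "y + \<eta> \<le> \<eta> * (1 + L / \<delta>)" by (simp add: algebra_simps)
    also have "\<dots> = e" using pos by (simp add: \<eta>_def)
    finally have "emeasure lborel V \<le> ennreal e" using Vle by (meson ennreal_leI order_trans)
    then have Ve: "V \<in> lmeasurable" "measure lebesgue V \<le> e"
    proof -
      assume *: "emeasure lborel V \<le> ennreal e"
      then have "emeasure lebesgue V \<le> ennreal e" by simp
      then show "V \<in> lmeasurable" by (intro fmeasurableI) (auto intro: le_less_trans)
      show "measure lebesgue V \<le> e" using * e unfolding measure_def by (simp add: enn2real_leI)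
    qed
    have neg: "?E - V \<in> null_sets lebesgue" using C(4) by (simp add: V_def negligible_iff_null_sets)
    show "\<exists>T. ?E \<subseteq> T \<and> T \<in> lmeasurable \<and> measure lebesgue T \<le> e"
    proof (intro exI[of _ "V \<union> (?E - V)"] conjI)
      show "V \<union> (?E - V) \<in> lmeasurable" using Ve(1) neg by (intro fmeasurable.Un) (auto intro: negligible_imp_measurable simp: negligible_iff_null_sets)
      show "measure lebesgue (V \<union> (?E - V)) \<le> e" using Ve neg by (subst measure_Un_null_set) auto
    qed auto
  qed
  then have "negligible (\<Union>n. {x \<in> S. L + inverse (real (Suc n)) \<le> f x})" by (intro negligible_countable_Union) auto
  moreover have "{x \<in> S. L < f x} \<subseteq> (\<Union>n. {x \<in> S. L + inverse (real (Suc n)) \<le> f x})"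
  proof safe
    fix x assume "x \<in> S" "L < f x"
    then obtain n where "inverse (real (Suc n)) < f x - L" using reals_Archimedean[of "f x - L"] by auto
    then show "x \<in> (\<Union>n. {x \<in> S. L + inverse (real (Suc n)) \<le> f x})" using \<open>x \<in> S\<close> by (auto intro!: exI[of _ n])
  qed
  ultimately show ?thesis by (rule negligible_subset)
qed

section \<open>Exit radii and the good-lambda inequality\<close>

lemma ennreal_pint_restrict:
  assumes "Lp 2 g" "S \<in> sets borel"
  shows "ennreal (pint 2 (restr S g)) = (NN y. indicator S y * ennreal ((norm (g y))\<^sup>2))"
proof -
  have "Lp 2 (restr S g)" by (rule Lp_restrict(1)[OF assms]) auto
  from ennreal_pint[OF this, symmetric] show ?thesis by (auto intro!: nn_integral_cong simp: indicator_def)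
qed

text \<open>The global counterpart of \<open>excess\<close>; weighted sums over geometric levels
  recover the q-th power integral.\<close>

definition level :: "('a::euclidean_space \<Rightarrow> 'a) \<Rightarrow> real \<Rightarrow> real" where
  "level g \<mu> = pint 2 (\<lambda>y. indicator {y. \<mu> < norm (g y)} y *\<^sub>R g y)"

text \<open>Exit time argument: for \<open>y\<close> with \<open>|g y| > L\<close> take the largest dyadic radius for which the average of
  \<open>|g|\<^sup>2 + |h|\<^sup>2\<close> exceeds \<open>L\<^sup>2\<close>, and cover by the Vitali lemma.\<close>

lemma good_lambda:
  fixes g h :: "'a::euclidean_space \<Rightarrow> 'a"
  defines "V \<equiv> \<lambda>r. unit_ball_vol (real DIM('a)) * r ^ DIM('a)"
  assumes g: "Lp 2 g" and h: "Lp 2 h" and \<rho>: "0 < \<rho>" and l: "0 < L" and A: "1 \<le> A" and \<theta>: "0 \<le> \<theta>"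
    and total: "pint 2 g + pint 2 h \<le> L\<^sup>2 * V \<rho>"
    and "local": "\<And>y s. 0 < s \<Longrightarrow> s < \<rho> \<Longrightarrow>
      (\<And>i::nat. 1 \<le> i \<Longrightarrow> pint 2 (restr (ball y (2 ^ i * s)) g) + pint 2 (restr (ball y (2 ^ i * s)) h) \<le> L\<^sup>2 * V (2 ^ i * s)) \<Longrightarrow>
      excess g y (5 * s) (2 * A * L) \<le> \<theta> * (L\<^sup>2 * V s)"
  shows "level g (2 * A * L) \<le> 2 * \<theta> * (level g (L / 2) + level h (L / 2))"
proof -
  have [measurable]: "g \<in> borel_measurable borel" "h \<in> borel_measurable borel" using g h by (auto dest: Lp_borel)
  note excess_sets[OF \<open>g \<in> borel_measurable borel\<close>, measurable]
  define \<Phi> where "\<Phi> y = (norm (g y))\<^sup>2 + (norm (h y))\<^sup>2" for y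
  have \<Phi>m[measurable]: "\<Phi> \<in> borel_measurable borel" unfolding \<Phi>_def by measurable
  have \<Phi>0: "0 \<le> \<Phi> y" for y by (simp add: \<Phi>_def)
  have i\<Phi>: "integrable lborel \<Phi>" using Lp_integrable[OF g] Lp_integrable[OF h] by (simp add: \<Phi>_def[abs_def])
  have Vpos: "0 < V r" if "0 < r" for r using that by (simp add: V_def)
  have eV: "emeasure lborel (ball y r) = ennreal (V r)" if "0 \<le> r" for y :: 'a and r
    using that by (simp add: V_def emeasure_ball)
  define P where "P S = pint 2 (restr S g) + pint 2 (restr S h)" for S
  have eP: "ennreal (P S) = (NN y. indicator S y * ennreal (\<Phi> y))" if [measurable]: "S \<in> sets borel" for S
  proof -
    have "ennreal (P S) = (NN y. indicator S y * ennreal ((norm (g y))\<^sup>2)) + (NN y. indicator S y * ennreal ((norm (h y))\<^sup>2))"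
      unfolding P_def by (simp add: ennreal_pint_restrict g h that)
    also have "\<dots> = (NN y. indicator S y * ennreal ((norm (g y))\<^sup>2) + indicator S y * ennreal ((norm (h y))\<^sup>2))"
      by (rule nn_integral_add[symmetric]) auto
    also have "\<dots> = (NN y. indicator S y * ennreal (\<Phi> y))" by (intro nn_integral_cong) (auto simp: \<Phi>_def indicator_def)
    finally show ?thesis .
  qed
  have Ptot: "P S \<le> L\<^sup>2 * V \<rho>" if "S \<in> sets borel" for S
    unfolding P_def using Lp_restrict(2)[OF g that] Lp_restrict(2)[OF h that] total by simp
  \<comment> \<open>With dyadic radii the largest bad radius becomes the least bad index. Radii
    above \<open>\<rho>\<close> cause no trouble, because the total energy already fits into the
    bound at \<open>\<rho>\<close>.\<close>
  define \<rho>' where "\<rho>' j = \<rho> / 2 ^ j" for j :: nat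
  have \<rho>'p: "0 < \<rho>' j" for j using \<rho> by (simp add: \<rho>'_def)
  define bad where "bad y j \<longleftrightarrow> L\<^sup>2 * V (\<rho>' j) < P (ball y (\<rho>' j))" for y j
  define S where "S = {y. \<exists>j. bad y j}"
  define s where "s y = \<rho>' (LEAST j. bad y j)" for y
  have sprop: "0 < s y" "s y < \<rho>" "L\<^sup>2 * V (s y) < P (ball y (s y))"
    "\<And>i::nat. 1 \<le> i \<Longrightarrow> P (ball y (2 ^ i * s y)) \<le> L\<^sup>2 * V (2 ^ i * s y)" if y: "y \<in> S" for y
  proof -
    obtain j0 where "bad y j0" using y by (auto simp: S_def)
    define j where "j = (LEAST j. bad y j)"
    have bj: "bad y j" unfolding j_def using \<open>bad y j0\<close> by (rule LeastI)
    have sj: "s y = \<rho>' j" by (simp add: s_def j_def)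
    \<comment> \<open>The hypothesis \<open>total\<close> excludes the radius \<open>\<rho>\<close>
      itself, so the exit radius is strictly smaller.\<close>
    have "\<not> bad y 0" using Ptot[of "ball y \<rho>"] by (simp add: bad_def \<rho>'_def not_less)
    then have "j \<noteq> 0" using bj by metis
    then have "(1::real) < 2 ^ j" by (intro one_less_power) auto
    then show "0 < s y" "s y < \<rho>" using \<rho> by (auto simp: sj \<rho>'_def divide_less_eq)
    show "L\<^sup>2 * V (s y) < P (ball y (s y))" using bj by (simp add: sj bad_def)
    fix i :: nat assume i: "1 \<le> i"
    show "P (ball y (2 ^ i * s y)) \<le> L\<^sup>2 * V (2 ^ i * s y)"
    proof (cases "i \<le> j")
      case True
      have "\<not> bad y (j - i)" using not_less_Least[of "j - i" "bad y"] i \<open>j \<noteq> 0\<close> by (simp add: j_def)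
      moreover have "2 ^ i * s y = \<rho>' (j - i)" using True by (simp add: sj \<rho>'_def power_diff)
      ultimately show ?thesis by (simp add: bad_def)
    next
      case False
      then have "(2::real) ^ j \<le> 2 ^ i" by (intro power_increasing) auto
      then have "\<rho> \<le> 2 ^ i * s y" using \<rho> by (simp add: sj \<rho>'_def field_simps)
      then have "V \<rho> \<le> V (2 ^ i * s y)" using \<rho> by (auto simp: V_def intro!: mult_left_mono power_mono)
      then have "L\<^sup>2 * V \<rho> \<le> L\<^sup>2 * V (2 ^ i * s y)" by (intro mult_left_mono) auto
      then show ?thesis using Ptot[of "ball y (2 ^ i * s y)"] by simp
    qed
  qed
  \<comment> \<open>At points outside \<open>S\<close> all dyadic averages are at most
    \<open>L\<^sup>2\<close>, so almost all of these points satisfy the same bound for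
    \<open>\<Phi>\<close> itself.\<close>
  have neg: "negligible {x \<in> - S. L\<^sup>2 < \<Phi> x}"
  proof (rule density_bound_negligible[OF i\<Phi> \<Phi>0])
    fix x d assume x: "x \<in> - S" and d: "(0::real) < d"
    obtain j where j: "(1 / 2) ^ j < d / \<rho>" using real_arch_pow_inv[of "d / \<rho>" "1/2"] d \<rho> by auto
    have "\<rho>' j < d" using j \<rho> by (simp add: \<rho>'_def field_simps power_divide)
    moreover have "(NN y. indicator (ball x (\<rho>' j)) y * ennreal (\<Phi> y)) \<le> ennreal (L\<^sup>2) * emeasure lborel (ball x (\<rho>' j))"
    proof -
      have "P (ball x (\<rho>' j)) \<le> L\<^sup>2 * V (\<rho>' j)" using x by (auto simp: S_def bad_def not_less)
      then have "ennreal (P (ball x (\<rho>' j))) \<le> ennreal (L\<^sup>2 * V (\<rho>' j))" by (rule ennreal_leI)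
      then show ?thesis using \<rho>'p[of j] Vpos[of "\<rho>' j"] by (simp add: eP eV ennreal_mult)
    qed
    ultimately show "\<exists>r. 0 < r \<and> r < d \<and> (NN y. indicator (ball x r) y * ennreal (\<Phi> y)) \<le> ennreal (L\<^sup>2) * emeasure lborel (ball x r)"
      using \<rho>'p[of j] by blast
  qed auto
  \<comment> \<open>The disjoint balls will carry mass of \<open>Q\<close>, and their fivefold
    enlargements the excess of \<open>g\<close>. This is why the hypothesis \<open>local\<close>
    speaks of the radius \<open>5 * s\<close>.\<close>
  obtain C where C: "countable C" "C \<subseteq> S"
    "pairwise (\<lambda>i j. disjnt (cball i (s i)) (cball j (s j))) C"
    "S \<subseteq> (\<Union>i\<in>C. cball i (5 * s i))"
  proof (rule Vitali_covering_lemma_cballs[where S=S and K=S and a="\<lambda>y. y" and r=s and B=\<rho>])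
    show "S \<subseteq> (\<Union>i\<in>S. cball i (s i))" using sprop(1) by (meson UN_I centre_in_cball less_imp_le subsetI)
    show "0 < s i \<and> s i \<le> \<rho>" if "i \<in> S" for i using sprop(1,2)[OF that] by simp
  qed (use that in blast)
  let ?T = "{y. 2 * A * L < norm (g y)}"
  let ?e = "\<lambda>i y. indicator {z \<in> cball i (5 * s i). 2 * A * L < norm (g z)} y * ennreal ((norm (g y))\<^sup>2)"
  have Tm[measurable]: "?T \<in> sets borel" by measurable
  have TS: "AE y in lborel. y \<in> ?T \<longrightarrow> y \<in> S"
  proof -
    have "AE y in lebesgue. y \<notin> {x \<in> - S. L\<^sup>2 < \<Phi> x}"
      using neg by (intro AE_not_in) (simp add: negligible_iff_null_sets)
    then have "AE y in lborel. y \<notin> {x \<in> - S. L\<^sup>2 < \<Phi> x}" by (simp only: AE_completion_iff)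
    then show ?thesis
    proof eventually_elim
      fix y assume y: "y \<notin> {x \<in> - S. L\<^sup>2 < \<Phi> x}"
      show "y \<in> ?T \<longrightarrow> y \<in> S"
      proof
        assume "y \<in> ?T"
        moreover have "1 * L \<le> 2 * A * L" using A l by (intro mult_right_mono) auto
        ultimately have "L < norm (g y)" by simp
        then have "L\<^sup>2 < (norm (g y))\<^sup>2" using l by (intro power_strict_mono) auto
        then have "L\<^sup>2 < \<Phi> y" unfolding \<Phi>_def using zero_le_power2[of "norm (h y)"] by linarith
        then show "y \<in> S" using y by auto
      qed
    qed
  qed
  \<comment> \<open>Keeps only values above \<open>L / 2\<close>. The discarded parts of
    \<open>g\<close> and \<open>h\<close> contribute at most \<open>L\<^sup>2 / 4\<close> each,
    together half of the average that an exit ball exceeds, so \<open>Q\<close> retains a mass of at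
    least \<open>L\<^sup>2 * V (s y) / 2\<close> on each exit ball.\<close>
  define Q where "Q = (\<lambda>y. indicator {y. L / 2 < norm (g y)} y * ennreal ((norm (g y))\<^sup>2) + indicator {y. L / 2 < norm (h y)} y * ennreal ((norm (h y))\<^sup>2))"
  have [measurable]: "Q \<in> borel_measurable borel" unfolding Q_def by measurable
  define M where "M = density lborel Q"
  have lev: "ennreal (level w \<mu>) = (NN y. indicator {y. \<mu> < norm (w y)} y * ennreal ((norm (w y))\<^sup>2))" if w: "Lp 2 w" for w :: "'a \<Rightarrow> 'a" and \<mu>
    unfolding level_def by (rule ennreal_pint_restrict[OF w]) (use Lp_borel[OF w] in measurable)
  have tot: "emeasure M UNIV = ennreal (level g (L / 2) + level h (L / 2))"
  proof -
    have "emeasure M UNIV = (NN y. Q y)" unfolding M_def by (subst emeasure_density) auto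
    also have "\<dots> = ennreal (level g (L / 2)) + ennreal (level h (L / 2))"
      unfolding Q_def lev[OF g] lev[OF h] by (rule nn_integral_add) measurable
    finally show ?thesis by (simp add: level_def)
  qed
  have ballM: "ennreal (L\<^sup>2 * V (s y)) \<le> 2 * emeasure M (cball y (s y))" if y: "y \<in> C" for y
  proof -
    have yS: "y \<in> S" using y C by auto
    let ?B = "ball y (s y)"
    have [measurable]: "?B \<in> sets borel" by simp
    let ?q = "emeasure M ?B"
    have "ennreal (L\<^sup>2 * V (s y)) \<le> ennreal (P ?B)" using sprop(3)[OF yS] by (intro ennreal_leI) simp
    also have "\<dots> = (NN z. indicator ?B z * ennreal (\<Phi> z))" by (rule eP) auto
    also have "\<dots> \<le> (NN z. indicator ?B z * Q z + ennreal (L\<^sup>2 / 2) * indicator ?B z)"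
    proof (rule nn_integral_mono)
      fix z
      have sq: "(norm (w z))\<^sup>2 \<le> L\<^sup>2 / 4" if "\<not> L / 2 < norm (w z)" for w :: "'a \<Rightarrow> 'a"
      proof -
        have "(norm (w z))\<^sup>2 \<le> (L / 2)\<^sup>2" using that by (intro power_mono) auto
        then show ?thesis by (simp add: power_divide)
      qed
      have "ennreal (\<Phi> z) \<le> Q z + ennreal (L\<^sup>2 / 2)"
      proof -
        have "ennreal (\<Phi> z) = ennreal ((norm (g z))\<^sup>2) + ennreal ((norm (h z))\<^sup>2)" by (simp add: \<Phi>_def)
        also have "\<dots> \<le> (indicator {y. L / 2 < norm (g y)} z * ennreal ((norm (g z))\<^sup>2) + ennreal (L\<^sup>2 / 4)) + (indicator {y. L / 2 < norm (h y)} z * ennreal ((norm (h z))\<^sup>2) + ennreal (L\<^sup>2 / 4))"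
          using sq[of g] sq[of h] by (intro add_mono) (auto simp: indicator_def intro: ennreal_leI)
        also have "\<dots> = Q z + (ennreal (L\<^sup>2 / 4) + ennreal (L\<^sup>2 / 4))" by (simp add: Q_def add_ac)
        also have "ennreal (L\<^sup>2 / 4) + ennreal (L\<^sup>2 / 4) = ennreal (L\<^sup>2 / 2)"
          using ennreal_plus[of "L\<^sup>2 / 4" "L\<^sup>2 / 4"] by simp
        finally show ?thesis .
      qed
      then show "indicator ?B z * ennreal (\<Phi> z) \<le> indicator ?B z * Q z + ennreal (L\<^sup>2 / 2) * indicator ?B z"
        by (auto simp: indicator_def)
    qed
    also have "\<dots> = ?q + ennreal (L\<^sup>2 / 2) * ennreal (V (s y))"
    proof -
      have "?q = (NN z. indicator ?B z * Q z)" unfolding M_def by (subst emeasure_density) (auto simp: mult.commute)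
      moreover have "(NN z. ennreal (L\<^sup>2 / 2) * indicator ?B z) = ennreal (L\<^sup>2 / 2) * ennreal (V (s y))"
        using sprop(1)[OF yS] by (subst nn_integral_cmult) (auto simp: eV)
      ultimately show ?thesis by (subst nn_integral_add) auto
    qed
    also have "ennreal (L\<^sup>2 / 2) * ennreal (V (s y)) = ennreal (L\<^sup>2 * V (s y) / 2)"
      using Vpos[OF sprop(1)[OF yS]] by (simp flip: ennreal_mult)
    finally have *: "ennreal (L\<^sup>2 * V (s y)) \<le> ?q + ennreal (L\<^sup>2 * V (s y) / 2)" .
    have qfin: "?q \<noteq> \<infinity>"
    proof -
      have "?q \<le> emeasure M UNIV" by (intro emeasure_mono) (auto simp: M_def)
      then show ?thesis unfolding tot by (auto simp: top_unique)
    qed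
    then obtain q where q: "?q = ennreal q" "0 \<le> q" by (cases ?q) auto
    have vp: "0 \<le> L\<^sup>2 * V (s y)" using Vpos[OF sprop(1)[OF yS]] by simp
    have "ennreal (L\<^sup>2 * V (s y)) \<le> ennreal (q + L\<^sup>2 * V (s y) / 2)" using * q vp by simp
    then have "L\<^sup>2 * V (s y) \<le> q + L\<^sup>2 * V (s y) / 2" using q vp by (subst (asm) ennreal_le_iff) auto
    then have "ennreal (L\<^sup>2 * V (s y)) \<le> ennreal (2 * q)" by (intro ennreal_leI) simp
    also have "\<dots> = 2 * ?q" using q by (simp add: ennreal_mult)
    also have "\<dots> \<le> 2 * emeasure M (cball y (s y))" by (intro mult_left_mono emeasure_mono) (auto simp: M_def)
    finally show ?thesis .
  qed
  have "ennreal (level g (2 * A * L)) = (NN y. indicator ?T y * ennreal ((norm (g y))\<^sup>2))" by (rule lev[OF g])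
  also have "\<dots> \<le> (NN y. (\<integral>\<^sup>+i. ?e i y \<partial>count_space C))"
  proof (rule nn_integral_mono_AE)
    show "AE y in lborel. indicator ?T y * ennreal ((norm (g y))\<^sup>2)
      \<le> (\<integral>\<^sup>+i. ?e i y \<partial>count_space C)" using TS
    proof eventually_elim
      fix y assume y: "y \<in> ?T \<longrightarrow> y \<in> S"
      show "indicator ?T y * ennreal ((norm (g y))\<^sup>2)
        \<le> (\<integral>\<^sup>+i. ?e i y \<partial>count_space C)"
      proof (cases "y \<in> ?T")
        case True
        then obtain i where i: "i \<in> C" "y \<in> cball i (5 * s i)" using y C(4) by blast
        have "indicator ?T y * ennreal ((norm (g y))\<^sup>2) = ?e i y" using True i by simp
        also have "\<dots> \<le> (\<integral>\<^sup>+i. ?e i y \<partial>count_space C)" by (rule nn_integral_ge_point) (rule i(1))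
        finally show ?thesis .
      qed simp
    qed
  qed
  also have "\<dots> = (\<integral>\<^sup>+i. (NN y. ?e i y) \<partial>count_space C)"
    by (rule nn_integral_count_space_nn_integral[OF C(1)]) measurable
  also have "\<dots> \<le> (\<integral>\<^sup>+i. ennreal (2 * \<theta>) * emeasure M (cball i (s i)) \<partial>count_space C)"
  proof (rule nn_integral_mono)
    fix i assume "i \<in> space (count_space C)"
    then have i: "i \<in> C" "i \<in> S" using C(2) by auto
    have "(NN y. ?e i y) = ennreal (excess g i (5 * s i) (2 * A * L))"
      unfolding excess_def by (rule ennreal_pint_restrict[OF g, symmetric]) measurable
    also have "\<dots> \<le> ennreal (\<theta> * (L\<^sup>2 * V (s i)))"
      using "local"[OF sprop(1,2)[OF i(2)]] sprop(4)[OF i(2)] by (intro ennreal_leI) (auto simp: P_def)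
    also have "\<dots> = ennreal \<theta> * ennreal (L\<^sup>2 * V (s i))" using \<theta> by (simp add: ennreal_mult')
    also have "\<dots> \<le> ennreal \<theta> * (2 * emeasure M (cball i (s i)))" by (intro mult_left_mono ballM i) auto
    also have "\<dots> = ennreal (2 * \<theta>) * emeasure M (cball i (s i))" using \<theta> by (simp add: ennreal_mult mult_ac)
    finally show "(NN y. ?e i y) \<le> ennreal (2 * \<theta>) * emeasure M (cball i (s i))" .
  qed
  also have "\<dots> = ennreal (2 * \<theta>) * (\<integral>\<^sup>+i. emeasure M (cball i (s i)) \<partial>count_space C)" by (rule nn_integral_cmult) auto
  also have "(\<integral>\<^sup>+i. emeasure M (cball i (s i)) \<partial>count_space C) = emeasure M (\<Union>i\<in>C. cball i (s i))"
    using C(3) by (intro emeasure_UN_countable[OF _ C(1), symmetric])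
      (auto simp: M_def disjoint_family_on_def pairwise_def disjnt_def)
  also have "ennreal (2 * \<theta>) * \<dots> \<le> ennreal (2 * \<theta>) * emeasure M UNIV"
    by (intro mult_left_mono emeasure_mono) (auto simp: M_def)
  also have "\<dots> = ennreal (2 * \<theta> * (level g (L / 2) + level h (L / 2)))"
    unfolding tot using \<theta> by (simp add: ennreal_mult' level_def)
  finally show ?thesis using \<theta> by (subst (asm) ennreal_le_iff) (auto simp: level_def)
qed

lemma pint_restrict_mono:
  assumes "Lp p g" "S \<in> sets borel" "S' \<in> sets borel" "S \<subseteq> S'" "0 < p"
  shows "pint p (restr S g) \<le> pint p (restr S' g)"
proof -
  have "pint p (restr S g) \<le> 1 powr p * pint p (restr S' g)"
  proof (rule Lp_bound(2)[OF Lp_restrict(1)[OF assms(1,3,5)]])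
    show "(restr S g) \<in> borel_measurable borel" using Lp_borel[OF Lp_restrict(1)[OF assms(1,2,5)]] .
  qed (use assms in \<open>auto simp: indicator_def\<close>)
  then show ?thesis by simp
qed

lemma level_sets:
  assumes [measurable]: "g \<in> borel_measurable borel"
  shows "{y. \<mu> < norm (g y)} \<in> sets borel"
  by measurable

lemma level_le: "Lp 2 g \<Longrightarrow> level g \<mu> \<le> pint 2 g" for g :: "'a::euclidean_space \<Rightarrow> 'a"
  unfolding level_def by (intro Lp_restrict(2) level_sets Lp_borel) auto

lemma level_integral:
  assumes "Lp 2 g"
  shows "level g \<mu> = (LBINT y. (if \<mu> < norm (g y) then 1 else 0) * (norm (g y))\<^sup>2)"
    "integrable lborel (\<lambda>y. (if \<mu> < norm (g y) then 1 else 0) * (norm (g y))\<^sup>2)"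
proof -
  let ?l = "\<lambda>y. (if \<mu> < norm (g y) then 1 else 0) * (norm (g y))\<^sup>2"
  have eq: "norm (indicator {y. \<mu> < norm (g y)} y *\<^sub>R g y) powr 2 = ?l y" for y by auto
  show "level g \<mu> = (LBINT y. ?l y)" unfolding level_def pint_def eq ..
  have "Lp 2 (\<lambda>y. indicator {y. \<mu> < norm (g y)} y *\<^sub>R g y)"
    by (intro Lp_restrict(1) assms level_sets Lp_borel[OF assms]) auto
  from Lp_integrable[OF this] show "integrable lborel (\<lambda>y. ?l y)" unfolding eq .
qed

text \<open>Fatou's lemma. Bounds at arbitrarily large heights suffice because the truncated
  integrals grow with the height, so callers can use heights of their own.\<close>

lemma Lp_of_truncations:
  assumes [measurable]: "u \<in> borel_measurable borel" and X: "0 \<le> X"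
    and part: "\<And>N::nat. \<exists>M\<ge>real N. (NN y. indicator {y. norm (u y) \<le> M} y * ennreal (norm (u y) powr q)) \<le> ennreal X"
  shows "Lp q u" "pint q u \<le> X"
proof -
  let ?t = "\<lambda>N y. indicator {y. norm (u y) \<le> real N} y * ennreal (norm (u y) powr q)"
  have bd: "(NN y. ?t N y) \<le> ennreal X" for N
  proof -
    obtain M where M: "real N \<le> M" "(NN y. indicator {y. norm (u y) \<le> M} y * ennreal (norm (u y) powr q)) \<le> ennreal X"
      using part by blast
    have "(NN y. ?t N y) \<le> (NN y. indicator {y. norm (u y) \<le> M} y * ennreal (norm (u y) powr q))"
      using M(1) by (intro nn_integral_mono) (auto simp: indicator_def)
    then show ?thesis using M(2) by (rule order_trans)
  qed
  have "(NN y. ennreal (norm (u y) powr q)) \<le> (NN y. liminf (\<lambda>N. ?t N y))"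
  proof (rule nn_integral_mono)
    fix y
    obtain N0 where N0: "norm (u y) \<le> real N0" using real_arch_simple[of "norm (u y)"] by blast
    have "\<forall>\<^sub>F N in sequentially. ennreal (norm (u y) powr q) \<le> ?t N y"
      by (rule eventually_sequentiallyI[of N0]) (use N0 in auto)
    then show "ennreal (norm (u y) powr q) \<le> liminf (\<lambda>N. ?t N y)" by (rule Liminf_bounded)
  qed
  also have "\<dots> \<le> liminf (\<lambda>N. NN y. ?t N y)" by (rule nn_integral_liminf) measurable
  also have "\<dots> \<le> liminf (\<lambda>N::nat. ennreal X)" by (intro Liminf_mono always_eventually allI bd)
  also have "\<dots> = ennreal X" by (simp add: Liminf_const)
  finally show "Lp q u" "pint q u \<le> X" using X by (auto intro: Lp_nn_bound)
qed

text \<open>A discrete layer cake formula: with weights \<open>t k\<close>, the energies at the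
  levels \<open>a ^ k * \<mu>0\<close> add up to an integral comparable with the q-th powers above
  \<open>\<mu>0\<close>. The assumption \<open>small\<close> makes \<open>step\<close> a contraction
  by 1/2 in spite of the growth of the weights by \<open>\<beta>\<close>. Only finite sums are
  absorbed, so the finiteness of the q-th power integral is a conclusion.\<close>

lemma level_summation:
  fixes g h :: "'a::euclidean_space \<Rightarrow> 'a"
  assumes q: "2 < q" and g: "Lp 2 g" and h: "Lp 2 h" "Lp q h" and a: "1 < a" and \<mu>0: "0 < \<mu>0" and \<theta>: "0 \<le> \<theta>"
    and step: "\<And>\<mu>. \<mu>0 \<le> \<mu> \<Longrightarrow> level g (a * \<mu>) \<le> \<theta> * (level g \<mu> + level h \<mu>)"
    and small: "\<theta> * a powr (q - 2) \<le> 1 / 2"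
  defines "\<beta> \<equiv> a powr (q - 2)"
  shows "Lp q g" "pint q g \<le> (1 + 2 * \<beta>) * \<mu>0 powr (q - 2) * pint 2 g + \<beta> * (\<beta> / (\<beta> - 1)) * pint q h"
proof -
  let ?pw = "\<mu>0 powr (q - 2)"
  have [measurable]: "g \<in> borel_measurable borel" "h \<in> borel_measurable borel" using g h by (auto dest: Lp_borel)
  have \<beta>: "1 < \<beta>" unfolding \<beta>_def using a q by (simp add: less_powr_iff)
  define t where "t k = (a ^ k * \<mu>0) powr (q - 2)" for k
  have tS: "t (Suc k) = \<beta> * t k" for k using a \<mu>0 unfolding t_def \<beta>_def power_Suc mult.assoc by (rule_tac powr_mult)
  have t0: "0 < t k" for k using a \<mu>0 by (simp add: t_def)
  \<comment> \<open>The total weight of the first \<open>N\<close> levels below the value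
    \<open>y\<close>. \<open>wle\<close> and \<open>low\<close> compare it with
    \<open>y powr (q - 2)\<close> from both sides: the geometric sum costs \<open>D\<close>, one
    missing level costs \<open>\<beta>\<close>.\<close>
  define w where "w N y = (\<Sum>k<N. t k * (if a ^ k * \<mu>0 < y then 1 else 0))" for N y
  have w0: "0 \<le> w N y" for N y unfolding w_def using t0 by (intro sum_nonneg) (auto simp: less_imp_le)
  have wS: "w (Suc N) y = w N y + t N * (if a ^ N * \<mu>0 < y then 1 else 0)" for N y by (simp add: w_def)
  define D where "D = \<beta> / (\<beta> - 1)"
  have D: "0 < D" using \<beta> by (simp add: D_def)
  have wt: "w N y \<le> t N / (\<beta> - 1)" for N y
  proof (induction N)
    case 0
    then show ?case using t0[of 0] \<beta> by (simp add: w_def)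
  next
    case (Suc N)
    have "w (Suc N) y \<le> t N / (\<beta> - 1) + t N" using Suc t0[of N] by (auto simp: wS)
    also have "\<dots> = t (Suc N) / (\<beta> - 1)" using \<beta> by (simp add: tS field_simps)
    finally show ?case .
  qed
  have wle: "w N y \<le> D * y powr (q - 2)" if y: "0 \<le> y" for N y
  proof (induction N)
    case 0
    then show ?case using D by (simp add: w_def)
  next
    case (Suc N)
    show ?case
    proof (cases "a ^ N * \<mu>0 < y")
      case True
      have "w (Suc N) y \<le> t N / (\<beta> - 1) + t N" using wt[of N y] True by (simp add: wS)
      also have "\<dots> = D * t N" using \<beta> by (simp add: D_def field_simps)
      also have "\<dots> \<le> D * y powr (q - 2)" unfolding t_def using D True a \<mu>0 q by (intro mult_left_mono powr_mono2) auto
      finally show ?thesis .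
    qed (use Suc in \<open>simp add: wS\<close>)
  qed
  have low: "y powr (q - 2) \<le> ?pw + \<beta> * w N y" if "0 \<le> y" "y \<le> a ^ N * \<mu>0" for N y using that
  proof (induction N)
    case 0
    then show ?case using q by (simp add: w_def powr_mono2)
  next
    case (Suc N)
    show ?case
    proof (cases "y \<le> a ^ N * \<mu>0")
      case True
      then have "y powr (q - 2) \<le> ?pw + \<beta> * w N y" using Suc by simp
      also have "\<dots> = ?pw + \<beta> * w (Suc N) y" using True by (simp add: wS)
      finally show ?thesis .
    next
      case False
      have "y powr (q - 2) \<le> t (Suc N)" unfolding t_def using Suc.prems q by (intro powr_mono2) auto
      also have "\<dots> = \<beta> * (t N * (if a ^ N * \<mu>0 < y then 1 else 0))" using False by (simp add: tS)
      also have "\<dots> \<le> ?pw + \<beta> * w (Suc N) y" unfolding wS using w0[of N y] \<beta> by (simp add: distrib_left)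
      finally show ?thesis .
    qed
  qed
  have lsum: "(\<Sum>k<N. t k * level u (a ^ k * \<mu>0)) = (LBINT y. w N (norm (u y)) * (norm (u y))\<^sup>2)"
    "integrable lborel (\<lambda>y. w N (norm (u y)) * (norm (u y))\<^sup>2)" if u: "Lp 2 u" for N and u :: "'a \<Rightarrow> 'a"
  proof -
    have eq: "w N (norm (u y)) * (norm (u y))\<^sup>2 = (\<Sum>k<N. t k * ((if a ^ k * \<mu>0 < norm (u y) then 1 else 0) * (norm (u y))\<^sup>2))" for y
      by (simp add: w_def sum_distrib_right mult.assoc)
    show "(\<Sum>k<N. t k * level u (a ^ k * \<mu>0)) = (LBINT y. w N (norm (u y)) * (norm (u y))\<^sup>2)"
      unfolding eq level_integral(1)[OF u]
      by (subst Bochner_Integration.integral_sum) (auto intro!: integrable_mult_right level_integral(2)[OF u])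
    show "integrable lborel (\<lambda>y. w N (norm (u y)) * (norm (u y))\<^sup>2)"
      unfolding eq by (intro Bochner_Integration.integrable_sum integrable_mult_right level_integral(2)[OF u])
  qed
  define b where "b k = t k * level g (a ^ k * \<mu>0)" for k
  define c where "c k = t k * level h (a ^ k * \<mu>0)" for k
  have bn: "0 \<le> b k" and cn: "0 \<le> c k" for k using t0[of k] by (auto simp: b_def c_def level_def)
  have bS: "b (Suc k) \<le> (b k + c k) / 2" for k
  proof -
    have "\<mu>0 \<le> a ^ k * \<mu>0" using a \<mu>0 by (simp add: one_le_power)
    then have "level g (a ^ Suc k * \<mu>0) \<le> \<theta> * (level g (a ^ k * \<mu>0) + level h (a ^ k * \<mu>0))"
      using step[of "a ^ k * \<mu>0"] by (simp add: mult.assoc)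
    then have "b (Suc k) \<le> \<beta> * t k * (\<theta> * (level g (a ^ k * \<mu>0) + level h (a ^ k * \<mu>0)))"
      unfolding b_def tS using t0[of k] \<beta> by (intro mult_left_mono) auto
    also have "\<dots> = (\<theta> * \<beta>) * (b k + c k)" by (simp add: b_def c_def algebra_simps)
    also have "\<dots> \<le> (1 / 2) * (b k + c k)" using small bn[of k] cn[of k] by (intro mult_right_mono) (auto simp: \<beta>_def)
    finally show ?thesis by simp
  qed
  have sb: "(\<Sum>k<N. b k) \<le> 2 * b 0 + (\<Sum>k<N. c k)" for N
  proof -
    have "(\<Sum>k<N. b k) + b N \<le> 2 * b 0 + (\<Sum>k<N. c k)"
    proof -
      \<comment> \<open>The additional \<open>2 * b N\<close> makes the induction close, since
        \<open>bS\<close> bounds \<open>b N + 2 * b (Suc N)\<close> by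
        \<open>2 * b N + c N\<close>.\<close>
      have "(\<Sum>k<N. b k) + 2 * b N \<le> 2 * b 0 + (\<Sum>k<N. c k)"
      proof (induction N)
        case (Suc N)
        then show ?case using bS[of N] bn[of N] by simp
      qed simp
      then show ?thesis using bn[of N] by simp
    qed
    then show ?thesis using bn[of N] by simp
  qed
  have sc: "(\<Sum>k<N. c k) \<le> D * pint q h" for N
  proof -
    have "(\<Sum>k<N. c k) = (LBINT y. w N (norm (h y)) * (norm (h y))\<^sup>2)" unfolding c_def by (rule lsum(1)[OF h(1)])
    also have "\<dots> \<le> (LBINT y. D * norm (h y) powr q)"
    proof (rule integral_mono)
      show "integrable lborel (\<lambda>y. w N (norm (h y)) * (norm (h y))\<^sup>2)" by (rule lsum(2)[OF h(1)])
      show "integrable lborel (\<lambda>y. D * norm (h y) powr q)" using Lp_integrable[OF h(2)] by simp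
      fix y
      have "w N (norm (h y)) * (norm (h y))\<^sup>2 \<le> D * norm (h y) powr (q - 2) * (norm (h y))\<^sup>2"
        by (intro mult_right_mono wle) auto
      also have "D * norm (h y) powr (q - 2) * (norm (h y))\<^sup>2 = D * norm (h y) powr q"
        by (cases "h y = 0") (auto simp: powr_diff)
      finally show "w N (norm (h y)) * (norm (h y))\<^sup>2 \<le> D * norm (h y) powr q" .
    qed
    also have "\<dots> = D * pint q h" by (simp add: pint_def)
    finally show ?thesis .
  qed
  define X where "X = ?pw * pint 2 g + \<beta> * (2 * b 0 + D * pint q h)"
  have X0: "0 \<le> X" using bn[of 0] \<beta> D by (simp add: X_def)
  have part: "(NN y. indicator {y. norm (g y) \<le> a ^ N * \<mu>0} y * ennreal (norm (g y) powr q)) \<le> ennreal X" for N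
  proof -
    let ?m = "\<lambda>y. ?pw * (norm (g y))\<^sup>2 + \<beta> * (w N (norm (g y)) * (norm (g y))\<^sup>2)"
    have i2: "integrable lborel (\<lambda>y. (norm (g y))\<^sup>2)" using Lp_integrable[OF g] by simp
    have i: "integrable lborel (\<lambda>y. ?m y)" using i2 lsum(2)[OF g] by simp
    have "(NN y. indicator {y. norm (g y) \<le> a ^ N * \<mu>0} y * ennreal (norm (g y) powr q))
      \<le> (NN y. ennreal (?m y))"
    proof (rule nn_integral_mono)
      fix y
      show "indicator {y. norm (g y) \<le> a ^ N * \<mu>0} y * ennreal (norm (g y) powr q) \<le> ennreal (?m y)"
      proof (cases "norm (g y) \<le> a ^ N * \<mu>0")
        case True
        have "norm (g y) powr q = norm (g y) powr (q - 2) * (norm (g y))\<^sup>2"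
          by (cases "g y = 0") (auto simp: powr_diff)
        also have "\<dots> \<le> (?pw + \<beta> * w N (norm (g y))) * (norm (g y))\<^sup>2"
          using low[OF _ True] by (intro mult_right_mono) auto
        finally show ?thesis using True by (simp add: algebra_simps ennreal_leI)
      qed simp
    qed
    also have "\<dots> = ennreal (LBINT y. ?m y)" using w0 \<beta> by (intro nn_integral_eq_integral[OF i]) auto
    also have "(LBINT y. ?m y) = ?pw * pint 2 g + \<beta> * (\<Sum>k<N. b k)"
      unfolding b_def lsum(1)[OF g] using i2 lsum(2)[OF g] by (simp add: pint_def)
    also have "ennreal \<dots> \<le> ennreal X"
      unfolding X_def using sb[of N] sc[of N] \<beta> by (intro ennreal_leI add_left_mono mult_left_mono) auto
    finally show ?thesis .
  qed
  have fin: "\<exists>M\<ge>real n. (NN y. indicator {y. norm (g y) \<le> M} y * ennreal (norm (g y) powr q)) \<le> ennreal X" for n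
  proof -
    obtain N where "real n / \<mu>0 < a ^ N" using real_arch_pow[OF a] by blast
    then show ?thesis using \<mu>0 part[of N] by (intro exI[of _ "a ^ N * \<mu>0"]) (simp add: field_simps less_imp_le)
  qed
  show "Lp q g" by (rule Lp_of_truncations(1)[OF _ X0 fin]) measurable
  have "b 0 \<le> ?pw * pint 2 g" unfolding b_def t_def using level_le[OF g] by (simp add: mult_left_mono)
  then have "X \<le> ?pw * pint 2 g + \<beta> * (2 * (?pw * pint 2 g) + D * pint q h)"
    unfolding X_def using \<beta> by (intro add_left_mono mult_left_mono add_right_mono) auto
  also have "\<dots> = (1 + 2 * \<beta>) * ?pw * pint 2 g + \<beta> * (\<beta> / (\<beta> - 1)) * pint q h" by (simp add: D_def algebra_simps)
  finally show "pint q g \<le> (1 + 2 * \<beta>) * ?pw * pint 2 g + \<beta> * (\<beta> / (\<beta> - 1)) * pint q h"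
    using Lp_of_truncations(2)[OF _ X0 fin] by simp
qed

text \<open>At a point where the sum exceeds \<open>2 * \<mu>\<close>, either \<open>w\<close>
  dominates, and then \<open>norm (w y) > \<mu>\<close>, or \<open>z\<close> does. In each case the
  sum is at most twice the dominating term, and the square gives 4.\<close>

lemma excess_sum_le:
  assumes w: "Lp 2 w" and z: "Lp 2 z"
  shows "excess (\<lambda>y. w y + z y) x r (2 * \<mu>) \<le> 4 * excess w x r \<mu> + 4 * pint 2 z"
proof -
  have [measurable]: "w \<in> borel_measurable borel" "z \<in> borel_measurable borel" using w z by (auto dest: Lp_borel)
  let ?g = "\<lambda>y. w y + z y"
  let ?E = "{y \<in> cball x r. 2 * \<mu> < norm (?g y)}" and ?W = "{y \<in> cball x r. \<mu> < norm (w y)}"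
  have g: "Lp 2 ?g" by (intro Lp_add w z) auto
  have E: "?E \<in> sets borel" "?W \<in> sets borel" by (auto intro!: excess_sets)
  have LE: "Lp 2 (restr ?E ?g)" "Lp 2 (restr ?W w)" by (intro Lp_restrict g w E; simp)+
  have "excess ?g x r (2 * \<mu>) \<le> (LBINT y. 4 * norm (indicator ?W y *\<^sub>R w y) powr 2 + 4 * norm (z y) powr 2)"
    unfolding excess_def pint_def
  proof (rule integral_mono[OF Lp_integrable[OF LE(1)]])
    show "integrable lborel (\<lambda>y. 4 * norm (indicator ?W y *\<^sub>R w y) powr 2 + 4 * norm (z y) powr 2)"
      using Lp_integrable[OF LE(2)] Lp_integrable[OF z] by (intro Bochner_Integration.integrable_add integrable_mult_right)
    fix y
    show "norm (indicator ?E y *\<^sub>R ?g y) powr 2 \<le> 4 * norm (indicator ?W y *\<^sub>R w y) powr 2 + 4 * norm (z y) powr 2"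
    proof (cases "y \<in> ?E")
      case True
      have tri: "norm (w y + z y) \<le> norm (w y) + norm (z y)" by (rule norm_triangle_ineq)
      show ?thesis
      proof (cases "norm (z y) \<le> norm (w y)")
        case c: True
        then have "y \<in> ?W" using True tri by auto
        moreover have "(norm (w y + z y))\<^sup>2 \<le> (2 * norm (w y))\<^sup>2" using c tri by (intro power_mono) auto
        ultimately show ?thesis using True by (simp add: power_mult_distrib add_increasing2)
      next
        case False
        then have "(norm (w y + z y))\<^sup>2 \<le> (2 * norm (z y))\<^sup>2" using tri by (intro power_mono) auto
        then show ?thesis using True by (simp add: power_mult_distrib add_increasing)
      qed
    qed simp
  qed
  also have "\<dots> = 4 * excess w x r \<mu> + 4 * pint 2 z"
    unfolding excess_def pint_def using Lp_integrable[OF LE(2)] Lp_integrable[OF z]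
    by (subst Bochner_Integration.integral_add) (auto simp del: powr_numeral)
  finally show ?thesis .
qed

text \<open>Supplies the harmonicity hypothesis of \<open>excess_decay\<close> for the part of a
  solution whose data have been cut away.\<close>

lemma L2_solution_cong_0:
  assumes "L2_solution \<Omega> f g" "\<And>x. x \<in> U \<Longrightarrow> f x = 0" "Lp 2 f"
    "test_function (\<Omega> \<inter> U) \<psi>"
  shows "(LBINT y. g y \<bullet> gradient \<psi> y) = 0"
proof -
  have "(LBINT y. (g y + f y) \<bullet> gradient \<psi> y) = 0"
    using assms(1) test_function_mono[OF assms(4), of \<Omega>] by (auto simp: L2_solution_def)
  moreover have "(LBINT y. (g y + f y) \<bullet> gradient \<psi> y) = (LBINT y. g y \<bullet> gradient \<psi> y)"
  proof (rule Bochner_Integration.integral_cong[OF refl])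
    fix y show "(g y + f y) \<bullet> gradient \<psi> y = g y \<bullet> gradient \<psi> y"
      using assms(2)[of y] gradient_test_0[OF assms(4), of y] by (cases "y \<in> U") auto
  qed
  ultimately show ?thesis by simp
qed

text \<open>On a ball, \<open>g = w + z\<close>, where \<open>z\<close> solves the problem with data cut off to the ball (and is controlled
  by the energy estimate), while \<open>w\<close> is harmonic there and has the decay shown above.\<close>

lemma local_estimate:
  assumes \<kappa>: "0 < \<kappa>" "\<kappa> < 1" and q: "2 < q" "q < 3" and dim: "DIM('a::euclidean_space) = 3"
  shows "\<exists>C>0. \<forall>\<Omega> r0 (f :: 'a \<Rightarrow> 'a) g. uniform_cone \<Omega> r0 \<kappa> \<longrightarrow> bounded \<Omega> \<longrightarrow> open \<Omega> \<longrightarrow>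
     L2_solution \<Omega> f g \<longrightarrow> Lp 2 f \<longrightarrow> Lp q f \<longrightarrow>
     Lp q g \<and> pint q g \<le> C * ((pint 2 f / r0 ^ 3) powr ((q - 2) / 2) * pint 2 f + pint q f)"
proof -
  \<comment> \<open>Enough iterations of the decay to bring its exponent \<open>\<sigma>\<close>
    above \<open>q - 2\<close>, which is below 1 because \<open>q < 3\<close>.\<close>
  obtain k where k: "(1 / 3 :: real) ^ k < 3 - q" using real_arch_pow_inv[of "3 - q" "1/3"] q by auto
  define \<sigma> where "\<sigma> = 1 - (1 / 3 :: real) ^ k"
  have \<sigma>: "q - 2 < \<sigma>" using k by (simp add: \<sigma>_def)
  define \<epsilon> where "\<epsilon> = \<sigma> - (q - 2)"
  have \<epsilon>: "0 < \<epsilon>" using \<sigma> by (simp add: \<epsilon>_def)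
  obtain C1 where C1: "C1 > 0" and dec: "\<And>\<Omega> r0 (g :: 'a \<Rightarrow> 'a) x r a L. uniform_cone \<Omega> r0 \<kappa> \<Longrightarrow> grad_closure 2 \<Omega> g \<Longrightarrow>
     (\<forall>\<psi>. test_function (\<Omega> \<inter> ball x (4 * 2 ^ k * r)) \<psi> \<longrightarrow> (LBINT y. g y \<bullet> gradient \<psi> y) = 0) \<Longrightarrow>
     0 < r \<Longrightarrow> 4 * 2 ^ k * r \<le> r0 \<Longrightarrow> 0 < a \<Longrightarrow> 0 < L \<Longrightarrow>
     pint 2 (restr (cball x (4 * 2 ^ k * r)) g) \<le> a\<^sup>2 * r ^ 3 \<Longrightarrow>
     excess g x r L \<le> C1 * a\<^sup>2 * r ^ 3 * (a / L) powr \<sigma>" using excess_decay[OF \<kappa> dim, of k] unfolding \<sigma>_def by blast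
  define u where "u = unit_ball_vol (real DIM('a))"
  have u: "u > 0" by (simp add: u_def)
  \<comment> \<open>Volume ratio of the balls of radius \<open>2 ^ (k + 5) * s\<close> and
    \<open>s\<close>. The decay needs the radius \<open>20 * 2 ^ k * s\<close>, and 32 is the next
    power of 2.\<close>
  define N where "N = (8::real) ^ (k + 5)"
  have N: "N > 0" by (simp add: N_def)
  \<comment> \<open>With \<open>a = c1 * L\<close> the energy bound required by the decay becomes
    \<open>a\<^sup>2 * (5 * s) ^ 3 = 4 * (L\<^sup>2 * (N * V s))\<close>, the bound obtained for the
    harmonic part.\<close>
  define c1 where "c1 = sqrt (4 * N * u / 125)"
  have c1: "c1 > 0" "c1\<^sup>2 = 4 * N * u / 125" using N u by (auto simp: c1_def)
  \<comment> \<open>The level ratio \<open>A\<close> is taken so large that the decay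
    \<open>A powr (- \<sigma>)\<close> beats the weight \<open>A powr (q - 2)\<close> of
    \<open>level_summation\<close>. Only then is the weight \<open>K\<close> of the data chosen,
    large in terms of \<open>A\<close>.\<close>
  define X where "X = 128 * C1 * N * c1 powr \<sigma> * 4 powr (q - 2)"
  have X: "X > 0" using C1 N c1 by (simp add: X_def)
  define A where "A = max 1 (X powr (1 / \<epsilon>))"
  have A: "1 \<le> A" by (simp add: A_def)
  have A\<epsilon>: "X * A powr (- \<epsilon>) \<le> 1"
  proof -
    have "X = (X powr (1 / \<epsilon>)) powr \<epsilon>" using X \<epsilon> by (simp add: powr_powr)
    also have "\<dots> \<le> A powr \<epsilon>" using X \<epsilon> by (intro powr_mono2) (auto simp: A_def)
    finally show ?thesis using A by (simp add: powr_minus divide_simps)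
  qed
  define K where "K = sqrt (max 1 (32 * N * (4 * A) powr (q - 2)))"
  have K: "1 \<le> K" "32 * N * (4 * A) powr (q - 2) \<le> K\<^sup>2" by (auto simp: K_def)
  define \<theta> where "\<theta> = 16 * C1 * N * c1 powr \<sigma> * A powr (- \<sigma>) + 4 * N / K\<^sup>2"
  have \<theta>: "0 \<le> \<theta>" using C1 N by (simp add: \<theta>_def)
  define \<beta> where "\<beta> = (4 * A) powr (q - 2)"
  have \<beta>0: "\<beta> > 0" using A by (simp add: \<beta>_def)
  have \<beta>: "1 < \<beta>" unfolding \<beta>_def using A q by (simp add: less_powr_iff)
  have small: "2 * \<theta> * (4 * A) powr (q - 2) \<le> 1 / 2"
  proof -
    have "\<beta> = 4 powr (q - 2) * A powr (q - 2)" using A by (simp add: \<beta>_def powr_mult)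
    then have "32 * C1 * N * c1 powr \<sigma> * A powr (- \<sigma>) * \<beta> = X / 4 * (A powr (- \<sigma>) * A powr (q - 2))"
      by (simp add: X_def)
    also have "A powr (- \<sigma>) * A powr (q - 2) = A powr (- \<epsilon>)" by (simp add: \<epsilon>_def flip: powr_add)
    finally have 1: "32 * C1 * N * c1 powr \<sigma> * A powr (- \<sigma>) * \<beta> \<le> 1 / 4" using A\<epsilon> by simp
    have 2: "8 * N / K\<^sup>2 * \<beta> \<le> 1 / 4" using K by (simp add: \<beta>_def divide_simps)
    have "2 * \<theta> * \<beta> = 32 * C1 * N * c1 powr \<sigma> * A powr (- \<sigma>) * \<beta> + 8 * N / K\<^sup>2 * \<beta>" by (simp add: \<theta>_def algebra_simps)
    then show ?thesis using 1 2 by (simp add: \<beta>_def)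
  qed
  \<comment> \<open>Keeps \<open>4 * 2 ^ k * (5 * s)\<close>, the largest radius used, below
    \<open>r0\<close> for all \<open>s < d * r0\<close>.\<close>
  define d where "d = 1 / (20 * (2::real) ^ k)"
  have d: "d > 0" by (simp add: d_def)
  \<comment> \<open>Fixes the starting level: for \<open>P > 0\<close> it makes
    \<open>(2 * \<mu>0)\<^sup>2 * V \<rho>\<close> equal to \<open>(1 + K\<^sup>2) * P\<close>, the
    bound for the total energy of \<open>g\<close> and \<open>h\<close>.\<close>
  define c2 where "c2 = sqrt ((1 + K\<^sup>2) / (u * d ^ 3)) / 2"
  have c2: "c2 > 0" using u d K by (auto simp: c2_def add_pos_nonneg)
  define C where "C = (1 + 2 * \<beta>) * c2 powr (q - 2) + \<beta> * (\<beta> / (\<beta> - 1)) * K powr q"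
  have C: "C > 0" using \<beta> c2 by (simp add: C_def add_pos_nonneg)
  have main: "Lp q g \<and> pint q g \<le> C * ((pint 2 f / r0 ^ 3) powr ((q - 2) / 2) * pint 2 f + pint q f)"
    if uc: "uniform_cone \<Omega> r0 \<kappa>" and \<Omega>: "bounded \<Omega>" "open \<Omega>" and sol: "L2_solution \<Omega> f g" and f: "Lp 2 f" "Lp q f"
    for \<Omega> r0 and f g :: "'a \<Rightarrow> 'a"
  proof -
    have r0: "r0 > 0" using uc by (simp add: uniform_cone_def)
    define P where "P = pint 2 f"
    have P0: "0 \<le> P" by (simp add: P_def)
    define h where "h y = K *\<^sub>R f y" for y
    have h: "Lp 2 h" "Lp q h" unfolding h_def using f q by (auto intro: Lp_scaleR)
    have ph: "pint q h = K powr q * pint q f" "pint 2 h = K\<^sup>2 * P"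
      unfolding h_def[abs_def] pint_scaleR P_def using K by auto
    have gc: "grad_closure 2 \<Omega> g" using sol by (simp add: L2_solution_def)
    have g: "Lp 2 g" by (rule grad_closure_Lp[OF gc])
    have pg: "pint 2 g \<le> P" unfolding P_def by (rule L2_solution_bound[OF sol f(1)])
    define \<rho> where "\<rho> = d * r0"
    have \<rho>: "\<rho> > 0" using d r0 by (simp add: \<rho>_def)
    define V where "V r = unit_ball_vol (real DIM('a)) * r ^ DIM('a)" for r
    have V3: "V r = u * r ^ 3" for r using dim by (simp add: V_def u_def)
    \<comment> \<open>The levels must be positive also if \<open>P = 0\<close>. Then
      \<open>pint 2 g = 0\<close>, and the value 1 disappears from the final bound.\<close>
    define \<mu>0 where "\<mu>0 = (if P = 0 then 1 else c2 * (P / r0 ^ 3) powr (1 / 2))"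
    have \<mu>0: "\<mu>0 > 0" using c2 P0 r0 by (auto simp: \<mu>0_def)
    have \<mu>0sq: "(1 + K\<^sup>2) * P \<le> (2 * \<mu>0)\<^sup>2 * V \<rho>"
    proof (cases "P = 0")
      case False
      have "(2 * \<mu>0)\<^sup>2 = 4 * c2\<^sup>2 * ((P / r0 ^ 3) powr (1 / 2))\<^sup>2"
        using False by (simp add: \<mu>0_def power_mult_distrib)
      also have "((P / r0 ^ 3) powr (1 / 2))\<^sup>2 = P / r0 ^ 3" using P0 r0 by (simp add: powr_half_sqrt)
      also have "4 * c2\<^sup>2 = (1 + K\<^sup>2) / (u * d ^ 3)"
      proof -
        have "0 \<le> (1 + K\<^sup>2) / (u * d ^ 3)" using u d by simp
        then have 1: "(sqrt ((1 + K\<^sup>2) / (u * d ^ 3)))\<^sup>2 = (1 + K\<^sup>2) / (u * d ^ 3)" by (rule real_sqrt_pow2)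
        have "4 * (Y / 2\<^sup>2) = Y" for Y :: real by simp
        then show ?thesis unfolding c2_def power_divide 1 .
      qed
      finally have "(2 * \<mu>0)\<^sup>2 * V \<rho> = (1 + K\<^sup>2) / (u * d ^ 3) * (P / r0 ^ 3) * (u * (d * r0) ^ 3)"
        by (simp add: V3 \<rho>_def)
      also have "\<dots> = (1 + K\<^sup>2) * P" using u d r0 by (simp add: power_mult_distrib)
      finally show ?thesis by simp
    next
      case True
      then show ?thesis using \<rho> u by (simp add: V3)
    qed
    have step: "level g ((4 * A) * \<mu>) \<le> 2 * \<theta> * (level g \<mu> + level h \<mu>)" if \<mu>: "\<mu>0 \<le> \<mu>" for \<mu>
    proof -
      \<comment> \<open>\<open>good_lambda\<close> passes from the level \<open>L / 2\<close> to
        \<open>2 * A * L\<close>, a ratio of \<open>4 * A\<close>.\<close>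
      define L where "L = 2 * \<mu>"
      have l: "L > 0" using \<mu> \<mu>0 by (simp add: L_def)
      have "level g (2 * A * L) \<le> 2 * \<theta> * (level g (L / 2) + level h (L / 2))"
      proof (rule good_lambda[OF g h(1) \<rho> l A \<theta>, folded V_def])
        have "pint 2 g + pint 2 h \<le> (1 + K\<^sup>2) * P" using pg by (simp add: ph distrib_right)
        also note \<mu>0sq
        also have "(2 * \<mu>0)\<^sup>2 * V \<rho> \<le> L\<^sup>2 * V \<rho>"
          unfolding L_def using \<mu> \<mu>0 \<rho> u by (intro mult_right_mono power_mono) (auto simp: V3)
        finally show "pint 2 g + pint 2 h \<le> L\<^sup>2 * V \<rho>" .
        fix y s assume s: "0 < s" "s < \<rho>"
          and avg: "\<And>i::nat. 1 \<le> i \<Longrightarrow> pint 2 (restr (ball y (2 ^ i * s)) g) + pint 2 (restr (ball y (2 ^ i * s)) h) \<le> L\<^sup>2 * V (2 ^ i * s)"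
        define R where "R = 4 * 2 ^ k * (5 * s)"
        have Rr0: "R \<le> r0"
        proof -
          have "R \<le> 4 * 2 ^ k * (5 * \<rho>)" unfolding R_def using s by (intro mult_left_mono) auto
          also have "\<dots> = r0" by (simp add: \<rho>_def d_def)
          finally show ?thesis .
        qed
        let ?B = "cball y R" and ?B' = "ball y (2 ^ (k + 5) * s)"
        have "R < 2 ^ (k + 5) * s" using s by (simp add: R_def power_add)
        then have sub: "?B \<subseteq> ?B'" by auto
        have Vs: "V s > 0" using s u by (simp add: V3)
        have VN: "V (2 ^ (k + 5) * s) = N * V s"
        proof -
          have "((2::real) ^ (k + 5)) ^ 3 = (2 ^ 3) ^ (k + 5)" by (simp only: power_mult[symmetric] mult.commute)
          then show ?thesis by (simp add: V3 N_def power_mult_distrib)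
        qed
        have av: "pint 2 (restr ?B' g) + pint 2 (restr ?B' h) \<le> L\<^sup>2 * (N * V s)"
          using avg[of "k + 5"] by (simp add: VN)
        define f1 where "f1 z = indicator ?B z *\<^sub>R f z" for z
        have f1: "Lp 2 f1" unfolding f1_def by (intro Lp_restrict f) auto
        have gf: "pint 2 (restr ?B g) + K\<^sup>2 * pint 2 f1 \<le> L\<^sup>2 * (N * V s)"
        proof -
          have "(restr ?B h) = (\<lambda>z. K *\<^sub>R f1 z)" by (auto simp: h_def f1_def)
          then have "K\<^sup>2 * pint 2 f1 = pint 2 (restr ?B h)" using K by (simp add: pint_scaleR)
          moreover have "pint 2 (restr ?B h) \<le> pint 2 (restr ?B' h)"
            by (rule pint_restrict_mono[OF h(1) _ _ sub]) auto
          moreover have "pint 2 (restr ?B g) \<le> pint 2 (restr ?B' g)" by (rule pint_restrict_mono[OF g _ _ sub]) auto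
          ultimately show ?thesis using av by linarith
        qed
        have fB: "K\<^sup>2 * pint 2 f1 \<le> L\<^sup>2 * (N * V s)"
          using gf pint_nonneg[of 2 "\<lambda>z. indicator ?B z *\<^sub>R g z"] by linarith
        have f1B: "pint 2 f1 \<le> L\<^sup>2 * (N * V s) / K\<^sup>2" using fB K by (simp add: field_simps)
        have f1B': "pint 2 f1 \<le> K\<^sup>2 * pint 2 f1" using mult_right_mono[of 1 "K\<^sup>2" "pint 2 f1"] K by simp
        obtain z where z: "L2_solution \<Omega> f1 z" using L2_solution_exists[OF f1 \<Omega>(1)] \<Omega>(2) by auto
        have zL: "Lp 2 z" using z grad_closure_Lp unfolding L2_solution_def by blast
        have zb: "pint 2 z \<le> pint 2 f1" by (rule L2_solution_bound[OF z f1])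
        define w where "w x = g x - z x" for x
        have w: "L2_solution \<Omega> (\<lambda>x. f x - f1 x) w" unfolding w_def by (rule L2_solution_diff[OF sol z f(1) f1])
        have wgc: "grad_closure 2 \<Omega> w" using w by (simp add: L2_solution_def)
        have wL: "Lp 2 w" by (rule grad_closure_Lp[OF wgc])
        have harm: "\<forall>\<psi>. test_function (\<Omega> \<inter> ball y (4 * 2 ^ k * (5 * s))) \<psi> \<longrightarrow> (LBINT y. w y \<bullet> gradient \<psi> y) = 0"
        proof (intro allI impI)
          fix \<psi> assume "test_function (\<Omega> \<inter> ball y (4 * 2 ^ k * (5 * s))) \<psi>"
          then show "(LBINT y. w y \<bullet> gradient \<psi> y) = 0" by (rule L2_solution_cong_0[OF w, rotated 2])
              (auto simp: f1_def R_def[symmetric] intro!: Lp_diff f f1[unfolded f1_def])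
        qed
        define a where "a = c1 * L"
        have a: "a > 0" using c1 l by (simp add: a_def)
        have aV: "a\<^sup>2 * (5 * s) ^ 3 = 4 * (L\<^sup>2 * (N * V s))" using c1(2) by (simp add: a_def power_mult_distrib V3)
        have wB: "pint 2 (restr (cball y (4 * 2 ^ k * (5 * s))) w) \<le> a\<^sup>2 * (5 * s) ^ 3"
        proof -
          have "pint 2 (\<lambda>x. indicator ?B x *\<^sub>R g x - indicator ?B x *\<^sub>R z x)
              \<le> 2 powr 2 * (pint 2 (restr ?B g) + pint 2 (restr ?B z))" by (intro Lp_diff Lp_restrict g zL) auto
          moreover have "(\<lambda>x. indicator ?B x *\<^sub>R g x - indicator ?B x *\<^sub>R z x) = (restr ?B w)"
            by (auto simp: w_def scaleR_diff_right)
          moreover have "pint 2 (restr ?B z) \<le> pint 2 z" by (rule Lp_restrict(2)[OF zL]) auto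
          ultimately have "pint 2 (restr ?B w) \<le> 4 * (L\<^sup>2 * (N * V s))" using gf f1B' zb by simp
          then show ?thesis unfolding aV by (simp only: R_def)
        qed
        have ex: "excess w y (5 * s) (A * L) \<le> C1 * a\<^sup>2 * (5 * s) ^ 3 * (a / (A * L)) powr \<sigma>"
          by (rule dec[OF uc wgc harm _ _ a _ wB]) (use s Rr0 A l in \<open>auto simp: R_def\<close>)
        have "excess g y (5 * s) (2 * A * L) = excess (\<lambda>y. w y + z y) y (5 * s) (2 * (A * L))"
          by (simp add: w_def mult.assoc)
        also have "\<dots> \<le> 4 * excess w y (5 * s) (A * L) + 4 * pint 2 z" by (rule excess_sum_le[OF wL zL])
        also have "\<dots> \<le> 4 * (C1 * a\<^sup>2 * (5 * s) ^ 3 * (a / (A * L)) powr \<sigma>) + 4 * (L\<^sup>2 * (N * V s) / K\<^sup>2)"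
          using ex zb f1B by linarith
        also have "\<dots> = \<theta> * (L\<^sup>2 * V s)"
        proof -
          have "a / (A * L) = c1 * (1 / A)" using l A by (simp add: a_def)
          then have "(a / (A * L)) powr \<sigma> = c1 powr \<sigma> * A powr (- \<sigma>)"
            using c1 A by (simp only: powr_mult) (simp add: powr_divide powr_minus_divide)
          then have "4 * (C1 * a\<^sup>2 * (5 * s) ^ 3 * (a / (A * L)) powr \<sigma>) = 4 * C1 * (a\<^sup>2 * (5 * s) ^ 3) * (c1 powr \<sigma> * A powr (- \<sigma>))"
            by (simp only: mult.assoc)
          also have "\<dots> = 16 * C1 * N * c1 powr \<sigma> * A powr (- \<sigma>) * (L\<^sup>2 * V s)" unfolding aV by (simp add: mult_ac)
          finally show ?thesis by (simp add: \<theta>_def algebra_simps)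
        qed
        finally show "excess g y (5 * s) (2 * A * L) \<le> \<theta> * (L\<^sup>2 * V s)" .
      qed
      then show ?thesis by (simp add: L_def mult_ac)
    qed
    have A4: "1 < 4 * A" using A by simp
    have L: "Lp q g" and bd: "pint q g \<le> (1 + 2 * \<beta>) * \<mu>0 powr (q - 2) * pint 2 g + \<beta> * (\<beta> / (\<beta> - 1)) * pint q h"
      using level_summation[OF q(1) g h A4 \<mu>0 _ step small] \<theta> unfolding \<beta>_def by simp_all
    have "\<mu>0 powr (q - 2) * pint 2 g \<le> c2 powr (q - 2) * ((P / r0 ^ 3) powr ((q - 2) / 2) * P)"
    proof (cases "P = 0")
      case True
      then show ?thesis using pg pint_nonneg[of 2 g] by simp
    next
      case False
      have "\<mu>0 powr (q - 2) = c2 powr (q - 2) * (P / r0 ^ 3) powr ((q - 2) / 2)"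
        using False c2 P0 r0 by (simp add: \<mu>0_def powr_mult powr_powr)
      then show ?thesis using pg by (simp add: mult.assoc mult_left_mono)
    qed
    then have "(1 + 2 * \<beta>) * (\<mu>0 powr (q - 2) * pint 2 g) \<le> (1 + 2 * \<beta>) * (c2 powr (q - 2) * ((P / r0 ^ 3) powr ((q - 2) / 2) * P))"
      using \<beta> by (intro mult_left_mono) auto
    with bd have "pint q g \<le> (1 + 2 * \<beta>) * c2 powr (q - 2) * ((P / r0 ^ 3) powr ((q - 2) / 2) * P) + \<beta> * (\<beta> / (\<beta> - 1)) * K powr q * pint q f"
      by (simp add: ph mult.assoc)
    also have "\<dots> \<le> C * ((P / r0 ^ 3) powr ((q - 2) / 2) * P) + C * pint q f"
      using \<beta> P0 by (intro add_mono mult_right_mono) (auto simp: C_def)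
    finally show ?thesis using L by (simp add: P_def distrib_left)
  qed
  show ?thesis by (rule exI[of _ C]) (use C main in blast)
qed

section \<open>Approximation by test functions in higher norms\<close>

lemma pint_le_of_pointwise:
  assumes "f \<in> borel_measurable borel" "integrable lborel B" "\<And>x. norm (f x) powr p \<le> B x"
  shows "Lp p f" "pint p f \<le> (LBINT x. B x)"
proof -
  have i: "integrable lborel (\<lambda>x. norm (f x) powr p)" by (rule Bochner_Integration.integrable_bound[OF assms(2)])
      (use assms in \<open>auto intro: order_trans[OF _ abs_ge_self]\<close>)
  then show "Lp p f" using assms(1) by (simp add: Lp_def)
  show "pint p f \<le> (LBINT x. B x)" unfolding pint_def by (rule integral_mono[OF i assms(2,3)])
qed

lemma pint_tail:
  fixes f :: "'a::euclidean_space \<Rightarrow> 'b::euclidean_space"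
  assumes f: "Lp p f" and p: "0 < p" and e: "0 < e"
  shows "\<exists>M>0. (LBINT x. (if M < norm (f x) then norm (f x) powr p else 0)) < e"
proof -
  have [measurable]: "f \<in> borel_measurable borel" using f by (rule Lp_borel)
  have "(\<lambda>n. LBINT x. (if real n < norm (f x) then norm (f x) powr p else 0)) \<longlonglongrightarrow> (LINT (x::'a)|lborel. (0::real))"
  proof (rule integral_dominated_convergence[OF _ _ Lp_integrable[OF f]])
    show "AE x in lborel. (\<lambda>n. if real n < norm (f x) then norm (f x) powr p else 0) \<longlonglongrightarrow> 0"
    proof (rule AE_I2)
      fix x
      obtain N where N: "norm (f x) \<le> real N" using real_arch_simple[of "norm (f x)"] by blast
      show "(\<lambda>n. if real n < norm (f x) then norm (f x) powr p else 0) \<longlonglongrightarrow> 0"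
        by (rule tendsto_eventually, rule eventually_sequentiallyI[of N]) (use N in auto)
    qed
  qed auto
  from order_tendstoD(2)[OF this, of e] e
  obtain N where N: "(LBINT x. (if real n < norm (f x) then norm (f x) powr p else 0)) < e" if "n \<ge> N" for n
    by (auto simp: eventually_sequentially)
  show ?thesis using N[of "Suc N"] by (intro exI[of _ "real (Suc N)"]) auto
qed

section \<open>Continuity of translations\<close>

definition translation_continuous :: "real \<Rightarrow> ('a::euclidean_space \<Rightarrow> 'b::euclidean_space) \<Rightarrow> bool" where
  "translation_continuous p F \<longleftrightarrow> (\<forall>e>0. \<exists>\<delta>>0. \<forall>h. norm h < \<delta> \<longrightarrow> pint p (\<lambda>y. F (y - h) - F y) < e)"

lemma translation_continuous_compact_support:
  fixes G :: "'a::euclidean_space \<Rightarrow> 'b::euclidean_space"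
  assumes G: "continuous_on UNIV G" and K: "compact K" "\<And>x. x \<notin> K \<Longrightarrow> G x = 0"
  shows "translation_continuous 2 G"
  unfolding translation_continuous_def
proof (intro allI impI)
  fix e :: real assume e: "0 < e"
  obtain R where "\<forall>x\<in>K. norm x \<le> R" using compact_imp_bounded[OF K(1)] unfolding bounded_iff by blast
  then have R: "norm x \<le> R" if "x \<in> K" for x using that by blast
  let ?B = "cball (0::'a) (R + 1)"
  define m where "m = measure lborel ?B + 1"
  have m: "0 < m" by (simp add: m_def add_nonneg_pos)
  define \<eta> where "\<eta> = sqrt (e / (2 * m))"
  have \<eta>: "\<eta> > 0" "\<eta>\<^sup>2 = e / (2 * m)" using e m by (auto simp: \<eta>_def)
  have uc: "uniformly_continuous_on (cball 0 (R + 2)) G"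
    by (rule compact_uniformly_continuous) (auto intro: continuous_on_subset[OF G])
  obtain d where d: "d > 0" "\<And>x y. x \<in> cball 0 (R + 2) \<Longrightarrow> y \<in> cball 0 (R + 2) \<Longrightarrow> dist y x < d \<Longrightarrow> dist (G y) (G x) < \<eta>"
    using uc \<eta>(1) unfolding uniformly_continuous_on_def by metis
  have "pint 2 (\<lambda>y. G (y - h) - G y) < e" if h: "norm h < min 1 d" for h
  proof -
    have [measurable]: "G \<in> borel_measurable borel" by (rule borel_measurable_continuous_onI[OF G])
    have iB: "integrable lborel (\<lambda>y. indicator ?B y * \<eta>\<^sup>2)"
      using emeasure_lborel_cball_finite[of "0::'a" "R + 1"] by (intro integrable_mult_left integrable_real_indicator) auto
    have "pint 2 (\<lambda>y. G (y - h) - G y) \<le> (LBINT y. indicator ?B y * \<eta>\<^sup>2)"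
    proof (rule pint_le_of_pointwise(2)[OF _ iB])
      fix y
      show "norm (G (y - h) - G y) powr 2 \<le> indicator ?B y * \<eta>\<^sup>2"
      proof (cases "y \<in> ?B")
        case True
        have "norm (y - h) \<le> norm y + norm h" by (rule norm_triangle_ineq4)
        then have "norm (y - h) \<le> R + 2" using True h by simp
        then have "dist (G (y - h)) (G y) < \<eta>" using True h by (intro d) (auto simp: dist_norm norm_minus_commute)
        then have "(norm (G (y - h) - G y))\<^sup>2 \<le> \<eta>\<^sup>2" by (intro power_mono) (auto simp: dist_norm)
        then show ?thesis using True by simp
      next
        case False
        have "norm y \<le> norm (y - h) + norm h" using norm_triangle_ineq[of "y - h" h] by simp
        then have "y \<notin> K" "y - h \<notin> K" using False h R[of y] R[of "y - h"] by auto
        then show ?thesis using K(2) by simp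
      qed
    qed measurable
    also have "\<dots> = measure lborel ?B * \<eta>\<^sup>2" by (subst integral_mult_left_zero) simp
    also have "\<dots> \<le> m * \<eta>\<^sup>2" by (intro mult_right_mono) (auto simp: m_def)
    also have "\<dots> < e" using e m by (simp add: \<eta>)
    finally show ?thesis .
  qed
  then show "\<exists>\<delta>>0. \<forall>h. norm h < \<delta> \<longrightarrow> pint 2 (\<lambda>y. G (y - h) - G y) < e" using d(1) by (intro exI[of _ "min 1 d"]) auto
qed

lemma translation_continuous_limit:
  assumes F: "Lp 2 F" and ex: "\<And>e. 0 < e \<Longrightarrow> \<exists>G. Lp 2 G \<and> translation_continuous 2 G \<and> pdist 2 G F < e"
  shows "translation_continuous 2 F"
  unfolding translation_continuous_def
proof (intro allI impI)
  fix e :: real assume e: "0 < e"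
  \<comment> \<open>The two applications of the triangle inequality with factor 4 cost
    \<open>4 * (1 + 8) = 36\<close> times this quantity.\<close>
  then have e40: "0 < e / 40" by simp
  obtain G where G: "Lp 2 G" "translation_continuous 2 G" "pdist 2 G F < e / 40" using ex[OF e40] by blast
  obtain \<delta> where \<delta>: "\<delta> > 0" "\<And>h. norm h < \<delta> \<Longrightarrow> pint 2 (\<lambda>y. G (y - h) - G y) < e / 40"
    using G(2) e40 unfolding translation_continuous_def by blast
  have "pint 2 (\<lambda>y. F (y - h) - F y) < e" if h: "norm h < \<delta>" for h
  proof -
    let ?E = "\<lambda>y. G y - F y"
    have LE: "Lp 2 ?E" by (intro Lp_diff G F) auto
    have LD: "Lp 2 (\<lambda>y. G (y - h) - G y)" by (intro Lp_diff Lp_shift G) auto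
    have LES: "Lp 2 (\<lambda>y. ?E (y - h))" by (rule Lp_shift(1)[OF LE])
    have "pint 2 (\<lambda>y. ?E (y - h)) = pint 2 ?E" by (rule Lp_shift(2)[OF LE])
    moreover have "pint 2 (\<lambda>y. ?E y - ?E (y - h)) \<le> 2 powr 2 * (pint 2 ?E + pint 2 (\<lambda>y. ?E (y - h)))"
      by (rule Lp_diff(2)[OF LE LES]) simp
    moreover have "pint 2 (\<lambda>y. (G (y - h) - G y) + (?E y - ?E (y - h))) \<le> 2 powr 2 * (pint 2 (\<lambda>y. G (y - h) - G y) + pint 2 (\<lambda>y. ?E y - ?E (y - h)))"
      by (rule Lp_add(2)[OF LD Lp_diff(1)[OF LE LES]]) auto
    moreover have "(\<lambda>y. (G (y - h) - G y) + (?E y - ?E (y - h))) = (\<lambda>y. F (y - h) - F y)" by auto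
    ultimately have "pint 2 (\<lambda>y. F (y - h) - F y) \<le> 4 * (pint 2 (\<lambda>y. G (y - h) - G y) + 8 * pint 2 ?E)" by simp
    also have "\<dots> < 4 * (e / 40 + 8 * (e / 40))" using \<delta>(2)[OF h] G(3) by simp
    also have "\<dots> \<le> e" using e by simp
    finally show ?thesis .
  qed
  then show "\<exists>\<delta>>0. \<forall>h. norm h < \<delta> \<longrightarrow> pint 2 (\<lambda>y. F (y - h) - F y) < e" using \<delta>(1) by blast
qed

text \<open>Where the difference is at most \<open>M\<close>, its \<open>q\<close>-th power is bounded by \<open>M powr (q - 2)\<close> times its square;
  elsewhere \<open>F\<close> or its translate exceeds \<open>M / 2\<close>.\<close>

lemma translation_continuous_higher:
  assumes F: "Lp 2 F" "Lp q F" and q: "2 \<le> q" and tc: "translation_continuous 2 F"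
  shows "translation_continuous q F"
  unfolding translation_continuous_def
proof (intro allI impI)
  fix e :: real assume e: "0 < e"
  define d where "d = e / (4 * 2 powr q)"
  have d: "d > 0" using e by (simp add: d_def)
  have q0: "q > 0" using q by simp
  have [measurable]: "F \<in> borel_measurable borel" using F by (auto dest: Lp_borel)
  obtain M where M: "M > 0" "(LBINT x. (if M < norm (F x) then norm (F x) powr q else 0)) < d"
    using pint_tail[OF F(2) q0 d] by blast
  define \<tau> where "\<tau> = e / (2 * (2 * M) powr (q - 2))"
  have \<tau>: "\<tau> > 0" using e M by (simp add: \<tau>_def)
  obtain \<delta> where \<delta>: "\<delta> > 0" "\<And>h. norm h < \<delta> \<Longrightarrow> pint 2 (\<lambda>y. F (y - h) - F y) < \<tau>"
    using tc \<tau> unfolding translation_continuous_def by blast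
  have "pint q (\<lambda>y. F (y - h) - F y) < e" if h: "norm h < \<delta>" for h
  proof -
    let ?D = "\<lambda>y. F (y - h) - F y"
    let ?T = "\<lambda>x. if M < norm (F x) then norm (F x) powr q else 0"
    have LD: "Lp 2 ?D" by (intro Lp_diff Lp_shift F) auto
    have iT: "integrable lborel ?T" by (rule Bochner_Integration.integrable_bound[OF Lp_integrable[OF F(2)]]) auto
    have iTs: "integrable lborel (\<lambda>x. ?T (x - h))" by (rule lborel_integrable_shift[OF iT])
    have eqTs: "(LBINT x. ?T (x - h)) = (LBINT x. ?T x)" by (rule lborel_integral_shift) measurable
    let ?B = "\<lambda>y. (2 * M) powr (q - 2) * norm (?D y) powr 2 + 2 powr q * (?T y + ?T (y - h))"
    have iB: "integrable lborel ?B" using Lp_integrable[OF LD] iT iTs by (intro Bochner_Integration.integrable_add integrable_mult_right)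
    have "pint q ?D \<le> (LBINT y. ?B y)"
    proof (rule pint_le_of_pointwise(2)[OF _ iB])
      fix y
      show "norm (?D y) powr q \<le> ?B y"
      proof (cases "norm (?D y) \<le> 2 * M")
        case True
        have "norm (?D y) powr q = norm (?D y) powr (q - 2) * norm (?D y) powr 2"
          by (simp flip: powr_add del: powr_numeral)
        also have "\<dots> \<le> (2 * M) powr (q - 2) * norm (?D y) powr 2"
          using True q by (intro mult_right_mono powr_mono2) auto
        finally show ?thesis by (simp add: add_increasing2)
      next
        case False
        define X where "X = max (norm (F y)) (norm (F (y - h)))"
        have DX: "norm (?D y) \<le> 2 * X" using norm_triangle_ineq4[of "F (y - h)" "F y"] by (simp add: X_def)
        then have "M < X" using False by simp
        have "norm (?D y) powr q \<le> (2 * X) powr q" using DX q by (intro powr_mono2) auto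
        also have "\<dots> = 2 powr q * X powr q" by (simp add: powr_mult X_def le_max_iff_disj)
        also have "X powr q \<le> ?T y + ?T (y - h)" using \<open>M < X\<close> by (auto simp: X_def max_def add_increasing add_increasing2)
        finally show ?thesis by (simp add: add_increasing)
      qed
    qed measurable
    also have "\<dots> = (2 * M) powr (q - 2) * pint 2 ?D + 2 powr q * ((LBINT x. ?T x) + (LBINT x. ?T x))"
      unfolding pint_def using Lp_integrable[OF LD] iT iTs eqTs by (simp del: powr_numeral)
    also have "\<dots> < (2 * M) powr (q - 2) * \<tau> + 2 powr q * (d + d)"
      using \<delta>(2)[OF h] M by (intro add_strict_mono mult_strict_left_mono) auto
    also have "\<dots> = e" using M by (simp add: \<tau>_def d_def field_simps)
    finally show ?thesis .
  qed
  then show "\<exists>\<delta>>0. \<forall>h. norm h < \<delta> \<longrightarrow> pint q (\<lambda>y. F (y - h) - F y) < e" using \<delta>(1) by blast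
qed

text \<open>Lower semicontinuity of the L^q norm under L^2 convergence, without subsequences. Where
  \<open>|u| \<le> N\<close>, either \<open>|u| \<le> 2 |w|\<close>, or
  \<open>|u| \<le> 2 |w - u|\<close> and its q-th power is at most a constant depending on
  \<open>N\<close> times \<open>|w - u|\<^sup>2\<close>; for each \<open>N\<close>, a
  \<open>w\<close> close enough to \<open>u\<close> makes the second part at most 1.\<close>

lemma Lp_limit_bound:
  assumes u: "Lp 2 u" and q: "2 \<le> q"
    and w: "\<And>e. 0 < e \<Longrightarrow> \<exists>w. Lp 2 w \<and> Lp q w \<and> pint q w \<le> B \<and> pdist 2 w u < e"
  shows "Lp q u"
proof -
  have [measurable]: "u \<in> borel_measurable borel" using u by (rule Lp_borel)
  have B0: "0 \<le> B" using w[of 1] pint_nonneg[of q] by (meson order_trans zero_less_one)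
  have part: "(NN y. indicator {y. norm (u y) \<le> real N} y * ennreal (norm (u y) powr q)) \<le> ennreal (2 powr q * B + 1)" for N
  proof -
    define M where "M = real N + 1"
    have M: "M > 0" by (simp add: M_def)
    have pos: "0 < 1 / (4 * M powr (q - 2))" using M by simp
    obtain v where v: "Lp 2 v" "Lp q v" "pint q v \<le> B" "pdist 2 v u < 1 / (4 * M powr (q - 2))"
      using w[OF pos] by blast
    have Lvu: "Lp 2 (\<lambda>y. v y - u y)" by (intro Lp_diff v u) auto
    let ?B = "\<lambda>y. 2 powr q * norm (v y) powr q + 4 * M powr (q - 2) * norm (v y - u y) powr 2"
    have iB: "integrable lborel ?B"
      using Lp_integrable[OF v(2)] Lp_integrable[OF Lvu] by (intro Bochner_Integration.integrable_add integrable_mult_right)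
    have "(NN y. indicator {y. norm (u y) \<le> real N} y * ennreal (norm (u y) powr q)) \<le> (NN y. ennreal (?B y))"
    proof (rule nn_integral_mono)
      fix y
      have "norm (u y) powr q \<le> ?B y" if n: "norm (u y) \<le> real N"
      proof (cases "norm (u y) \<le> 2 * norm (v y)")
        case True
        then have "norm (u y) powr q \<le> (2 * norm (v y)) powr q" using q by (intro powr_mono2) auto
        then show ?thesis by (simp add: powr_mult add_increasing2)
      next
        case False
        then have D: "norm (u y) \<le> 2 * norm (v y - u y)" using norm_triangle_ineq2[of "u y" "v y"] by (simp add: norm_minus_commute)
        have "norm (u y) powr q = norm (u y) powr (q - 2) * norm (u y) powr 2" by (simp flip: powr_add del: powr_numeral)
        also have "\<dots> \<le> M powr (q - 2) * (2 * norm (v y - u y)) powr 2"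
          using n D q M by (intro mult_mono powr_mono2) (auto simp: M_def)
        also have "\<dots> = 4 * M powr (q - 2) * norm (v y - u y) powr 2" by (simp add: power_mult_distrib)
        finally show ?thesis by (simp add: add_increasing)
      qed
      then show "indicator {y. norm (u y) \<le> real N} y * ennreal (norm (u y) powr q) \<le> ennreal (?B y)"
        by (cases "norm (u y) \<le> real N") (simp_all add: ennreal_leI del: ennreal_plus)
    qed
    also have "\<dots> = ennreal (LBINT y. ?B y)" by (rule nn_integral_eq_integral[OF iB]) auto
    also have "(LBINT y. ?B y) = 2 powr q * pint q v + 4 * M powr (q - 2) * pdist 2 v u"
      unfolding pint_def using Lp_integrable[OF v(2)] Lp_integrable[OF Lvu] by (simp del: powr_numeral)
    also have "ennreal \<dots> \<le> ennreal (2 powr q * B + 1)"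
    proof (intro ennreal_leI add_mono)
      show "2 powr q * pint q v \<le> 2 powr q * B" using v(3) by simp
      show "4 * M powr (q - 2) * pdist 2 v u \<le> 1" using v(4) M by (simp add: field_simps)
    qed
    finally show ?thesis .
  qed
  then have "\<exists>M\<ge>real N. (NN y. indicator {y. norm (u y) \<le> M} y * ennreal (norm (u y) powr q)) \<le> ennreal (2 powr q * B + 1)" for N
    by blast
  then show ?thesis by (rule Lp_of_truncations(1)[rotated 2]) (use B0 in auto)
qed

section \<open>Smoothing by averages over a box\<close>

definition box_measure :: "'a::euclidean_space \<Rightarrow> 'a \<Rightarrow> 'a measure" where
  "box_measure a b = density lborel (\<lambda>h. ennreal (indicator (cbox a b) h / measure lborel (cbox a b)))"

text \<open>Averages of smooth functions are smooth, so the uniform density on a box can take the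
  place of a mollifier. It is a probability density, as Jensen's inequality demands. The sign in
  \<open>y - h\<close> moves supports by vectors of the box, and the box can be placed inside a
  cone.\<close>

definition box_average :: "'a::euclidean_space \<Rightarrow> 'a \<Rightarrow> ('a \<Rightarrow> 'b::euclidean_space) \<Rightarrow> 'a \<Rightarrow> 'b" where
  "box_average a b F y = (LINT h|box_measure a b. F (y - h))"

context
  fixes a b :: "'a::euclidean_space"
  assumes ab: "0 < measure lborel (cbox a b)"
begin

lemma box_measure_space [simp]: "space (box_measure a b) = UNIV" and box_measure_sets [measurable_cong]: "sets (box_measure a b) = sets borel"
  by (auto simp: box_measure_def)

lemma box_measure_nn:
  assumes [measurable]: "f \<in> borel_measurable borel"
  shows "(\<integral>\<^sup>+h. f h \<partial>box_measure a b) = ennreal (1 / measure lborel (cbox a b)) * (NN h. indicator (cbox a b) h * f h)"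
proof -
  have "(\<integral>\<^sup>+h. f h \<partial>box_measure a b) = (NN h. ennreal (indicator (cbox a b) h / measure lborel (cbox a b)) * f h)"
    unfolding box_measure_def by (rule nn_integral_density) auto
  also have "\<dots> = (NN h. ennreal (1 / measure lborel (cbox a b)) * (indicator (cbox a b) h * f h))"
    by (intro nn_integral_cong) (auto simp: indicator_def)
  also have "\<dots> = ennreal (1 / measure lborel (cbox a b)) * (NN h. indicator (cbox a b) h * f h)"
    by (rule nn_integral_cmult) auto
  finally show ?thesis .
qed

lemma box_measure_1: "emeasure (box_measure a b) (space (box_measure a b)) = 1"
proof -
  have "emeasure (box_measure a b) (space (box_measure a b)) = (\<integral>\<^sup>+h. 1 \<partial>box_measure a b)" by simp
  also have "\<dots> = ennreal (1 / measure lborel (cbox a b)) * emeasure lborel (cbox a b)" by (subst box_measure_nn) auto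
  also have "emeasure lborel (cbox a b) = ennreal (measure lborel (cbox a b))"
    by (rule emeasure_eq_ennreal_measure) (simp add: emeasure_lborel_cbox_eq)
  finally show ?thesis using ab by (simp flip: ennreal_mult)
qed

lemma finite_box_measure: "finite_measure (box_measure a b)"
  by (rule finite_measureI) (simp only: box_measure_1, simp)

lemma box_average_borel:
  assumes [measurable]: "F \<in> borel_measurable borel"
  shows "(box_average a b F :: 'a \<Rightarrow> 'b::euclidean_space) \<in> borel_measurable borel"
proof -
  interpret finite_measure "box_measure a b" by (rule finite_box_measure)
  show ?thesis unfolding box_average_def[abs_def] by (rule borel_measurable_lebesgue_integral) measurable
qed

lemma box_average_powr_le:
  assumes [measurable]: "F \<in> borel_measurable borel" and p: "1 \<le> p"
  shows "ennreal (norm (box_average a b F y) powr p) \<le> (\<integral>\<^sup>+h. ennreal (norm (F (y - h)) powr p) \<partial>box_measure a b)"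
proof (cases "integrable (box_measure a b) (\<lambda>h. F (y - h))")
  case True
  have "norm (box_average a b F y) \<le> (LINT h|box_measure a b. norm (F (y - h)))"
    unfolding box_average_def by (rule integral_norm_bound)
  then have "ennreal (norm (box_average a b F y) powr p) \<le> ennreal ((LINT h|box_measure a b. norm (F (y - h))) powr p)"
    using p by (intro ennreal_leI powr_mono2) auto
  also have "\<dots> \<le> (\<integral>\<^sup>+h. ennreal (norm (F (y - h)) powr p) \<partial>box_measure a b)"
    by (rule Jensen_powr[OF box_measure_1]) (use True p in auto)
  finally show ?thesis .
next
  \<comment> \<open>A divergent average is 0 by the convention for the Bochner integral, so the
    bound is trivial.\<close>
  case False
  then show ?thesis by (simp add: box_average_def not_integrable_integral_eq)
qed

lemma box_average_integrable:
  assumes F: "Lp p F" and p: "1 \<le> p"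
  shows "integrable (box_measure a b) (\<lambda>h. F (y - h))"
proof -
  have [measurable]: "F \<in> borel_measurable borel" using F by (rule Lp_borel)
  interpret finite_measure "box_measure a b" by (rule finite_box_measure)
  have "(\<integral>\<^sup>+h. ennreal (norm (F (y - h)) powr p) \<partial>box_measure a b)
      = ennreal (1 / measure lborel (cbox a b)) * (NN h. indicator (cbox a b) h * ennreal (norm (F (y - h)) powr p))"
    by (rule box_measure_nn) measurable
  also have "\<dots> \<le> ennreal (1 / measure lborel (cbox a b)) * (NN h. ennreal (norm (F (y - h)) powr p))"
    by (intro mult_left_mono nn_integral_mono) (auto simp: indicator_def)
  also have "(NN h. ennreal (norm (F (y - h)) powr p)) = ennreal (pint p F)"
    by (subst lborel_nn_reflect[of "\<lambda>h. ennreal (norm (F h) powr p)"]) (auto simp: ennreal_pint[OF F])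
  also have "ennreal (1 / measure lborel (cbox a b)) * \<dots> < \<infinity>" by (simp add: ennreal_mult_less_top)
  finally have i: "integrable (box_measure a b) (\<lambda>h. norm (F (y - h)) powr p)" by (intro integrableI_nonneg) auto
  show ?thesis
  proof (rule Bochner_Integration.integrable_bound)
    show "integrable (box_measure a b) (\<lambda>h. 1 + norm (F (y - h)) powr p)" using i by simp
    have "x \<le> 1 + x powr p" if "0 \<le> x" for x :: real
    proof (cases "x \<le> 1")
      case False
      then have "x powr 1 \<le> x powr p" using p by (intro powr_mono) auto
      then show ?thesis using False by simp
    qed (simp add: add_increasing2)
    then show "AE h in box_measure a b. norm (F (y - h)) \<le> norm (1 + norm (F (y - h)) powr p)" by simp
  qed measurable
qed

lemma box_average_diff:
  assumes "Lp p F" "Lp p G" "1 \<le> p"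
  shows "box_average a b (\<lambda>y. F y - G y) y = box_average a b F y - box_average a b G y"
  unfolding box_average_def by (intro Bochner_Integration.integral_diff box_average_integrable[of p] assms)

lemma box_average_Lp:
  assumes F: "Lp p F" and p: "1 \<le> p"
  shows "Lp p (box_average a b F)" "pint p (box_average a b F) \<le> pint p F"
proof -
  have [measurable]: "F \<in> borel_measurable borel" using F by (rule Lp_borel)
  interpret finite_measure "box_measure a b" by (rule finite_box_measure)
  interpret P: pair_sigma_finite lborel "box_measure a b" ..
  have "(NN y. ennreal (norm (box_average a b F y) powr p)) \<le> (NN y. (\<integral>\<^sup>+h. ennreal (norm (F (y - h)) powr p) \<partial>box_measure a b))"
    by (intro nn_integral_mono box_average_powr_le p) auto
  also have "\<dots> = (\<integral>\<^sup>+h. (NN y. ennreal (norm (F (y - h)) powr p)) \<partial>box_measure a b)"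
    by (rule P.Fubini'[symmetric]) measurable
  also have "\<dots> = (\<integral>\<^sup>+h. ennreal (pint p F) \<partial>box_measure a b)"
    by (intro nn_integral_cong, subst lborel_nn_shift_minus[of "\<lambda>y. ennreal (norm (F y) powr p)"]) (auto simp: ennreal_pint[OF F])
  also have "\<dots> = ennreal (pint p F)" using box_measure_1 by simp
  finally have *: "(NN y. ennreal (norm (box_average a b F y) powr p)) \<le> ennreal (pint p F)" .
  show "Lp p (box_average a b F)" "pint p (box_average a b F) \<le> pint p F"
    using Lp_nn_bound[OF _ * pint_nonneg] box_average_borel[of F] by auto
qed

text \<open>The error is itself the average of the translation differences; by Jensen's inequality
  and Fubini it is no worse than the worst translation in the box.\<close>

lemma box_average_close:
  assumes F: "Lp p F" and p: "1 \<le> p" and c: "\<And>h. h \<in> cbox a b \<Longrightarrow> pint p (\<lambda>y. F (y - h) - F y) \<le> e" and e: "0 \<le> e"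
  shows "pdist p (box_average a b F) F \<le> e"
proof -
  have [measurable]: "F \<in> borel_measurable borel" using F by (rule Lp_borel)
  interpret finite_measure "box_measure a b" by (rule finite_box_measure)
  interpret P: pair_sigma_finite lborel "box_measure a b" ..
  have ms: "measure (box_measure a b) (space (box_measure a b)) = 1" using box_measure_1 by (simp add: measure_def)
  have eq: "box_average a b F y - F y = (LINT h|box_measure a b. F (y - h) - F y)" for y
    unfolding box_average_def using box_average_integrable[OF F p, of y] ms by (subst Bochner_Integration.integral_diff) auto
  have pt: "ennreal (norm (box_average a b F y - F y) powr p) \<le> (\<integral>\<^sup>+h. ennreal (norm (F (y - h) - F y) powr p) \<partial>box_measure a b)" for y
  proof -
    have i: "integrable (box_measure a b) (\<lambda>h. F (y - h) - F y)" using box_average_integrable[OF F p, of y] by simp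
    have "norm (box_average a b F y - F y) \<le> (LINT h|box_measure a b. norm (F (y - h) - F y))"
      unfolding eq by (rule integral_norm_bound)
    then have "ennreal (norm (box_average a b F y - F y) powr p) \<le> ennreal ((LINT h|box_measure a b. norm (F (y - h) - F y)) powr p)"
      using p by (intro ennreal_leI powr_mono2) auto
    also have "\<dots> \<le> (\<integral>\<^sup>+h. ennreal (norm (F (y - h) - F y) powr p) \<partial>box_measure a b)"
      by (rule Jensen_powr[OF box_measure_1]) (use i p in auto)
    finally show ?thesis .
  qed
  have "(NN y. ennreal (norm (box_average a b F y - F y) powr p)) \<le> (NN y. (\<integral>\<^sup>+h. ennreal (norm (F (y - h) - F y) powr p) \<partial>box_measure a b))"
    by (intro nn_integral_mono pt)
  also have "\<dots> = (\<integral>\<^sup>+h. (NN y. ennreal (norm (F (y - h) - F y) powr p)) \<partial>box_measure a b)"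
    by (rule P.Fubini'[symmetric]) measurable
  also have "\<dots> \<le> (\<integral>\<^sup>+h. ennreal e \<partial>box_measure a b)"
  proof (rule nn_integral_mono_AE)
    have "AE h in box_measure a b. h \<in> cbox a b"
      unfolding box_measure_def by (subst AE_density) (auto simp: indicator_def intro!: AE_I2)
    then show "AE h in box_measure a b. (NN y. ennreal (norm (F (y - h) - F y) powr p)) \<le> ennreal e"
    proof eventually_elim
      fix h assume h: "h \<in> cbox a b"
      have L: "Lp p (\<lambda>y. F (y - h) - F y)" using p by (intro Lp_diff Lp_shift F) auto
      show "(NN y. ennreal (norm (F (y - h) - F y) powr p)) \<le> ennreal e"
        unfolding ennreal_pint[OF L] by (intro ennreal_leI c h)
    qed
  qed
  also have "\<dots> = ennreal e" using box_measure_1 by simp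
  finally have *: "(NN y. ennreal (norm (box_average a b F y - F y) powr p)) \<le> ennreal e" .
  show ?thesis using Lp_nn_bound(2)[OF _ * e] box_average_borel[of F] by auto
qed

text \<open>Averaging maps \<open>L\<^sup>2\<close> boundedly into \<open>L\<^sup>\<infinity>\<close>, hence into \<open>L\<^sup>q\<close> for \<open>q \<ge> 2\<close>.\<close>

lemma box_average_higher:
  assumes F: "Lp 2 F" and q: "2 \<le> q"
  shows "Lp q (box_average a b F)"
    "pint q (box_average a b F) \<le> (pint 2 F / measure lborel (cbox a b)) powr ((q - 2) / 2) * pint 2 F"
proof -
  have [measurable]: "F \<in> borel_measurable borel" using F by (rule Lp_borel)
  let ?S = "pint 2 F / measure lborel (cbox a b)"
  have S0: "0 \<le> ?S" using ab by simp
  have sup: "norm (box_average a b F y) powr 2 \<le> ?S" for y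
  proof -
    have "ennreal (norm (box_average a b F y) powr 2) \<le> (\<integral>\<^sup>+h. ennreal (norm (F (y - h)) powr 2) \<partial>box_measure a b)"
      by (rule box_average_powr_le) auto
    also have "\<dots> = ennreal (1 / measure lborel (cbox a b)) * (NN h. indicator (cbox a b) h * ennreal (norm (F (y - h)) powr 2))"
      by (rule box_measure_nn) measurable
    also have "\<dots> \<le> ennreal (1 / measure lborel (cbox a b)) * (NN h. ennreal (norm (F (y - h)) powr 2))"
      by (intro mult_left_mono nn_integral_mono) (auto simp: indicator_def)
    also have "(NN h. ennreal (norm (F (y - h)) powr 2)) = (NN h. ennreal (norm (F h) powr 2))"
      by (rule lborel_nn_reflect) measurable
    also have "\<dots> = ennreal (pint 2 F)" by (rule ennreal_pint[OF F])
    also have "ennreal (1 / measure lborel (cbox a b)) * ennreal (pint 2 F) = ennreal ?S" by (simp flip: ennreal_mult)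
    finally show ?thesis using S0 by (subst (asm) ennreal_le_iff) auto
  qed
  have A2: "Lp 2 (box_average a b F)" "pint 2 (box_average a b F) \<le> pint 2 F" using box_average_Lp[OF F] by auto
  have pt: "norm (box_average a b F y) powr q \<le> ?S powr ((q - 2) / 2) * norm (box_average a b F y) powr 2" for y
  proof -
    have "norm (box_average a b F y) powr q = (norm (box_average a b F y) powr 2) powr ((q - 2) / 2) * norm (box_average a b F y) powr 2"
      unfolding powr_powr by (subst powr_add[symmetric], rule arg_cong[where f="\<lambda>e. _ powr e"]) (simp add: field_simps)
    also have "\<dots> \<le> ?S powr ((q - 2) / 2) * norm (box_average a b F y) powr 2"
      using sup q by (intro mult_right_mono powr_mono2) auto
    finally show ?thesis .
  qed
  have i: "integrable lborel (\<lambda>y. ?S powr ((q - 2) / 2) * norm (box_average a b F y) powr 2)"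
    using Lp_integrable[OF A2(1)] by (rule integrable_mult_right)
  show "Lp q (box_average a b F)" by (rule pint_le_of_pointwise(1)[OF Lp_borel[OF A2(1)] i pt])
  have "pint q (box_average a b F) \<le> ?S powr ((q - 2) / 2) * pint 2 (box_average a b F)"
    using pint_le_of_pointwise(2)[OF Lp_borel[OF A2(1)] i pt] by (simp add: pint_def del: powr_numeral)
  also have "\<dots> \<le> ?S powr ((q - 2) / 2) * pint 2 F" using A2(2) by (intro mult_left_mono) auto
  finally show "pint q (box_average a b F) \<le> ?S powr ((q - 2) / 2) * pint 2 F" .
qed

lemma box_average_integral:
  assumes F: "continuous_on UNIV F"
  shows "box_average a b F y = integral (cbox a b) (\<lambda>h. F (y - h)) /\<^sub>R measure lborel (cbox a b)"
proof -
  have [measurable]: "F \<in> borel_measurable borel" by (rule borel_measurable_continuous_onI[OF F])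
  have c: "continuous_on (cbox a b) (\<lambda>h. F (y - h))"
    by (rule continuous_on_compose2[OF F]) (auto intro!: continuous_intros)
  have i: "set_integrable lborel (cbox a b) (\<lambda>h. F (y - h))"
    unfolding set_integrable_def by (rule borel_integrable_compact[OF _ c]) auto
  have "box_average a b F y = (LBINT h. (indicator (cbox a b) h / measure lborel (cbox a b)) *\<^sub>R F (y - h))"
    unfolding box_average_def box_measure_def by (rule integral_density) (auto simp: indicator_def)
  also have "\<dots> = (LBINT h. (1 / measure lborel (cbox a b)) *\<^sub>R (indicator (cbox a b) h *\<^sub>R F (y - h)))"
    by (intro Bochner_Integration.integral_cong) auto
  also have "\<dots> = (LINT h:cbox a b|lborel. F (y - h)) /\<^sub>R measure lborel (cbox a b)"
    unfolding set_lebesgue_integral_def by (subst integral_scaleR_right) (simp add: divide_inverse)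
  also have "(LINT h:cbox a b|lborel. F (y - h)) = integral (cbox a b) (\<lambda>h. F (y - h))"
    by (rule set_borel_integral_eq_integral(2)[OF i])
  finally show ?thesis .
qed

text \<open>Differentiation under the integral: the Leibniz rule applies to the gauge integral over
  the box with the derivative as a bounded linear function, and \<open>box_average_integral\<close>
  connects that integral with the average.\<close>

lemma box_average_derivative:
  fixes \<phi> :: "'a \<Rightarrow> real"
  assumes d: "\<And>x. (\<phi> has_derivative (\<lambda>v. g x \<bullet> v)) (at x)" and g: "continuous_on UNIV g"
  shows "(box_average a b \<phi> has_derivative (\<lambda>v. box_average a b g y \<bullet> v)) (at y)"
proof -
  let ?B = "blinfun_apply (integral (cbox a b) (\<lambda>h. blinfun_inner_left (g (y - h))))"
  have cphi: "continuous_on UNIV \<phi>"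
    using d by (auto intro!: continuous_at_imp_continuous_on has_derivative_continuous)
  have cg: "continuous_on S (\<lambda>h. g (x - h))" for x S
    by (rule continuous_on_compose2[OF g]) (auto intro!: continuous_intros)
  have L: "((\<lambda>x. integral (cbox a b) (\<lambda>h. \<phi> (x - h))) has_derivative
      ?B) (at y within UNIV)"
  proof (rule leibniz_rule)
    fix x t :: 'a
    have "((\<lambda>x. x - t) has_derivative (\<lambda>v. v)) (at x)" by (auto intro!: derivative_eq_intros)
    from has_derivative_compose[OF this d]
    show "((\<lambda>x. \<phi> (x - t)) has_derivative blinfun_apply (blinfun_inner_left (g (x - t)))) (at x within UNIV)"
      by (simp add: inner_commute)
    show "(\<lambda>h. \<phi> (x - h)) integrable_on cbox a b"
      by (intro integrable_continuous continuous_on_compose2[OF cphi]) (auto intro!: continuous_intros)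
    have "continuous_on (UNIV \<times> cbox a b) (\<lambda>z. g (fst z - snd z))"
      by (rule continuous_on_compose2[OF g]) (auto intro!: continuous_intros)
    then show "continuous_on (UNIV \<times> cbox a b) (\<lambda>(x, t). blinfun_inner_left (g (x - t)))"
      by (auto simp: case_prod_beta intro!: bounded_linear.continuous_on[OF bounded_linear_blinfun_inner_left])
  qed auto
  have "?B v = integral (cbox a b) (\<lambda>h. g (y - h)) \<bullet> v" for v
  proof -
    have "?B v = integral (cbox a b) (\<lambda>h. blinfun_inner_left (g (y - h)) v)" by (rule blinfun_apply_integral)
        (auto intro!: integrable_continuous bounded_linear.continuous_on[OF bounded_linear_blinfun_inner_left] cg)
    also have "\<dots> = integral (cbox a b) (\<lambda>h. g (y - h)) \<bullet> v"
      using integral_linear[OF integrable_continuous[OF cg] bounded_linear_inner_left, of a b v y]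
      by (simp add: o_def inner_commute)
    finally show ?thesis .
  qed
  then have "?B = (\<lambda>v. integral (cbox a b) (\<lambda>h. g (y - h)) \<bullet> v)" by (rule ext)
  with L have "((\<lambda>x. integral (cbox a b) (\<lambda>h. \<phi> (x - h))) has_derivative (\<lambda>v. integral (cbox a b) (\<lambda>h. g (y - h)) \<bullet> v)) (at y)"
    by simp
  then have "((\<lambda>x. integral (cbox a b) (\<lambda>h. \<phi> (x - h)) /\<^sub>R measure lborel (cbox a b)) has_derivative
     (\<lambda>v. (integral (cbox a b) (\<lambda>h. g (y - h)) \<bullet> v) /\<^sub>R measure lborel (cbox a b))) (at y)"
    by (rule has_derivative_scaleR_right)
  then show ?thesis by (simp add: box_average_integral[OF cphi, abs_def] box_average_integral[OF g])
qed

text \<open>All orders are assumed at once because the induction passes to directional derivatives,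
  which must satisfy the same hypothesis.\<close>

lemma C_k_box_average:
  assumes "\<And>j. C_k j \<phi>" shows "C_k k (box_average a b (\<phi> :: 'a \<Rightarrow> real))"
  using assms
proof (induction k arbitrary: \<phi>)
  have der: "(box_average a b \<phi> has_derivative (\<lambda>v. box_average a b (gradient \<phi>) y \<bullet> v)) (at y)" if "\<And>j. C_k j \<phi>" for \<phi> :: "'a \<Rightarrow> real" and y
  proof -
    have "smooth \<phi>" using that by (simp add: smooth_def)
    then show ?thesis by (intro box_average_derivative smooth_gradient_derivative smooth_gradient_continuous)
  qed
  {
    case 0
    then show ?case using has_derivative_continuous[OF der[OF 0]] by (auto intro!: continuous_at_imp_continuous_on)
  next
    case (Suc k)
    have sm: "smooth \<phi>" using Suc.prems by (simp add: smooth_def)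
    show ?case
    proof (rule C_k_SucI[OF der[OF Suc.prems]])
      fix v
      have eq: "frechet_derivative \<phi> (at x) v = gradient \<phi> x \<bullet> v" for x
        using frechet_derivative_at[OF smooth_gradient_derivative[OF sm, of x]] by metis
      have Cv: "C_k j (\<lambda>x. gradient \<phi> x \<bullet> v)" for j
      proof -
        have "C_k j (\<lambda>x. frechet_derivative \<phi> (at x) v)" using Suc.prems[of "Suc j"] by simp
        then show ?thesis by (simp only: eq)
      qed
      have cg: "continuous_on UNIV (gradient \<phi>)" by (rule smooth_gradient_continuous[OF sm])
      have "box_average a b (gradient \<phi>) y \<bullet> v = box_average a b (\<lambda>x. gradient \<phi> x \<bullet> v) y" for y
      proof -
        have c2: "continuous_on UNIV (\<lambda>x. gradient \<phi> x \<bullet> v)" using cg by (intro continuous_intros)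
        have ch: "continuous_on (cbox a b) (\<lambda>h. gradient \<phi> (y - h))"
          by (rule continuous_on_compose2[OF cg]) (auto intro!: continuous_intros)
        have "integral (cbox a b) (\<lambda>h. gradient \<phi> (y - h) \<bullet> v) = integral (cbox a b) (\<lambda>h. gradient \<phi> (y - h)) \<bullet> v"
          using integral_linear[OF integrable_continuous[OF ch] bounded_linear_inner_left, of v] by (simp add: o_def)
        then show ?thesis by (simp add: box_average_integral[OF cg] box_average_integral[OF c2])
      qed
      then show "C_k k (\<lambda>y. box_average a b (gradient \<phi>) y \<bullet> v)" using Suc.IH[OF Cv] by simp
    qed
  }
qed

lemma smooth_box_average: "smooth \<phi> \<Longrightarrow> smooth (box_average a b (\<phi> :: 'a \<Rightarrow> real))"
  by (simp add: smooth_def C_k_box_average)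

lemma gradient_box_average: "smooth \<phi> \<Longrightarrow> gradient (box_average a b (\<phi> :: 'a \<Rightarrow> real)) y = box_average a b (gradient \<phi>) y"
  by (intro gradient_eqI box_average_derivative smooth_gradient_derivative smooth_gradient_continuous)

lemma box_average_0:
  assumes F: "continuous_on UNIV F" "\<And>h. h \<in> cbox a b \<Longrightarrow> F (y - h) = 0"
  shows "box_average a b (F :: 'a \<Rightarrow> 'b::euclidean_space) y = 0"
  unfolding box_average_integral[OF F(1)] using integral_cong[of "cbox a b" "\<lambda>h. F (y - h)" "\<lambda>h. 0"] F(2) by simp

lemma test_function_box_average:
  assumes \<phi>: "test_function \<Omega> \<phi>" and K: "compact K" "\<And>x. x \<notin> K \<Longrightarrow> \<phi> x = 0"
    and sub: "\<And>x h. x \<in> K \<Longrightarrow> h \<in> cbox a b \<Longrightarrow> x + h \<in> \<Omega>'"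
  shows "test_function \<Omega>' (box_average a b \<phi>)"
proof (rule test_functionI)
  have sm: "smooth \<phi>" by (rule test_function_smooth[OF \<phi>])
  show "smooth (box_average a b \<phi>)" by (rule smooth_box_average[OF sm])
  show "compact {x + h | x h. x \<in> K \<and> h \<in> cbox a b}" by (rule compact_sums[OF K(1)]) auto
  show "{x + h | x h. x \<in> K \<and> h \<in> cbox a b} \<subseteq> \<Omega>'" using sub by auto
  show "box_average a b \<phi> y = 0" if y: "y \<notin> {x + h | x h. x \<in> K \<and> h \<in> cbox a b}" for y
  proof (rule box_average_0[OF smooth_continuous[OF sm]])
    fix h assume h: "h \<in> cbox a b"
    have "y - h \<notin> K"
    proof
      assume "y - h \<in> K"
      then have "(y - h) + h \<in> {x + h | x h. x \<in> K \<and> h \<in> cbox a b}" using h by blast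
      then show False using y by simp
    qed
    then show "\<phi> (y - h) = 0" by (rule K(2))
  qed
qed

end

lemma box_in_ball:
  assumes "0 < \<delta>"
  shows "\<exists>a b. 0 < measure lborel (cbox a b) \<and> cbox a b \<subseteq> ball c \<delta>"
proof -
  obtain a b where ab: "cbox a b \<subseteq> ball c \<delta>" "c \<in> box a b"
    using open_contains_cbox[of "ball c \<delta>" c] assms by (metis centre_in_ball open_ball)
  then have "box a b \<noteq> {}" by auto
  then have "0 < measure lborel (cbox a b)" by (simp add: content_pos_lt_eq box_ne_empty)
  then show ?thesis using ab by blast
qed

text \<open>For a box fixed in advance, averaging upgrades convergence in L^2 to convergence in L^q:
  once \<open>pint 2 (F n)\<close> is below the volume of the box, the extra factor in
  \<open>box_average_higher\<close> is at most 1.\<close>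

lemma box_average_small:
  assumes ab: "0 < measure lborel (cbox a b)" and F: "\<And>n. Lp 2 (F n)" "(\<lambda>n. pint 2 (F n)) \<longlonglongrightarrow> 0" and q: "2 \<le> q" and e: "0 < e"
  shows "\<forall>\<^sub>F n in sequentially. pint q (box_average a b (F n)) < e"
proof -
  let ?c = "measure lborel (cbox a b)"
  have "0 < min ?c e" using ab e by simp
  from order_tendstoD(2)[OF F(2) this] show ?thesis
  proof eventually_elim
    fix n assume n: "pint 2 (F n) < min ?c e"
    have "pint q (box_average a b (F n)) \<le> (pint 2 (F n) / ?c) powr ((q - 2) / 2) * pint 2 (F n)"
      by (rule box_average_higher(2)[OF ab F(1) q])
    also have "\<dots> \<le> 1 * pint 2 (F n)" using n ab q by (intro mult_right_mono powr_le1) auto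
    also have "\<dots> < e" using n by simp
    finally show "pint q (box_average a b (F n)) < e" .
  qed
qed

lemma test_function_translation_continuous:
  assumes "test_function \<Omega> \<phi>"
  shows "translation_continuous 2 \<phi>" "translation_continuous 2 (gradient \<phi>)"
proof -
  obtain K where K: "compact K" "\<And>x. x \<notin> K \<Longrightarrow> \<phi> x = 0" "\<And>x. x \<notin> K \<Longrightarrow> gradient \<phi> x = 0"
    using test_functionE(2)[OF assms] by blast
  have sm: "smooth \<phi>" by (rule test_function_smooth[OF assms])
  show "translation_continuous 2 \<phi>"
    by (rule translation_continuous_compact_support[OF smooth_continuous[OF sm] K(1,2)])
  show "translation_continuous 2 (gradient \<phi>)"
    by (rule translation_continuous_compact_support[OF smooth_gradient_continuous[OF sm] K(1,3)])
qed

lemma tendsto_pint_ex: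
  assumes "(\<lambda>n. pdist p (F n) f) \<longlonglongrightarrow> 0" "0 < e" "\<And>n. P (F n)"
  shows "\<exists>G. P G \<and> pdist p G f < e"
  using order_tendstoD(2)[OF assms(1,2)] assms(3) by (auto simp: eventually_sequentially)

text \<open>Poincare's inequality is available for test functions only. Averages of
  \<open>\<phi> n\<close> over a small box are test functions in a larger ball; their gradients are
  bounded in L^q, because averaging turns the L^2 error into an L^q error. These averages
  approximate \<open>u\<close> in L^2, and \<open>Lp_limit_bound\<close> concludes.\<close>

lemma potential_higher_integrability:
  fixes u :: "'a::euclidean_space \<Rightarrow> real"
  assumes \<phi>: "\<And>n. test_function \<Omega> (\<phi> n)" and \<Omega>: "\<Omega> \<subseteq> cball 0 R" "0 < R" and q: "2 \<le> q"
    and u: "Lp 2 u" "(\<lambda>n. pdist 2 (\<phi> n) u) \<longlonglongrightarrow> 0"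
    and g: "Lp 2 g" "Lp q g" "(\<lambda>n. pdist 2 (gradient (\<phi> n)) g) \<longlonglongrightarrow> 0"
  shows "Lp q u"
proof (rule Lp_limit_bound[OF u(1) q])
  fix e :: real assume e: "0 < e"
  define B where "B = (3 * (R + 1)) powr q * (2 powr q * (1 + pint q g))"
  have q1: "1 \<le> q" "0 < q" using q by auto
  have L: "Lp 2 (\<phi> n)" "Lp 2 (gradient (\<phi> n))" for n using test_function_Lp[OF \<phi>] by auto
  have tc: "translation_continuous 2 u"
  proof (rule translation_continuous_limit[OF u(1)])
    fix d :: real assume d: "0 < d"
    show "\<exists>G. Lp 2 G \<and> translation_continuous 2 G \<and> pdist 2 G u < d"
      using tendsto_pint_ex[OF u(2) d, of "\<lambda>G. Lp 2 G \<and> translation_continuous 2 G"] L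
        test_function_translation_continuous[OF \<phi>] by blast
  qed
  have e16: "0 < e / 16" using e by simp
  obtain \<delta> where \<delta>: "\<delta> > 0" "\<And>h. norm h < \<delta> \<Longrightarrow> pint 2 (\<lambda>y. u (y - h) - u y) < e / 16"
    using tc e16 unfolding translation_continuous_def by blast
  have "0 < min 1 \<delta>" using \<delta> by simp
  from box_in_ball[OF this, of "0::'a"]
  obtain a b :: 'a where ab: "0 < measure lborel (cbox a b)" "cbox a b \<subseteq> ball 0 (min 1 \<delta>)" by blast
  have hsm: "norm h < 1" "norm h < \<delta>" if "h \<in> cbox a b" for h using that ab(2) by auto
  have ev: "\<forall>\<^sub>F n in sequentially. pdist 2 (\<phi> n) u < e / 16 \<and> pint q (box_average a b (\<lambda>x. gradient (\<phi> n) x - g x)) < 1"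
    by (intro eventually_conj order_tendstoD(2)[OF u(2) e16] box_average_small[OF ab(1) _ g(3) q]) (auto intro!: Lp_diff L g)
  then obtain n where n: "pdist 2 (\<phi> n) u < e / 16" "pint q (box_average a b (\<lambda>x. gradient (\<phi> n) x - g x)) < 1"
    by (auto simp: eventually_sequentially)
  let ?w = "box_average a b (\<phi> n)"
  obtain K where K: "compact K" "K \<subseteq> \<Omega>" "\<And>x. x \<notin> K \<Longrightarrow> \<phi> n x = 0" using test_functionE(2)[OF \<phi>[of n]] by blast
  have wt: "test_function (cball 0 (R + 1)) ?w"
  proof (rule test_function_box_average[OF ab(1) \<phi> K(1,3)])
    fix x h assume "x \<in> K" "h \<in> cbox a b"
    then have "norm x \<le> R" "norm h < 1" using K(2) \<Omega> hsm by auto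
    then show "x + h \<in> cball 0 (R + 1)" using norm_triangle_ineq[of x h] by simp
  qed
  have Lw: "Lp 2 ?w" "Lp q ?w" using test_function_Lp[OF wt] q by auto
  have gw: "gradient ?w = (\<lambda>y. box_average a b (\<lambda>x. gradient (\<phi> n) x - g x) y + box_average a b g y)"
    using gradient_box_average[OF ab(1) test_function_smooth[OF \<phi>]] box_average_diff[OF ab(1) L(2) g(1)] by auto
  have Ldg: "Lp 2 (\<lambda>x. gradient (\<phi> n) x - g x)" by (intro Lp_diff L g) auto
  have "pint q (gradient ?w) \<le> 2 powr q * (pint q (box_average a b (\<lambda>x. gradient (\<phi> n) x - g x)) + pint q (box_average a b g))"
    unfolding gw by (intro Lp_add box_average_higher(1)[OF ab(1) Ldg q] box_average_Lp[OF ab(1) g(2)] q1)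
  also have "\<dots> \<le> 2 powr q * (1 + pint q g)"
    using n(2) box_average_Lp(2)[OF ab(1) g(2) q1(1)] by (intro mult_left_mono) auto
  finally have gq: "pint q (gradient ?w) \<le> 2 powr q * (1 + pint q g)" .
  have "pint q ?w \<le> (3 * (R + 1)) powr q * pint q (gradient ?w)"
    by (rule Poincare_test[OF wt _ _ q1(1)]) (use \<Omega> in auto)
  also have "\<dots> \<le> B" unfolding B_def by (intro mult_left_mono gq) auto
  finally have wB: "pint q ?w \<le> B" .
  have Ldu: "Lp 2 (\<lambda>x. \<phi> n x - u x)" by (intro Lp_diff L u) auto
  have "pint 2 (\<lambda>y. box_average a b (\<lambda>x. \<phi> n x - u x) y + (box_average a b u y - u y))
      \<le> 2 powr 2 * (pint 2 (box_average a b (\<lambda>x. \<phi> n x - u x)) + pdist 2 (box_average a b u) u)"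
    by (intro Lp_add Lp_diff box_average_Lp(1)[OF ab(1) Ldu] box_average_Lp(1)[OF ab(1) u(1)] u) auto
  moreover have "(\<lambda>y. box_average a b (\<lambda>x. \<phi> n x - u x) y + (box_average a b u y - u y)) = (\<lambda>y. ?w y - u y)"
    using box_average_diff[OF ab(1) L(1) u(1)] by auto
  moreover have "pint 2 (box_average a b (\<lambda>x. \<phi> n x - u x)) \<le> pdist 2 (\<phi> n) u" by (rule box_average_Lp(2)[OF ab(1) Ldu]) simp
  moreover have "pdist 2 (box_average a b u) u \<le> e / 16"
    by (rule box_average_close[OF ab(1) u(1)]) (use \<delta>(2) hsm e in \<open>auto intro: less_imp_le\<close>)
  ultimately have "pdist 2 ?w u \<le> 4 * (pdist 2 (\<phi> n) u + e / 16)" by simp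
  also have "\<dots> < e" using n(1) e by simp
  finally show "\<exists>w. Lp 2 w \<and> Lp q w \<and> pint q w \<le> (3 * (R + 1)) powr q * (2 powr q * (1 + pint q g)) \<and> pdist 2 w u < e"
    using Lw wB unfolding B_def by blast
qed

text \<open>By Poincare's inequality the functions are Cauchy because their gradients are. The
  sequence is given from outside, so that potential and gradient are limits along the same test
  functions.\<close>

lemma grad_closure_potential:
  assumes g: "grad_closure p \<Omega> g" and \<Omega>: "bounded \<Omega>" "\<Omega> \<in> sets borel" and p: "1 \<le> p"
    and \<phi>: "\<And>n::nat. test_function \<Omega> (\<phi> n)" "(\<lambda>n. pdist p (gradient (\<phi> n)) g) \<longlonglongrightarrow> 0"
  shows "\<exists>u. Lp p u \<and> (\<forall>x. x \<notin> \<Omega> \<longrightarrow> u x = 0) \<and> (\<lambda>n. pdist p (\<phi> n) u) \<longlonglongrightarrow> 0"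
proof -
  obtain R where R: "0 < R" "\<Omega> \<subseteq> cball 0 R" using \<Omega>(1) unfolding bounded_pos by (auto simp: subset_iff)
  have p0: "0 < p" using p by simp
  have L: "Lp p (\<phi> n)" "Lp p (gradient (\<phi> n))" for n using test_function_Lp[OF \<phi>(1) p0] by auto
  have gL: "Lp p g" by (rule grad_closure_Lp[OF g])
  define c where "c = (3 * R) powr p * 2 powr p"
  have c: "c > 0" using R by (simp add: c_def)
  have diff: "pdist p (\<phi> n) (\<phi> m) \<le> c * (pdist p (gradient (\<phi> n)) g + pdist p (gradient (\<phi> m)) g)" for n m
  proof -
    have t: "test_function \<Omega> (\<lambda>x. \<phi> n x - \<phi> m x)" by (intro test_function_diff \<phi>)
    have gr: "gradient (\<lambda>x. \<phi> n x - \<phi> m x) = (\<lambda>x. (gradient (\<phi> n) x - g x) - (gradient (\<phi> m) x - g x))"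
      by (rule ext) (simp add: gradient_diff[OF test_function_smooth[OF \<phi>(1)] test_function_smooth[OF \<phi>(1)]])
    have "pdist p (\<phi> n) (\<phi> m) \<le> (3 * R) powr p * pint p (gradient (\<lambda>x. \<phi> n x - \<phi> m x))"
      by (rule Poincare_test[OF t R(2,1) p])
    also have "\<dots> \<le> (3 * R) powr p * (2 powr p * (pdist p (gradient (\<phi> n)) g + pdist p (gradient (\<phi> m)) g))"
      unfolding gr by (intro mult_left_mono Lp_diff L gL p0) auto
    finally show ?thesis by (simp add: c_def mult.assoc)
  qed
  have Cauchy: "\<exists>N. \<forall>m\<ge>N. \<forall>n\<ge>N. pdist p (\<phi> m) (\<phi> n) < e" if e: "0 < e" for e
  proof -
    have "0 < e / (2 * c)" using e c by simp
    from order_tendstoD(2)[OF \<phi>(2) this] obtain N where N: "\<And>n. n \<ge> N \<Longrightarrow> pdist p (gradient (\<phi> n)) g < e / (2 * c)"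
      by (auto simp: eventually_sequentially)
    have "pdist p (\<phi> m) (\<phi> n) < e" if "m \<ge> N" "n \<ge> N" for m n
    proof -
      have "c * (pdist p (gradient (\<phi> m)) g + pdist p (gradient (\<phi> n)) g) < c * (e / (2 * c) + e / (2 * c))"
        using N[OF that(1)] N[OF that(2)] c by (intro mult_strict_left_mono add_strict_mono) auto
      also have "\<dots> = e" using c by simp
      finally show ?thesis using diff[of m n] by linarith
    qed
    then show ?thesis by blast
  qed
  have z: "\<phi> n x = 0" if "x \<notin> \<Omega>" for n x using test_functionE(2)[OF \<phi>(1)[of n]] that by blast
  obtain u where "Lp p u" "\<And>x. x \<notin> \<Omega> \<Longrightarrow> u x = 0" "(\<lambda>n. pdist p (\<phi> n) u) \<longlonglongrightarrow> 0"
    by (rule Lp_complete[of p \<phi> \<Omega>]) (use L z \<Omega> p Cauchy in auto)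
  then show ?thesis by blast
qed

lemma grad_closure_sum:
  fixes \<Omega> :: "'a::euclidean_space set"
  assumes "finite I" "\<And>i. i \<in> I \<Longrightarrow> grad_closure p \<Omega> (G i)" "0 < p"
  shows "grad_closure p \<Omega> (\<lambda>x. \<Sum>i\<in>I. G i x)"
  using assms(1,2)
proof (induction I rule: finite_induct)
  case empty
  have "gradient (\<lambda>x::'a. 0) = (\<lambda>x. 0)" by (auto simp: gradient_const)
  with grad_closure_test[OF test_function_0 assms(3), of \<Omega>] show ?case by (simp only: sum.empty)
next
  case (insert i I)
  then show ?case using grad_closure_add[OF _ _ assms(3), of \<Omega> "G i" "\<lambda>x. \<Sum>i\<in>I. G i x"] by simp
qed

text \<open>Yields a partition of unity from cutoffs without any division: where one of the factors
  \<open>1 - \<eta> j\<close> vanishes, the sum is 1.\<close>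

lemma partition_telescope:
  fixes \<eta> :: "nat \<Rightarrow> real"
  shows "(\<Sum>i<N. \<eta> i * (\<Prod>j<i. 1 - \<eta> j)) = 1 - (\<Prod>j<N. 1 - \<eta> j)"
  by (induction N) (auto simp: algebra_simps)

text \<open>Localize by a partition of unity, move each piece into \<open>\<Omega>\<close> along the cone, and smooth it by averaging
  over a small box of translations.\<close>

lemma grad_closure_upgrade:
  fixes g :: "'a::euclidean_space \<Rightarrow> 'a"
  assumes uc: "uniform_cone \<Omega> r0 \<kappa>" and \<Omega>: "bounded \<Omega>" "open \<Omega>" and gc: "grad_closure 2 \<Omega> g"
    and gq: "Lp q g" and q: "2 \<le> q"
  shows "grad_closure q \<Omega> g"
proof -
  have q0: "0 < q" "1 \<le> q" using q by auto
  have r0: "r0 > 0" and \<kappa>: "0 < \<kappa>" "\<kappa> < 1" using uc by (auto simp: uniform_cone_def)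
  have \<Omega>b: "\<Omega> \<in> sets borel" using \<Omega>(2) by simp
  have gL: "Lp 2 g" by (rule grad_closure_Lp[OF gc])
  have g0: "g x = 0" if "x \<notin> \<Omega>" for x by (rule grad_closure_0[OF gc that])
  obtain R where R: "0 < R" "\<Omega> \<subseteq> cball 0 R" using \<Omega>(1) unfolding bounded_pos by (auto simp: subset_iff)
  obtain \<phi> where \<phi>: "\<And>n. test_function \<Omega> (\<phi> n)" "(\<lambda>n. pdist 2 (gradient (\<phi> n)) g) \<longlonglongrightarrow> 0"
    using grad_closure_approx[OF gc] by blast
  obtain u where u: "Lp 2 u" "\<And>x. x \<notin> \<Omega> \<Longrightarrow> u x = 0" "(\<lambda>n. pdist 2 (\<phi> n) u) \<longlonglongrightarrow> 0"
    using grad_closure_potential[OF gc \<Omega>(1) \<Omega>b _ \<phi>] by auto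
  have uq: "Lp q u" by (rule potential_higher_integrability[OF \<phi>(1) R(2,1) q u(1,3) gL gq \<phi>(2)])
  have L\<phi>: "Lp 2 (\<phi> n)" "Lp 2 (gradient (\<phi> n))" for n using test_function_Lp[OF \<phi>(1)] by auto
  have sm: "smooth (\<phi> n)" for n by (rule test_function_smooth[OF \<phi>(1)])
  \<comment> \<open>The pieces are supported in balls of radius \<open>2 * \<rho> < r0\<close>,
    where a single cone direction serves.\<close>
  define \<rho> where "\<rho> = r0 / 3"
  have \<rho>: "\<rho> > 0" using r0 by (simp add: \<rho>_def)
  have "cball (0::'a) (R + 1) \<subseteq> (\<Union>x\<in>cball 0 (R + 1). ball x \<rho>)" using \<rho> by force
  then obtain X where X: "X \<subseteq> cball 0 (R + 1)" "finite X" "cball (0::'a) (R + 1) \<subseteq> (\<Union>x\<in>X. ball x \<rho>)"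
    using compactE_image[OF compact_cball, of "cball 0 (R + 1)" "\<lambda>x. ball x \<rho>"] by (metis open_ball)
  obtain xs where xs: "set xs = X" using finite_list[OF X(2)] by blast
  define N where "N = length xs"
  define \<eta> where "\<eta> i = cutoff (xs ! i) \<rho> (2 * \<rho>)" for i
  define \<theta> where "\<theta> i y = \<eta> i y * (\<Prod>j<i. 1 - \<eta> j y)" for i y
  have \<theta>sm: "smooth (\<theta> i)" for i
    unfolding \<theta>_def \<eta>_def by (intro smooth_mult smooth_cutoff smooth_prod smooth_diff smooth_const) auto
  have \<theta>0: "\<theta> i y = 0" if "y \<notin> cball (xs ! i) (2 * \<rho>)" for i y using that \<rho> by (simp add: \<theta>_def \<eta>_def cutoff_0)
  have \<theta>test: "test_function UNIV (\<theta> i)" for i by (rule test_functionI[OF \<theta>sm compact_cball _ \<theta>0]) auto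
  have \<theta>sum: "(\<Sum>i<N. \<theta> i y) = 1" if y: "y \<in> cball 0 (R + 1)" for y
  proof -
    obtain x where "x \<in> X" "y \<in> ball x \<rho>" using X(3) y by blast
    then obtain j where j: "j < N" "y \<in> ball (xs ! j) \<rho>" using xs by (auto simp: N_def in_set_conv_nth)
    then have "\<eta> j y = 1" using \<rho> by (simp add: \<eta>_def cutoff_1)
    then have "(\<Prod>j<N. 1 - \<eta> j y) = 0" using j(1) by (intro prod_zero) auto
    then show ?thesis using partition_telescope[of "\<lambda>i. \<eta> i y" N] by (simp add: \<theta>_def)
  qed
  \<comment> \<open>The sum of the \<open>\<theta> i\<close> is constant near points of
    \<open>\<Omega>\<close>. Therefore the terms with \<open>u\<close> cancel, and the pieces
    \<open>F i\<close> add up to \<open>g\<close>.\<close>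
  have \<theta>gsum: "(\<Sum>i<N. gradient (\<theta> i) y) = 0" if y: "y \<in> \<Omega>" for y
  proof -
    have "gradient (\<lambda>y. \<Sum>i<N. \<theta> i y) y = 0"
    proof (rule gradient_eqI)
      have "((\<lambda>y. 1) has_derivative (\<lambda>v. 0 \<bullet> v)) (at y)" by simp
      then show "((\<lambda>y. \<Sum>i<N. \<theta> i y) has_derivative (\<lambda>v. 0 \<bullet> v)) (at y)"
        by (rule has_derivative_transform_within_open[of _ _ _ _ "ball 0 (R + 1)"]) (use y R \<theta>sum in \<open>force+\<close>)
    qed
    then show ?thesis using gradient_sum[of "{..<N}" \<theta> y] \<theta>sm by simp
  qed
  define F where "F i y = \<theta> i y *\<^sub>R g y + u y *\<^sub>R gradient (\<theta> i) y" for i y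
  define Fn where "Fn i n = gradient (\<lambda>y. \<theta> i y * \<phi> n y)" for i n
  have Fn: "Fn i n y = \<theta> i y *\<^sub>R gradient (\<phi> n) y + \<phi> n y *\<^sub>R gradient (\<theta> i) y" for i n y
    unfolding Fn_def by (rule gradient_mult[OF \<theta>sm sm])
  have part: "grad_closure q \<Omega> (F i)" for i
  proof -
    obtain M where M: "0 < M" "\<And>y. \<bar>\<theta> i y\<bar> \<le> M" "\<And>y. norm (gradient (\<theta> i) y) \<le> M"
      using test_function_bounded[OF \<theta>test[of i]] by blast
    have [measurable]: "\<theta> i \<in> borel_measurable borel" "gradient (\<theta> i) \<in> borel_measurable borel"
      using \<theta>sm by (auto intro: borel_smooth borel_gradient)
    have mult: "Lp p (\<lambda>y. \<theta> i y *\<^sub>R G y + v y *\<^sub>R gradient (\<theta> i) y) \<and>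
        pint p (\<lambda>y. \<theta> i y *\<^sub>R G y + v y *\<^sub>R gradient (\<theta> i) y) \<le> 2 powr p * M powr p * (pint p G + pint p v)"
      if G: "Lp p G" and v: "Lp p v" and p: "0 < p" for p and G :: "'a \<Rightarrow> 'a" and v :: "'a \<Rightarrow> real"
    proof -
      have [measurable]: "G \<in> borel_measurable borel" "v \<in> borel_measurable borel" using G v by (auto dest: Lp_borel)
      have l1: "norm (\<theta> i y *\<^sub>R G y) \<le> M * norm (G y)" for y using M(2)[of y] by (simp add: mult_right_mono)
      have l2: "norm (v y *\<^sub>R gradient (\<theta> i) y) \<le> M * norm (v y)" for y
        using mult_left_mono[OF M(3)[of y], of "\<bar>v y\<bar>"] by (simp add: mult.commute)
      have b1: "Lp p (\<lambda>y. \<theta> i y *\<^sub>R G y)" "pint p (\<lambda>y. \<theta> i y *\<^sub>R G y) \<le> M powr p * pint p G"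
        using Lp_bound[OF G _ l1 _ p] M(1) by auto
      have b2: "Lp p (\<lambda>y. v y *\<^sub>R gradient (\<theta> i) y)" "pint p (\<lambda>y. v y *\<^sub>R gradient (\<theta> i) y) \<le> M powr p * pint p v"
        using Lp_bound[OF v _ l2 _ p] M(1) by auto
      have "pint p (\<lambda>y. \<theta> i y *\<^sub>R G y + v y *\<^sub>R gradient (\<theta> i) y) \<le> 2 powr p * (pint p (\<lambda>y. \<theta> i y *\<^sub>R G y) + pint p (\<lambda>y. v y *\<^sub>R gradient (\<theta> i) y))"
        by (rule Lp_add(2)[OF b1(1) b2(1) p])
      also have "\<dots> \<le> 2 powr p * (M powr p * pint p G + M powr p * pint p v)" using b1(2) b2(2) by (intro mult_left_mono add_mono) auto
      finally show ?thesis using Lp_add(1)[OF b1(1) b2(1) p] by (simp add: algebra_simps)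
    qed
    have LF: "Lp 2 (F i)" "Lp q (F i)" unfolding F_def using mult[OF gL u(1)] mult[OF gq uq] q by auto
    have LFn: "Lp 2 (Fn i n)" for n unfolding Fn[abs_def] using mult[OF L\<phi>(2) L\<phi>(1)] by auto
    have LE: "Lp 2 (\<lambda>y. Fn i n y - F i y)" for n by (intro Lp_diff LFn LF) auto
    have lim: "(\<lambda>n. pdist 2 (Fn i n) (F i)) \<longlonglongrightarrow> 0"
    proof (rule tendsto_sandwich[OF _ _ tendsto_const])
      show "\<forall>\<^sub>F n in sequentially. pdist 2 (Fn i n) (F i) \<le> 2 powr 2 * M powr 2 * (pdist 2 (gradient (\<phi> n)) g + pdist 2 (\<phi> n) u)"
      proof (intro always_eventually allI)
        fix n
        have eq: "Fn i n y - F i y = \<theta> i y *\<^sub>R (gradient (\<phi> n) y - g y) + (\<phi> n y - u y) *\<^sub>R gradient (\<theta> i) y" for y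
          by (simp add: Fn F_def algebra_simps)
        show "pdist 2 (Fn i n) (F i) \<le> 2 powr 2 * M powr 2 * (pdist 2 (gradient (\<phi> n)) g + pdist 2 (\<phi> n) u)"
          unfolding eq by (rule conjunct2[OF mult]) (auto intro!: Lp_diff L\<phi> gL u)
      qed
      show "(\<lambda>n. 2 powr 2 * M powr 2 * (pdist 2 (gradient (\<phi> n)) g + pdist 2 (\<phi> n) u)) \<longlonglongrightarrow> 0"
        using tendsto_mult_right_zero[OF tendsto_add[OF \<phi>(2) u(3), simplified], of "2 powr 2 * M powr 2"] .
    qed auto
    have tn: "test_function \<Omega> (\<lambda>y. \<theta> i y * \<phi> n y)" for n by (rule test_function_mult[OF \<theta>sm \<phi>(1)])
    have tc: "translation_continuous q (F i)"
    proof (rule translation_continuous_higher[OF LF q], rule translation_continuous_limit[OF LF(1)])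
      fix d :: real assume d: "0 < d"
      show "\<exists>G. Lp 2 G \<and> translation_continuous 2 G \<and> pdist 2 G (F i) < d"
        using tendsto_pint_ex[OF lim d, of "\<lambda>G. Lp 2 G \<and> translation_continuous 2 G"] LFn
          test_function_translation_continuous(2)[OF tn] unfolding Fn_def by blast
    qed
    show ?thesis
    proof (rule grad_closureI[OF q0(1) LF(2)])
      show "F i y = 0" if "y \<notin> \<Omega>" for y using g0[OF that] u(2)[OF that] by (simp add: F_def)
      fix e :: real assume e: "0 < e"
      define d where "d = e / (2 * 2 powr q)"
      have d: "d > 0" using e by (simp add: d_def)
      obtain \<delta> where \<delta>: "\<delta> > 0" "\<And>h. norm h < \<delta> \<Longrightarrow> pint q (\<lambda>y. F i (y - h) - F i y) < d"
        using tc d unfolding translation_continuous_def by blast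
      obtain w where w: "norm w = 1" and cone: "\<And>y t h. y \<in> \<Omega> \<inter> ball (xs ! i) r0 \<Longrightarrow> 0 < t \<Longrightarrow> t < r0 \<Longrightarrow> h \<in> ball (t *\<^sub>R w) (\<kappa> * t) \<Longrightarrow> y + h \<in> \<Omega>"
        using uc unfolding uniform_cone_def by meson
      \<comment> \<open>Short enough that all translations of the box have norm below
        \<open>\<delta>\<close>, and below \<open>r0\<close> for the cone condition. The box is
        fixed before \<open>n\<close>, because its volume determines how close \<open>Fn i n\<close>
        must be to \<open>F i\<close> in L^2.\<close>
      define t where "t = min (\<delta> / 4) (r0 / 2)"
      have t: "0 < t" "t < r0" "2 * t < \<delta>" using \<delta>(1) r0 by (auto simp: t_def)
      have "0 < \<kappa> * t" using \<kappa> t by simp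
      from box_in_ball[OF this, of "t *\<^sub>R w"]
      obtain a b where ab: "0 < measure lborel (cbox a b)" "cbox a b \<subseteq> ball (t *\<^sub>R w) (\<kappa> * t)" by blast
      have hn: "norm h < \<delta>" if "h \<in> cbox a b" for h
      proof -
        have "norm h \<le> norm (t *\<^sub>R w) + norm (h - t *\<^sub>R w)" using norm_triangle_ineq[of "t *\<^sub>R w" "h - t *\<^sub>R w"] by simp
        also have "norm (h - t *\<^sub>R w) \<le> \<kappa> * t" using that ab(2) by (auto simp: dist_norm norm_minus_commute less_imp_le)
        also have "\<kappa> * t \<le> 1 * t" using \<kappa> t by (intro mult_right_mono) auto
        finally show ?thesis using w t by simp
      qed
      have "\<forall>\<^sub>F n in sequentially. pint q (box_average a b (\<lambda>y. Fn i n y - F i y)) < d"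
        by (rule box_average_small[OF ab(1) LE lim q d])
      then obtain n where n: "pint q (box_average a b (\<lambda>y. Fn i n y - F i y)) < d"
        by (auto simp: eventually_sequentially)
      let ?\<psi> = "box_average a b (\<lambda>y. \<theta> i y * \<phi> n y)"
      obtain K where K: "compact K" "K \<subseteq> \<Omega>" "\<And>x. x \<notin> K \<Longrightarrow> \<phi> n x = 0" using test_functionE(2)[OF \<phi>(1)[of n]] by blast
      have t\<psi>: "test_function \<Omega> ?\<psi>"
      proof (rule test_function_box_average[OF ab(1) tn, where K="K \<inter> cball (xs ! i) (2 * \<rho>)"])
        show "compact (K \<inter> cball (xs ! i) (2 * \<rho>))" using K(1) by auto
        show "\<theta> i x * \<phi> n x = 0" if "x \<notin> K \<inter> cball (xs ! i) (2 * \<rho>)" for x using that K(3)[of x] \<theta>0[of x i] by auto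
        show "x + h \<in> \<Omega>" if "x \<in> K \<inter> cball (xs ! i) (2 * \<rho>)" "h \<in> cbox a b" for x h
          by (rule cone[OF _ t(1,2)]) (use that K(2) ab(2) r0 in \<open>auto simp: \<rho>_def\<close>)
      qed
      have eq: "gradient ?\<psi> y - F i y = box_average a b (\<lambda>y. Fn i n y - F i y) y + (box_average a b (F i) y - F i y)" for y
        using gradient_box_average[OF ab(1) test_function_smooth[OF tn]] box_average_diff[OF ab(1) LFn LF(1)]
        by (simp add: Fn_def)
      have "pdist q (gradient ?\<psi>) (F i) \<le> 2 powr q * (pint q (box_average a b (\<lambda>y. Fn i n y - F i y)) + pdist q (box_average a b (F i)) (F i))"
        unfolding eq by (intro Lp_add Lp_diff box_average_higher(1)[OF ab(1) LE q] box_average_Lp[OF ab(1) LF(2)] LF q0)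
      also have "\<dots> < 2 powr q * (d + d)"
      proof (intro mult_strict_left_mono add_less_le_mono n)
        show "pdist q (box_average a b (F i)) (F i) \<le> d"
          by (rule box_average_close[OF ab(1) LF(2) q0(2)]) (use \<delta>(2) hn d in \<open>auto intro: less_imp_le\<close>)
      qed simp
      also have "\<dots> = e" by (simp add: d_def)
      finally show "\<exists>\<psi>. test_function \<Omega> \<psi> \<and> pdist q (gradient \<psi>) (F i) < e" using t\<psi> by blast
    qed
  qed
  have "(\<Sum>i<N. F i y) = g y" for y
  proof (cases "y \<in> \<Omega>")
    case True
    then have "y \<in> cball 0 (R + 1)" using R by auto
    then have "(\<Sum>i<N. \<theta> i y) *\<^sub>R g y + u y *\<^sub>R (\<Sum>i<N. gradient (\<theta> i) y) = g y" by (simp add: \<theta>sum \<theta>gsum[OF True])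
    then show ?thesis by (simp add: F_def sum.distrib scaleR_sum_left scaleR_sum_right)
  next
    case False
    then show ?thesis using g0 u(2) by (simp add: F_def)
  qed
  then have "(\<lambda>y. \<Sum>i<N. F i y) = g" by auto
  then show ?thesis using grad_closure_sum[of "{..<N}" q \<Omega> F] part q0 by simp
qed

section \<open>The cone condition for the perforated ball\<close>

lemma uniform_cone_mono:
  assumes "uniform_cone \<Omega> r \<kappa>" "0 < r'" "r' \<le> r" "0 < \<kappa>'" "\<kappa>' \<le> \<kappa>"
  shows "uniform_cone \<Omega> r' \<kappa>'"
  unfolding uniform_cone_def
proof (intro conjI allI)
  show "\<kappa>' < 1" using assms by (simp add: uniform_cone_def)
  fix x
  obtain e where e: "norm e = 1" "\<And>y t h. y \<in> \<Omega> \<inter> ball x r \<Longrightarrow> 0 < t \<Longrightarrow> t < r \<Longrightarrow> h \<in> ball (t *\<^sub>R e) (\<kappa> * t) \<Longrightarrow> y + h \<in> \<Omega>"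
    using assms(1) unfolding uniform_cone_def by meson
  show "\<exists>e. norm e = 1 \<and> (\<forall>y\<in>\<Omega> \<inter> ball x r'. \<forall>t. 0 < t \<and> t < r' \<longrightarrow> (\<forall>h\<in>ball (t *\<^sub>R e) (\<kappa>' * t). y + h \<in> \<Omega>))"
  proof (intro exI[of _ e] conjI ballI allI impI e(1))
    fix y t h assume *: "y \<in> \<Omega> \<inter> ball x r'" "0 < t \<and> t < r'" "h \<in> ball (t *\<^sub>R e) (\<kappa>' * t)"
    have "\<kappa>' * t \<le> \<kappa> * t" using * assms by (intro mult_right_mono) auto
    then have "h \<in> ball (t *\<^sub>R e) (\<kappa> * t)" using *(3) by simp
    then show "y + h \<in> \<Omega>" using * assms by (intro e(2)[of y t h]) auto
  qed
qed (use assms in auto)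

lemma cone_norm_le:
  assumes "norm e = 1" "0 < t" "\<kappa> \<le> 1" "h \<in> ball (t *\<^sub>R e) (\<kappa> * t)"
  shows "norm h < 2 * t"
proof -
  have "norm h \<le> norm (t *\<^sub>R e) + norm (h - t *\<^sub>R e)" using norm_triangle_ineq[of "t *\<^sub>R e" "h - t *\<^sub>R e"] by simp
  also have "norm (h - t *\<^sub>R e) < \<kappa> * t" using assms(4) by (simp add: dist_norm norm_minus_commute)
  also have "\<kappa> * t \<le> 1 * t" using assms by (intro mult_right_mono) auto
  finally show ?thesis using assms by simp
qed

text \<open>If \<open>norm x \<le> 1 / 2\<close>, any direction works, since points move by less
  than 1/4. Otherwise the direction is \<open>- x / |x|\<close>: then
  \<open>y \<bullet> h \<le> - t / 4\<close> and \<open>|h|\<^sup>2 \<le> t / 4\<close>, so the norm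
  does not increase.\<close>

lemma uniform_cone_ball: "uniform_cone (ball (0::'a::euclidean_space) 1) (1 / 8) (1 / 8)"
  unfolding uniform_cone_def
proof (intro conjI allI)
  fix x :: 'a
  show "\<exists>e. norm e = 1 \<and> (\<forall>y\<in>ball 0 1 \<inter> ball x (1 / 8). \<forall>t. 0 < t \<and> t < 1 / 8 \<longrightarrow> (\<forall>h\<in>ball (t *\<^sub>R e) (1 / 8 * t). y + h \<in> ball 0 1))"
  proof (cases "norm x \<le> 1 / 2")
    case True
    obtain b :: 'a where b: "b \<in> Basis" using nonempty_Basis by blast
    show ?thesis
    proof (intro exI[of _ b] conjI ballI allI impI)
      show "norm b = 1" using b by simp
      fix y h t assume *: "y \<in> ball 0 1 \<inter> ball x (1 / 8)" "0 < t \<and> t < 1 / 8" "h \<in> ball (t *\<^sub>R b) (1 / 8 * t)"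
      have "norm h < 2 * t" by (rule cone_norm_le[of b t "1/8"]) (use * b in auto)
      moreover have "norm y \<le> norm x + norm (y - x)" using norm_triangle_ineq[of x "y - x"] by simp
      moreover have "norm (y - x) < 1 / 8" using * by (simp add: dist_norm norm_minus_commute)
      ultimately have "norm (y + h) < 1" using norm_triangle_ineq[of y h] True *(2) by linarith
      then show "y + h \<in> ball 0 1" by simp
    qed
  next
    case False
    define e where "e = - (x /\<^sub>R norm x)"
    have x0: "norm x > 0" using False by linarith
    show ?thesis
    proof (intro exI[of _ e] conjI ballI allI impI)
      show e1: "norm e = 1" using x0 by (simp add: e_def)
      fix y h t assume *: "y \<in> ball 0 1 \<inter> ball x (1 / 8)" "0 < t \<and> t < 1 / 8" "h \<in> ball (t *\<^sub>R e) (1 / 8 * t)"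
      define b where "b = h - t *\<^sub>R e"
      have b: "norm b < t / 8" using *(3) by (simp add: b_def dist_norm norm_minus_commute)
      have ny: "norm y < 1" and d: "norm (y - x) < 1 / 8" using *(1) by (auto simp: dist_norm norm_minus_commute)
      have hn: "norm h < 2 * t" by (rule cone_norm_le[of e t "1/8"]) (use * e1 in auto)
      have nh: "norm h \<le> 9 / 8 * t" using norm_triangle_ineq[of "t *\<^sub>R e" b] b e1 *(2) by (simp add: b_def)
      have ye: "y \<bullet> e \<le> - 1 / 2 + 1 / 8"
      proof -
        have "y \<bullet> e = x \<bullet> e + (y - x) \<bullet> e" by (simp add: inner_diff_left)
        also have "x \<bullet> e = - norm x" using x0 by (simp add: e_def power2_norm_eq_inner[symmetric] power2_eq_square)
        also have "(y - x) \<bullet> e \<le> norm (y - x) * norm e" by (rule norm_cauchy_schwarz)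
        finally show ?thesis using False d e1 by simp
      qed
      have yb: "y \<bullet> b \<le> t / 8"
      proof -
        have "y \<bullet> b \<le> norm y * norm b" by (rule norm_cauchy_schwarz)
        also have "\<dots> \<le> 1 * (t / 8)" using ny b by (intro mult_mono) auto
        finally show ?thesis by simp
      qed
      have "y \<bullet> h = t * (y \<bullet> e) + y \<bullet> b" by (simp add: b_def inner_diff_right)
      also have "\<dots> \<le> t * (- 1 / 2 + 1 / 8) + t / 8" using *(2) by (intro add_mono mult_left_mono ye yb) auto
      finally have yh: "y \<bullet> h \<le> - (t / 4)" by simp
      have "(norm h)\<^sup>2 \<le> (9 / 8 * t)\<^sup>2" using nh by (intro power_mono) auto
      also have "\<dots> \<le> 2 * t * t" by (simp add: power2_eq_square)
      also have "\<dots> \<le> 2 * t * (1 / 8)" using *(2) by (intro mult_left_mono) auto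
      finally have h2: "(norm h)\<^sup>2 \<le> t / 4" by simp
      have "(norm (y + h))\<^sup>2 = (norm y)\<^sup>2 + 2 * (y \<bullet> h) + (norm h)\<^sup>2"
        by (simp add: power2_norm_eq_inner algebra_simps inner_commute)
      also have "\<dots> \<le> (norm y)\<^sup>2" using yh h2 *(2) by linarith
      also have "\<dots> < 1" using ny by (simp add: power_less_one_iff)
      finally have "norm (y + h) < 1" by (simp add: power_less_one_iff)
      then show "y + h \<in> ball 0 1" by simp
    qed
  qed
qed auto

text \<open>\<open>P\<close> is the height of the graph above the point, positive exactly outside
  the closure in this ball. Moving by \<open>t\<close> against \<open>e\<close> raises it by
  \<open>t\<close>, and an error of size \<open>\<kappa> * t\<close> costs at most
  \<open>(1 + L) * \<kappa> * t\<close>, which the choice of \<open>\<kappa>\<close> keeps below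
  \<open>t\<close>.\<close>

lemma lipschitz_chart_cone:
  assumes r: "0 < r" and e: "norm e = 1" and L: "L-lipschitz_on {y. y \<bullet> e = 0} \<gamma>"
    and chart: "D \<inter> ball x r = {y \<in> ball x r. \<gamma> (y - (y \<bullet> e) *\<^sub>R e) < y \<bullet> e}"
    and y: "y \<in> ball x (r / 4)" "y \<notin> closure D" and t: "0 < t" "t < r / 4"
    and h: "h \<in> ball (t *\<^sub>R (- e)) (1 / (2 * (1 + L)) * t)"
  shows "y + h \<notin> closure D"
proof -
  have L0: "0 \<le> L" using L by (rule lipschitz_on_nonneg)
  have ee: "e \<bullet> e = 1" using e by (simp add: norm_eq_1)
  define \<pi> where "\<pi> y = y - (y \<bullet> e) *\<^sub>R e" for y
  have \<pi>0: "\<pi> y \<in> {y. y \<bullet> e = 0}" for y by (simp add: \<pi>_def inner_diff_left ee)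
  define P where "P y = \<gamma> (\<pi> y) - y \<bullet> e" for y
  have c\<pi>: "continuous_on UNIV \<pi>" unfolding \<pi>_def by (intro continuous_intros)
  have cP: "continuous_on UNIV P" unfolding P_def
    by (intro continuous_intros continuous_on_compose2[OF lipschitz_on_continuous_on[OF L] c\<pi>]) (use \<pi>0 in auto)
  have D: "z \<in> D \<longleftrightarrow> P z < 0" if "z \<in> ball x r" for z using chart that unfolding P_def \<pi>_def by (auto simp: set_eq_iff)
  have out: "z \<notin> closure D" if z: "z \<in> ball x r" "0 < P z" for z
  proof -
    have "open (ball x r \<inter> {z. 0 < P z})" by (intro open_Int open_ball open_Collect_less continuous_on_const cP)
    moreover have "(ball x r \<inter> {z. 0 < P z}) \<inter> D = {}" using D by force
    ultimately have "(ball x r \<inter> {z. 0 < P z}) \<inter> closure D = {}" by (simp add: open_Int_closure_eq_empty)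
    then show ?thesis using z by blast
  qed
  have yr: "y \<in> ball x r" using y(1) r by simp
  \<comment> \<open>If \<open>P y \<le> 0\<close>, arbitrarily small steps along \<open>e\<close>
    enter \<open>D\<close>, so \<open>y\<close> would lie in its closure.\<close>
  have Py: "0 < P y"
  proof (rule ccontr)
    assume "\<not> 0 < P y"
    then have Py: "P y \<le> 0" by simp
    have "y \<in> closure D" unfolding closure_approachable
    proof (intro allI impI)
      fix d :: real assume d: "0 < d"
      define s where "s = min (d / 2) (r / 2)"
      have s: "0 < s" "s < d" "s \<le> r / 2" using d r by (auto simp: s_def)
      have "P (y + s *\<^sub>R e) = P y - s"
      proof -
        have "\<pi> (y + s *\<^sub>R e) = \<pi> y" by (simp add: \<pi>_def inner_add_left ee algebra_simps)
        then show ?thesis by (simp add: P_def inner_add_left ee)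
      qed
      then have "P (y + s *\<^sub>R e) < 0" using Py s by simp
      moreover have "y + s *\<^sub>R e \<in> ball x r"
      proof -
        have "dist x (y + s *\<^sub>R e) \<le> dist x y + dist y (y + s *\<^sub>R e)" by (rule dist_triangle)
        also have "dist y (y + s *\<^sub>R e) = s" using s e by (simp add: dist_norm)
        finally show ?thesis using y(1) s r by simp
      qed
      ultimately have "y + s *\<^sub>R e \<in> D" using D by blast
      moreover have "dist (y + s *\<^sub>R e) y < d" using s e by (simp add: dist_norm)
      ultimately show "\<exists>z\<in>D. dist z y < d" by blast
    qed
    then show False using y(2) by simp
  qed
  define b where "b = h + t *\<^sub>R e"
  define \<kappa> where "\<kappa> = 1 / (2 * (1 + L))"
  have \<kappa>: "0 < \<kappa>" "\<kappa> * (1 + L) \<le> 1" "\<kappa> \<le> 1" using L0 by (auto simp: \<kappa>_def field_simps)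
  have "norm (- (h + t *\<^sub>R e)) < \<kappa> * t" using h by (simp add: dist_norm \<kappa>_def minus_diff_commute add.commute)
  then have b: "norm b \<le> \<kappa> * t" by (simp only: norm_minus_cancel b_def)
  have \<pi>b: "norm (\<pi> b) \<le> norm b"
  proof -
    have "(norm (\<pi> b))\<^sup>2 = (norm b)\<^sup>2 - (b \<bullet> e)\<^sup>2" unfolding power2_norm_eq_inner \<pi>_def
      by (simp add: inner_diff_left inner_diff_right ee inner_commute power2_eq_square)
    also have "\<dots> \<le> (norm b)\<^sup>2" by simp
    finally show ?thesis by (simp add: power2_le_iff_abs_le)
  qed
  have "\<pi> (y + h) - \<pi> y = \<pi> b" by (simp add: \<pi>_def b_def inner_add_left ee algebra_simps)
  then have "dist (\<gamma> (\<pi> (y + h))) (\<gamma> (\<pi> y)) \<le> L * norm (\<pi> b)"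
    using lipschitz_onD[OF L \<pi>0 \<pi>0, of "y + h" y] by (simp add: dist_norm)
  also have "\<dots> \<le> L * (\<kappa> * t)" using L0 \<pi>b b by (intro mult_left_mono) auto
  finally have g: "\<gamma> (\<pi> y) - L * (\<kappa> * t) \<le> \<gamma> (\<pi> (y + h))" by (simp add: dist_real_def abs_le_iff)
  have "b \<bullet> e \<le> norm b * norm e" by (rule norm_cauchy_schwarz)
  then have be: "b \<bullet> e \<le> \<kappa> * t" using b e by simp
  have "h \<bullet> e = b \<bullet> e - t" by (simp add: b_def inner_add_left ee)
  then have "P (y + h) \<ge> P y + (t - (\<kappa> * (1 + L)) * t)" using g be by (simp add: P_def inner_add_left algebra_simps)
  moreover have "(\<kappa> * (1 + L)) * t \<le> 1 * t" using \<kappa> t by (intro mult_right_mono) auto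
  ultimately have "0 < P (y + h)" using Py by simp
  moreover have "y + h \<in> ball x r"
  proof -
    have "norm h < 2 * t" by (rule cone_norm_le[of "- e" t \<kappa>]) (use e t \<kappa> h in \<open>auto simp: \<kappa>_def\<close>)
    moreover have "dist x (y + h) \<le> dist x y + norm h" using dist_triangle[of x "y + h" y] by (simp add: dist_norm)
    ultimately show ?thesis using y(1) t by simp
  qed
  ultimately show ?thesis using out by blast
qed

text \<open>Near the boundary a finite subcover of charts supplies the directions. Away from it any
  direction works, since a ball that meets both \<open>T\<close> and its complement must meet the
  boundary by connectedness.\<close>

lemma uniform_cone_complement:
  fixes T :: "'a::euclidean_space set"
  assumes "closed_lipschitz_domain T"
  shows "\<exists>r \<kappa>. uniform_cone (- T) r \<kappa>"
proof -
  obtain D where D: "lipschitz_domain D" "T = closure D" using assms by (auto simp: closed_lipschitz_domain_def)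
  have comp: "compact (frontier D)" using D(1) by (simp add: lipschitz_domain_def compact_frontier_bounded)
  have "\<forall>x\<in>frontier D. \<exists>\<rho> e \<kappa>. 0 < \<rho> \<and> norm e = 1 \<and> 0 < \<kappa> \<and> \<kappa> < 1 \<and>
    (\<forall>y\<in>- T \<inter> ball x \<rho>. \<forall>t. 0 < t \<and> t < \<rho> \<longrightarrow> (\<forall>h\<in>ball (t *\<^sub>R e) (\<kappa> * t). y + h \<in> - T))"
  proof
    fix x assume "x \<in> frontier D"
    then obtain r e L and \<gamma> :: "'a \<Rightarrow> real" where c: "r > 0" "norm e = 1" "L-lipschitz_on {y. y \<bullet> e = 0} \<gamma>"
      "D \<inter> ball x r = {y \<in> ball x r. \<gamma> (y - (y \<bullet> e) *\<^sub>R e) < y \<bullet> e}"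
      using D(1) unfolding lipschitz_domain_def lipschitz_boundary_def by blast
    have L0: "0 \<le> L" using c(3) by (rule lipschitz_on_nonneg)
    show "\<exists>\<rho> e \<kappa>. 0 < \<rho> \<and> norm e = 1 \<and> 0 < \<kappa> \<and> \<kappa> < 1 \<and>
      (\<forall>y\<in>- T \<inter> ball x \<rho>. \<forall>t. 0 < t \<and> t < \<rho> \<longrightarrow> (\<forall>h\<in>ball (t *\<^sub>R e) (\<kappa> * t). y + h \<in> - T))"
    proof (rule exI[of _ "r / 4"], rule exI[of _ "- e"], rule exI[of _ "1 / (2 * (1 + L))"], intro conjI ballI allI impI)
      fix y t h assume "y \<in> - T \<inter> ball x (r / 4)" "0 < t \<and> t < r / 4" "h \<in> ball (t *\<^sub>R - e) (1 / (2 * (1 + L)) * t)"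
      then show "y + h \<in> - T" using lipschitz_chart_cone[OF c, of y t h] D(2) by auto
    qed (use c L0 in \<open>auto simp: divide_less_eq\<close>)
  qed
  then obtain \<rho> E \<kappa> where loc: "\<And>x. x \<in> frontier D \<Longrightarrow> 0 < \<rho> x \<and> norm (E x) = 1 \<and> 0 < \<kappa> x \<and> \<kappa> x < 1 \<and>
    (\<forall>y\<in>- T \<inter> ball x (\<rho> x). \<forall>t. 0 < t \<and> t < \<rho> x \<longrightarrow> (\<forall>h\<in>ball (t *\<^sub>R E x) (\<kappa> x * t). y + h \<in> - T))" by metis
  have "frontier D \<subseteq> (\<Union>x\<in>frontier D. ball x (\<rho> x / 2))" using loc by force
  then obtain X where X: "X \<subseteq> frontier D" "finite X" "frontier D \<subseteq> (\<Union>x\<in>X. ball x (\<rho> x / 2))"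
    using compactE_image[OF comp, of "frontier D" "\<lambda>x. ball x (\<rho> x / 2)"] by (metis open_ball)
  \<comment> \<open>The boundary is covered by chart balls of half radius, \<open>x\<close> is
    within \<open>3 * r0\<close> of the boundary and \<open>y\<close> within \<open>r0\<close> of
    \<open>x\<close>. Since 1/2 + 4/8 = 1, \<open>y\<close> lies in the chart ball. The inserted
    values here and in \<open>k0\<close> keep \<open>Min\<close> defined for an empty
    \<open>X\<close>, and 1/2 ensures \<open>k0 < 1\<close>.\<close>
  define r0 where "r0 = Min (insert 1 ((\<lambda>x. \<rho> x / 8) ` X))"
  define k0 where "k0 = Min (insert (1 / 2) (\<kappa> ` X))"
  have r0: "0 < r0" unfolding r0_def using X loc by (subst Min_gr_iff) auto
  have k0: "0 < k0" unfolding k0_def using X loc by (subst Min_gr_iff) auto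
  have k1: "k0 < 1" unfolding k0_def using X(2) by (subst Min_less_iff) auto
  have r0x: "r0 \<le> \<rho> x / 8" if "x \<in> X" for x unfolding r0_def using X(2) that by (intro Min_le) auto
  have k0x: "k0 \<le> \<kappa> x" if "x \<in> X" for x unfolding k0_def using X(2) that by (intro Min_le) auto
  obtain b :: 'a where b: "b \<in> Basis" using nonempty_Basis by blast
  have "uniform_cone (- T) r0 k0" unfolding uniform_cone_def
  proof (intro conjI allI r0 k0 k1)
    fix x
    show "\<exists>e. norm e = 1 \<and> (\<forall>y\<in>- T \<inter> ball x r0. \<forall>t. 0 < t \<and> t < r0 \<longrightarrow> (\<forall>h\<in>ball (t *\<^sub>R e) (k0 * t). y + h \<in> - T))"
    proof (cases "\<exists>z\<in>frontier D. dist x z < 3 * r0")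
      case True
      then obtain z i where z: "dist x z < 3 * r0" "i \<in> X" "z \<in> ball i (\<rho> i / 2)" using X(3) by blast
      have i: "i \<in> frontier D" using z X by blast
      show ?thesis
      proof (intro exI[of _ "E i"] conjI ballI allI impI)
        show "norm (E i) = 1" using loc[OF i] by simp
        fix y t h assume *: "y \<in> - T \<inter> ball x r0" "0 < t \<and> t < r0" "h \<in> ball (t *\<^sub>R E i) (k0 * t)"
        have "dist i y \<le> dist i z + dist z x + dist x y"
          using dist_triangle[of i y z] dist_triangle[of z y x] by linarith
        also have "\<dots> < \<rho> i" using z *(1) r0x[OF z(2)] by (simp add: dist_commute)
        finally have 1: "y \<in> - T \<inter> ball i (\<rho> i)" using *(1) by simp
        have 2: "0 < t \<and> t < \<rho> i" using *(2) r0x[OF z(2)] by simp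
        have "k0 * t \<le> \<kappa> i * t" using *(2) k0x[OF z(2)] by (intro mult_right_mono) auto
        then have "h \<in> ball (t *\<^sub>R E i) (\<kappa> i * t)" using *(3) by simp
        then show "y + h \<in> - T" using loc[OF i] 1 2 by blast
      qed
    next
      case False
      show ?thesis
      proof (intro exI[of _ b] conjI ballI allI impI)
        show "norm b = 1" using b by simp
        fix y t h assume *: "y \<in> - T \<inter> ball x r0" "0 < t \<and> t < r0" "h \<in> ball (t *\<^sub>R b) (k0 * t)"
        have "norm h < 2 * t" by (rule cone_norm_le[of b t k0]) (use * b k1 in auto)
        moreover have "dist x (y + h) \<le> dist x y + norm h" using dist_triangle[of x "y + h" y] by (simp add: dist_norm)
        ultimately have yh: "y + h \<in> ball x (3 * r0)" using * by simp
        show "y + h \<in> - T"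
        proof
          assume "y + h \<in> T"
          then have "y + h \<in> ball x (3 * r0) \<inter> T" "y \<in> ball x (3 * r0) - T" using yh * r0 by auto
          then have "ball x (3 * r0) \<inter> frontier T \<noteq> {}" by (intro connected_Int_frontier connected_ball) blast+
          moreover have "frontier T \<subseteq> frontier D"
            unfolding D(2) frontier_def using interior_mono[OF closure_subset[of D]] by auto
          ultimately show False using False by auto
        qed
      qed
    qed
  qed
  then show ?thesis by blast
qed

lemma uniform_cone_scale:
  fixes T :: "'a::euclidean_space set"
  assumes uc: "uniform_cone (- T) r \<kappa>" and \<epsilon>: "0 < \<epsilon>"
  shows "uniform_cone (- ((\<lambda>x. \<epsilon> *\<^sub>R x) ` T)) (\<epsilon> * r) \<kappa>"
  unfolding uniform_cone_def
proof (intro conjI allI)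
  have mem: "z \<in> (\<lambda>x. \<epsilon> *\<^sub>R x) ` T \<longleftrightarrow> z /\<^sub>R \<epsilon> \<in> T" for z using \<epsilon> by (force simp: image_iff)
  fix x
  obtain e where e: "norm e = 1" "\<And>y t h. y \<in> - T \<inter> ball (x /\<^sub>R \<epsilon>) r \<Longrightarrow> 0 < t \<Longrightarrow> t < r \<Longrightarrow> h \<in> ball (t *\<^sub>R e) (\<kappa> * t) \<Longrightarrow> y + h \<in> - T"
    using uc unfolding uniform_cone_def by meson
  show "\<exists>e. norm e = 1 \<and> (\<forall>y\<in>- (\<lambda>x. \<epsilon> *\<^sub>R x) ` T \<inter> ball x (\<epsilon> * r). \<forall>t. 0 < t \<and> t < \<epsilon> * r \<longrightarrow> (\<forall>h\<in>ball (t *\<^sub>R e) (\<kappa> * t). y + h \<in> - (\<lambda>x. \<epsilon> *\<^sub>R x) ` T))"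
  proof (intro exI[of _ e] conjI ballI allI impI e(1))
    fix y t h assume *: "y \<in> - (\<lambda>x. \<epsilon> *\<^sub>R x) ` T \<inter> ball x (\<epsilon> * r)" "0 < t \<and> t < \<epsilon> * r" "h \<in> ball (t *\<^sub>R e) (\<kappa> * t)"
    have sc: "dist (a /\<^sub>R \<epsilon>) (b /\<^sub>R \<epsilon>) = dist a b / \<epsilon>" for a b :: 'a
      using \<epsilon> by (simp add: dist_norm divide_inverse flip: scaleR_diff_right)
    have "y /\<^sub>R \<epsilon> + h /\<^sub>R \<epsilon> \<in> - T"
    proof (rule e(2)[of _ "t / \<epsilon>"])
      show "y /\<^sub>R \<epsilon> \<in> - T \<inter> ball (x /\<^sub>R \<epsilon>) r" using *(1) \<epsilon> mem[of y] by (simp add: sc divide_less_eq mult.commute)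
      show "0 < t / \<epsilon>" "t / \<epsilon> < r" using *(2) \<epsilon> by (auto simp: divide_less_eq mult.commute)
      have "(t / \<epsilon>) *\<^sub>R e = (t *\<^sub>R e) /\<^sub>R \<epsilon>" by (simp add: divide_inverse mult.commute)
      then have "dist ((t / \<epsilon>) *\<^sub>R e) (h /\<^sub>R \<epsilon>) = dist (t *\<^sub>R e) h / \<epsilon>" by (simp only: sc)
      then show "h /\<^sub>R \<epsilon> \<in> ball ((t / \<epsilon>) *\<^sub>R e) (\<kappa> * (t / \<epsilon>))" using *(3) \<epsilon> by (simp add: divide_strict_right_mono)
    qed
    then show "y + h \<in> - (\<lambda>x. \<epsilon> *\<^sub>R x) ` T" using mem[of "y + h"] by (simp add: scaleR_add_right)
  qed
qed (use assms in \<open>auto simp: uniform_cone_def\<close>)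

text \<open>The two boundary components do not interact: by compactness of \<open>T\<close> all the
  holes stay at distance at least \<open>d\<close> from the unit sphere. Near the hole the cones of
  its complement serve, as moving by \<open>6 * c < d\<close> cannot leave the ball; elsewhere the
  hole is out of reach and the cones of the ball serve.\<close>

lemma uniform_cone_perforated_ball:
  fixes T :: "'a::euclidean_space set"
  assumes T: "closed_lipschitz_domain T" "T \<subseteq> ball 0 1"
  shows "\<exists>c \<kappa>. 0 < c \<and> 0 < \<kappa> \<and> \<kappa> < 1 \<and> (\<forall>\<epsilon>. 0 < \<epsilon> \<and> \<epsilon> < 1 \<longrightarrow> uniform_cone (perforated_ball T \<epsilon>) (c * \<epsilon>) \<kappa>)"
proof -
  obtain r1 \<kappa>1 where u1: "uniform_cone (- T) r1 \<kappa>1" using uniform_cone_complement[OF T(1)] by blast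
  have r1: "0 < r1" "0 < \<kappa>1" "\<kappa>1 < 1" using u1 by (auto simp: uniform_cone_def)
  have "compact T"
    using T(1) unfolding closed_lipschitz_domain_def lipschitz_domain_def by (auto simp: compact_closure)
  then have "compact (norm ` T)" by (intro compact_continuous_image continuous_intros)
  moreover have "T \<noteq> {}" using T(1) unfolding closed_lipschitz_domain_def lipschitz_domain_def by auto
  ultimately obtain m where m: "m \<in> norm ` T" "\<forall>a\<in>norm ` T. a \<le> m" using compact_attains_sup by (metis image_is_empty)
  define d where "d = 1 - m"
  have d: "0 < d" "\<And>x. x \<in> T \<Longrightarrow> norm x \<le> 1 - d" using m T(2) by (auto simp: d_def)
  define c where "c = min r1 (min (1 / 8) (d / 8))"
  define \<kappa> where "\<kappa> = min \<kappa>1 (1 / 8)"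
  have c: "0 < c" "c \<le> r1" "c \<le> 1 / 8" "c \<le> d / 8" using r1 d by (auto simp: c_def)
  have \<kappa>: "0 < \<kappa>" "\<kappa> < 1" "\<kappa> \<le> \<kappa>1" "\<kappa> \<le> 1 / 8" using r1 by (auto simp: \<kappa>_def)
  have "uniform_cone (perforated_ball T \<epsilon>) (c * \<epsilon>) \<kappa>" if \<epsilon>: "0 < \<epsilon>" "\<epsilon> < 1" for \<epsilon>
  proof -
    let ?T = "(\<lambda>x. \<epsilon> *\<^sub>R x) ` T"
    have uT: "uniform_cone (- ?T) (c * \<epsilon>) \<kappa>"
      by (rule uniform_cone_mono[OF uniform_cone_scale[OF u1 \<epsilon>(1)]]) (use c \<kappa> \<epsilon> in \<open>auto simp: mult.commute\<close>)
    have "c * \<epsilon> \<le> 1 / 8 * 1" using c \<epsilon> by (intro mult_mono) auto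
    then have uB: "uniform_cone (ball (0::'a) 1) (c * \<epsilon>) \<kappa>"
      by (intro uniform_cone_mono[OF uniform_cone_ball]) (use c \<kappa> \<epsilon> in auto)
    have ce: "0 < c * \<epsilon>" "c * \<epsilon> \<le> c" using c \<epsilon> by auto
    have T\<epsilon>: "norm p \<le> 1 - d" if "p \<in> ?T" for p
    proof -
      obtain x where x: "x \<in> T" "p = \<epsilon> *\<^sub>R x" using \<open>p \<in> ?T\<close> by blast
      have "norm p \<le> 1 * norm x" using x \<epsilon> by (simp add: mult_left_le_one_le)
      then show ?thesis using d(2)[OF x(1)] by simp
    qed
    show ?thesis unfolding uniform_cone_def perforated_ball_def
    proof (intro conjI allI ce(1) \<kappa>(1,2))
      fix x
      show "\<exists>e. norm e = 1 \<and> (\<forall>y\<in>(ball 0 1 - ?T) \<inter> ball x (c * \<epsilon>). \<forall>t. 0 < t \<and> t < c * \<epsilon> \<longrightarrow> (\<forall>h\<in>ball (t *\<^sub>R e) (\<kappa> * t). y + h \<in> ball 0 1 - ?T))"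
      proof (cases "ball x (3 * (c * \<epsilon>)) \<inter> ?T = {}")
        case True
        obtain e where e: "norm e = 1" "\<And>y t h. y \<in> ball 0 1 \<inter> ball x (c * \<epsilon>) \<Longrightarrow> 0 < t \<Longrightarrow> t < c * \<epsilon> \<Longrightarrow> h \<in> ball (t *\<^sub>R e) (\<kappa> * t) \<Longrightarrow> y + h \<in> ball 0 1"
          using uB unfolding uniform_cone_def by meson
        show ?thesis
        proof (intro exI[of _ e] conjI ballI allI impI e(1))
          fix y t h assume *: "y \<in> (ball 0 1 - ?T) \<inter> ball x (c * \<epsilon>)" "0 < t \<and> t < c * \<epsilon>" "h \<in> ball (t *\<^sub>R e) (\<kappa> * t)"
          have "norm h < 2 * t" by (rule cone_norm_le[of e t \<kappa>]) (use * e \<kappa> in auto)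
          moreover have "dist x (y + h) \<le> dist x y + norm h" using dist_triangle[of x "y + h" y] by (simp add: dist_norm)
          ultimately have "y + h \<in> ball x (3 * (c * \<epsilon>))" using * by simp
          moreover have "y + h \<in> ball 0 1" using * by (intro e(2)[of y t h]) auto
          ultimately show "y + h \<in> ball 0 1 - ?T" using True by blast
        qed
      next
        case False
        then obtain p where p: "p \<in> ?T" "dist x p < 3 * (c * \<epsilon>)" by (metis disjoint_iff mem_ball)
        obtain e where e: "norm e = 1" "\<And>y t h. y \<in> - ?T \<inter> ball x (c * \<epsilon>) \<Longrightarrow> 0 < t \<Longrightarrow> t < c * \<epsilon> \<Longrightarrow> h \<in> ball (t *\<^sub>R e) (\<kappa> * t) \<Longrightarrow> y + h \<in> - ?T"
          using uT unfolding uniform_cone_def by meson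
        show ?thesis
        proof (intro exI[of _ e] conjI ballI allI impI e(1))
          fix y t h assume *: "y \<in> (ball 0 1 - ?T) \<inter> ball x (c * \<epsilon>)" "0 < t \<and> t < c * \<epsilon>" "h \<in> ball (t *\<^sub>R e) (\<kappa> * t)"
          have nh: "norm h < 2 * t" by (rule cone_norm_le[of e t \<kappa>]) (use * e \<kappa> in auto)
          have "norm (y + h) \<le> norm p + dist p x + dist x y + norm h"
            using norm_triangle_ineq[of y h] norm_triangle_ineq[of p "y - p"] dist_triangle[of p y x]
            by (simp add: dist_norm norm_minus_commute)
          also have "\<dots> < (1 - d) + 6 * c" using T\<epsilon>[OF p(1)] p(2) * nh ce by (simp add: dist_commute)
          also have "\<dots> < 1" using c d by simp
          finally have "y + h \<in> ball 0 1" by simp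
          moreover have "y + h \<in> - ?T" using * by (intro e(2)[of y t h]) auto
          ultimately show "y + h \<in> ball 0 1 - ?T" by blast
        qed
      qed
    qed
  qed
  then show ?thesis using c \<kappa> by blast
qed

section \<open>Estimates uniform in the size of the hole\<close>

text \<open>The right side of \<open>local_estimate\<close>, with \<open>r\<close> the scale of the
  cones. In dimension 3 both terms scale alike when \<open>F\<close> and \<open>r\<close> are
  dilated together.\<close>

definition rescaled_energy :: "real \<Rightarrow> real \<Rightarrow> ('a::euclidean_space \<Rightarrow> 'a) \<Rightarrow> real" where
  "rescaled_energy q r F = (pint 2 F / r ^ 3) powr ((q - 2) / 2) * pint 2 F + pint q F"

text \<open>The first term is an increasing function of the energy, homogeneous of degree
  \<open>q / 2\<close>. The energy of the difference is at most 8 times the larger of the two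
  energies, which explains the first constant.\<close>

lemma rescaled_energy_diff:
  fixes F G :: "'a::euclidean_space \<Rightarrow> 'a"
  assumes F: "Lp 2 F" "Lp q F" and G: "Lp 2 G" "Lp q G" and q: "2 < q" and r: "0 < r"
  shows "rescaled_energy q r (\<lambda>x. F x - G x)
    \<le> (8 powr ((q - 2) / 2) * 8 + 2 powr q) * (rescaled_energy q r F + rescaled_energy q r G)"
proof -
  define s where "s = (q - 2) / 2"
  have s: "0 < s" using q by (simp add: s_def)
  define X where "X a = (a / r ^ 3) powr s * a" for a
  have X0: "0 \<le> X a" if "0 \<le> a" for a using that by (simp add: X_def)
  have mono: "X a \<le> X b" if "0 \<le> a" "a \<le> b" for a b
    unfolding X_def using that r s by (intro mult_mono powr_mono2 divide_right_mono) auto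
  define m where "m = max (pint 2 F) (pint 2 G)"
  have m0: "0 \<le> m" by (simp add: m_def le_max_iff_disj)
  have "pdist 2 F G \<le> 2 powr 2 * (pint 2 F + pint 2 G)" using F G by (intro Lp_diff) auto
  also have "\<dots> \<le> 8 * m" unfolding m_def by auto
  finally have "X (pdist 2 F G) \<le> X (8 * m)" by (intro mono) auto
  also have "X (8 * m) = (8 powr s * 8) * X m" unfolding X_def using m0 r by (simp add: powr_mult[symmetric])
  also have "X m \<le> X (pint 2 F) + X (pint 2 G)"
    using X0[of "pint 2 F"] X0[of "pint 2 G"] by (auto simp: m_def max_def)
  finally have 1: "X (pdist 2 F G) \<le> (8 powr s * 8) * (X (pint 2 F) + X (pint 2 G))" by simp
  have 2: "pdist q F G \<le> 2 powr q * (pint q F + pint q G)" using F G q by (intro Lp_diff) auto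
  have E: "rescaled_energy q r H = X (pint 2 H) + pint q H" for H :: "'a \<Rightarrow> 'a"
    by (simp add: rescaled_energy_def X_def s_def)
  have "0 \<le> 2 powr q * (X (pint 2 F) + X (pint 2 G))"
    using X0[of "pint 2 F"] X0[of "pint 2 G"] by (intro mult_nonneg_nonneg) auto
  moreover have "0 \<le> 8 powr s * 8 * (pint q F + pint q G)" by (intro mult_nonneg_nonneg) auto
  ultimately show ?thesis using 1 2 unfolding E s_def[symmetric] distrib_left distrib_right by linarith
qed

lemma measure_cball_le:
  assumes "DIM('a::euclidean_space) = 3" "0 < R"
  shows "measure lborel (cball (0::'a) R) \<le> 8 * R ^ 3"
proof -
  have "measure lborel (cball (0::'a) R) \<le> measure lborel (cbox (- (\<Sum>i\<in>Basis. R *\<^sub>R i)) (\<Sum>i\<in>Basis. R *\<^sub>R i) :: 'a set)"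
  proof (rule measure_mono_fmeasurable)
    show "cball (0::'a) R \<subseteq> cbox (- (\<Sum>i\<in>Basis. R *\<^sub>R i)) (\<Sum>i\<in>Basis. R *\<^sub>R i)"
    proof
      fix x :: 'a assume "x \<in> cball 0 R"
      then have "\<bar>x \<bullet> i\<bar> \<le> R" if "i \<in> Basis" for i using Basis_le_norm[OF that, of x] by simp
      then show "x \<in> cbox (- (\<Sum>i\<in>Basis. R *\<^sub>R i)) (\<Sum>i\<in>Basis. R *\<^sub>R i)" by (force simp: mem_box abs_le_iff)
    qed
  qed (auto intro: fmeasurable_cbox)
  also have "\<dots> = (\<Prod>i\<in>(Basis :: 'a set). 2 * R)"
    using assms(2) by (subst measure_lborel_cbox_eq) (auto intro!: prod.cong simp: inner_diff_left inner_add_left)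
  finally show ?thesis using assms(1) by (simp add: power_mult_distrib)
qed

text \<open>Hoelder's inequality on the ball, in the form of \<open>pint_nest\<close>. Only the
  ratio \<open>R / r\<close> enters the constant; this is the scale invariance that makes the
  correction near the hole uniform.\<close>

lemma rescaled_energy_support:
  fixes F :: "'a::euclidean_space \<Rightarrow> 'a"
  assumes dim: "DIM('a) = 3" and F: "Lp q F" "\<And>x. x \<notin> cball 0 R \<Longrightarrow> F x = 0" and R: "0 < R" and q: "2 < q" and r: "0 < r"
  shows "Lp 2 F" "rescaled_energy q r F \<le> (2 powr (q / 2) * (8 * (R / r) ^ 3) powr ((q - 2) / 2) + 1) * pint q F"
proof -
  let ?s = "(q - 2) / 2"
  define P where "P = pint q F"
  have P: "0 \<le> P" by (simp add: P_def)
  show "Lp 2 F" by (rule Lp_nest(1)[where S = "cball 0 R", OF F(1) _ _ F(2)]) (use q in auto)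
  define B where "B = 2 * (8 * R ^ 3) powr (1 - 2 / q) * P powr (2 / q)"
  have "pint 2 F \<le> B"
    unfolding B_def P_def by (rule pint_nest[where S = "cball 0 R", OF F(1) _ _ F(2)]) (use q R measure_cball_le[OF dim R] in auto)
  then have "(pint 2 F / r ^ 3) powr ?s * pint 2 F \<le> (B / r ^ 3) powr ?s * B"
    using q r by (intro mult_mono powr_mono2 divide_right_mono) (auto simp: B_def)
  also have "\<dots> = B powr (q / 2) * (1 / r ^ 3) powr ?s"
  proof -
    have B0: "0 \<le> B" by (simp add: B_def)
    have e: "1 + (q - 2) / 2 = q / 2" by (simp add: field_simps)
    have "(B / r ^ 3) powr ?s = B powr ?s * (1 / r ^ 3) powr ?s" using B0 r by (subst powr_mult[symmetric]) auto
    then have "(B / r ^ 3) powr ?s * B = (B * B powr ?s) * (1 / r ^ 3) powr ?s"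
      by (simp only: mult.assoc mult.commute mult.left_commute)
    then show ?thesis using B0 by (simp only: powr_mult_base e)
  qed
  also have "B powr (q / 2) = 2 powr (q / 2) * (8 * R ^ 3) powr ?s * P"
  proof -
    have "(1 - 2 / q) * (q / 2) = (q - 2) / 2" "2 / q * (q / 2) = 1" using q by (auto simp: field_simps)
    then show ?thesis unfolding B_def using P R by (simp add: powr_mult powr_powr)
  qed
  also have "2 powr (q / 2) * (8 * R ^ 3) powr ?s * P * (1 / r ^ 3) powr ?s
      = 2 powr (q / 2) * (8 * (R / r) ^ 3) powr ?s * P"
  proof -
    have "(8 * (R / r) ^ 3) = (8 * R ^ 3) * (1 / r ^ 3)" by (simp add: power_divide)
    then have "(8 * (R / r) ^ 3) powr ?s = (8 * R ^ 3) powr ?s * (1 / r ^ 3) powr ?s"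
      using R r by (simp only: powr_mult)
    then show ?thesis by (simp add: ac_simps)
  qed
  finally show "rescaled_energy q r F \<le> (2 powr (q / 2) * (8 * (R / r) ^ 3) powr ?s + 1) * pint q F"
    unfolding rescaled_energy_def P_def by (simp add: algebra_simps)
qed

text \<open>In the product rule the gradient of the cutoff costs \<open>M / \<rho>\<close>. Hardy's
  inequality on the ball of radius \<open>2 * \<rho>\<close> controls \<open>\<phi>\<close> with the
  factor \<open>(2 * \<rho>) powr q\<close>, so the powers of \<open>\<rho>\<close> cancel.\<close>

lemma gradient_cutoff_mult_Hardy:
  fixes q :: real
  assumes q: "1 < q" "q < DIM('a::euclidean_space)"
  shows "\<exists>C>0. \<forall>\<Omega>. \<forall>\<phi>::'a \<Rightarrow> real. \<forall>\<rho>>0. test_function \<Omega> \<phi> \<longrightarrow>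
    pint q (gradient (\<lambda>x. cutoff 0 \<rho> (2 * \<rho>) x * \<phi> x)) \<le> C * pint q (gradient \<phi>)"
proof -
  obtain C where C: "0 < C" "\<And>\<Omega> (\<phi>::'a \<Rightarrow> real) \<rho>. 0 < \<rho> \<Longrightarrow> test_function \<Omega> \<phi> \<Longrightarrow>
      (NN x. indicator (cball 0 \<rho>) x * ennreal (\<bar>\<phi> x\<bar> powr q)) \<le> ennreal (C * \<rho> powr q * pint q (gradient \<phi>))"
    using Hardy_test[OF q] by (elim exE conjE, intro that) blast+
  define M where "M = cutoff_const TYPE('a)"
  have M: "0 < M" unfolding M_def by (rule cutoff_const)
  have "pint q (gradient (\<lambda>x. cutoff 0 \<rho> (2 * \<rho>) x * \<phi> x)) \<le> 2 powr q * (1 + (2 * M) powr q * C) * pint q (gradient \<phi>)"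
    if \<rho>: "0 < \<rho>" and \<phi>: "test_function \<Omega> \<phi>" for \<Omega> and \<phi> :: "'a \<Rightarrow> real" and \<rho>
  proof -
    let ?\<eta> = "cutoff (0::'a) \<rho> (2 * \<rho>)"
    let ?N = "pint q (gradient \<phi>)"
    have sm: "smooth \<phi>" "smooth ?\<eta>" by (rule test_function_smooth[OF \<phi>], rule smooth_cutoff)
    note [measurable] = borel_smooth[OF sm(1)] borel_smooth[OF sm(2)] borel_gradient[OF sm(1)] borel_gradient[OF sm(2)]
    define w where "w x = indicator (cball 0 (2 * \<rho>)) x *\<^sub>R \<phi> x" for x
    have wb [measurable]: "w \<in> borel_measurable borel" unfolding w_def by (intro borel_measurable_scaleR borel_smooth[OF sm(1)] borel_measurable_indicator) auto
    have "(NN x. ennreal (norm (w x) powr q)) = (NN x. indicator (cball 0 (2 * \<rho>)) x * ennreal (\<bar>\<phi> x\<bar> powr q))"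
      by (intro nn_integral_cong) (auto simp: w_def indicator_def)
    also have "\<dots> \<le> ennreal (C * (2 * \<rho>) powr q * ?N)" using \<rho> \<phi> by (intro C) auto
    finally have w: "Lp q w" "pint q w \<le> C * (2 * \<rho>) powr q * ?N" using C(1) by (auto intro!: Lp_nn_bound[OF wb])
    have bd1: "norm (?\<eta> x *\<^sub>R gradient \<phi> x) \<le> 1 * norm (gradient \<phi> x)" for x
      using cutoff_bounds[of 0 \<rho> "2 * \<rho>" x] by (simp add: mult_left_le_one_le)
    have m: "(\<lambda>x. ?\<eta> x *\<^sub>R gradient \<phi> x) \<in> borel_measurable borel" "(\<lambda>x. \<phi> x *\<^sub>R gradient ?\<eta> x) \<in> borel_measurable borel"
      by measurable
    have q0: "0 < q" and M0: "0 \<le> M / \<rho>" using q M \<rho> by auto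
    have "Lp q (gradient \<phi>)" using \<phi> q0 by (rule test_function_Lp)
    note 1 = Lp_bound[OF this m(1) bd1 zero_le_one q0]
    have bd: "norm (\<phi> x *\<^sub>R gradient ?\<eta> x) \<le> M / \<rho> * norm (w x)" for x
    proof (cases "x \<in> cball 0 (2 * \<rho>)")
      case True
      then show ?thesis using mult_left_mono[OF gradient_cutoff_le[OF \<rho>, of 0 x], of "\<bar>\<phi> x\<bar>"]
        by (simp add: w_def M_def mult.commute)
    next
      case False
      then have "gradient ?\<eta> x = 0" using \<rho> by (intro gradient_cutoff_0) auto
      then show ?thesis using M \<rho> by simp
    qed
    note 2 = Lp_bound[OF w(1) m(2) bd M0 q0]
    have "(M / \<rho>) powr q * pint q w \<le> (M / \<rho>) powr q * (C * (2 * \<rho>) powr q * ?N)" by (intro mult_left_mono w) auto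
    also have "\<dots> = (2 * M) powr q * C * ?N" using M \<rho> by (simp add: powr_mult powr_divide)
    finally have 3: "pint q (\<lambda>x. \<phi> x *\<^sub>R gradient ?\<eta> x) \<le> (2 * M) powr q * C * ?N" using 2 by simp
    have "gradient (\<lambda>x. ?\<eta> x * \<phi> x) = (\<lambda>x. ?\<eta> x *\<^sub>R gradient \<phi> x + \<phi> x *\<^sub>R gradient ?\<eta> x)"
      using sm by (intro ext gradient_mult)
    then have "pint q (gradient (\<lambda>x. ?\<eta> x * \<phi> x)) \<le> 2 powr q * (pint q (\<lambda>x. ?\<eta> x *\<^sub>R gradient \<phi> x) + pint q (\<lambda>x. \<phi> x *\<^sub>R gradient ?\<eta> x))"
      using Lp_add(2)[OF 1(1) 2(1)] q by simp
    also have "\<dots> \<le> 2 powr q * (?N + (2 * M) powr q * C * ?N)" using 1 3 by (intro mult_left_mono add_mono) auto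
    finally show ?thesis by (simp add: algebra_simps)
  qed
  moreover have "0 < 2 powr q * (1 + (2 * M) powr q * C)" using C(1) by (simp add: add_pos_nonneg)
  ultimately show ?thesis by (intro exI[of _ "2 powr q * (1 + (2 * M) powr q * C)"] conjI allI impI)
qed

text \<open>The unit ball has cones at the fixed scale 1/8, so the energy term of
  \<open>local_estimate\<close> is absorbed into the q-th power of the data.\<close>

lemma ball_estimate:
  assumes q: "2 < q" "q < 3" and dim: "DIM('a::euclidean_space) = 3"
  shows "\<exists>C>0. \<forall>f v. L2_solution (ball (0::'a) 1) f v \<longrightarrow> Lp q f \<longrightarrow> (\<forall>x. x \<notin> ball 0 1 \<longrightarrow> f x = 0) \<longrightarrow>
    Lp q v \<and> pint q v \<le> C * pint q f"
proof -
  obtain C where C: "0 < C" "\<And>\<Omega> r0 (f :: 'a \<Rightarrow> 'a) g. uniform_cone \<Omega> r0 (1 / 8) \<Longrightarrow> bounded \<Omega> \<Longrightarrow> open \<Omega> \<Longrightarrow>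
      L2_solution \<Omega> f g \<Longrightarrow> Lp 2 f \<Longrightarrow> Lp q f \<Longrightarrow> Lp q g \<and> pint q g \<le> C * rescaled_energy q r0 f"
    using local_estimate[OF _ _ q dim, of "1 / 8"] unfolding rescaled_energy_def by auto
  define K where "K = 2 powr (q / 2) * (8 * (1 / (1 / 8)) ^ 3) powr ((q - 2) / 2) + 1"
  have K: "0 < K" unfolding K_def by (intro add_nonneg_pos) auto
  have "Lp q v \<and> pint q v \<le> (C * K) * pint q f"
    if f: "L2_solution (ball (0::'a) 1) f v" "Lp q f" "\<forall>x. x \<notin> ball 0 1 \<longrightarrow> f x = 0" for f v
  proof -
    have f0: "f x = 0" if "x \<notin> cball 0 1" for x using f(3) that by auto
    note E = rescaled_energy_support[OF dim f(2) f0, of 1 "1 / 8", folded K_def]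
    have "Lp q v \<and> pint q v \<le> C * rescaled_energy q (1 / 8) f"
      using f q E by (intro C(2)[of "ball 0 1"] uniform_cone_ball) auto
    moreover have "C * rescaled_energy q (1 / 8) f \<le> C * (K * pint q f)"
      using C(1) q by (intro mult_left_mono E(2)) auto
    ultimately show ?thesis by (simp add: mult.assoc)
  qed
  then show ?thesis using C(1) K by (intro exI[of _ "C * K"]) auto
qed

lemma open_perforated_ball:
  assumes "compact T" shows "open (perforated_ball T \<epsilon>)"
  unfolding perforated_ball_def
  by (intro open_Diff open_ball compact_imp_closed compact_continuous_image continuous_intros assms)

lemma perforated_ball_subset: "perforated_ball T \<epsilon> \<subseteq> ball 0 1"
  by (auto simp: perforated_ball_def)

lemma bounded_perforated_ball: "bounded (perforated_ball T \<epsilon>)"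
  by (rule bounded_subset[OF bounded_ball perforated_ball_subset])

lemma closed_lipschitz_domain_compact: "closed_lipschitz_domain T \<Longrightarrow> compact T"
  unfolding closed_lipschitz_domain_def lipschitz_domain_def by (auto simp: compact_closure)

text \<open>The factor \<open>1 - cutoff 0 \<epsilon> (2 * \<epsilon>)\<close> vanishes on the ball
  of radius \<open>\<epsilon>\<close>, which contains the hole.\<close>

lemma test_function_perforated_ball:
  assumes T: "T \<subseteq> ball 0 1" and \<epsilon>: "0 < \<epsilon>" and \<phi>: "test_function (ball 0 1) \<phi>"
  shows "test_function (perforated_ball T \<epsilon>) (\<lambda>x. \<phi> x - cutoff 0 \<epsilon> (2 * \<epsilon>) x * \<phi> x)"
proof -
  obtain K where K: "compact K" "K \<subseteq> ball 0 1" "\<And>x. x \<notin> K \<Longrightarrow> \<phi> x = 0" using test_functionE(2)[OF \<phi>] by blast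
  have "(\<lambda>x. \<epsilon> *\<^sub>R x) ` T \<subseteq> ball 0 \<epsilon>" using T \<epsilon> by auto
  then have "K - ball 0 \<epsilon> \<subseteq> perforated_ball T \<epsilon>" using K(2) unfolding perforated_ball_def by blast
  moreover have "\<phi> x - cutoff 0 \<epsilon> (2 * \<epsilon>) x * \<phi> x = 0" if "x \<notin> K - ball 0 \<epsilon>" for x
    using that K(3) cutoff_1[of \<epsilon> "2 * \<epsilon>" 0 x] \<epsilon> by auto
  ultimately show ?thesis using K(1) test_function_smooth[OF \<phi>]
    by (intro test_functionI[of _ "K - ball 0 \<epsilon>"] smooth_diff smooth_mult smooth_cutoff compact_diff) auto
qed

text \<open>The domain \<open>\<Omega>\<^sub>\<epsilon>\<close> satisfies the cone condition only at scale \<open>\<epsilon>\<close>, so \<open>local_estimate\<close> alone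
  loses a power of \<open>\<epsilon>\<close>. Therefore subtract from \<open>g\<close> the gradient of \<open>(1 - \<eta>) \<phi>\<close>, where \<open>\<nabla>\<phi>\<close>
  approximates the solution in the unperforated ball and \<open>\<eta>\<close> cuts off at scale \<open>\<epsilon>\<close>. The remaining data
  are supported at scale \<open>\<epsilon>\<close>, where the estimate is scale invariant, and Hardy's inequality bounds them.\<close>

lemma perforated_ball_estimate:
  fixes T :: "'a::euclidean_space set"
  assumes T: "closed_lipschitz_domain T" "T \<subseteq> ball 0 1" and q: "2 < q" "q < 3" and dim: "DIM('a) = 3"
  shows "\<exists>C>0. \<forall>\<epsilon> f g. 0 < \<epsilon> \<longrightarrow> \<epsilon> < 1 \<longrightarrow> L2_solution (perforated_ball T \<epsilon>) f g \<longrightarrow> Lp q f \<longrightarrow>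
    (\<forall>x. x \<notin> ball 0 1 \<longrightarrow> f x = 0) \<longrightarrow> Lp q g \<and> pint q g \<le> C * pint q f"
proof -
  obtain c \<kappa> where c: "0 < c" and \<kappa>: "0 < \<kappa>" "\<kappa> < 1"
    and uc: "\<And>\<epsilon>. 0 < \<epsilon> \<Longrightarrow> \<epsilon> < 1 \<Longrightarrow> uniform_cone (perforated_ball T \<epsilon>) (c * \<epsilon>) \<kappa>"
    using uniform_cone_perforated_ball[OF T] by metis
  obtain C1 where C1: "0 < C1" "\<And>\<Omega> r0 (f :: 'a \<Rightarrow> 'a) g. uniform_cone \<Omega> r0 \<kappa> \<Longrightarrow> bounded \<Omega> \<Longrightarrow> open \<Omega> \<Longrightarrow>
      L2_solution \<Omega> f g \<Longrightarrow> Lp 2 f \<Longrightarrow> Lp q f \<Longrightarrow> Lp q g \<and> pint q g \<le> C1 * rescaled_energy q r0 f"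
    using local_estimate[OF \<kappa> q dim] unfolding rescaled_energy_def by metis
  obtain C2 where C2: "0 < C2" "\<And>f v. L2_solution (ball (0::'a) 1) f v \<Longrightarrow> Lp q f \<Longrightarrow> (\<forall>x. x \<notin> ball 0 1 \<longrightarrow> f x = 0) \<Longrightarrow>
      Lp q v \<and> pint q v \<le> C2 * pint q f" using ball_estimate[OF q dim] by metis
  have q': "1 < q" "q < DIM('a)" using q dim by auto
  obtain C3 where C3: "0 < C3" "\<And>\<Omega> (\<phi>::'a \<Rightarrow> real) \<rho>. 0 < \<rho> \<Longrightarrow> test_function \<Omega> \<phi> \<Longrightarrow>
      pint q (gradient (\<lambda>x. cutoff 0 \<rho> (2 * \<rho>) x * \<phi> x)) \<le> C3 * pint q (gradient \<phi>)"
    using gradient_cutoff_mult_Hardy[OF q'] by metis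
  define K1 where "K1 = 8 powr ((q - 2) / 2) * 8 + 2 powr q"
  \<comment> \<open>For data supported in the radius \<open>2 * \<epsilon>\<close> and cones at
    scale \<open>c * \<epsilon>\<close> the relevant ratio is \<open>2 / c\<close>, free of
    \<open>\<epsilon>\<close>.\<close>
  define K2 where "K2 = 2 powr (q / 2) * (8 * (2 / c) ^ 3) powr ((q - 2) / 2) + 1"
  have K1: "0 < K1" unfolding K1_def by (intro add_pos_pos) auto
  have K2: "0 < K2" unfolding K2_def by (intro add_nonneg_pos) auto
  define Q where "Q = 2 powr q"
  have Q: "0 < Q" by (simp add: Q_def)
  define A where "A = Q * (C1 * K1 * K2 * C3 + Q * (1 + C3))"
  have A: "0 < A" unfolding A_def using Q C1 K1 K2 C3 by (intro mult_pos_pos add_pos_pos) auto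
  have "Lp q g \<and> pint q g \<le> (A * (Q * C2)) * pint q f"
    if \<epsilon>: "0 < \<epsilon>" "\<epsilon> < 1" and g: "L2_solution (perforated_ball T \<epsilon>) f g" and f: "Lp q f" and f0: "\<forall>x. x \<notin> ball 0 1 \<longrightarrow> f x = 0"
    for \<epsilon> f g
  proof -
    let ?\<Omega> = "perforated_ball T \<epsilon>"
    let ?\<eta> = "cutoff (0::'a) \<epsilon> (2 * \<epsilon>)"
    have op: "open ?\<Omega>" using T by (intro open_perforated_ball closed_lipschitz_domain_compact)
    have f2: "Lp 2 f" by (rule Lp_nest(1)[OF f, of _ "ball 0 1"]) (use q f0 in auto)
    obtain v where v: "L2_solution (ball 0 1) f v" using L2_solution_exists[OF f2, of "ball 0 1"] by auto
    have vq: "Lp q v" "pint q v \<le> C2 * pint q f" using C2(2)[OF v f f0] by auto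
    have v2: "Lp 2 v" and v0: "\<And>x. x \<notin> ball 0 1 \<Longrightarrow> v x = 0" and vg: "grad_closure 2 (ball 0 1) v"
      using v unfolding L2_solution_def grad_closure_def by auto
    have vgq: "grad_closure q (ball 0 1) v"
      by (rule grad_closure_upgrade[OF uniform_cone_ball _ _ vg vq(1)]) (use q in auto)
    \<comment> \<open>This constant blows up as \<open>\<epsilon>\<close> tends to 0, but it
      multiplies only \<open>pdist q (gradient \<phi>) v\<close>, which is made arbitrarily small by
      choosing \<open>\<phi>\<close> after \<open>\<epsilon>\<close>.\<close>
    define K3 where "K3 = 2 powr (q / 2) * (8 * (1 / (c * \<epsilon>)) ^ 3) powr ((q - 2) / 2) + 1"
    have K3: "0 < K3" unfolding K3_def by (intro add_nonneg_pos) auto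
    have step: "Lp q g \<and> pint q g \<le> A * pint q (gradient \<phi>) + Q * C1 * K1 * K3 * pdist q (gradient \<phi>) v"
      if \<phi>: "test_function (ball 0 1) \<phi>" for \<phi>
    proof -
      let ?E = "rescaled_energy q (c * \<epsilon>)" and ?N = "pint q (gradient \<phi>)"
      define F1 where "F1 x = gradient \<phi> x - v x" for x
      define F2 where "F2 = gradient (\<lambda>x. ?\<eta> x * \<phi> x)"
      define W where "W = gradient (\<lambda>x. \<phi> x - ?\<eta> x * \<phi> x)"
      have t2: "test_function (ball 0 1) (\<lambda>x. ?\<eta> x * \<phi> x)" using \<phi> by (intro test_function_mult smooth_cutoff)
      have t3: "test_function ?\<Omega> (\<lambda>x. \<phi> x - ?\<eta> x * \<phi> x)" using T \<epsilon> \<phi> by (intro test_function_perforated_ball)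
      have W: "W = (\<lambda>x. gradient \<phi> x - F2 x)"
        unfolding W_def F2_def using t2 \<phi> by (intro ext gradient_diff test_function_smooth)
      have Lg: "Lp p (gradient \<phi>)" "Lp p F2" "Lp p W" if "0 < p" for p
        unfolding F2_def W_def using \<phi> t2 t3 that by (auto intro: test_function_Lp)
      have L1: "Lp 2 F1" "Lp q F1" unfolding F1_def using Lg v2 vq q by (auto intro!: Lp_diff)
      have F10: "F1 x = 0" if "x \<notin> cball 0 1" for x
        using that v0[of x] gradient_test_0[OF \<phi>, of x] by (simp add: F1_def)
      have F20: "F2 x = 0" if "x \<notin> cball 0 (2 * \<epsilon>)" for x
      proof -
        have d: "2 * \<epsilon> < dist 0 x" using that by simp
        have "F2 x = ?\<eta> x *\<^sub>R gradient \<phi> x + \<phi> x *\<^sub>R gradient ?\<eta> x"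
          unfolding F2_def using \<phi> by (intro gradient_mult smooth_cutoff test_function_smooth)
        then show ?thesis using cutoff_0[of \<epsilon> "2 * \<epsilon>" 0 x] gradient_cutoff_0[of \<epsilon> "2 * \<epsilon>" 0 x] d \<epsilon> by simp
      qed
      define G where "G x = g x - W x" for x
      define F where "F x = F1 x - F2 x" for x
      have LF: "Lp 2 F" "Lp q F" unfolding F_def using L1 Lg q by (auto intro!: Lp_diff)
      \<comment> \<open>Since \<open>G + F = g - v\<close>, this is the difference of the equations
        in the perforated and in the full ball; test functions of the former are test functions of
        the latter.\<close>
      have G: "L2_solution ?\<Omega> F G" unfolding L2_solution_def
      proof (intro conjI allI impI)
        show "grad_closure 2 ?\<Omega> G"
          unfolding G_def W_def using g t3 by (intro grad_closure_diff grad_closure_test) (auto simp: L2_solution_def)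
        fix \<psi> assume \<psi>: "test_function ?\<Omega> \<psi>"
        have \<psi>': "test_function (ball 0 1) \<psi>" using \<psi> perforated_ball_subset by (rule test_function_mono)
        have 1: "(LBINT x. (g x + f x) \<bullet> gradient \<psi> x) = 0" using g \<psi> by (simp add: L2_solution_def)
        have 2: "(LBINT x. (v x + f x) \<bullet> gradient \<psi> x) = 0" using v \<psi>' by (simp add: L2_solution_def)
        have gL: "Lp 2 g" using g by (simp add: L2_solution_def grad_closure_def)
        have "Lp 2 (\<lambda>x. g x + f x)" "Lp 2 (\<lambda>x. v x + f x)" "Lp 2 (gradient \<psi>)"
          by (rule Lp_add[OF gL f2], simp, rule Lp_add[OF v2 f2], simp, rule test_function_Lp[OF \<psi>], simp)
        note i = L2_integrable_inner[OF this(1,3)] L2_integrable_inner[OF this(2,3)]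
        have "(LBINT x. (G x + F x) \<bullet> gradient \<psi> x)
            = (LBINT x. (g x + f x) \<bullet> gradient \<psi> x - (v x + f x) \<bullet> gradient \<psi> x)"
          by (intro Bochner_Integration.integral_cong) (simp_all add: G_def F_def F1_def W flip: inner_diff_left)
        also have "\<dots> = 0" using i 1 2 by simp
        finally show "(LBINT x. (G x + F x) \<bullet> gradient \<psi> x) = 0" .
      qed
      have Gq: "Lp q G" "pint q G \<le> C1 * ?E F" using C1(2)[OF uc[OF \<epsilon>] bounded_perforated_ball op G LF] by auto
      have c\<epsilon>: "0 < c * \<epsilon>" using c \<epsilon> by simp
      have "?E F \<le> K1 * (?E F1 + ?E F2)" unfolding F_def K1_def using L1 Lg q c\<epsilon> by (intro rescaled_energy_diff) auto
      also have "\<dots> \<le> K1 * (K3 * pint q F1 + K2 * pint q F2)"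
      proof (intro mult_left_mono add_mono)
        show "?E F1 \<le> K3 * pint q F1" unfolding K3_def using F10 L1 q c\<epsilon> by (intro rescaled_energy_support dim) auto
        have "2 / c = 2 * \<epsilon> / (c * \<epsilon>)" using \<epsilon> by simp
        then show "?E F2 \<le> K2 * pint q F2"
          unfolding K2_def using F20 Lg q c\<epsilon> \<epsilon> by (simp only:) (intro rescaled_energy_support dim, auto)
      qed (use K1 in auto)
      also have "pint q F2 \<le> C3 * ?N" unfolding F2_def by (rule C3(2)[OF \<epsilon>(1) \<phi>])
      finally have "?E F \<le> K1 * (K3 * pint q F1 + K2 * (C3 * ?N))" using K1 K2 by simp
      then have "C1 * ?E F \<le> C1 * (K1 * (K3 * pint q F1 + K2 * (C3 * ?N)))" using C1 by (intro mult_left_mono) auto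
      then have G1: "pint q G \<le> C1 * (K1 * (K3 * pint q F1 + K2 * (C3 * ?N)))" using Gq by simp
      have "pint q W \<le> Q * (?N + pint q F2)" unfolding W Q_def using Lg q by (intro Lp_diff) auto
      also have "\<dots> \<le> Q * (?N + C3 * ?N)" using Q C3(2)[OF \<epsilon>(1) \<phi>] by (simp add: F2_def)
      finally have W1: "pint q W \<le> Q * (1 + C3) * ?N" by (simp add: algebra_simps)
      have gG: "g = (\<lambda>x. G x + W x)" by (simp add: G_def)
      have "Lp q g" unfolding gG using Gq Lg q by (intro Lp_add) auto
      moreover have "pint q g \<le> Q * (pint q G + pint q W)" unfolding gG Q_def using Gq Lg q by (intro Lp_add) auto
      moreover have "Q * (pint q G + pint q W) \<le> Q * (C1 * (K1 * (K3 * pint q F1 + K2 * (C3 * ?N))) + Q * (1 + C3) * ?N)"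
        using Q G1 W1 by (intro mult_left_mono add_mono) auto
      ultimately show ?thesis unfolding A_def F1_def by (simp add: algebra_simps)
    qed
    define B where "B = A * Q + Q * C1 * K1 * K3"
    have B: "0 < B" unfolding B_def using A Q C1 K1 K3 by (intro add_pos_pos mult_pos_pos) auto
    have step2: "Lp q g \<and> pint q g \<le> (A * (Q * C2)) * pint q f + e" if e: "0 < e" for e
    proof -
      obtain \<phi> where \<phi>: "test_function (ball 0 1) \<phi>" "pdist q (gradient \<phi>) v < e / B"
        using grad_closure_ex[OF vgq, of "e / B"] e B by auto
      define P where "P = pdist q (gradient \<phi>) v"
      have L: "Lp q (\<lambda>x. gradient \<phi> x - v x)" using \<phi> vq q by (intro Lp_diff test_function_Lp) auto
      have "pint q (gradient \<phi>) \<le> Q * (P + pint q v)" using Lp_add(2)[OF L vq(1)] q by (simp add: Q_def P_def)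
      also have "\<dots> \<le> Q * (P + C2 * pint q f)" using Q vq by simp
      finally have "A * pint q (gradient \<phi>) \<le> A * (Q * (P + C2 * pint q f))" using A by (intro mult_left_mono) auto
      then have "pint q g \<le> (A * (Q * C2)) * pint q f + B * P"
        using step[OF \<phi>(1)] unfolding B_def P_def by (simp add: algebra_simps)
      moreover have "B * P \<le> e" using \<phi>(2) B by (simp add: P_def field_simps)
      ultimately show ?thesis using step[OF \<phi>(1)] by simp
    qed
    then show ?thesis using step2[of 1] by (auto intro: field_le_epsilon)
  qed
  then show ?thesis using A Q C2(1) by (intro exI[of _ "A * (Q * C2)"]) auto
qed

section \<open>Duality, existence and uniqueness in L^p\<close>

lemma conjugate_range:
  fixes p :: real
  assumes "3 / 2 < p" "p < 3"
  shows "3 / 2 < p / (p - 1)" "p / (p - 1) < 3" "1 / p + 1 / (p / (p - 1)) = 1"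
  using assms by (auto simp: field_simps)

text \<open>Test with the solution for the dual data \<open>|g| powr (p - 2) g\<close>.\<close>

lemma duality_estimate:
  assumes \<Omega>: "bounded \<Omega>" "\<Omega> \<in> sets borel" and p: "1 < p" "p \<le> 2" and pq: "1 / p + 1 / q = 1"
    and C: "0 < C" "\<And>h k. L2_solution \<Omega> h k \<Longrightarrow> Lp q h \<Longrightarrow> (\<And>x. x \<notin> \<Omega> \<Longrightarrow> h x = 0) \<Longrightarrow> Lp q k \<and> pint q k \<le> C * pint q h"
    and K: "\<And>a b. 0 \<le> a \<Longrightarrow> 0 \<le> b \<Longrightarrow> a * b \<le> 1 / (2 * C) * a powr q + K * b powr p"
    and f: "Lp 2 f" "Lp p f" and g: "L2_solution \<Omega> f g"
  shows "Lp p g" "pint p g \<le> 2 * K * pint p f"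
proof -
  have q: "1 < q" by (rule conjugate_gt_1[OF p(1) pq])
  have g2: "Lp 2 g" and g0: "\<And>x. x \<notin> \<Omega> \<Longrightarrow> g x = 0" and gc: "grad_closure 2 \<Omega> g"
    using g by (auto simp: L2_solution_def grad_closure_def)
  note [measurable] = Lp_borel[OF g2]
  show gp: "Lp p g" by (rule Lp_nest(1)[where S = \<Omega>, OF g2 _ _ g0]) (use p \<Omega> in auto)
  have "p * q = p + q" using pq p q by (simp add: field_simps)
  then have pq': "(p - 1) * q = p" by (simp add: algebra_simps)
  have q2: "2 \<le> q"
  proof -
    have "p * q \<le> 2 * q" using p q by (intro mult_right_mono) auto
    moreover have "p * q = p + q" using pq p q by (simp add: field_simps)
    moreover have "(p - 1) * q \<le> 1 * q" using p q by (intro mult_right_mono) auto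
    ultimately have "p \<le> q" using pq' by simp
    moreover have "1 / q \<le> 1 / 2"
    proof -
      have "1 / 2 \<le> 1 / p" using p by (simp add: field_simps)
      then show ?thesis using pq by simp
    qed
    ultimately show ?thesis using q by (simp add: field_simps)
  qed
  \<comment> \<open>At zeros of \<open>g\<close> this is 0 because the vector factor vanishes. With
    the conjugate exponent one gets \<open>pint q h = pint p g\<close>.\<close>
  define h where "h x = (norm (g x) powr (p - 2)) *\<^sub>R g x" for x
  have h0: "h x = 0" if "x \<notin> \<Omega>" for x using g0[OF that] by (simp add: h_def)
  have hb [measurable]: "h \<in> borel_measurable borel" unfolding h_def by measurable
  have nh: "norm (h x) = norm (g x) powr (p - 1)" for x
  proof (cases "g x = 0")
    case False
    have "norm (h x) = norm (g x) powr (p - 2) * norm (g x) powr 1" using False by (simp add: h_def)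
    also have "\<dots> = norm (g x) powr (p - 1)" by (subst powr_add[symmetric]) (simp add: algebra_simps)
    finally show ?thesis .
  qed (simp add: h_def)
  have nhq: "norm (h x) powr q = norm (g x) powr p" for x unfolding nh by (simp add: powr_powr pq')
  have hq: "Lp q h" "pint q h = pint p g" using gp by (simp_all add: Lp_def pint_def nhq)
  have h2: "Lp 2 h" by (rule Lp_nest(1)[where S = \<Omega>, OF hq(1) _ _ h0]) (use q2 \<Omega> in auto)
  obtain k where k: "L2_solution \<Omega> h k" using L2_solution_exists[OF h2 \<Omega>] by blast
  have kq: "Lp q k" "pint q k \<le> C * pint p g" using C(2)[OF k hq(1) h0] hq(2) by auto
  have kc: "grad_closure 2 \<Omega> k" and k2: "Lp 2 k" using k by (auto simp: L2_solution_def grad_closure_def)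
  have "(LBINT x. (g x + f x) \<bullet> k x) = 0" by (rule L2_solution_orthogonal[OF g f(1) kc])
  then have 1: "(LBINT x. g x \<bullet> k x) + (LBINT x. f x \<bullet> k x) = 0"
    using L2_integrable_inner[OF g2 k2] L2_integrable_inner[OF f(1) k2] by (simp add: inner_add_left)
  have "(LBINT x. (k x + h x) \<bullet> g x) = 0" by (rule L2_solution_orthogonal[OF k h2 gc])
  then have 2: "(LBINT x. k x \<bullet> g x) + (LBINT x. h x \<bullet> g x) = 0"
    using L2_integrable_inner[OF k2 g2] L2_integrable_inner[OF h2 g2] by (simp add: inner_add_left)
  have "h x \<bullet> g x = norm (g x) powr p" for x
  proof (cases "g x = 0")
    case False
    have "h x \<bullet> g x = norm (g x) powr (p - 2) * norm (g x) powr 2" unfolding norm_powr_2 by (simp add: h_def)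
    also have "\<dots> = norm (g x) powr p" by (subst powr_add[symmetric]) simp
    finally show ?thesis .
  qed (simp add: h_def)
  then have "pint p g = (LBINT x. h x \<bullet> g x)" by (simp add: pint_def)
  also have "\<dots> = (LBINT x. k x \<bullet> f x)" using 1 2 by (simp add: inner_commute)
  \<comment> \<open>The Young parameter \<open>1 / (2 * C)\<close> is matched to the estimate for
    \<open>k\<close>, so that half of \<open>pint p g\<close> can be absorbed; by \<open>gp\<close>
    this is a genuine integral.\<close>
  also have "\<dots> \<le> 1 / (2 * C) * pint q k + K * pint p f" using pairing_bound(2)[OF kq(1) f(2) K] by simp
  also have "1 / (2 * C) * pint q k \<le> 1 / (2 * C) * (C * pint p g)" using C kq(2) by (intro mult_left_mono) auto
  also have "\<dots> = pint p g / 2" using C by simp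
  finally show "pint p g \<le> 2 * K * pint p f" by simp
qed

text \<open>The energy bound serves at 2, \<open>perforated_ball_estimate\<close> above and duality
  below. The gradient reaches the closure for exponent \<open>p\<close> by
  \<open>grad_closure_upgrade\<close> above 2, and below 2 because the domain is bounded.\<close>

lemma perforated_ball_L2_estimate:
  fixes T :: "'a::euclidean_space set"
  assumes T: "closed_lipschitz_domain T" "T \<subseteq> ball 0 1" and p: "3 / 2 < p" "p < 3" and dim: "DIM('a) = 3"
  shows "\<exists>C>0. \<forall>\<epsilon> f g. 0 < \<epsilon> \<longrightarrow> \<epsilon> < 1 \<longrightarrow> L2_solution (perforated_ball T \<epsilon>) f g \<longrightarrow> Lp 2 f \<longrightarrow> Lp p f \<longrightarrow>
    (\<forall>x. x \<notin> ball 0 1 \<longrightarrow> f x = 0) \<longrightarrow> grad_closure p (perforated_ball T \<epsilon>) g \<and> pint p g \<le> C * pint p f"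
proof -
  have op: "open (perforated_ball T \<epsilon>)" for \<epsilon> using T by (intro open_perforated_ball closed_lipschitz_domain_compact)
  consider "p = 2" | "2 < p" | "p < 2" by linarith
  then show ?thesis
  proof cases
    case 1
    then show ?thesis by (intro exI[of _ 1]) (auto simp: L2_solution_def intro: L2_solution_bound)
  next
    case 2
    obtain c \<kappa> where uc: "\<And>\<epsilon>. 0 < \<epsilon> \<Longrightarrow> \<epsilon> < 1 \<Longrightarrow> uniform_cone (perforated_ball T \<epsilon>) (c * \<epsilon>) \<kappa>"
      using uniform_cone_perforated_ball[OF T] by blast
    obtain C where C: "0 < C" "\<And>\<epsilon> f g. 0 < \<epsilon> \<Longrightarrow> \<epsilon> < 1 \<Longrightarrow> L2_solution (perforated_ball T \<epsilon>) f g \<Longrightarrow> Lp p f \<Longrightarrow>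
      (\<forall>x. x \<notin> ball 0 1 \<longrightarrow> f x = 0) \<Longrightarrow> Lp p g \<and> pint p g \<le> C * pint p f"
      using perforated_ball_estimate[OF T 2 p(2) dim] by blast
    show ?thesis
    proof (intro exI[of _ C] conjI allI impI)
      fix \<epsilon> f g assume \<epsilon>: "0 < \<epsilon>" "\<epsilon> < 1" and g: "L2_solution (perforated_ball T \<epsilon>) f g" and f: "Lp p f" "\<forall>x. x \<notin> ball 0 1 \<longrightarrow> f x = 0"
      note * = C(2)[OF \<epsilon> g f]
      show "pint p g \<le> C * pint p f" using * by simp
      have "grad_closure 2 (perforated_ball T \<epsilon>) g" using g by (simp add: L2_solution_def)
      then show "grad_closure p (perforated_ball T \<epsilon>) g"
        by (rule grad_closure_upgrade[OF uc[OF \<epsilon>] bounded_perforated_ball op]) (use * 2 in simp_all)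
    qed (rule C)
  next
    case 3
    define q where "q = p / (p - 1)"
    have pq: "1 / p + 1 / q = 1" and q: "2 < q" "q < 3" using p 3 conjugate_range[OF p] by (auto simp: q_def field_simps)
    obtain C where C: "0 < C" "\<And>\<epsilon> f g. 0 < \<epsilon> \<Longrightarrow> \<epsilon> < 1 \<Longrightarrow> L2_solution (perforated_ball T \<epsilon>) f g \<Longrightarrow> Lp q f \<Longrightarrow>
      (\<forall>x. x \<notin> ball 0 1 \<longrightarrow> f x = 0) \<Longrightarrow> Lp q g \<and> pint q g \<le> C * pint q f"
      using perforated_ball_estimate[OF T q dim] by blast
    have p1: "1 < p" and C2: "0 < 1 / (2 * C)" using p C by auto
    obtain K where K: "0 < K" "\<forall>a\<ge>0. \<forall>b\<ge>0. a * b \<le> 1 / (2 * C) * a powr q + K * b powr p"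
      using Young_small[OF p1 pq C2] by (elim exE conjE) (rule that)
    have K2: "a * b \<le> 1 / (2 * C) * a powr q + K * b powr p" if "0 \<le> a" "0 \<le> b" for a b
      using K(2) that by (elim allE impE)
    show ?thesis
    proof (intro exI[of _ "2 * K"] conjI allI impI)
      fix \<epsilon> f g assume \<epsilon>: "0 < \<epsilon>" "\<epsilon> < 1" and g: "L2_solution (perforated_ball T \<epsilon>) f g" and f: "Lp 2 f" "Lp p f"
      have 2: "Lp q k \<and> pint q k \<le> C * pint q h"
        if "L2_solution (perforated_ball T \<epsilon>) h k" "Lp q h" "\<And>x. x \<notin> perforated_ball T \<epsilon> \<Longrightarrow> h x = 0" for h k
        using perforated_ball_subset[of T \<epsilon>] that by (intro C(2)[OF \<epsilon> that(1,2)]) blast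
      show "pint p g \<le> 2 * K * pint p f"
        using p 3 op by (intro duality_estimate(2)[OF bounded_perforated_ball _ _ _ pq C(1) 2 K2 f g]) auto
      have "grad_closure 2 (perforated_ball T \<epsilon>) g" using g by (simp add: L2_solution_def)
      then show "grad_closure p (perforated_ball T \<epsilon>) g"
        by (rule grad_closure_nest) (use p 3 op bounded_perforated_ball in simp_all)
    qed (use K in simp)
  qed
qed

text \<open>Data in L^p with \<open>p < 2\<close> may have infinite energy. The truncations have
  finite energy, so \<open>L2_solution_exists\<close> applies to them.\<close>

lemma truncation:
  assumes f: "Lp p f" "\<And>x. x \<notin> S \<Longrightarrow> f x = 0" and S: "bounded S" and p: "0 < p"
  defines "F \<equiv> \<lambda>(n::nat) x. if norm (f x) \<le> real n then f x else 0"
  shows "Lp 2 (F n)" "Lp p (F n)" "pint p (F n) \<le> pint p f" "(\<lambda>n. pdist p (F n) f) \<longlonglongrightarrow> 0"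
proof -
  note [measurable] = Lp_borel[OF f(1)]
  have Fb: "F n \<in> borel_measurable borel" for n unfolding F_def by measurable
  show "Lp 2 (F n)" by (rule Lp_bounded_support[OF Fb _ _ S, of n "real n"]) (auto simp: F_def f(2))
  have "norm (F n x) \<le> 1 * norm (f x)" for x by (simp add: F_def)
  from Lp_bound[OF f(1) Fb this _ p] show "Lp p (F n)" "pint p (F n) \<le> pint p f" by simp_all
  define t where "t M x = (if M < norm (f x) then norm (f x) powr p else 0)" for M x
  have ti: "integrable lborel (t M)" for M
    by (rule Bochner_Integration.integrable_bound[OF Lp_integrable[OF f(1)]]) (auto simp: t_def[abs_def])
  have eq: "pdist p (F n) f = (LBINT x. t (real n) x)" for n
    unfolding pint_def by (intro Bochner_Integration.integral_cong) (auto simp: F_def t_def)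
  show "(\<lambda>n. pdist p (F n) f) \<longlonglongrightarrow> 0"
  proof (rule LIMSEQ_I)
    fix e :: real assume "0 < e"
    then obtain M where M: "(LBINT x. t M x) < e" using pint_tail[OF f(1) p] unfolding t_def by blast
    obtain N :: nat where N: "M \<le> real N" using real_arch_simple by blast
    have "norm (pdist p (F n) f - 0) < e" if n: "N \<le> n" for n
    proof -
      have "(LBINT x. t (real n) x) \<le> (LBINT x. t M x)" by (intro integral_mono ti) (use n N in \<open>auto simp: t_def\<close>)
      then show ?thesis using M by (simp add: eq[symmetric])
    qed
    then show "\<exists>N. \<forall>n\<ge>N. norm (pdist p (F n) f - 0) < e" by blast
  qed
qed

text \<open>By linearity the estimate also holds for differences, so the solutions for truncated
  data are Cauchy in L^p. The factor \<open>2 powr p\<close> is the price of the triangle inequality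
  in the limit.\<close>

lemma dirichlet_gradient_exists:
  fixes T :: "'a::euclidean_space set"
  assumes T: "closed_lipschitz_domain T" "T \<subseteq> ball 0 1" and p: "3 / 2 < p" "p < 3" and dim: "DIM('a) = 3"
  shows "\<exists>C>0. \<forall>\<epsilon> f. 0 < \<epsilon> \<longrightarrow> \<epsilon> < 1 \<longrightarrow> Lp p f \<longrightarrow> (\<forall>x. x \<notin> ball 0 1 \<longrightarrow> f x = 0) \<longrightarrow>
    (\<exists>g. grad_closure p (perforated_ball T \<epsilon>) g \<and> pint p g \<le> C * pint p f \<and>
      (\<forall>\<psi>. test_function (perforated_ball T \<epsilon>) \<psi> \<longrightarrow> (LBINT x. (g x + f x) \<bullet> gradient \<psi> x) = 0))"
proof -
  obtain C where C: "0 < C" "\<And>\<epsilon> f g. 0 < \<epsilon> \<Longrightarrow> \<epsilon> < 1 \<Longrightarrow> L2_solution (perforated_ball T \<epsilon>) f g \<Longrightarrow> Lp 2 f \<Longrightarrow> Lp p f \<Longrightarrow>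
    (\<forall>x. x \<notin> ball 0 1 \<longrightarrow> f x = 0) \<Longrightarrow> grad_closure p (perforated_ball T \<epsilon>) g \<and> pint p g \<le> C * pint p f"
    using perforated_ball_L2_estimate[OF T p dim] by blast
  define q where "q = p / (p - 1)"
  have pq: "1 / p + 1 / q = 1" and q: "0 < q" "1 < q" using p conjugate_range[OF p] by (auto simp: q_def)
  have p0: "0 < p" "1 < p" "1 \<le> p" using p by auto
  show ?thesis
  proof (intro exI[of _ "2 powr p * C"] conjI allI impI)
    fix \<epsilon> :: real and f :: "'a \<Rightarrow> 'a"
    assume \<epsilon>: "0 < \<epsilon>" "\<epsilon> < 1" and f: "Lp p f" and f0: "\<forall>x. x \<notin> ball 0 1 \<longrightarrow> f x = 0"
    let ?\<Omega> = "perforated_ball T \<epsilon>"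
    have op: "open ?\<Omega>" using T by (intro open_perforated_ball closed_lipschitz_domain_compact)
    define F where "F = (\<lambda>(n::nat) x. if norm (f x) \<le> real n then f x else 0)"
    have f0': "\<And>x. x \<notin> ball 0 1 \<Longrightarrow> f x = 0" using f0 by blast
    have F: "Lp 2 (F n)" "Lp p (F n)" "pint p (F n) \<le> pint p f" "(\<lambda>n. pdist p (F n) f) \<longlonglongrightarrow> 0"
      and F0: "\<forall>x. x \<notin> ball 0 1 \<longrightarrow> F n x = 0" for n
      using truncation[where S = "ball 0 1", OF f f0' bounded_ball p0(1)] f0 unfolding F_def by auto
    have "\<exists>g. L2_solution ?\<Omega> (F n) g" for n using op by (intro L2_solution_exists F bounded_perforated_ball) auto
    then obtain g where g: "\<And>n. L2_solution ?\<Omega> (F n) (g n)" by metis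
    have gp: "grad_closure p ?\<Omega> (g n)" "pint p (g n) \<le> C * pint p (F n)" for n using C(2)[OF \<epsilon> g F(1,2) F0] by auto
    have gL: "Lp p (g n)" for n using gp(1) by (rule grad_closure_Lp)
    have gd: "pdist p (g m) (g n) \<le> C * pdist p (F m) (F n)" for m n
    proof -
      have "L2_solution ?\<Omega> (\<lambda>x. F m x - F n x) (\<lambda>x. g m x - g n x)" by (rule L2_solution_diff[OF g g F(1) F(1)])
      then show ?thesis using C(2)[OF \<epsilon>] Lp_diff(1)[OF F(1) F(1), of m n] Lp_diff(1)[OF F(2) F(2) p0(1), of m n] F0[of m] F0[of n] by simp
    qed
    have Cauchy: "\<exists>N. \<forall>m\<ge>N. \<forall>n\<ge>N. pdist p (g m) (g n) < e" if e: "0 < e" for e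
    proof -
      define d where "d = e / (2 * C * 2 powr p)"
      have d: "0 < d" using e C by (simp add: d_def)
      then obtain N where N: "\<And>n. N \<le> n \<Longrightarrow> pdist p (F n) f < d" using LIMSEQ_D[OF F(4) d] by auto
      have "pdist p (g m) (g n) < e" if mn: "N \<le> m" "N \<le> n" for m n
      proof -
        have "pint p (\<lambda>x. (F m x - f x) - (F n x - f x)) \<le> 2 powr p * (pdist p (F m) f + pdist p (F n) f)"
          by (rule Lp_diff(2)[OF Lp_diff(1)[OF F(2) f] Lp_diff(1)[OF F(2) f]]) (rule p0)+
        also have "\<dots> < 2 powr p * (d + d)" using N[OF mn(1)] N[OF mn(2)] by (intro mult_strict_left_mono) auto
        also have "\<dots> = e / C" using C by (simp add: d_def)
        finally have "C * pdist p (F m) (F n) < e" using C by (simp add: field_simps)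
        then show ?thesis using gd[of m n] by simp
      qed
      then show ?thesis by blast
    qed
    obtain G where G: "Lp p G" "\<And>x. x \<notin> ?\<Omega> \<Longrightarrow> G x = 0" "(\<lambda>n. pdist p (g n) G) \<longlonglongrightarrow> 0"
      by (rule Lp_complete[OF gL grad_closure_0[OF gp(1)] bounded_perforated_ball borel_open[OF op] p0(3) Cauchy]; (rule that)?)
    have G1: "grad_closure p ?\<Omega> G"
    proof (rule grad_closure_limit[OF p0(1) G(1,2)])
      fix e :: real assume "0 < e"
      then show "\<exists>H. grad_closure p ?\<Omega> H \<and> pdist p H G < e" using gp(1) by (intro tendsto_pint_ex[OF G(3)])
    qed
    have G2: "(LBINT x. (G x + f x) \<bullet> gradient \<psi> x) = 0" if \<psi>: "test_function ?\<Omega> \<psi>" for \<psi>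
    proof -
      have \<psi>q: "Lp q (gradient \<psi>)" using \<psi> q(1) by (rule test_function_Lp)
      have i: "integrable lborel (\<lambda>x. gradient \<psi> x \<bullet> h x)" if "Lp p h" for h :: "'a \<Rightarrow> 'a"
        by (rule pairing_integrable[OF \<psi>q that p0(2) pq])
      let ?I = "\<lambda>h. LBINT x. gradient \<psi> x \<bullet> h x"
      have split: "(LBINT x. (a x + b x) \<bullet> gradient \<psi> x) = ?I a + ?I b"
        if "Lp p a" "Lp p b" for a b
      proof -
        have "(\<lambda>x. (a x + b x) \<bullet> gradient \<psi> x) = (\<lambda>x. gradient \<psi> x \<bullet> a x + gradient \<psi> x \<bullet> b x)"
          by (simp only: inner_add_left inner_commute[of "gradient \<psi> _"])
        then show ?thesis using i that by simp
      qed
      have "?I (g n) + ?I (F n) = 0" for n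
        using g[of n] \<psi> split[OF gL[of n] F(2)[of n]] by (simp add: L2_solution_def)
      moreover have "(\<lambda>n. ?I (g n) + ?I (F n))
          \<longlonglongrightarrow> ?I G + ?I f" by (intro tendsto_add pairing_limit[OF \<psi>q _ p0(2) pq] G f gL F)
      ultimately have "?I G + ?I f = 0" by (simp add: LIMSEQ_const_iff)
      then show ?thesis by (simp only: split[OF G(1) f])
    qed
    have G3: "pint p G \<le> 2 powr p * C * pint p f"
    proof (rule field_le_epsilon)
      fix e :: real assume e: "0 < e"
      have "\<exists>H. (\<exists>n. H = g n) \<and> pdist p H G < e / 2 powr p" by (rule tendsto_pint_ex[OF G(3)]) (use e in auto)
      then obtain n where n: "pdist p (g n) G < e / 2 powr p" by blast
      have "pint p (\<lambda>x. g n x - (g n x - G x)) \<le> 2 powr p * (pint p (g n) + pdist p (g n) G)"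
        by (rule Lp_diff(2)[OF gL Lp_diff(1)[OF gL G(1)]]) (rule p0)+
      then have "pint p G \<le> 2 powr p * pint p (g n) + 2 powr p * pdist p (g n) G" by (simp add: distrib_left)
      also have "2 powr p * pint p (g n) \<le> 2 powr p * (C * pint p f)"
        using gp(2)[of n] F(3)[of n] C(1) by (intro mult_left_mono) (auto intro: order_trans mult_left_mono)
      also have "2 powr p * pdist p (g n) G \<le> e" using n by (simp add: field_simps)
      finally show "pint p G \<le> 2 powr p * C * pint p f + e" by simp
    qed
    show "\<exists>g. grad_closure p ?\<Omega> g \<and> pint p g \<le> 2 powr p * C * pint p f \<and>
      (\<forall>\<psi>. test_function ?\<Omega> \<psi> \<longrightarrow> (LBINT x. (g x + f x) \<bullet> gradient \<psi> x) = 0)" using G1 G2 G3 by blast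
  qed (use C in simp)
qed

text \<open>Since \<open>g\<close> is only in \<open>L\<^sup>p\<close>, it cannot be tested with itself; test it with the solution for
  the bounded data \<open>g / (1 + |g|)\<close> instead.\<close>

lemma dirichlet_gradient_unique:
  fixes T :: "'a::euclidean_space set"
  assumes T: "closed_lipschitz_domain T" "T \<subseteq> ball 0 1" and p: "3 / 2 < p" "p < 3" and dim: "DIM('a) = 3"
    and \<epsilon>: "0 < \<epsilon>" "\<epsilon> < 1" and g: "grad_closure p (perforated_ball T \<epsilon>) g"
    and orth: "\<And>\<psi>. test_function (perforated_ball T \<epsilon>) \<psi> \<Longrightarrow> (LBINT x. g x \<bullet> gradient \<psi> x) = 0"
  shows "AE x in lborel. g x = 0"
proof -
  let ?\<Omega> = "perforated_ball T \<epsilon>"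
  have op: "open ?\<Omega>" using T by (intro open_perforated_ball closed_lipschitz_domain_compact)
  define q where "q = p / (p - 1)"
  have pq: "1 / p + 1 / q = 1" and q: "3 / 2 < q" "q < 3" using p conjugate_range[OF p] by (auto simp: q_def)
  have qp: "1 / q + 1 / p = 1" and p1: "1 < p" and q1: "1 < q" using pq p q by auto
  have gL: "Lp p g" and g0: "\<And>x. x \<notin> ?\<Omega> \<Longrightarrow> g x = 0" using g by (auto simp: grad_closure_def)
  note [measurable] = Lp_borel[OF gL]
  \<comment> \<open>Bounded data on a bounded set lie in every L^r, so \<open>k\<close> is an energy
    solution whose gradient also lies in the closure for the dual exponent. Pairing each equation
    with the other gradient shows that the nonnegative function \<open>h \<bullet> g\<close> has
    integral 0.\<close>
  define h where "h x = g x /\<^sub>R (1 + norm (g x))" for x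
  have hb: "h \<in> borel_measurable borel" unfolding h_def by measurable
  have h1: "norm (h x) \<le> 1" for x by (simp add: h_def divide_simps add_pos_nonneg)
  have h0: "h x = 0" if "x \<notin> ?\<Omega>" for x using g0[OF that] by (simp add: h_def)
  have hL: "Lp r h" if "0 < r" for r by (rule Lp_bounded_support[OF hb h1 h0 bounded_perforated_ball that])
  obtain k where k: "L2_solution ?\<Omega> h k"
    using L2_solution_exists[OF hL[of 2] bounded_perforated_ball borel_open[OF op]] by auto
  have "\<forall>x. x \<notin> ball 0 1 \<longrightarrow> h x = 0" using h0 perforated_ball_subset[of T \<epsilon>] by blast
  then have kc: "grad_closure q ?\<Omega> k" using perforated_ball_L2_estimate[OF T q dim] \<epsilon> k hL q by fastforce
  have kL: "Lp q k" and hq: "Lp q h" using kc q by (auto intro: grad_closure_Lp hL)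
  have 1: "(LBINT x. g x \<bullet> k x) = 0" by (rule grad_closure_orthogonal[OF gL kc q1 qp orth])
  have khL: "Lp q (\<lambda>x. k x + h x)" using q by (intro Lp_add kL hq) auto
  have 2: "(LBINT x. (k x + h x) \<bullet> g x) = 0"
    by (rule grad_closure_orthogonal[OF khL g p1 pq]) (use k in \<open>simp add: L2_solution_def\<close>)
  have i: "integrable lborel (\<lambda>x. k x \<bullet> g x)" "integrable lborel (\<lambda>x. h x \<bullet> g x)"
    using pairing_integrable[OF kL gL p1 pq] pairing_integrable[OF hq gL p1 pq] by auto
  have "(LBINT x. k x \<bullet> g x) = 0" using 1 by (simp add: inner_commute)
  then have "(LBINT x. h x \<bullet> g x) = 0" using 2 i by (simp add: inner_add_left)
  moreover have "h x \<bullet> g x = (norm (g x))\<^sup>2 / (1 + norm (g x))" for x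
    by (simp add: h_def power2_norm_eq_inner divide_inverse mult.commute)
  moreover have "0 \<le> (norm (g x))\<^sup>2 / (1 + norm (g x))" for x by (simp add: add_nonneg_nonneg)
  ultimately have "AE x in lborel. h x \<bullet> g x = 0" using integral_nonneg_eq_0_iff_AE[OF i(2)] by simp
  then show ?thesis
  proof eventually_elim
    case (elim x)
    have "1 + norm (g x) \<noteq> 0" by (smt (verit) norm_ge_zero)
    then show ?case using elim by (simp add: h_def)
  qed
qed

section \<open>Weak gradients\<close>

text \<open>Dictionary between the two settings: \<open>f\<close> is Lebesgue measurable on
  \<open>\<Omega>\<close> with irrelevant values elsewhere, as in the definitions of the spaces;
  \<open>h\<close> is its Borel representative on the whole space, as in all the estimates
  above.\<close>

definition borel_version :: "'a::euclidean_space set \<Rightarrow> ('a \<Rightarrow> 'b::euclidean_space) \<Rightarrow> ('a \<Rightarrow> 'b) \<Rightarrow> bool" where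
  "borel_version \<Omega> f h \<longleftrightarrow> h \<in> borel_measurable borel \<and> (\<forall>x. x \<notin> \<Omega> \<longrightarrow> h x = 0) \<and> (AE x in lborel. x \<in> \<Omega> \<longrightarrow> f x = h x)"

lemma AE_lebesgue_on_iff:
  assumes "\<Omega> \<in> sets borel"
  shows "(AE x in lebesgue_on \<Omega>. P x) \<longleftrightarrow> (AE x in lborel. x \<in> \<Omega> \<longrightarrow> P x)"
  using assms by (simp add: AE_restrict_space_iff AE_completion_iff)

text \<open>Completeness of Lebesgue measure: subsets of the exceptional null set are
  measurable.\<close>

lemma lebesgue_measurable_AE:
  fixes f h :: "'a::euclidean_space \<Rightarrow> 'b::euclidean_space"
  assumes h: "h \<in> borel_measurable borel" and ae: "AE x in lborel. f x = h x"
  shows "f \<in> borel_measurable lebesgue"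
proof (rule borel_measurableI)
  fix S :: "'b set" assume S: "open S"
  have h': "h \<in> borel_measurable lebesgue" using h by (simp add: measurable_completion)
  have 1: "Measurable.pred lebesgue (\<lambda>x. f x \<noteq> h x)" using ae by (intro sets_completion_AE) auto
  have 2: "Measurable.pred lebesgue (\<lambda>x. f x \<in> S \<and> f x \<noteq> h x)" using ae by (intro sets_completion_AE) auto
  have 3: "Measurable.pred lebesgue (\<lambda>x. h x \<in> S)" using measurable_sets[OF h', of S] S by (simp add: pred_def vimage_def)
  have "{x. h x \<in> S} - {x. f x \<noteq> h x} \<union> {x. f x \<in> S \<and> f x \<noteq> h x} \<in> sets lebesgue"
    using 1 2 3 unfolding pred_def by (intro sets.Un sets.Diff) auto
  moreover have "{x. h x \<in> S} - {x. f x \<noteq> h x} \<union> {x. f x \<in> S \<and> f x \<noteq> h x} = {x. f x \<in> S}" by auto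
  ultimately show "f -` S \<inter> space lebesgue \<in> sets lebesgue" by (simp add: vimage_def)
qed

lemma borel_version_integral:
  assumes \<Omega>: "\<Omega> \<in> sets borel" and fh: "borel_version \<Omega> f h"
  shows "f \<in> borel_measurable (lebesgue_on \<Omega>)" "integrable (lebesgue_on \<Omega>) f \<longleftrightarrow> integrable lborel h"
    "(LINT x|lebesgue_on \<Omega>. f x) = (LBINT x. h x)"
proof -
  have h: "h \<in> borel_measurable borel" "h \<in> borel_measurable lebesgue"
    using fh by (auto simp: borel_version_def measurable_completion)
  have \<Omega>': "\<Omega> \<inter> space lebesgue \<in> sets lebesgue" using \<Omega> by simp
  have ae: "AE x in lborel. indicator \<Omega> x *\<^sub>R f x = h x"
    using fh unfolding borel_version_def by (auto simp: indicator_def)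
  have m: "(restr \<Omega> f) \<in> borel_measurable lebesgue" by (rule lebesgue_measurable_AE[OF h(1) ae])
  then show "f \<in> borel_measurable (lebesgue_on \<Omega>)" by (simp add: borel_measurable_restrict_space_iff[OF \<Omega>'])
  have ae': "AE x in lebesgue. indicator \<Omega> x *\<^sub>R f x = h x" using ae by (simp add: AE_completion_iff)
  show "integrable (lebesgue_on \<Omega>) f \<longleftrightarrow> integrable lborel h"
    unfolding integrable_restrict_space[OF \<Omega>'] using integrable_cong_AE[OF m h(2) ae'] h(1) by (simp add: integrable_completion)
  show "(LINT x|lebesgue_on \<Omega>. f x) = (LBINT x. h x)"
    unfolding integral_restrict_space[OF \<Omega>'] using integral_cong_AE[OF m h(2) ae'] h(1) by (simp add: integral_completion)
qed

lemma borel_version_map: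
  assumes "borel_version \<Omega> f h" "(\<lambda>x. \<Phi> x (h x)) \<in> borel_measurable borel" "\<And>x. x \<notin> \<Omega> \<Longrightarrow> \<Phi> x 0 = 0"
  shows "borel_version \<Omega> (\<lambda>x. \<Phi> x (f x)) (\<lambda>x. \<Phi> x (h x))"
  using assms unfolding borel_version_def by auto

lemma borel_version_exists:
  assumes \<Omega>: "\<Omega> \<in> sets borel" and f: "f \<in> borel_measurable (lebesgue_on \<Omega>)"
  shows "\<exists>h. borel_version \<Omega> f h"
proof -
  have "(restr \<Omega> f) \<in> borel_measurable lebesgue" using f \<Omega> by (subst (asm) borel_measurable_restrict_space_iff) auto
  then have "\<forall>b. \<exists>h\<in>borel_measurable lborel. AE x in lborel. (indicator \<Omega> x *\<^sub>R f x) \<bullet> b = h x"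
    by (intro allI completion_ex_borel_measurable_real borel_measurable_inner) auto
  then obtain h where h: "\<And>b. h b \<in> borel_measurable lborel" "\<And>b. AE x in lborel. (indicator \<Omega> x *\<^sub>R f x) \<bullet> b = h b x"
    by metis
  define H where "H x = indicator \<Omega> x *\<^sub>R (\<Sum>b\<in>Basis. h b x *\<^sub>R b)" for x
  have "AE x in lborel. \<forall>b\<in>Basis. (indicator \<Omega> x *\<^sub>R f x) \<bullet> b = h b x" using h(2) by (intro AE_finite_allI) auto
  then have "AE x in lborel. x \<in> \<Omega> \<longrightarrow> f x = H x"
  proof eventually_elim
    case (elim x)
    show ?case
    proof
      assume x: "x \<in> \<Omega>"
      have "f x = (\<Sum>b\<in>Basis. (f x \<bullet> b) *\<^sub>R b)" by (simp add: euclidean_representation)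
      also have "\<dots> = H x" using elim x by (simp add: H_def)
      finally show "f x = H x" .
    qed
  qed
  moreover have "H \<in> borel_measurable borel"
    unfolding H_def using h(1) \<Omega> by (intro borel_measurable_scaleR borel_measurable_sum borel_measurable_indicator) auto
  ultimately show ?thesis unfolding borel_version_def H_def by auto
qed

lemma borel_version_Lp:
  assumes \<Omega>: "\<Omega> \<in> sets borel" and fh: "borel_version \<Omega> f h"
  shows "f \<in> Lp_space \<Omega> p \<longleftrightarrow> Lp p h" "Lp_norm \<Omega> p f = pint p h powr (1 / p)"
proof -
  have h: "h \<in> borel_measurable borel" using fh by (simp add: borel_version_def)
  have "borel_version \<Omega> (\<lambda>x. norm (f x) powr p) (\<lambda>x. norm (h x) powr p)"
    by (rule borel_version_map[OF fh, where \<Phi> = "\<lambda>x y. norm y powr p"]) (use h in auto)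
  note * = borel_version_integral(2,3)[OF \<Omega> this]
  show "f \<in> Lp_space \<Omega> p \<longleftrightarrow> Lp p h" using borel_version_integral(1)[OF \<Omega> fh] * h by (simp add: Lp_space_def Lp_def)
  show "Lp_norm \<Omega> p f = pint p h powr (1 / p)" using * by (simp add: Lp_norm_def pint_def)
qed

lemma borel_version_L1_loc:
  assumes fh: "borel_version \<Omega> f h" and i: "integrable lborel h"
  shows "f \<in> L1_loc \<Omega>"
  unfolding L1_loc_def
proof (intro CollectI allI impI, elim conjE)
  fix K assume K: "compact K" "K \<subseteq> \<Omega>"
  have "borel_version K f (restr K h)"
    using fh K compact_imp_closed[OF K(1)] unfolding borel_version_def by (auto simp: subset_iff)
  moreover have "integrable lborel (restr K h)"
    using K i by (intro integrable_mult_indicator) (auto intro: borel_compact)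
  ultimately have "integrable (lebesgue_on K) f" using borel_version_integral(2)[of K] borel_compact[OF K(1)] by blast
  then show "f absolutely_integrable_on K"
    using borel_compact[OF K(1)] by (simp add: set_integrable_def integrable_restrict_space)
qed

section \<open>The fundamental lemma and uniqueness of weak gradients\<close>

lemma AE_zero_of_boxes:
  fixes H :: "'a::euclidean_space \<Rightarrow> real"
  assumes H: "integrable lborel H" and box: "\<And>p q. (LBINT x. indicator (box p q) x * H x) = 0"
  shows "AE x in lborel. H x = 0"
proof -
  have i: "set_integrable lborel A H" if "A \<in> sets borel" for A
    using integrable_mult_indicator[OF _ H] that by (simp add: set_integrable_def)
  have "(LBINT x. H x) = 0"
  proof (rule LIMSEQ_unique)
    let ?b = "\<lambda>n. box (- (real n *\<^sub>R One)) (real n *\<^sub>R One) :: 'a set"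
    have "(\<lambda>n. LBINT x. indicator (?b n) x * H x) \<longlonglongrightarrow> (LBINT x. H x)"
    proof (rule integral_dominated_convergence[where w = "\<lambda>x. \<bar>H x\<bar>"])
      show "AE x in lborel. (\<lambda>n. indicator (?b n) x * H x) \<longlonglongrightarrow> H x"
      proof (intro AE_I2 tendsto_eventually)
        fix x :: 'a
        obtain N :: nat where N: "norm x < real N" using reals_Archimedean2 by blast
        show "\<forall>\<^sub>F n in sequentially. indicator (?b n) x * H x = H x" unfolding eventually_sequentially
        proof (intro exI[of _ N] allI impI)
          fix n assume "N \<le> n"
          then have "\<bar>x \<bullet> b\<bar> < real n" if "b \<in> Basis" for b using Basis_le_norm[OF that, of x] N by simp
          then have "x \<in> ?b n" by (auto simp: mem_box abs_less_iff minus_less_iff)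
          then show "indicator (?b n) x * H x = H x" by simp
        qed
      qed
    qed (use H in \<open>auto simp: indicator_def\<close>)
    then show "(\<lambda>n. 0) \<longlonglongrightarrow> (LBINT x. H x)" by (simp add: box)
  qed simp
  \<comment> \<open>Boxes are stable under intersection and generate the Borel sets, so the
    vanishing extends to all Borel sets by Dynkin's argument. The complement step uses the total
    integral computed before; the sets \<open>{x. 0 < H x}\<close> and \<open>{x. H x < 0}\<close>
    then decide the claim.\<close>
  have zero: "(LINT x:A|lborel. H x) = 0" if "A \<in> sets borel" for A
  proof -
    have *: "A \<in> sigma_sets UNIV (range (\<lambda>(a, b). box a b :: 'a set))" using that by (simp add: borel_eq_box)
    have "Int_stable (range (\<lambda>(a, b). box a b :: 'a set))" by (auto simp: Int_stable_def box_Int_box)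
    moreover have "range (\<lambda>(a, b). box a b :: 'a set) \<subseteq> Pow UNIV" by simp
    ultimately show ?thesis using *
    proof (induction rule: sigma_sets_induct_disjoint)
      case (basic A)
      then show ?case using box by (auto simp: set_lebesgue_integral_def)
    next
      case (compl A)
      then have A: "A \<in> sets borel" by (simp add: borel_eq_box)
      have "(LINT x:UNIV - A|lborel. H x) = (LBINT x. H x - indicator A x *\<^sub>R H x)"
        unfolding set_lebesgue_integral_def by (intro Bochner_Integration.integral_cong) (auto simp: indicator_def)
      also have "\<dots> = 0" using i[OF A] H compl \<open>(LBINT x. H x) = 0\<close> by (simp add: set_integrable_def set_lebesgue_integral_def)
      finally show ?case .
    next
      case (union A)
      then have A: "A i \<in> sets borel" for i by (auto simp: borel_eq_box image_subset_iff)
      have "(LINT x:(\<Union>i. A i)|lborel. H x) = (\<Sum>i. (LINT x:A i|lborel. H x))"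
        using A union(1) by (intro lebesgue_integral_countable_add i) (auto simp: disjoint_family_on_def)
      then show ?case using union by simp
    qed (simp add: set_lebesgue_integral_def)
  qed
  have [measurable]: "H \<in> borel_measurable borel" using H by simp
  have sign: "AE x in lborel. indicator A x * (s * H x) = 0"
    if A: "A \<in> sets borel" "\<And>x. x \<in> A \<Longrightarrow> 0 \<le> s * H x" for A s
  proof -
    have 1: "integrable lborel (\<lambda>x. s * (indicator A x * H x))" "(LBINT x. s * (indicator A x * H x)) = 0"
      using i[OF A(1)] zero[OF A(1)] by (simp_all add: set_integrable_def set_lebesgue_integral_def)
    have "AE x in lborel. s * (indicator A x * H x) = 0"
      using integral_nonneg_eq_0_iff_AE[OF 1(1)] 1(2) A(2) by (auto simp: indicator_def)
    then show ?thesis by eventually_elim (simp add: mult.left_commute)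
  qed
  have "AE x in lborel. indicator {x. 0 < H x} x * (1 * H x) = 0" by (rule sign) auto
  moreover have "AE x in lborel. indicator {x. H x < 0} x * (-1 * H x) = 0" by (rule sign) auto
  ultimately show ?thesis by eventually_elim (auto simp: indicator_def split: if_splits)
qed

text \<open>Approximates the indicator of a box, not of a ball, because
  \<open>AE_zero_of_boxes\<close> needs a generator that is stable under intersection.\<close>

definition box_cutoff :: "'a::euclidean_space \<Rightarrow> 'a \<Rightarrow> nat \<Rightarrow> 'a \<Rightarrow> real" where
  "box_cutoff p q n x = (\<Prod>b\<in>Basis. smooth_step (real n * (x \<bullet> b - p \<bullet> b)) * smooth_step (real n * (q \<bullet> b - x \<bullet> b)))"

lemma smooth_box_cutoff: "smooth (box_cutoff p q n)"
  unfolding box_cutoff_def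
proof (intro smooth_prod finite_Basis smooth_mult smoothI C_k_smooth_step)
  fix b k
  have "C_k k (\<lambda>x. real n * (x \<bullet> b + - (p \<bullet> b)))" "C_k k (\<lambda>x. real n * (q \<bullet> b + (-1) * (x \<bullet> b)))"
    by (intro C_k_mult C_k_add C_k_const C_k_inner)+
  then show "C_k k (\<lambda>x. real n * (x \<bullet> b - p \<bullet> b))" "C_k k (\<lambda>x. real n * (q \<bullet> b - x \<bullet> b))" by simp_all
qed

lemma box_cutoff_bounds: "0 \<le> box_cutoff p q n x" "box_cutoff p q n x \<le> 1"
  unfolding box_cutoff_def using smooth_step_bounds by (auto intro!: prod_nonneg prod_le_1 mult_le_one)

lemma box_cutoff_0: "x \<notin> box p q \<Longrightarrow> box_cutoff p q n x = 0"
proof -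
  assume "x \<notin> box p q"
  then obtain b where b: "b \<in> Basis" "x \<bullet> b \<le> p \<bullet> b \<or> q \<bullet> b \<le> x \<bullet> b" by (auto simp: mem_box not_less)
  then have "smooth_step (real n * (x \<bullet> b - p \<bullet> b)) * smooth_step (real n * (q \<bullet> b - x \<bullet> b)) = 0"
    by (auto intro!: smooth_step_0 mult_nonneg_nonpos)
  then show ?thesis unfolding box_cutoff_def using b(1) by (intro prod_zero) auto
qed

lemma box_cutoff_tendsto: "(\<lambda>n. box_cutoff p q n x) \<longlonglongrightarrow> indicator (box p q) x"
proof (cases "x \<in> box p q")
  case True
  have 1: "(\<lambda>n. smooth_step (real n * t)) \<longlonglongrightarrow> 1" if t: "0 < t" for t
  proof (rule tendsto_eventually)
    obtain N :: nat where N: "1 / t \<le> real N" using real_arch_simple[of "1 / t"] by blast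
    have "smooth_step (real n * t) = 1" if "N \<le> n" for n
    proof -
      have "1 \<le> real N * t" using N t by (simp add: field_simps)
      also have "\<dots> \<le> real n * t" using that t by (intro mult_right_mono) auto
      finally show ?thesis by (rule smooth_step_1)
    qed
    then show "\<forall>\<^sub>F n in sequentially. smooth_step (real n * t) = 1" unfolding eventually_sequentially by blast
  qed
  have "(\<lambda>n. box_cutoff p q n x) \<longlonglongrightarrow> (\<Prod>b\<in>(Basis :: 'a set). 1 * 1)"
    unfolding box_cutoff_def by (intro tendsto_prod tendsto_mult 1) (use True in \<open>auto simp: mem_box\<close>)
  then show ?thesis using True by simp
qed (simp add: box_cutoff_0)

text \<open>Local integrability gives honest integrals only on boxes whose closure lies in
  \<open>\<Omega>\<close>, so the claim is proved on these. Countably many such boxes exhaust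
  \<open>\<Omega>\<close>, and their boundaries are null sets.\<close>

lemma fundamental_lemma:
  fixes g :: "'a::euclidean_space \<Rightarrow> 'b::euclidean_space"
  assumes \<Omega>: "open \<Omega>" and g: "g \<in> L1_loc \<Omega>" and zero: "\<And>\<psi>. test_function \<Omega> \<psi> \<Longrightarrow> (LINT x|lebesgue_on \<Omega>. \<psi> x *\<^sub>R g x) = 0"
  shows "AE x in lborel. x \<in> \<Omega> \<longrightarrow> g x = 0"
proof -
  have onbox: "AE x in lborel. x \<in> box a c \<longrightarrow> g x = 0" if ac: "cbox a c \<subseteq> \<Omega>" for a c
  proof -
    have "set_integrable lebesgue (cbox a c) g" using g ac by (auto simp: L1_loc_def)
    then have "set_integrable lebesgue (box a c) g" by (rule set_integrable_subset) (auto simp: box_subset_cbox)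
    then have gi: "integrable (lebesgue_on (box a c)) g" by (simp add: set_integrable_def integrable_restrict_space)
    obtain G where G: "borel_version (box a c) g G" using borel_version_exists[of "box a c" g] gi by auto
    have Gi: "integrable lborel G" using borel_version_integral(2)[OF _ G] gi by simp
    have G0: "\<And>x. x \<notin> box a c \<Longrightarrow> G x = 0" and Gb [measurable]: "G \<in> borel_measurable borel" using G by (auto simp: borel_version_def)
    have box: "(LBINT x. indicator (box p q) x *\<^sub>R G x) = 0" for p q
    proof -
      obtain p' q' where pq: "box p q \<inter> box a c = box p' q'" unfolding box_Int_box by blast
      have eq: "indicator (box p q) x *\<^sub>R G x = indicator (box p' q') x *\<^sub>R G x" for x
        using G0[of x] pq by (auto simp: indicator_def set_eq_iff)
      show ?thesis
      proof (cases "box p' q' = {}")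
        case True
        then show ?thesis by (simp add: eq)
      next
        case False
        have "cbox p' q' \<subseteq> closure (box a c)" using closure_box[OF False] pq closure_mono[of "box p' q'" "box a c"] by auto
        also have "\<dots> \<subseteq> cbox a c" by (intro closure_minimal box_subset_cbox closed_cbox)
        finally have sub: "cbox p' q' \<subseteq> \<Omega>" using ac by blast
        have "(LBINT x. box_cutoff p' q' n x *\<^sub>R G x) = 0" for n
        proof -
          have t: "test_function \<Omega> (box_cutoff p' q' n)"
            using sub box_subset_cbox[of p' q'] by (intro test_functionI[of _ "cbox p' q'"] smooth_box_cutoff) (auto intro: box_cutoff_0)
          have out: "box_cutoff p' q' n x = 0" if "x \<notin> box a c" for x using that pq by (intro box_cutoff_0) auto
          have "borel_version \<Omega> (\<lambda>x. box_cutoff p' q' n x *\<^sub>R g x) (\<lambda>x. box_cutoff p' q' n x *\<^sub>R G x)"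
            unfolding borel_version_def
          proof (intro conjI allI impI)
            show "(\<lambda>x. box_cutoff p' q' n x *\<^sub>R G x) \<in> borel_measurable borel"
              using borel_smooth[OF smooth_box_cutoff] Gb by (intro borel_measurable_scaleR)
            show "box_cutoff p' q' n x *\<^sub>R G x = 0" if "x \<notin> \<Omega>" for x
              using that ac box_subset_cbox[of a c] out[of x] by auto
            have "AE x in lborel. x \<in> box a c \<longrightarrow> g x = G x" using G by (simp add: borel_version_def)
            then show "AE x in lborel. x \<in> \<Omega> \<longrightarrow> box_cutoff p' q' n x *\<^sub>R g x = box_cutoff p' q' n x *\<^sub>R G x"
              by eventually_elim (use out in fastforce)
          qed
          from borel_version_integral(3)[OF borel_open[OF \<Omega>] this] show ?thesis using zero[OF t] by simp
        qed
        moreover have "(\<lambda>n. LBINT x. box_cutoff p' q' n x *\<^sub>R G x) \<longlonglongrightarrow> (LBINT x. indicator (box p' q') x *\<^sub>R G x)"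
        proof (rule integral_dominated_convergence[where w = "\<lambda>x. norm (G x)"])
          show "AE x in lborel. (\<lambda>n. box_cutoff p' q' n x *\<^sub>R G x) \<longlonglongrightarrow> indicator (box p' q') x *\<^sub>R G x"
            by (intro AE_I2 tendsto_scaleR box_cutoff_tendsto tendsto_const)
          show "\<And>n. AE x in lborel. norm (box_cutoff p' q' n x *\<^sub>R G x) \<le> norm (G x)"
            by (auto simp: box_cutoff_bounds intro!: mult_left_le_one_le)
          show "\<And>n. (\<lambda>x. box_cutoff p' q' n x *\<^sub>R G x) \<in> borel_measurable lborel"
            using borel_smooth[OF smooth_box_cutoff] Gb by (auto intro!: borel_measurable_scaleR)
        qed (use Gi in auto)
        ultimately show ?thesis unfolding eq by (simp add: LIMSEQ_const_iff)
      qed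
    qed
    have "AE x in lborel. G x \<bullet> b = 0" for b
    proof (rule AE_zero_of_boxes)
      show "integrable lborel (\<lambda>x. G x \<bullet> b)" using Gi by simp
      fix p q :: 'a
      have "integrable lborel (restr (box p q) G)" using Gi by (intro integrable_mult_indicator) auto
      from integral_inner_left[OF this, of b] show "(LBINT x. indicator (box p q) x * (G x \<bullet> b)) = 0"
        using box[of p q] by simp
    qed
    then have "AE x in lborel. \<forall>b\<in>Basis. G x \<bullet> b = 0" by (intro AE_finite_allI) auto
    then have "AE x in lborel. G x = 0" by eventually_elim (simp add: euclidean_all_zero_iff)
    moreover have "AE x in lborel. x \<in> box a c \<longrightarrow> g x = G x" using G by (simp add: borel_version_def)
    ultimately show ?thesis by eventually_elim auto
  qed
  obtain D where D: "countable D" "D \<subseteq> Pow \<Omega>" "\<And>X. X \<in> D \<Longrightarrow> \<exists>a b. X = cbox a b" "\<Union>D = \<Omega>"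
    using open_countable_Union_open_cbox[OF \<Omega>] by metis
  have "AE x in lborel. x \<in> X \<longrightarrow> g x = 0" if "X \<in> D" for X
  proof -
    obtain a c where X: "X = cbox a c" using D(3)[OF \<open>X \<in> D\<close>] by blast
    have "cbox a c - box a c \<in> null_sets lborel"
      using negligible_frontier_interval[of a c] by (simp add: negligible_iff_null_sets null_sets_completion_iff)
    then have "AE x in lborel. x \<notin> cbox a c - box a c" by (rule AE_not_in)
    moreover have "AE x in lborel. x \<in> box a c \<longrightarrow> g x = 0" using D(2) \<open>X \<in> D\<close> X by (intro onbox) auto
    ultimately show ?thesis unfolding X by eventually_elim auto
  qed
  then have "AE x in lborel. \<forall>X\<in>D. x \<in> X \<longrightarrow> g x = 0" using D(1) by (subst AE_ball_countable) auto
  then show ?thesis by eventually_elim (use D(4) in auto)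
qed

lemma weak_gradient_unique:
  assumes \<Omega>: "open \<Omega>" and g: "is_weak_gradient \<Omega> u g" and h: "is_weak_gradient \<Omega> u h"
  shows "AE x in lborel. x \<in> \<Omega> \<longrightarrow> g x = h x"
proof -
  have gh: "g \<in> L1_loc \<Omega>" "h \<in> L1_loc \<Omega>" using g h by (auto simp: is_weak_gradient_def)
  have "AE x in lborel. x \<in> \<Omega> \<longrightarrow> g x - h x = 0"
  proof (rule fundamental_lemma[OF \<Omega>])
    show "(\<lambda>x. g x - h x) \<in> L1_loc \<Omega>" using gh unfolding L1_loc_def by (auto intro: set_integral_diff)
    fix \<psi> assume \<psi>: "test_function \<Omega> \<psi>"
    obtain K where K: "compact K" "K \<subseteq> \<Omega>" "\<And>x. x \<notin> K \<Longrightarrow> \<psi> x = 0" using test_functionE(2)[OF \<psi>] by blast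
    obtain M where M: "\<And>x. \<bar>\<psi> x\<bar> \<le> M" using test_function_bounded[OF \<psi>] by blast
    have i: "integrable (lebesgue_on \<Omega>) (\<lambda>x. \<psi> x *\<^sub>R k x)" if "k \<in> L1_loc \<Omega>" for k
    proof -
      define w where "w x = indicator K x *\<^sub>R k x" for x
      have w: "integrable lebesgue w" using that K by (auto simp: L1_loc_def set_integrable_def w_def[abs_def])
      have M0: "0 \<le> M" using M[of 0] by simp
      have "\<psi> \<in> borel_measurable lebesgue"
        using borel_smooth[OF test_function_smooth[OF \<psi>]] by (simp add: measurable_completion)
      then have "integrable lebesgue (\<lambda>x. \<psi> x *\<^sub>R w x)"
        by (intro Bochner_Integration.integrable_bound[OF integrable_mult_right[OF integrable_norm[OF w], of M]])
          (use M0 M w in \<open>auto intro!: mult_right_mono simp: abs_mult\<close>)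
      also have "(\<lambda>x. \<psi> x *\<^sub>R w x) = (restr \<Omega> (\<lambda>x. \<psi> x *\<^sub>R k x))"
        using K by (auto simp: fun_eq_iff indicator_def w_def)
      finally show ?thesis using borel_open[OF \<Omega>] by (simp add: integrable_restrict_space)
    qed
    have "(LINT x|lebesgue_on \<Omega>. \<psi> x *\<^sub>R g x) = (LINT x|lebesgue_on \<Omega>. \<psi> x *\<^sub>R h x)"
      using g h \<psi> unfolding is_weak_gradient_def by (metis minus_equation_iff)
    then show "(LINT x|lebesgue_on \<Omega>. \<psi> x *\<^sub>R (g x - h x)) = 0"
      using Bochner_Integration.integral_diff[OF i[OF gh(1)] i[OF gh(2)]] by (simp add: scaleR_diff_right)
  qed
  then show ?thesis by simp
qed

section \<open>Sobolev functions with zero boundary values as pairs\<close>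

lemma Lp_integrable_bounded:
  assumes f: "Lp p f" "1 \<le> p" and \<Omega>: "bounded \<Omega>" "\<Omega> \<in> sets borel" "\<And>x. x \<notin> \<Omega> \<Longrightarrow> f x = 0"
  shows "integrable lborel f"
proof -
  have "Lp 1 f" by (rule Lp_nest(1)[OF f(1) _ f(2) \<Omega>(3) \<Omega>(1,2)]) auto
  then show ?thesis unfolding Lp_def by (auto intro: integrable_norm_cancel)
qed

text \<open>The weak gradient relation on the Borel side, with global integrability in place of
  \<open>L1_loc\<close>; functions in L^p on a bounded domain have it, and differences are then
  immediate.\<close>

definition parts_identity :: "'a::euclidean_space set \<Rightarrow> ('a \<Rightarrow> real) \<Rightarrow> ('a \<Rightarrow> 'a) \<Rightarrow> bool" where
  "parts_identity \<Omega> u g \<longleftrightarrow> integrable lborel u \<and> integrable lborel g \<and> (\<forall>\<psi>. test_function \<Omega> \<psi> \<longrightarrow>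
     (LBINT x. u x *\<^sub>R gradient \<psi> x) = - (LBINT x. \<psi> x *\<^sub>R g x))"

lemma integrable_scaleR_test:
  fixes u :: "'a::euclidean_space \<Rightarrow> real" and g :: "'a \<Rightarrow> 'a"
  assumes \<psi>: "test_function \<Omega> \<psi>"
  shows "integrable lborel u \<Longrightarrow> integrable lborel (\<lambda>x. u x *\<^sub>R gradient \<psi> x)"
    and "integrable lborel g \<Longrightarrow> integrable lborel (\<lambda>x. \<psi> x *\<^sub>R g x)"
proof -
  have sm: "smooth \<psi>" by (rule test_function_smooth[OF \<psi>])
  note [measurable] = borel_smooth[OF sm] borel_gradient[OF sm]
  obtain M where M: "M > 0" "\<And>x. \<bar>\<psi> x\<bar> \<le> M \<and> norm (gradient \<psi> x) \<le> M" using test_function_bounded[OF \<psi>] by blast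
  show "integrable lborel (\<lambda>x. u x *\<^sub>R gradient \<psi> x)" if u: "integrable lborel u"
    by (rule Bochner_Integration.integrable_bound[OF integrable_mult_right[OF integrable_norm[OF u], of M]])
      (use M u in \<open>auto simp: abs_mult mult.commute[of M] intro!: mult_left_mono\<close>)
  show "integrable lborel (\<lambda>x. \<psi> x *\<^sub>R g x)" if g: "integrable lborel g"
    by (rule Bochner_Integration.integrable_bound[OF integrable_mult_right[OF integrable_norm[OF g], of M]])
      (use M g in \<open>auto simp: abs_mult intro!: mult_right_mono\<close>)
qed

lemma parts_identity_diff:
  assumes "parts_identity \<Omega> u g" "parts_identity \<Omega> v h"
  shows "parts_identity \<Omega> (\<lambda>x. u x - v x) (\<lambda>x. g x - h x)"
  unfolding parts_identity_def
proof (intro conjI allI impI)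
  have i: "integrable lborel u" "integrable lborel v" "integrable lborel g" "integrable lborel h"
    using assms by (auto simp: parts_identity_def)
  then show "integrable lborel (\<lambda>x. u x - v x)" "integrable lborel (\<lambda>x. g x - h x)" by auto
  fix \<psi> assume \<psi>: "test_function \<Omega> \<psi>"
  then show "(LBINT x. (u x - v x) *\<^sub>R gradient \<psi> x) = - (LBINT x. \<psi> x *\<^sub>R (g x - h x))"
    using assms integrable_scaleR_test(1)[OF \<psi> i(1)] integrable_scaleR_test(1)[OF \<psi> i(2)]
      integrable_scaleR_test(2)[OF \<psi> i(3)] integrable_scaleR_test(2)[OF \<psi> i(4)]
    by (simp add: parts_identity_def scaleR_diff_left scaleR_diff_right)
qed

lemma test_function_integrable:
  assumes "test_function \<Omega> \<phi>" shows "integrable lborel \<phi>" "integrable lborel (gradient \<phi>)"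
proof -
  have "Lp 1 \<phi>" using assms by (intro test_function_Lp) auto
  then show "integrable lborel \<phi>" unfolding Lp_def by (auto intro: integrable_norm_cancel)
  show "integrable lborel (gradient \<phi>)" using assms by (rule integral_gradient_test)
qed

lemma parts_identity_test: "test_function \<Omega> \<phi> \<Longrightarrow> parts_identity \<Omega> \<phi> (gradient \<phi>)"
  unfolding parts_identity_def
  by (auto intro: test_function_integrable integration_by_parts_test(1)[OF test_function_smooth])

lemma parts_identity_weak_gradient:
  assumes \<Omega>: "open \<Omega>" and u: "borel_version \<Omega> u u'" "integrable lborel u'" and g: "borel_version \<Omega> g g'" "integrable lborel g'"
  shows "is_weak_gradient \<Omega> u g \<longleftrightarrow> parts_identity \<Omega> u' g'"
proof -
  have \<Omega>': "\<Omega> \<in> sets borel" using \<Omega> by simp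
  have "(LINT x|lebesgue_on \<Omega>. u x *\<^sub>R gradient \<psi> x) = (LBINT x. u' x *\<^sub>R gradient \<psi> x)"
    "(LINT x|lebesgue_on \<Omega>. \<psi> x *\<^sub>R g x) = (LBINT x. \<psi> x *\<^sub>R g' x)" if \<psi>: "test_function \<Omega> \<psi>" for \<psi>
  proof -
    note i = integrable_scaleR_test(1)[OF \<psi> u(2)] integrable_scaleR_test(2)[OF \<psi> g(2)]
    have "borel_version \<Omega> (\<lambda>x. u x *\<^sub>R gradient \<psi> x) (\<lambda>x. u' x *\<^sub>R gradient \<psi> x)"
      by (rule borel_version_map[OF u(1), where \<Phi> = "\<lambda>x y. y *\<^sub>R gradient \<psi> x"]) (use i in auto)
    then show "(LINT x|lebesgue_on \<Omega>. u x *\<^sub>R gradient \<psi> x) = (LBINT x. u' x *\<^sub>R gradient \<psi> x)"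
      by (rule borel_version_integral(3)[OF \<Omega>'])
    have "borel_version \<Omega> (\<lambda>x. \<psi> x *\<^sub>R g x) (\<lambda>x. \<psi> x *\<^sub>R g' x)"
      by (rule borel_version_map[OF g(1), where \<Phi> = "\<lambda>x y. \<psi> x *\<^sub>R y"]) (use i in auto)
    then show "(LINT x|lebesgue_on \<Omega>. \<psi> x *\<^sub>R g x) = (LBINT x. \<psi> x *\<^sub>R g' x)"
      by (rule borel_version_integral(3)[OF \<Omega>'])
  qed
  then show ?thesis using borel_version_L1_loc[OF u] borel_version_L1_loc[OF g] u(2) g(2)
    by (auto simp: is_weak_gradient_def parts_identity_def)
qed

text \<open>\<open>weak_gradient\<close> is an arbitrary choice. Uniqueness identifies the chosen
  function with \<open>g\<close> almost everywhere, which makes the Sobolev norm computable.\<close>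

lemma W1p_borel_version:
  assumes \<Omega>: "open \<Omega>" and u: "borel_version \<Omega> u u'" "Lp p u'" and g: "Lp p g" "\<And>x. x \<notin> \<Omega> \<Longrightarrow> g x = 0"
    and ug: "parts_identity \<Omega> u' g" and p: "0 < p"
  shows "u \<in> W1p \<Omega> p" "borel_version \<Omega> (weak_gradient \<Omega> u) g"
    "W1p_norm \<Omega> p u = (pint p u' + pint p g) powr (1 / p)"
proof -
  have \<Omega>': "\<Omega> \<in> sets borel" using \<Omega> by simp
  have gg: "borel_version \<Omega> g g" using Lp_borel[OF g(1)] g(2) by (simp add: borel_version_def)
  have wg: "is_weak_gradient \<Omega> u g"
    using parts_identity_weak_gradient[OF \<Omega> u(1) _ gg] ug by (simp add: parts_identity_def)
  then have "is_weak_gradient \<Omega> u (weak_gradient \<Omega> u)" unfolding weak_gradient_def by (rule someI[where P = "is_weak_gradient \<Omega> u"])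
  from weak_gradient_unique[OF \<Omega> this wg] show 1: "borel_version \<Omega> (weak_gradient \<Omega> u) g"
    using gg by (simp add: borel_version_def)
  show "u \<in> W1p \<Omega> p"
    unfolding W1p_def using borel_version_Lp(1)[OF \<Omega>' u(1)] borel_version_Lp(1)[OF \<Omega>' gg] u(2) g(1) wg by auto
  show "W1p_norm \<Omega> p u = (pint p u' + pint p g) powr (1 / p)"
    unfolding W1p_norm_def borel_version_Lp(2)[OF \<Omega>' u(1)] borel_version_Lp(2)[OF \<Omega>' 1]
    using p by (simp add: powr_powr)
qed

text \<open>A function of \<open>W1p_0\<close> together with its gradient, as Borel functions on the
  whole space; one test function approximates both at once.\<close>

definition sobolev_pair :: "real \<Rightarrow> 'a::euclidean_space set \<Rightarrow> ('a \<Rightarrow> real) \<Rightarrow> ('a \<Rightarrow> 'a) \<Rightarrow> bool" where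
  "sobolev_pair p \<Omega> u g \<longleftrightarrow> Lp p u \<and> Lp p g \<and> (\<forall>x. x \<notin> \<Omega> \<longrightarrow> u x = 0 \<and> g x = 0) \<and>
     (\<forall>e>0. \<exists>\<phi>. test_function \<Omega> \<phi> \<and> pdist p \<phi> u < e \<and> pdist p (gradient \<phi>) g < e)"

lemma sobolev_pair_exists:
  assumes g: "grad_closure p \<Omega> g" and \<Omega>: "bounded \<Omega>" "open \<Omega>" and p: "1 \<le> p"
  shows "\<exists>u. sobolev_pair p \<Omega> u g"
proof -
  obtain \<phi> where \<phi>: "\<And>n::nat. test_function \<Omega> (\<phi> n)" "(\<lambda>n. pdist p (gradient (\<phi> n)) g) \<longlonglongrightarrow> 0"
    using grad_closure_approx[OF g] by blast
  obtain u where u: "Lp p u" "\<forall>x. x \<notin> \<Omega> \<longrightarrow> u x = 0" "(\<lambda>n. pdist p (\<phi> n) u) \<longlonglongrightarrow> 0"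
    using grad_closure_potential[OF g \<Omega>(1) borel_open[OF \<Omega>(2)] p \<phi>] by blast
  have "\<exists>\<phi>. test_function \<Omega> \<phi> \<and> pdist p \<phi> u < e \<and> pdist p (gradient \<phi>) g < e" if e: "0 < e" for e
  proof -
    have "\<forall>\<^sub>F n in sequentially. pdist p (\<phi> n) u < e \<and> pdist p (gradient (\<phi> n)) g < e"
      using order_tendstoD(2)[OF u(3) e] order_tendstoD(2)[OF \<phi>(2) e] by (rule eventually_conj)
    then obtain n where "pdist p (\<phi> n) u < e \<and> pdist p (gradient (\<phi> n)) g < e"
      unfolding eventually_sequentially by blast
    then show ?thesis using \<phi>(1) by blast
  qed
  then show ?thesis using u g unfolding sobolev_pair_def grad_closure_def by blast
qed

lemma sobolev_pair_grad_closure: "sobolev_pair p \<Omega> u g \<Longrightarrow> 0 < p \<Longrightarrow> grad_closure p \<Omega> g"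
  unfolding sobolev_pair_def by (intro grad_closureI) blast+

lemma pint_diff_diff:
  assumes "Lp p a" "Lp p a'" "Lp p b" "Lp p b'" "pdist p a a' < d" "pdist p b b' < d" "0 < p"
  shows "pint p (\<lambda>x. (a x - b x) - (a' x - b' x)) < 2 powr p * (d + d)"
proof -
  have "pint p (\<lambda>x. (a x - a' x) - (b x - b' x)) \<le> 2 powr p * (pdist p a a' + pdist p b b')"
    using assms by (intro Lp_diff Lp_diff(1)) auto
  also have "\<dots> < 2 powr p * (d + d)" using assms by (intro mult_strict_left_mono) auto
  finally show ?thesis by (simp add: algebra_simps)
qed

lemma sobolev_pair_diff:
  assumes u: "sobolev_pair p \<Omega> u g" and v: "sobolev_pair p \<Omega> v h" and p: "0 < p"
  shows "sobolev_pair p \<Omega> (\<lambda>x. u x - v x) (\<lambda>x. g x - h x)"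
  unfolding sobolev_pair_def
proof (intro conjI allI impI)
  have L: "Lp p u" "Lp p g" "Lp p v" "Lp p h" using u v by (auto simp: sobolev_pair_def)
  show "Lp p (\<lambda>x. u x - v x)" "Lp p (\<lambda>x. g x - h x)" using L p by (auto intro: Lp_diff)
  show "x \<notin> \<Omega> \<Longrightarrow> u x - v x = 0" "x \<notin> \<Omega> \<Longrightarrow> g x - h x = 0" for x using u v by (auto simp: sobolev_pair_def)
  fix e :: real assume e: "0 < e"
  define d where "d = e / (2 powr p * 2)"
  have d: "0 < d" using e by (simp add: d_def)
  obtain \<phi> where \<phi>: "test_function \<Omega> \<phi>" "pdist p \<phi> u < d" "pdist p (gradient \<phi>) g < d"
    using u d unfolding sobolev_pair_def by blast
  obtain \<psi> where \<psi>: "test_function \<Omega> \<psi>" "pdist p \<psi> v < d" "pdist p (gradient \<psi>) h < d"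
    using v d unfolding sobolev_pair_def by blast
  note T = test_function_Lp[OF \<phi>(1) p] test_function_Lp[OF \<psi>(1) p]
  have dp: "2 powr p * (d + d) = e" by (simp add: d_def)
  have "gradient (\<lambda>x. \<phi> x - \<psi> x) = (\<lambda>x. gradient \<phi> x - gradient \<psi> x)"
    using \<phi>(1) \<psi>(1) by (intro ext gradient_diff test_function_smooth)
  then show "\<exists>\<phi>. test_function \<Omega> \<phi> \<and> pint p (\<lambda>x. \<phi> x - (u x - v x)) < e \<and> pint p (\<lambda>x. gradient \<phi> x - (g x - h x)) < e"
    using pint_diff_diff[OF T(1) L(1) T(3) L(3) \<phi>(2) \<psi>(2) p] pint_diff_diff[OF T(2) L(2) T(4) L(4) \<phi>(3) \<psi>(3) p]
    unfolding dp by (intro exI[of _ "\<lambda>x. \<phi> x - \<psi> x"] conjI test_function_diff \<phi>(1) \<psi>(1)) simp_all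
qed

text \<open>Poincare's inequality in the limit: approximating test functions have small gradients
  and are therefore small. It carries uniqueness from gradients over to the solutions
  themselves.\<close>

lemma sobolev_pair_zero:
  assumes u: "sobolev_pair p \<Omega> u g" and g: "AE x in lborel. g x = 0" and \<Omega>: "bounded \<Omega>" and p: "1 \<le> p"
  shows "AE x in lborel. u x = 0"
proof -
  have L: "Lp p u" "Lp p g" using u by (auto simp: sobolev_pair_def)
  note [measurable] = Lp_borel[OF L(1)] Lp_borel[OF L(2)]
  obtain R where R: "0 < R" "\<Omega> \<subseteq> cball 0 R" using \<Omega> by (auto simp: bounded_pos subset_iff)
  define K where "K = 2 powr p * (1 + (3 * R) powr p)"
  have K: "0 < K" unfolding K_def by (intro mult_pos_pos add_pos_nonneg) auto
  have "pint p u \<le> 0 + e" if e: "0 < e" for e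
  proof -
    obtain \<phi> where \<phi>: "test_function \<Omega> \<phi>" "pdist p \<phi> u < e / K" "pdist p (gradient \<phi>) g < e / K"
      using u e K unfolding sobolev_pair_def by (meson divide_pos_pos)
    have m: "gradient \<phi> \<in> borel_measurable borel" by (rule borel_gradient[OF test_function_smooth[OF \<phi>(1)]])
    have "pdist p (gradient \<phi>) g = pint p (gradient \<phi>)" unfolding pint_def using g m by (intro integral_cong_AE) auto
    then have 1: "pint p (gradient \<phi>) < e / K" using \<phi>(3) by simp
    have T: "Lp p \<phi>" using \<phi>(1) p by (intro test_function_Lp) auto
    have "pint p (\<lambda>x. \<phi> x - (\<phi> x - u x)) \<le> 2 powr p * (pint p \<phi> + pdist p \<phi> u)"
      using T L p by (intro Lp_diff Lp_diff(1)) auto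
    also have "\<dots> \<le> 2 powr p * ((3 * R) powr p * (e / K) + e / K)"
    proof (intro mult_left_mono add_mono)
      have "pint p \<phi> \<le> (3 * R) powr p * pint p (gradient \<phi>)" by (rule Poincare_test[OF \<phi>(1) R(2,1) p])
      also have "\<dots> \<le> (3 * R) powr p * (e / K)" using 1 by (intro mult_left_mono) auto
      finally show "pint p \<phi> \<le> (3 * R) powr p * (e / K)" .
    qed (use \<phi> in auto)
    also have "\<dots> = K * (e / K)" by (simp add: K_def algebra_simps add_divide_distrib)
    also have "\<dots> = e" using K by simp
    finally show ?thesis by simp
  qed
  then have "pint p u \<le> 0" by (rule field_le_epsilon)
  then have "pint p u = 0" using pint_nonneg[of p u] by linarith
  then have "AE x in lborel. norm (u x) powr p = 0"
    using integral_nonneg_eq_0_iff_AE[OF Lp_integrable[OF L(1)]] by (simp add: pint_def)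
  then show ?thesis by eventually_elim simp
qed

lemma sobolev_pair_parts_identity:
  fixes u :: "'a::euclidean_space \<Rightarrow> real"
  assumes u: "sobolev_pair p \<Omega> u g" and \<Omega>: "bounded \<Omega>" "open \<Omega>" and p: "1 < p"
  shows "parts_identity \<Omega> u g"
  unfolding parts_identity_def
proof (intro conjI allI impI)
  have L: "Lp p u" "Lp p g" and out: "\<And>x. x \<notin> \<Omega> \<Longrightarrow> u x = 0" "\<And>x. x \<notin> \<Omega> \<Longrightarrow> g x = 0" using u by (auto simp: sobolev_pair_def)
  show i: "integrable lborel u" "integrable lborel g"
    using p L out \<Omega> by (auto intro: Lp_integrable_bounded[where \<Omega> = \<Omega>])
  define q where "q = p / (p - 1)"
  have pq: "1 / p + 1 / q = 1" and q: "0 < q" using p by (auto simp: q_def field_simps)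
  have "\<forall>n. \<exists>\<phi>. test_function \<Omega> \<phi> \<and> pdist p \<phi> u < inverse (real (Suc n)) \<and> pdist p (gradient \<phi>) g < inverse (real (Suc n))"
    using u unfolding sobolev_pair_def by simp
  then obtain \<phi> where \<phi>: "\<And>n. test_function \<Omega> (\<phi> n)" "\<And>n. pdist p (\<phi> n) u < inverse (real (Suc n))"
    "\<And>n. pdist p (gradient (\<phi> n)) g < inverse (real (Suc n))" by metis
  have lim: "(\<lambda>n. pdist p (\<phi> n) u) \<longlonglongrightarrow> 0" "(\<lambda>n. pdist p (gradient (\<phi> n)) g) \<longlonglongrightarrow> 0"
    by (rule tendsto_sandwich[OF _ _ tendsto_const LIMSEQ_inverse_real_of_nat]; use \<phi> in \<open>auto intro!: always_eventually less_imp_le\<close>)+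
  have p0: "0 < p" using p by simp
  note T = test_function_Lp[OF \<phi>(1) p0]
  fix \<psi> assume \<psi>: "test_function \<Omega> \<psi>"
  note S = test_function_Lp[OF \<psi> q]
  show "(LBINT x. u x *\<^sub>R gradient \<psi> x) = - (LBINT x. \<psi> x *\<^sub>R g x)"
  \<comment> \<open>By components, since \<open>pairing_limit\<close> concerns real-valued
    pairings.\<close>
  proof (rule euclidean_eqI)
    fix b :: 'a assume b: "b \<in> Basis"
    have nb: "norm b = 1" using b by simp
    have m: "(\<lambda>x. gradient \<psi> x \<bullet> b) \<in> borel_measurable borel" "(\<lambda>x. \<psi> x *\<^sub>R b) \<in> borel_measurable borel"
      using Lp_borel[OF S(1)] Lp_borel[OF S(2)] by auto
    have 1: "Lp q (\<lambda>x. gradient \<psi> x \<bullet> b)"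
      by (rule Lp_bound(1)[OF S(2) m(1), of 1]) (use q nb Cauchy_Schwarz_ineq2[of _ b] in auto)
    have 2: "Lp q (\<lambda>x. \<psi> x *\<^sub>R b)" by (rule Lp_bound(1)[OF S(1) m(2), of 1]) (use q nb in auto)
    have l1: "(\<lambda>n. LBINT x. (gradient \<psi> x \<bullet> b) \<bullet> \<phi> n x) \<longlonglongrightarrow> (LBINT x. (gradient \<psi> x \<bullet> b) \<bullet> u x)"
      by (rule pairing_limit[OF 1 L(1) p pq T(1) lim(1)])
    have l2: "(\<lambda>n. LBINT x. (\<psi> x *\<^sub>R b) \<bullet> gradient (\<phi> n) x) \<longlonglongrightarrow> (LBINT x. (\<psi> x *\<^sub>R b) \<bullet> g x)"
      by (rule pairing_limit[OF 2 L(2) p pq T(2) lim(2)])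
    have inner: "(LBINT x. (gradient \<psi> x \<bullet> b) \<bullet> w x) = (LBINT x. w x *\<^sub>R gradient \<psi> x) \<bullet> b"
      "(LBINT x. (\<psi> x *\<^sub>R b) \<bullet> k x) = (LBINT x. \<psi> x *\<^sub>R k x) \<bullet> b"
      if "integrable lborel w" "integrable lborel k" for w k
      using integral_inner_left[OF integrable_scaleR_test(1)[OF \<psi> that(1)], of b]
        integral_inner_left[OF integrable_scaleR_test(2)[OF \<psi> that(2)], of b]
      by (simp_all add: mult.commute inner_commute[of b])
    have e: "(LBINT x. (gradient \<psi> x \<bullet> b) \<bullet> \<phi> n x) = - (LBINT x. (\<psi> x *\<^sub>R b) \<bullet> gradient (\<phi> n) x)" for n
      using inner[OF test_function_integrable[OF \<phi>(1)[of n]]] integration_by_parts_test(1)[OF test_function_smooth[OF \<phi>(1)[of n]] \<psi>]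
      by simp
    have "(LBINT x. (gradient \<psi> x \<bullet> b) \<bullet> u x) = - (LBINT x. (\<psi> x *\<^sub>R b) \<bullet> g x)"
      by (rule LIMSEQ_unique[OF l1[unfolded e] tendsto_minus[OF l2]])
    then show "(LBINT x. u x *\<^sub>R gradient \<psi> x) \<bullet> b = - (LBINT x. \<psi> x *\<^sub>R g x) \<bullet> b" using inner[OF i] by simp
  qed
qed

lemma sobolev_pair_test: "test_function \<Omega> \<phi> \<Longrightarrow> 0 < p \<Longrightarrow> sobolev_pair p \<Omega> \<phi> (gradient \<phi>)"
  using test_functionE(2)[of \<Omega> \<phi>] unfolding sobolev_pair_def by (fastforce intro: test_function_Lp)

lemma sobolev_pair_W1p_0:
  assumes u: "sobolev_pair p \<Omega> u g" and \<Omega>: "bounded \<Omega>" "open \<Omega>" and p: "1 < p"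
  shows "u \<in> W1p_0 \<Omega> p" "borel_version \<Omega> (weak_gradient \<Omega> u) g"
proof -
  have p0: "0 < p" using p by simp
  have pair: "v \<in> W1p \<Omega> p" "borel_version \<Omega> (weak_gradient \<Omega> v) h" "W1p_norm \<Omega> p v = (pint p v + pint p h) powr (1 / p)"
    if v: "sobolev_pair p \<Omega> v h" for v h
  proof -
    have *: "Lp p v" "Lp p h" "\<And>x. x \<notin> \<Omega> \<Longrightarrow> h x = 0" "borel_version \<Omega> v v"
      using v Lp_borel[of p v] by (auto simp: sobolev_pair_def borel_version_def)
    note ** = W1p_borel_version[OF \<Omega>(2) *(4,1,2,3) sobolev_pair_parts_identity[OF v \<Omega> p] p0]
    show "v \<in> W1p \<Omega> p" "borel_version \<Omega> (weak_gradient \<Omega> v) h" "W1p_norm \<Omega> p v = (pint p v + pint p h) powr (1 / p)"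
      using ** by auto
  qed
  show "borel_version \<Omega> (weak_gradient \<Omega> u) g" by (rule pair(2)[OF u])
  have "\<exists>\<phi>. test_function \<Omega> \<phi> \<and> W1p_norm \<Omega> p (\<lambda>x. u x - \<phi> x) < d" if d: "0 < d" for d
  proof -
    have "0 < d powr p / 2" using d by simp
    then obtain \<phi> where \<phi>: "test_function \<Omega> \<phi>" "pdist p \<phi> u < d powr p / 2" "pdist p (gradient \<phi>) g < d powr p / 2"
      using u unfolding sobolev_pair_def by blast
    have "W1p_norm \<Omega> p (\<lambda>x. u x - \<phi> x) = (pdist p u \<phi> + pdist p g (gradient \<phi>)) powr (1 / p)"
      by (rule pair(3)[OF sobolev_pair_diff[OF u sobolev_pair_test[OF \<phi>(1) p0] p0]])
    also have "\<dots> < (d powr p) powr (1 / p)"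
      using \<phi>(2,3) p by (intro powr_less_mono2) (simp_all add: pint_minus_commute[of p u \<phi>] pint_minus_commute[of p g])
    also have "\<dots> = d" using d p by (simp add: powr_powr)
    finally show ?thesis using \<phi>(1) by blast
  qed
  then show "u \<in> W1p_0 \<Omega> p" unfolding W1p_0_def using pair(1)[OF u] by blast
qed

text \<open>The converse of \<open>sobolev_pair_W1p_0\<close>. Uniqueness is claimed among all weak
  solutions, and a competing solution is known only as a member of \<open>W1p_0\<close>.\<close>

lemma W1p_0_sobolev_pair:
  assumes v: "v \<in> W1p_0 \<Omega> p" and \<Omega>: "bounded \<Omega>" "open \<Omega>" and p: "1 < p"
  shows "\<exists>u g. sobolev_pair p \<Omega> u g \<and> borel_version \<Omega> v u \<and> borel_version \<Omega> (weak_gradient \<Omega> v) g"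
proof -
  have p0: "0 < p" and p1: "1 \<le> p" using p by auto
  have \<Omega>': "\<Omega> \<in> sets borel" using \<Omega> by simp
  obtain g0 where v0: "v \<in> Lp_space \<Omega> p" and g0: "g0 \<in> Lp_space \<Omega> p" "is_weak_gradient \<Omega> v g0"
    using v by (auto simp: W1p_0_def W1p_def)
  obtain u where u: "borel_version \<Omega> v u" using borel_version_exists[OF \<Omega>'] v0 by (auto simp: Lp_space_def)
  obtain g where g: "borel_version \<Omega> g0 g" using borel_version_exists[OF \<Omega>'] g0 by (auto simp: Lp_space_def)
  have L: "Lp p u" "Lp p g" using borel_version_Lp(1)[OF \<Omega>' u] borel_version_Lp(1)[OF \<Omega>' g] v0 g0 by auto
  have out: "\<And>x. x \<notin> \<Omega> \<Longrightarrow> u x = 0" "\<And>x. x \<notin> \<Omega> \<Longrightarrow> g x = 0" using u g by (auto simp: borel_version_def)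
  note i = Lp_integrable_bounded[OF L(1) p1 \<Omega>(1) \<Omega>' out(1)] Lp_integrable_bounded[OF L(2) p1 \<Omega>(1) \<Omega>' out(2)]
  have ug: "parts_identity \<Omega> u g" using parts_identity_weak_gradient[OF \<Omega>(2) u i(1) g i(2)] g0(2) by simp
  have "\<exists>\<phi>. test_function \<Omega> \<phi> \<and> pdist p \<phi> u < e \<and> pdist p (gradient \<phi>) g < e" if e: "0 < e" for e
  proof -
    have "0 < e powr (1 / p)" using e by simp
    then obtain \<phi> where \<phi>: "test_function \<Omega> \<phi>" "W1p_norm \<Omega> p (\<lambda>x. v x - \<phi> x) < e powr (1 / p)"
      using v unfolding W1p_0_def by blast
    note T = test_function_Lp[OF \<phi>(1) p0]
    have "\<phi> x = 0" if "x \<notin> \<Omega>" for x using test_functionE(2)[OF \<phi>(1)] that by blast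
    then have "borel_version \<Omega> (\<lambda>x. v x - \<phi> x) (\<lambda>x. u x - \<phi> x)" using Lp_borel[OF L(1)] Lp_borel[OF T(1)]
      by (intro borel_version_map[OF u, where \<Phi> = "\<lambda>x y. y - \<phi> x"]) auto
    from W1p_borel_version(3)[OF \<Omega>(2) this _ _ _ parts_identity_diff[OF ug parts_identity_test[OF \<phi>(1)]] p0]
    have "W1p_norm \<Omega> p (\<lambda>x. v x - \<phi> x) = (pdist p u \<phi> + pdist p g (gradient \<phi>)) powr (1 / p)"
      using L T p0 out(2) gradient_test_0[OF \<phi>(1)] by (simp add: Lp_diff(1))
    then have "(pdist p u \<phi> + pdist p g (gradient \<phi>)) powr (1 / p) < e powr (1 / p)" using \<phi>(2) by simp
    then have "pdist p u \<phi> + pdist p g (gradient \<phi>) < e"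
      using e p powr_mono2[of "1 / p" e "pdist p u \<phi> + pdist p g (gradient \<phi>)"]
      by (meson leD less_imp_le not_less zero_le_divide_1_iff order_trans zero_le_one)
    then show ?thesis using \<phi>(1) pint_nonneg[of p "\<lambda>x. u x - \<phi> x"] pint_nonneg[of p "\<lambda>x. g x - gradient \<phi> x"]
        pint_minus_commute[of p u \<phi>] pint_minus_commute[of p g "gradient \<phi>"] by (intro exI[of _ \<phi>]) linarith
  qed
  then have "sobolev_pair p \<Omega> u g" using L out unfolding sobolev_pair_def by blast
  then show ?thesis using u W1p_borel_version(2)[OF \<Omega>(2) u L out(2) ug p0] by blast
qed

theorem theorem1p1:
  fixes T :: "(real ^ 3) set" and p :: real
  assumes "closed_lipschitz_domain T" and "T \<subseteq> ball 0 1"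
    and "3 / 2 < p" and "p < 3"
  shows "\<exists>C::real. \<forall>\<epsilon>\<in>{0<..<1}. \<forall>f\<in>Lp_space (perforated_ball T \<epsilon>) p.
           \<exists>u. weak_solution (perforated_ball T \<epsilon>) p f u \<and>
               (\<forall>v. weak_solution (perforated_ball T \<epsilon>) p f v \<longrightarrow>
                    (AE x in lebesgue_on (perforated_ball T \<epsilon>). v x = u x)) \<and>
               Lp_norm (perforated_ball T \<epsilon>) p (weak_gradient (perforated_ball T \<epsilon>) u)
                 \<le> C * Lp_norm (perforated_ball T \<epsilon>) p f"
proof -
  have p: "0 < p" "1 < p" "1 \<le> p" using assms by auto
  have dim: "DIM(real ^ 3) = 3" by simp
  obtain C where C: "0 < C" "\<And>\<epsilon> f. 0 < \<epsilon> \<Longrightarrow> \<epsilon> < 1 \<Longrightarrow> Lp p f \<Longrightarrow> (\<forall>x. x \<notin> ball 0 1 \<longrightarrow> f x = 0) \<Longrightarrow>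
    \<exists>g. grad_closure p (perforated_ball T \<epsilon>) g \<and> pint p g \<le> C * pint p f \<and>
      (\<forall>\<psi>. test_function (perforated_ball T \<epsilon>) \<psi> \<longrightarrow> (LBINT x. (g x + f x) \<bullet> gradient \<psi> x) = 0)"
    using dirichlet_gradient_exists[OF assms dim] by blast
  show ?thesis
  \<comment> \<open>\<open>C\<close> bounds p-th powers, so its p-th root bounds norms.\<close>
  proof (intro exI[of _ "C powr (1 / p)"] ballI)
    fix \<epsilon> :: real and f :: "real ^ 3 \<Rightarrow> real ^ 3" assume "\<epsilon> \<in> {0<..<1}" and f: "f \<in> Lp_space (perforated_ball T \<epsilon>) p"
    then have \<epsilon>: "0 < \<epsilon>" "\<epsilon> < 1" by auto
    define \<Omega> where "\<Omega> = perforated_ball T \<epsilon>"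
    have \<Omega>: "bounded \<Omega>" "open \<Omega>" "\<Omega> \<in> sets borel"
      using open_perforated_ball[OF closed_lipschitz_domain_compact[OF assms(1)], of \<epsilon>]
      by (auto simp: \<Omega>_def bounded_perforated_ball)
    obtain f' where f': "borel_version \<Omega> f f'"
      using borel_version_exists[OF \<Omega>(3), of f] f by (auto simp: Lp_space_def \<Omega>_def)
    have fL: "Lp p f'" using borel_version_Lp(1)[OF \<Omega>(3) f'] f by (simp add: \<Omega>_def)
    have f0: "\<And>x. x \<notin> \<Omega> \<Longrightarrow> f' x = 0" using f' by (simp add: borel_version_def)
    then have "\<forall>x. x \<notin> ball 0 1 \<longrightarrow> f' x = 0" using perforated_ball_subset[of T \<epsilon>] unfolding \<Omega>_def by blast
    then obtain g where g: "grad_closure p \<Omega> g" "pint p g \<le> C * pint p f'"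
      "\<And>\<psi>. test_function \<Omega> \<psi> \<Longrightarrow> (LBINT x. (g x + f' x) \<bullet> gradient \<psi> x) = 0"
      using C(2)[OF \<epsilon> fL] unfolding \<Omega>_def by blast
    obtain u where u: "sobolev_pair p \<Omega> u g" using sobolev_pair_exists[OF g(1) \<Omega>(1,2) p(3)] by blast
    have inner: "(LINT x|lebesgue_on \<Omega>. k x \<bullet> gradient \<psi> x) = (LBINT x. k' x \<bullet> gradient \<psi> x)"
      "integrable lborel (\<lambda>x. k' x \<bullet> gradient \<psi> x)"
      if k: "borel_version \<Omega> k k'" "Lp p k'" and \<psi>: "test_function \<Omega> \<psi>" for k k' \<psi>
    proof -
      have "0 < p / (p - 1)" "1 / p + 1 / (p / (p - 1)) = 1" using p by (auto simp: field_simps)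
      then have "integrable lborel (\<lambda>x. gradient \<psi> x \<bullet> k' x)"
        by (intro pairing_integrable[OF _ k(2) p(2)] test_function_Lp[OF \<psi>])
      then show i: "integrable lborel (\<lambda>x. k' x \<bullet> gradient \<psi> x)" by (simp add: inner_commute)
      have "borel_version \<Omega> (\<lambda>x. k x \<bullet> gradient \<psi> x) (\<lambda>x. k' x \<bullet> gradient \<psi> x)"
        by (rule borel_version_map[OF k(1), where \<Phi> = "\<lambda>x y. y \<bullet> gradient \<psi> x"]) (use i in auto)
      then show "(LINT x|lebesgue_on \<Omega>. k x \<bullet> gradient \<psi> x) = (LBINT x. k' x \<bullet> gradient \<psi> x)"
        by (rule borel_version_integral(3)[OF \<Omega>(3)])
    qed
    \<comment> \<open>Ties the weak formulation on the domain to the equation for Borel gradients.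
      It is stated for an arbitrary \<open>v\<close>, because it serves for the constructed solution
      and for its competitors.\<close>
    have eq: "(LINT x|lebesgue_on \<Omega>. weak_gradient \<Omega> v x \<bullet> gradient \<psi> x) = - (LINT x|lebesgue_on \<Omega>. f x \<bullet> gradient \<psi> x)
        \<longleftrightarrow> (LBINT x. (h x + f' x) \<bullet> gradient \<psi> x) = 0"
      if "borel_version \<Omega> (weak_gradient \<Omega> v) h" "Lp p h" "test_function \<Omega> \<psi>" for v h \<psi>
      using inner[OF that] inner[OF f' fL that(3)] by (auto simp: inner_add_left)
    note uW = sobolev_pair_W1p_0[OF u \<Omega>(1,2) p(2)]
    have gL: "Lp p g" by (rule grad_closure_Lp[OF g(1)])
    have sol: "weak_solution \<Omega> p f u" unfolding weak_solution_def using uW eq[OF uW(2) gL] g(3) by blast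
    have uniq: "AE x in lebesgue_on \<Omega>. v x = u x" if v: "weak_solution \<Omega> p f v" for v
    proof -
      have vW: "v \<in> W1p_0 \<Omega> p" using v by (simp add: weak_solution_def)
      obtain w h where w: "sobolev_pair p \<Omega> w h" "borel_version \<Omega> v w" "borel_version \<Omega> (weak_gradient \<Omega> v) h"
        using W1p_0_sobolev_pair[OF vW \<Omega>(1,2) p(2)] by blast
      have hL: "Lp p h" using w(1) by (simp add: sobolev_pair_def)
      have d: "sobolev_pair p \<Omega> (\<lambda>x. w x - u x) (\<lambda>x. h x - g x)" by (rule sobolev_pair_diff[OF w(1) u p(1)])
      have "(LBINT x. (h x - g x) \<bullet> gradient \<psi> x) = 0" if \<psi>: "test_function \<Omega> \<psi>" for \<psi>
      proof -
        have "(LBINT x. (h x + f' x) \<bullet> gradient \<psi> x) = 0" using v eq[OF w(3) hL \<psi>] \<psi> by (simp add: weak_solution_def)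
        then show ?thesis using g(3)[OF \<psi>] inner(2)[OF w(3) hL \<psi>] inner(2)[OF uW(2) gL \<psi>] inner(2)[OF f' fL \<psi>]
          by (simp add: inner_add_left inner_diff_left)
      qed
      then have "AE x in lborel. h x - g x = 0" using sobolev_pair_grad_closure[OF d p(1)] unfolding \<Omega>_def
        by (intro dirichlet_gradient_unique[OF assms dim \<epsilon>]) auto
      then have "AE x in lborel. w x - u x = 0" by (rule sobolev_pair_zero[OF d _ \<Omega>(1) p(3)])
      moreover have "AE x in lborel. x \<in> \<Omega> \<longrightarrow> v x = w x" using w(2) by (simp add: borel_version_def)
      ultimately show ?thesis unfolding AE_lebesgue_on_iff[OF \<Omega>(3)] by eventually_elim auto
    qed
    have "Lp_norm \<Omega> p (weak_gradient \<Omega> u) = pint p g powr (1 / p)" by (rule borel_version_Lp(2)[OF \<Omega>(3) uW(2)])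
    also have "\<dots> \<le> (C * pint p f') powr (1 / p)" using g(2) p by (intro powr_mono2) auto
    also have "\<dots> = C powr (1 / p) * Lp_norm \<Omega> p f" using C(1) by (simp add: borel_version_Lp(2)[OF \<Omega>(3) f'] powr_mult)
    finally show "\<exists>u. weak_solution (perforated_ball T \<epsilon>) p f u \<and>
               (\<forall>v. weak_solution (perforated_ball T \<epsilon>) p f v \<longrightarrow>
                    (AE x in lebesgue_on (perforated_ball T \<epsilon>). v x = u x)) \<and>
               Lp_norm (perforated_ball T \<epsilon>) p (weak_gradient (perforated_ball T \<epsilon>) u)
                 \<le> C powr (1 / p) * Lp_norm (perforated_ball T \<epsilon>) p f"
      using sol uniq unfolding \<Omega>_def[symmetric] by blast
  qed
qed

end
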